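(* Let $G$ be a finite connected graph of minimal degree at least $2$ which is not a cycle, let $W:V(G)\to\mathbb{R}$, and let $(\mathcal T,\mathcal W)=(\widetilde G,\widetilde W)$ be its universal cover with $H_{\mathcal T}=\mathcal A_{\mathcal T}+\mathcal W$. Then: (i) $\sigma(H_{\mathcal T})=\left(\bigcup_{r=1}^\ell J_r\right)\sqcup\mathfrak F\sqcup\mathfrak F'$, where the $J_r$ are finitely many open intervals, $\mathfrak F$ is a finite set of points and $\mathfrak F'$ is the set of endpoints of the intervals $J_r$; moreover $\bigcup_{r}J_r\neq\emptyset$. (ii) For $\lambda\in J_r$ and all adjacent $v\sim w$ in $\mathcal T$, the limit $\zeta^\lambda_w(v):=\lim_{\eta\downarrow0}\zeta^{\lambda+i\eta}_w(v)$ exists and $|\Im\zeta^\lambda_w(v)|>0$. (iii) For $\lambda\in J_r$ and all $v,w\in\mathcal T$, the limit $G^{\lambda+i0}(v,w)=\lim_{\eta\downarrow0}(H_{\mathcal T}-\lambda-i\eta)^{-1}(v,w)$ exists. (iv) For every closed interval $I\subset J_r$, the spectrum of $H_{\mathcal T}$ in $I$ is purely absolutely continuous. (v) If $\mathfrak F\neq\emptyset$, the points of $\mathfrak F$ are eigenvalues of $H_{\mathcal T}$ of infinite multiplicity.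
   Context: The universal cover $\widetilde G$ of $G$ is a tree with covering map $\pi$, and $\widetilde W=W\circ\pi$. For adjacent vertices $v\sim w$ of the tree $\mathcal T$, $\mathcal T^{(v|w)}$ denotes the connected component containing $v$ of $\mathcal T$ with the edge $\{v,w\}$ removed, $H^{(v|w)}_{\mathcal T}$ the restriction of $\mathcal A+\mathcal W$ to $\mathcal T^{(v|w)}$, and for $\Im\gamma>0$, $\zeta^\gamma_w(v)=-(H^{(v|w)}_{\mathcal T}-\gamma)^{-1}(v,v)$. *)

theory Defs
  imports "HOL-Analysis.Analysis"
begin

definition simple_graph :: "'a set \<Rightarrow> ('a \<Rightarrow> 'a \<Rightarrow> bool) \<Rightarrow> bool" where
  "simple_graph V E \<longleftrightarrow> finite V \<and> (\<forall>x y. E x y \<longrightarrow> x \<in> V \<and> y \<in> V)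
     \<and> (\<forall>x y. E x y \<longrightarrow> E y x) \<and> (\<forall>x. \<not> E x x)"

definition graph_connected :: "'a set \<Rightarrow> ('a \<Rightarrow> 'a \<Rightarrow> bool) \<Rightarrow> bool" where
  "graph_connected V E \<longleftrightarrow> V \<noteq> {} \<and> (\<forall>x\<in>V. \<forall>y\<in>V. E\<^sup>*\<^sup>* x y)"

definition degree :: "'a set \<Rightarrow> ('a \<Rightarrow> 'a \<Rightarrow> bool) \<Rightarrow> 'a \<Rightarrow> nat" where
  "degree V E v = card {u \<in> V. E v u}"

definition is_cycle_graph :: "'a set \<Rightarrow> ('a \<Rightarrow> 'a \<Rightarrow> bool) \<Rightarrow> bool" where
  "is_cycle_graph V E \<longleftrightarrow> (\<exists>(n::nat) g. n \<ge> 3 \<and> bij_betw g {..<n} V \<and>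
      (\<forall>i<n. \<forall>j<n. E (g i) (g j) \<longleftrightarrow> (j = (i + 1) mod n \<or> i = (j + 1) mod n)))"

section \<open>Universal cover: non-backtracking walks from a root\<close>

definition nbw :: "'a set \<Rightarrow> ('a \<Rightarrow> 'a \<Rightarrow> bool) \<Rightarrow> 'a \<Rightarrow> 'a list set" where
  "nbw V E r = {p. p \<noteq> [] \<and> hd p = r \<and> set p \<subseteq> V
     \<and> (\<forall>i. Suc i < length p \<longrightarrow> E (p ! i) (p ! Suc i))
     \<and> (\<forall>i. i + 2 < length p \<longrightarrow> p ! i \<noteq> p ! (i + 2))}"

text \<open>Adjacency in the tree (covering map is \<open>last\<close>).\<close>
definition tadj :: "'a list \<Rightarrow> 'a list \<Rightarrow> bool" where
  "tadj p q \<longleftrightarrow> (\<exists>x. q = p @ [x]) \<or> (\<exists>x. p = q @ [x])"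

definition cut_component :: "'a list set \<Rightarrow> 'a list \<Rightarrow> 'a list \<Rightarrow> 'a list set" where
  "cut_component T v w = {u. (\<lambda>a b. a \<in> T \<and> b \<in> T \<and> tadj a b \<and> {a, b} \<noteq> {v, w})\<^sup>*\<^sup>* v u}"

definition ell2 :: "'v set \<Rightarrow> ('v \<Rightarrow> complex) \<Rightarrow> bool" where
  "ell2 S f \<longleftrightarrow> (\<forall>x. x \<notin> S \<longrightarrow> f x = 0) \<and> ((\<lambda>x. (cmod (f x))\<^sup>2) summable_on S)"

definition l2_inner :: "'v set \<Rightarrow> ('v \<Rightarrow> complex) \<Rightarrow> ('v \<Rightarrow> complex) \<Rightarrow> complex" where
  "l2_inner S f g = infsum (\<lambda>x. cnj (f x) * g x) S"

definition Hsub :: "('a list \<Rightarrow> real) \<Rightarrow> 'a list set \<Rightarrow> ('a list \<Rightarrow> complex) \<Rightarrow> 'a list \<Rightarrow> complex" where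
  "Hsub Wt S f p = (if p \<in> S then (\<Sum>q\<in>{q \<in> S. tadj p q}. f q) + complex_of_real (Wt p) * f p else 0)"

definition spectrum_op :: "('a list \<Rightarrow> real) \<Rightarrow> 'a list set \<Rightarrow> complex set" where
  "spectrum_op Wt S = {z. \<not> (\<forall>g. ell2 S g \<longrightarrow>
      (\<exists>!f. ell2 S f \<and> (\<forall>x\<in>S. Hsub Wt S f x - z * f x = g x)))}"

definition resolvent :: "('a list \<Rightarrow> real) \<Rightarrow> 'a list set \<Rightarrow> complex \<Rightarrow> ('a list \<Rightarrow> complex) \<Rightarrow> 'a list \<Rightarrow> complex" where
  "resolvent Wt S z g = (THE f. ell2 S f \<and> (\<forall>x\<in>S. Hsub Wt S f x - z * f x = g x))"

definition delta :: "'v \<Rightarrow> 'v \<Rightarrow> complex" where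
  "delta y = (\<lambda>x. if x = y then 1 else 0)"

definition green :: "('a list \<Rightarrow> real) \<Rightarrow> 'a list set \<Rightarrow> complex \<Rightarrow> 'a list \<Rightarrow> 'a list \<Rightarrow> complex" where
  "green Wt S z x y = resolvent Wt S z (delta y) x"

definition zeta :: "('a list \<Rightarrow> real) \<Rightarrow> 'a list set \<Rightarrow> complex \<Rightarrow> 'a list \<Rightarrow> 'a list \<Rightarrow> complex" where
  "zeta Wt T z w v = - green Wt (cut_component T v w) z v v"

definition is_spectral_measure :: "('a list \<Rightarrow> real) \<Rightarrow> 'a list set \<Rightarrow> ('a list \<Rightarrow> complex) \<Rightarrow> real measure \<Rightarrow> bool" where
  "is_spectral_measure Wt S f \<mu> \<longleftrightarrow> finite_measure \<mu> \<and> sets \<mu> = sets borel \<and>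
     (\<forall>z. Im z \<noteq> 0 \<longrightarrow> integrable \<mu> (\<lambda>t. 1 / (complex_of_real t - z)) \<and>
        l2_inner S f (resolvent Wt S z f) = (\<integral>t. 1 / (complex_of_real t - z) \<partial>\<mu>))"

definition purely_ac_on :: "('a list \<Rightarrow> real) \<Rightarrow> 'a list set \<Rightarrow> real set \<Rightarrow> bool" where
  "purely_ac_on Wt S I \<longleftrightarrow> (\<forall>f. ell2 S f \<longrightarrow> (\<exists>\<mu>. is_spectral_measure Wt S f \<mu> \<and>
      (\<forall>A \<in> sets borel. A \<subseteq> I \<longrightarrow> emeasure lborel A = 0 \<longrightarrow> emeasure \<mu> A = 0)))"

definition eigenvalue_inf_mult :: "('a list \<Rightarrow> real) \<Rightarrow> 'a list set \<Rightarrow> real \<Rightarrow> bool" where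
  "eigenvalue_inf_mult Wt S lam \<longleftrightarrow> (\<forall>n. \<exists>B. finite B \<and> card B = n \<and>
     (\<forall>f\<in>B. ell2 S f \<and> (\<forall>x\<in>S. Hsub Wt S f x = complex_of_real lam * f x)) \<and>
     (\<forall>c. (\<forall>x. (\<Sum>f\<in>B. c f * f x) = 0) \<longrightarrow> (\<forall>f\<in>B. c f = 0)))"

end

theory Submission
  imports Defs "HOL-Probability.Probability" "HOL-Complex_Analysis.Complex_Analysis" "HOL-Real_Asymp.Real_Asymp"
begin

text \<open>The Green functions at the roots of the cones of the tree are finitely many functions, indexed by directed
  edges of the graph, which satisfy the algebraic system
  \<open>y\<^sub>j (z - W\<^sub>j - \<Sum>\<^sub>k y\<^sub>k) = 1\<close>, the sum running over the non-backtracking continuations of \<open>j\<close>.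
  At infinity the system has a unique formal solution, and differentiating it shows that every derivation
  over the rational functions vanishes on that solution; hence each \<open>y\<^sub>j\<close> is algebraic over the rational
  functions. An algebraic function on the upper half plane extends continuously to the real line off a finite
  set, and on each complementary interval its boundary values are either all real or all nonreal.
  Taking imaginary parts in the system, the directed edges whose boundary value at a point is real form a set closed
  under continuation; as the graph is not a cycle, such a set is empty or contains all edges. So every
  complementary interval either lies in the resolvent set or carries purely absolutely continuous
  spectrum, and an isolated spectral point is an atom of the spectral measures at all the infinitely many vertices
  above some vertex of the graph. Some interval is of the second kind, because the spectral measure
  at the root of an infinite tree has infinite support.\<close>

section \<open>Hausdorff moment problem\<close>

text \<open>Spectral measures are obtained from moments: the form p \<mapsto> <f, p(A) f> is
  nonnegative on Bernstein products, Hausdorff's theorem turns it into the measure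
  \<open>spec f\<close>, and polynomial approximation yields a continuous functional calculus.
  Statements about the spectrum then reduce to scalar measures at delta functions. The derivations
  vanish for a valuation reason. With x_j the expansion at infinity, differentiating the system
  gives D x_j = x_j^2 * (sum of the D x_k), and x_j vanishes at infinity; a nonzero D x_j of least
  order would have order greater than itself. No elimination of unknowns and no Jacobian is
  involved. One algebraic equation does not give the dichotomy real or nonreal, because nonreal
  values may run into a multiple real root. Therefore a second relation is kept, for the derivative
  of the minimal polynomial along the solution. Its constant term vanishes at finitely many points
  only; elsewhere the boundary values are simple roots, and a conjugate pair cannot merge
  there.\<close>

lemma monomial_Bernstein_expansion:
  assumes "j \<le> n"
  shows "[:0, 1::real:] ^ j = (\<Sum>k\<le>n. smult (real (k choose j) / real (n choose j) * real (n choose k))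
            ([:0, 1:] ^ k * [:1, - 1:] ^ (n - k)))"
proof -
  let ?X = "[:0, 1::real:]" and ?Y = "[:1, - 1::real:]"
  let ?f = "\<lambda>k. smult (real (k choose j) / real (n choose j) * real (n choose k)) (?X ^ k * ?Y ^ (n - k))"
  have one: "?X + ?Y = 1" by (simp add: one_pCons)
  have "(\<Sum>k\<le>n. ?f k) = (\<Sum>k\<in>{j..n}. ?f k)"
    by (rule sum.mono_neutral_right) (auto simp: binomial_eq_0)
  also have "\<dots> = (\<Sum>i\<in>{0..n-j}. ?f (i + j))"
    using sum.shift_bounds_cl_nat_ivl[of ?f 0 j "n - j"] assms by simp
  also have "\<dots> = (\<Sum>i\<in>{0..n-j}. ?X ^ j * (of_nat ((n - j) choose i) * ?X ^ i * ?Y ^ (n - j - i)))"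
  proof (rule sum.cong[OF refl])
    fix i assume i: "i \<in> {0..n-j}"
    \<comment> \<open>A k-set and then a j-subset of it can be chosen in the other order. This pulls
      X^j out of the sum and leaves the binomial expansion of (X + Y)^(n - j) = 1.\<close>
    have "real ((i+j) choose j) * real (n choose (i+j)) = real (n choose j) * real ((n - j) choose i)"
      using choose_mult[of j "i+j" n] i assms
      by (metis add_diff_cancel_right' atLeastAtMost_iff le_add2 le_diff_conv2 mult.commute of_nat_mult)
    moreover have "real (n choose j) \<noteq> 0" using assms by simp
    ultimately have "real ((i+j) choose j) / real (n choose j) * real (n choose (i+j)) = real ((n - j) choose i)"
      by (simp add: field_simps)
    then show "?f (i + j) = ?X ^ j * (of_nat ((n - j) choose i) * ?X ^ i * ?Y ^ (n - j - i))"
      by (simp add: of_nat_poly power_add algebra_simps diff_diff_add add.commute)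
  qed
  also have "\<dots> = ?X ^ j * (?X + ?Y) ^ (n - j)"
    unfolding binomial_ring[of ?X ?Y "n - j"] sum_distrib_left by (simp add: atMost_atLeast0)
  finally show ?thesis unfolding one by simp
qed

text \<open>The ratio is the product of the factors (k - i) / (n - i) over i < j, and for i \<le> k
  such a factor lies within i / (n - i) of k / n. Induction on j adds up the errors. The estimate
  compares Bernstein coefficients with powers of the support points k / n.\<close>

lemma binomial_ratio_approx:
  assumes "k \<le> n" "j < n"
  shows "\<bar>real (k choose j) / real (n choose j) - (real k / real n) ^ j\<bar> \<le> real (j * j) / real (n - j)"
  using assms(2)
proof (induction j)
  case 0
  then show ?case by simp
next
  case (Suc j)
  let ?a = "\<lambda>j. real (k choose j) / real (n choose j)"
  have jn: "j < n" using Suc by simp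
  have nj: "real (n choose j) > 0" using jn by simp
  have a1: "0 \<le> ?a j" "?a j \<le> 1"
    using binomial_right_mono[OF assms(1), of j] nj by (auto simp: divide_simps)
  have step: "real (m choose Suc j) * real (Suc j) = real (m choose j) * (real m - real j)" for m
  proof (cases "j \<le> m")
    case True
    then show ?thesis
      using binomial_absorb_comp[of m j] binomial_absorption[of j m]
      by (metis (no_types, lifting) mult.commute of_nat_diff of_nat_mult choose_mult_lemma binomial_absorption
           Suc_times_binomial_eq binomial_Suc_Suc_eq_times times_binomial_minus1_eq)
  next
    case False then show ?thesis by (simp add: binomial_eq_0)
  qed
  have rec: "?a (Suc j) = ?a j * ((real k - real j) / (real n - real j))"
  proof -
    have "?a (Suc j) = (real (k choose Suc j) * real (Suc j)) / (real (n choose Suc j) * real (Suc j))"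
      by simp
    then show ?thesis by (simp only: step times_divide_times_eq)
  qed
  have est: "\<bar>?a j * ((real k - real j) / (real n - real j) - real k / real n)\<bar> \<le> real j / real (n - j)"
  proof (cases "j \<le> k")
    case True
    have "(real k - real j) / (real n - real j) - real k / real n
        = - (real j / real (n - j)) * ((real n - real k) / real n)"
      using jn by (simp add: field_simps of_nat_diff)
    then have "\<bar>(real k - real j) / (real n - real j) - real k / real n\<bar>
        = (real j / real (n - j)) * ((real n - real k) / real n)"
      using jn assms(1) by (simp add: abs_mult)
    also have "\<dots> \<le> real j / real (n - j) * 1"
      using jn by (intro mult_left_mono) auto
    finally have "\<bar>?a j\<bar> * \<bar>(real k - real j) / (real n - real j) - real k / real n\<bar> \<le> 1 * (real j / real (n - j))"
      using a1 by (intro mult_mono) auto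
    then show ?thesis by (simp only: abs_mult mult_1)
  next
    case False then show ?thesis by (simp add: binomial_eq_0)
  qed
  have "\<bar>?a (Suc j) - (real k / real n) ^ Suc j\<bar>
      = \<bar>?a j * ((real k - real j) / (real n - real j) - real k / real n)
          + (?a j - (real k / real n) ^ j) * (real k / real n)\<bar>"
    unfolding rec by (simp add: algebra_simps)
  also have "\<dots> \<le> real j / real (n - j) + \<bar>?a j - (real k / real n) ^ j\<bar> * 1"
  proof (intro order_trans[OF abs_triangle_ineq] add_mono est)
    have "\<bar>real k / real n\<bar> \<le> 1" using assms(1) jn by simp
    then show "\<bar>(?a j - (real k / real n) ^ j) * (real k / real n)\<bar> \<le> \<bar>?a j - (real k / real n) ^ j\<bar> * 1"
      unfolding abs_mult by (rule mult_left_mono) simp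
  qed
  also have "\<dots> \<le> real j / real (n - j) + real (j * j) / real (n - j)"
    using Suc.IH[OF jn] by simp
  also have "\<dots> = real (j + j * j) / real (n - j)" by (simp add: add_divide_distrib)
  also have "\<dots> \<le> real (Suc j * Suc j) / real (n - Suc j)"
    using Suc.prems by (intro frac_le) auto
  finally show ?case .
qed

text \<open>Hausdorff's construction. The values \<open>w n k\<close> of L on the Bernstein
  polynomials of degree n are nonnegative and add up to L 1 = 1, so they are probabilities for the
  points k / n. By \<open>binomial_ratio_approx\<close> the moments of these discrete measures tend
  to those of L, and any weak limit is the measure sought.\<close>

lemma hausdorff_moment_normalized:
  fixes L :: "real poly \<Rightarrow> real"
  assumes add: "\<And>p q. L (p + q) = L p + L q" and smult: "\<And>c p. L (smult c p) = c * L p"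
    and pos: "\<And>k l. L ([:0, 1:] ^ k * [:1, - 1:] ^ l) \<ge> 0" and one: "L 1 = 1"
  obtains M where "real_distribution M" "AE t in M. t \<in> {0..1}" "\<And>p. (\<integral>t. poly p t \<partial>M) = L p"
proof -
  define w where "w n k = real (n choose k) * L ([:0, 1:] ^ k * [:1, - 1:] ^ (n - k))" for n k
  have w0: "w n k \<ge> 0" for n k using pos by (simp add: w_def)
  have L0: "L 0 = 0" using smult[of 0 0] by simp
  have Lsum: "L (\<Sum>i\<in>A. f i) = (\<Sum>i\<in>A. L (f i))" if "finite A" for A and f :: "nat \<Rightarrow> real poly"
    using that by induction (auto simp: L0 add)
  have mom: "L ([:0, 1:] ^ j) = (\<Sum>k\<le>n. real (k choose j) / real (n choose j) * w n k)" if "j \<le> n" for j n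
    unfolding monomial_Bernstein_expansion[OF that] Lsum[OF finite_atMost] by (simp add: smult w_def mult.assoc)
  have w1: "(\<Sum>k\<le>n. w n k) = 1" for n using mom[of 0 n] one by simp
  \<comment> \<open>Degree \<open>Suc n\<close> keeps the support points k / \<open>Suc n\<close>
    free of division by zero.\<close>
  define \<mu> where "\<mu> n = distr (point_measure {..Suc n} (\<lambda>k. ennreal (w (Suc n) k))) borel (\<lambda>k. real k / real (Suc n))" for n
  have int: "integral\<^sup>L (\<mu> n) g = (\<Sum>k\<le>Suc n. w (Suc n) k * g (real k / real (Suc n)))"
    if "g \<in> borel_measurable borel" for n and g :: "real \<Rightarrow> real"
    unfolding \<mu>_def using that w0
    by (subst integral_distr) (auto simp: measurable_point_measure_eq1 lebesgue_integral_point_measure_finite simp del: of_nat_Suc)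
  have prob: "prob_space (point_measure {..Suc n} (\<lambda>k. ennreal (w (Suc n) k)))" for n
    by (rule prob_spaceI) (simp add: emeasure_point_measure_finite space_point_measure sum_ennreal w0 w1 del: sum.atMost_Suc)
  have rd: "real_distribution (\<mu> n)" for n
    unfolding \<mu>_def real_distribution_def real_distribution_axioms_def
    by (intro conjI prob_space.prob_space_distr prob) (auto simp: measurable_point_measure_eq1)
  have tight: "tight \<mu>"
    unfolding tight_def
  proof (intro conjI allI impI rd)
    fix e :: real assume e: "e > 0"
    have "measure (\<mu> n) {-1<..2} = 1" for n
    proof -
      interpret real_distribution "\<mu> n" by (rule rd)
      have "integral\<^sup>L (\<mu> n) (indicator {-1<..2}) = (\<Sum>k\<le>Suc n. w (Suc n) k * indicator {-1<..2} (real k / real (Suc n)))"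
        by (rule int) simp
      also have "\<dots> = (\<Sum>k\<le>Suc n. w (Suc n) k)"
      proof (rule sum.cong[OF refl])
        fix k assume "k \<in> {..Suc n}"
        then have "0 \<le> real k / real (Suc n)" "real k / real (Suc n) \<le> 1" by (auto simp: divide_simps)
        then have "real k / real (Suc n) \<in> {-1<..2}" unfolding greaterThanAtMost_iff by linarith
        then show "w (Suc n) k * indicator {-1<..2} (real k / real (Suc n)) = w (Suc n) k"
          by (simp del: of_nat_Suc)
      qed
      finally show ?thesis using w1 by (simp del: sum.atMost_Suc)
    qed
    then show "\<exists>a b. a < b \<and> (\<forall>n. 1 - e < measure (\<mu> n) {a<..b})"
      using e by (intro exI[of _ "-1"] exI[of _ 2]) auto
  qed
  obtain r M where r: "strict_mono (r::nat\<Rightarrow>nat)" and M: "real_distribution M" and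
      wc: "weak_conv_m (\<mu> \<circ> id \<circ> r) M"
    using tight_imp_convergent_subsubsequence[OF tight, of id] by (auto simp: strict_mono_def)
  interpret M: real_distribution M by (rule M)
  have conv: "(\<lambda>n. integral\<^sup>L (\<mu> (r n)) g) \<longlonglongrightarrow> integral\<^sup>L M g"
    if "\<And>x. isCont g x" "\<And>x. norm (g x) \<le> B" for g :: "real \<Rightarrow> real" and B
    using weak_conv_imp_integral_bdd_continuous_conv[OF _ M wc, of g B] rd that by (simp add: o_def)
  have AE: "AE t in M. t \<in> {0..1}"
  proof -
    \<comment> \<open>A bounded continuous function that is nonnegative and vanishes exactly on
      [0, 1]. Its integral is 0 for every approximant, hence also for the weak limit.\<close>
    define g :: "real \<Rightarrow> real" where "g t = min 1 (max 0 (t - 1) + max 0 (- t))" for t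
    have gc: "isCont g x" for x unfolding g_def by (intro continuous_intros)
    have gm: "g \<in> borel_measurable borel" unfolding g_def by measurable
    have gM: "g \<in> borel_measurable M" unfolding g_def by measurable
    have "integral\<^sup>L (\<mu> (r n)) g = 0" for n
      unfolding int[OF gm] by (intro sum.neutral) (auto simp: g_def divide_simps)
    then have "integral\<^sup>L M g = 0"
      using conv[of g 1] gc LIMSEQ_unique[OF tendsto_const] by (force simp: g_def)
    moreover have "integrable M g"
      by (rule M.integrable_const_bound[of _ 1], simp add: g_def, rule gM)
    ultimately have "AE t in M. g t = 0"
      by (subst integral_nonneg_eq_0_iff_AE[symmetric]) (auto simp: g_def[abs_def])
    then show ?thesis by eventually_elim (auto simp: g_def min_def max_def split: if_splits)
  qed
  have momM: "(\<integral>t. t ^ j \<partial>M) = L ([:0, 1:] ^ j)" for j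
  proof -
    \<comment> \<open>Powers are unbounded on the line. Clamping t to [0, 1] makes weak convergence
      applicable and changes nothing on the supports.\<close>
    define g :: "real \<Rightarrow> real" where "g t = (max 0 (min 1 t)) ^ j" for t
    have gc: "isCont g x" for x unfolding g_def by (intro continuous_intros)
    have gm: "g \<in> borel_measurable borel" unfolding g_def by measurable
    have gM: "g \<in> borel_measurable M" unfolding g_def by measurable
    have gb: "norm (g x) \<le> 1" for x by (auto simp: g_def power_abs intro!: power_le_one)
    have eq: "(\<integral>t. t ^ j \<partial>M) = integral\<^sup>L M g"
      using AE gM by (intro integral_cong_AE) (auto simp: g_def)
    have bd: "\<bar>integral\<^sup>L (\<mu> n) g - L ([:0, 1:] ^ j)\<bar> \<le> real (j * j) / real (Suc n - j)" if "n > j" for n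
    proof -
      have "integral\<^sup>L (\<mu> n) g = (\<Sum>k\<le>Suc n. w (Suc n) k * (real k / real (Suc n)) ^ j)"
        unfolding int[OF gm]
      proof (intro sum.cong refl)
        fix k assume "k \<in> {..Suc n}"
        then have "0 \<le> real k / real (Suc n)" "real k / real (Suc n) \<le> 1" by (auto simp: divide_simps)
        then show "w (Suc n) k * g (real k / real (Suc n)) = w (Suc n) k * (real k / real (Suc n)) ^ j"
          unfolding g_def by (metis max_absorb2 min_absorb2)
      qed
      then have "\<bar>integral\<^sup>L (\<mu> n) g - L ([:0, 1:] ^ j)\<bar>
         = \<bar>\<Sum>k\<le>Suc n. w (Suc n) k * ((real k / real (Suc n)) ^ j - real (k choose j) / real (Suc n choose j))\<bar>"
        using mom[of j "Suc n"] that by (simp add: sum_subtractf[symmetric] algebra_simps del: sum.atMost_Suc of_nat_Suc)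
      also have "\<dots> \<le> (\<Sum>k\<le>Suc n. w (Suc n) k * (real (j * j) / real (Suc n - j)))"
      proof (intro order_trans[OF sum_abs] sum_mono)
        fix k assume "k \<in> {..Suc n}"
        then show "\<bar>w (Suc n) k * ((real k / real (Suc n)) ^ j - real (k choose j) / real (Suc n choose j))\<bar>
            \<le> w (Suc n) k * (real (j * j) / real (Suc n - j))"
          using binomial_ratio_approx[of k "Suc n" j] that w0[of "Suc n" k]
          unfolding abs_mult by (intro mult_mono) (auto simp: abs_minus_commute simp del: of_nat_Suc)
      qed
      also have "\<dots> = real (j * j) / real (Suc n - j)"
        unfolding sum_distrib_right[symmetric] w1 by simp
      finally show ?thesis .
    qed
    have "(\<lambda>n. real (j * j) / real (Suc n - j)) \<longlonglongrightarrow> 0"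
      by real_asymp
    then have "(\<lambda>n. integral\<^sup>L (\<mu> n) g - L ([:0, 1:] ^ j)) \<longlonglongrightarrow> 0"
      by (rule Lim_null_comparison[rotated]) (use bd in \<open>auto simp: eventually_sequentially intro!: exI[of _ "Suc j"]\<close>)
    then have "(\<lambda>n. integral\<^sup>L (\<mu> n) g) \<longlonglongrightarrow> L ([:0, 1:] ^ j)"
      by (simp add: LIM_zero_iff)
    then have "(\<lambda>n. integral\<^sup>L (\<mu> (r n)) g) \<longlonglongrightarrow> L ([:0, 1:] ^ j)"
      using LIMSEQ_subseq_LIMSEQ[OF _ r] by (force simp: o_def)
    then show ?thesis using conv[of g 1] gc gb LIMSEQ_unique eq by metis
  qed
  have integ: "integrable M (\<lambda>t. t ^ j)" for j
  proof (rule M.integrable_const_bound[of _ 1])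
    show "AE t in M. norm (t ^ j) \<le> 1" using AE by eventually_elim (simp add: power_le_one)
  qed simp
  have "(\<integral>t. poly p t \<partial>M) = L p" for p
  proof -
    have "poly p t = (\<Sum>i\<le>Polynomial.degree p. Polynomial.coeff p i * t ^ i)" for t by (rule poly_altdef)
    then have "(\<integral>t. poly p t \<partial>M) = (\<Sum>i\<le>Polynomial.degree p. Polynomial.coeff p i * L ([:0, 1:] ^ i))"
      using integ by (simp add: momM)
    also have "\<dots> = L (\<Sum>i\<le>Polynomial.degree p. smult (Polynomial.coeff p i) ([:0, 1:] ^ i))"
      by (simp add: Lsum smult)
    also have "(\<Sum>i\<le>Polynomial.degree p. smult (Polynomial.coeff p i) ([:0, 1:] ^ i)) = p"
      using poly_as_sum_of_monoms[of p] by (simp add: monom_altdef)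
    finally show ?thesis .
  qed
  then show ?thesis using that[OF M AE] by blast
qed

section \<open>Square-summable functions\<close>

text \<open>The predicate \<open>ell2 S\<close> is replaced by a type, so that norm, inner product
  and completeness become class instances. The type ranges over the whole index type; a subset S
  enters later through the support condition \<open>supp\<close>.\<close>

typedef 'v l2 = "{f :: 'v \<Rightarrow> complex. (\<lambda>x. (cmod (f x))\<^sup>2) summable_on UNIV}"
  morphisms l2_fun Abs_l2
  by (rule exI[of _ "\<lambda>_. 0"]) simp

setup_lifting type_definition_l2

lemma l2_fun_summable: "(\<lambda>x. (cmod (l2_fun u x))\<^sup>2) summable_on A"
  using l2_fun[of u] summable_on_subset_banach by blast

lemma square_summable_comparison:
  assumes "g summable_on UNIV" "\<And>x. (cmod (f x))\<^sup>2 \<le> g x"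
  shows "(\<lambda>x. (cmod (f x))\<^sup>2) summable_on UNIV"
  by (rule summable_on_comparison_test[OF assms(1)]) (use assms(2) in auto)

lemma cmod_add_squared_le: "(cmod (a + b))\<^sup>2 \<le> 2 * (cmod a)\<^sup>2 + 2 * (cmod b)\<^sup>2"
proof -
  have "(cmod (a + b))\<^sup>2 \<le> (cmod a + cmod b)\<^sup>2" by (intro power_mono norm_triangle_ineq) auto
  also have "\<dots> \<le> 2 * (cmod a)\<^sup>2 + 2 * (cmod b)\<^sup>2"
    using sum_squares_bound[of "cmod a" "cmod b"] by (simp add: power2_sum)
  finally show ?thesis .
qed

lemma square_summable_add:
  assumes "(\<lambda>x. (cmod (f x))\<^sup>2) summable_on UNIV" "(\<lambda>x. (cmod (g x))\<^sup>2) summable_on UNIV"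
  shows "(\<lambda>x. (cmod (f x + g x))\<^sup>2) summable_on UNIV"
proof (rule square_summable_comparison)
  show "(\<lambda>x. 2 * (cmod (f x))\<^sup>2 + 2 * (cmod (g x))\<^sup>2) summable_on UNIV"
    by (intro summable_on_add summable_on_cmult_right assms)
qed (rule cmod_add_squared_le)

lemma square_summable_cmult:
  assumes "(\<lambda>x. (cmod (f x))\<^sup>2) summable_on UNIV"
  shows "(\<lambda>x. (cmod (c * f x))\<^sup>2) summable_on UNIV"
  using summable_on_cmult_right[OF assms] by (simp add: norm_mult power_mult_distrib)

lift_definition cscale :: "complex \<Rightarrow> 'v l2 \<Rightarrow> 'v l2" is "\<lambda>c f x. c * f x"
  by (rule square_summable_cmult)

instantiation l2 :: (type) real_vector
begin

lift_definition zero_l2 :: "'a l2" is "\<lambda>_. 0" by simp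
lift_definition plus_l2 :: "'a l2 \<Rightarrow> 'a l2 \<Rightarrow> 'a l2" is "\<lambda>f g x. f x + g x" by (rule square_summable_add)
lift_definition uminus_l2 :: "'a l2 \<Rightarrow> 'a l2" is "\<lambda>f x. - f x" by simp
lift_definition minus_l2 :: "'a l2 \<Rightarrow> 'a l2 \<Rightarrow> 'a l2" is "\<lambda>f g x. f x - g x"
proof -
  fix f g :: "'a \<Rightarrow> complex"
  assume "(\<lambda>x. (cmod (f x))\<^sup>2) summable_on UNIV" "(\<lambda>x. (cmod (g x))\<^sup>2) summable_on UNIV"
  then show "(\<lambda>x. (cmod (f x - g x))\<^sup>2) summable_on UNIV"
    using square_summable_add[of f "\<lambda>x. - g x"] by simp
qed
lift_definition scaleR_l2 :: "real \<Rightarrow> 'a l2 \<Rightarrow> 'a l2" is "\<lambda>c f x. complex_of_real c * f x"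
  by (rule square_summable_cmult)

instance
  by standard (transfer; simp add: algebra_simps)+

end

lemma l2_fun_simps [simp]:
  "l2_fun 0 x = 0" "l2_fun (u + v) x = l2_fun u x + l2_fun v x" "l2_fun (- u) x = - l2_fun u x"
  "l2_fun (u - v) x = l2_fun u x - l2_fun v x" "l2_fun (r *\<^sub>R u) x = complex_of_real r * l2_fun u x"
  "l2_fun (cscale c u) x = c * l2_fun u x"
  by (transfer; simp)+

lemma l2_eqI: "(\<And>x. l2_fun u x = l2_fun v x) \<Longrightarrow> u = v"
  by (metis ext l2_fun_inject)

lemma l2_fun_prod_norm_summable: "(\<lambda>x. norm (cnj (l2_fun u x) * l2_fun v x)) summable_on A"
proof (rule summable_on_comparison_test)
  show "(\<lambda>x. (cmod (l2_fun u x))\<^sup>2 + (cmod (l2_fun v x))\<^sup>2) summable_on A"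
    by (intro summable_on_add l2_fun_summable)
  show "norm (cnj (l2_fun u x) * l2_fun v x) \<le> (cmod (l2_fun u x))\<^sup>2 + (cmod (l2_fun v x))\<^sup>2" for x
    using sum_squares_bound[of "cmod (l2_fun u x)" "cmod (l2_fun v x)"]
      mult_nonneg_nonneg[OF norm_ge_zero[of "l2_fun u x"] norm_ge_zero[of "l2_fun v x"]]
    unfolding norm_mult complex_mod_cnj by linarith
qed auto

lemma l2_fun_prod_summable: "(\<lambda>x. cnj (l2_fun u x) * l2_fun v x) summable_on A"
  by (rule abs_summable_summable[OF l2_fun_prod_norm_summable])

definition cinner :: "'v l2 \<Rightarrow> 'v l2 \<Rightarrow> complex" where
  "cinner u v = (\<Sum>\<^sub>\<infinity>x. cnj (l2_fun u x) * l2_fun v x)"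

lemma cinner_add_right: "cinner u (v + w) = cinner u v + cinner u w"
  unfolding cinner_def by (simp add: distrib_left infsum_add l2_fun_prod_summable)

lemma cinner_cscale_right: "cinner u (cscale c v) = c * cinner u v"
  unfolding cinner_def by (subst infsum_cmult_right'[symmetric]) (simp add: mult_ac)

lemma cinner_commute: "cinner v u = cnj (cinner u v)"
  unfolding cinner_def infsum_cnj[symmetric] by (simp add: mult_ac)

lemma cinner_self: "cinner u u = complex_of_real (\<Sum>\<^sub>\<infinity>x. (cmod (l2_fun u x))\<^sup>2)"
proof -
  have "((\<lambda>x. complex_of_real ((cmod (l2_fun u x))\<^sup>2)) has_sum complex_of_real (\<Sum>\<^sub>\<infinity>x. (cmod (l2_fun u x))\<^sup>2)) UNIV"
    by (intro has_sum_bounded_linear[OF bounded_linear_of_real] has_sum_infsum l2_fun_summable)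
  then show ?thesis
    unfolding cinner_def by (intro infsumI) (simp only: complex_norm_square mult.commute)
qed

lemma cscale_of_real: "cscale (complex_of_real r) u = r *\<^sub>R u"
  by (rule l2_eqI) simp

text \<open>The space is made a real Hilbert space with the real part of the complex form as inner
  product. Moments, norms and limits need real scalars only; complex information is carried
  separately by \<open>cinner\<close> and \<open>cscale\<close>.\<close>

instantiation l2 :: (type) real_inner
begin

definition inner_l2 :: "'a l2 \<Rightarrow> 'a l2 \<Rightarrow> real" where "inner_l2 u v = Re (cinner u v)"
definition norm_l2 :: "'a l2 \<Rightarrow> real" where "norm_l2 u = sqrt (inner u u)"
definition sgn_l2 :: "'a l2 \<Rightarrow> 'a l2" where "sgn_l2 u = u /\<^sub>R norm u"
definition dist_l2 :: "'a l2 \<Rightarrow> 'a l2 \<Rightarrow> real" where "dist_l2 u v = norm (u - v)"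
definition uniformity_l2 :: "('a l2 \<times> 'a l2) filter" where
  "uniformity_l2 = (INF e\<in>{0<..}. principal {(x, y). dist x y < e})"
definition open_l2 :: "'a l2 set \<Rightarrow> bool" where
  "open_l2 U \<longleftrightarrow> (\<forall>x\<in>U. eventually (\<lambda>(x', y). x' = x \<longrightarrow> y \<in> U) uniformity)"

instance
proof
  fix u v w :: "'a l2" and r :: real
  show "dist u v = norm (u - v)" by (rule dist_l2_def)
  show "sgn u = u /\<^sub>R norm u" by (rule sgn_l2_def)
  show "(uniformity :: ('a l2 \<times> 'a l2) filter) = (INF e\<in>{0<..}. principal {(x, y). dist x y < e})"
    by (rule uniformity_l2_def)
  show "open U \<longleftrightarrow> (\<forall>x\<in>U. eventually (\<lambda>(x', y). x' = x \<longrightarrow> y \<in> U) uniformity)" for U :: "'a l2 set"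
    by (rule open_l2_def)
  show comm: "inner u v = inner v u" for u v :: "'a l2"
    unfolding inner_l2_def by (subst cinner_commute) simp
  have "inner w (u + v) = inner w u + inner w v" by (simp add: inner_l2_def cinner_add_right)
  then show "inner (u + v) w = inner u w + inner v w" by (metis comm)
  have "inner v (r *\<^sub>R u) = r * inner v u"
    by (simp add: inner_l2_def cinner_cscale_right flip: cscale_of_real)
  then show "inner (r *\<^sub>R u) v = r * inner u v" by (metis comm)
  have nn: "0 \<le> (\<Sum>\<^sub>\<infinity>x. (cmod (l2_fun u x))\<^sup>2)" by (rule infsum_nonneg) simp
  then show "0 \<le> inner u u" by (simp add: inner_l2_def cinner_self)
  show "(inner u u = 0) = (u = 0)"
  proof
    assume "inner u u = 0"
    then have 0: "(\<Sum>\<^sub>\<infinity>x. (cmod (l2_fun u x))\<^sup>2) = 0" by (simp add: inner_l2_def cinner_self)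
    have "(cmod (l2_fun u x))\<^sup>2 = 0" for x
      using nonneg_infsum_le_0D[of "\<lambda>x. (cmod (l2_fun u x))\<^sup>2" UNIV x] 0 l2_fun_summable[of u UNIV] by simp
    then show "u = 0" by (intro l2_eqI) simp
  qed (simp add: inner_l2_def cinner_def)
  show "norm u = sqrt (inner u u)" by (rule norm_l2_def)
qed

end

lemma norm_l2_squared: "(norm u)\<^sup>2 = (\<Sum>\<^sub>\<infinity>x. (cmod (l2_fun u x))\<^sup>2)"
  by (simp add: power2_norm_eq_inner inner_l2_def cinner_self)

lemma sum_cmod_squared_le_norm: "finite A \<Longrightarrow> (\<Sum>x\<in>A. (cmod (l2_fun u x))\<^sup>2) \<le> (norm u)\<^sup>2"
  unfolding norm_l2_squared by (rule finite_sum_le_infsum) (auto simp: l2_fun_summable)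

lemma cmod_l2_fun_le_norm: "cmod (l2_fun u x) \<le> norm u"
  using sum_cmod_squared_le_norm[of "{x}" u] by (simp add: abs_le_square_iff[symmetric])

lemma square_summable_bounded:
  assumes "\<And>A. finite A \<Longrightarrow> (\<Sum>x\<in>A. (cmod (f x))\<^sup>2) \<le> B"
  shows "(\<lambda>x. (cmod (f x))\<^sup>2) summable_on UNIV" "(\<Sum>\<^sub>\<infinity>x. (cmod (f x))\<^sup>2) \<le> B"
proof -
  show s: "(\<lambda>x. (cmod (f x))\<^sup>2) summable_on UNIV"
    by (rule nonneg_bdd_above_summable_on) (use assms in \<open>auto intro!: bdd_aboveI[of _ B]\<close>)
  show "(\<Sum>\<^sub>\<infinity>x. (cmod (f x))\<^sup>2) \<le> B"
    by (rule infsum_le_finite_sums[OF s]) (use assms in auto)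
qed

text \<open>Coordinates are bounded by the norm, so a Cauchy sequence has a pointwise limit. The
  norm estimates pass to that limit through finite partial sums, as in Fatou's lemma.\<close>

instance l2 :: (type) complete_space
proof
  fix X :: "nat \<Rightarrow> 'a l2" assume C: "Cauchy X"
  have "Cauchy (\<lambda>n. l2_fun (X n) x)" for x
  proof (rule CauchyI)
    fix e :: real assume "0 < e"
    then obtain M where M: "\<forall>m\<ge>M. \<forall>n\<ge>M. norm (X m - X n) < e"
      using CauchyD[OF C] by blast
    have "norm (l2_fun (X m) x - l2_fun (X n) x) < e" if "m \<ge> M" "n \<ge> M" for m n
    proof -
      have "norm (l2_fun (X m - X n) x) \<le> norm (X m - X n)" by (rule cmod_l2_fun_le_norm)
      also have "\<dots> < e" using M that by blast
      finally show ?thesis by simp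
    qed
    then show "\<exists>M. \<forall>m\<ge>M. \<forall>n\<ge>M. norm (l2_fun (X m) x - l2_fun (X n) x) < e" by blast
  qed
  then have "\<exists>l. (\<lambda>n. l2_fun (X n) x) \<longlonglongrightarrow> l" for x
    by (simp add: Cauchy_convergent_iff convergent_def)
  then obtain f where f: "\<And>x. (\<lambda>n. l2_fun (X n) x) \<longlonglongrightarrow> f x" by metis
  have fat: "(\<Sum>x\<in>A. (cmod (l2_fun (X n) x - f x))\<^sup>2) \<le> e\<^sup>2"
    if "\<And>m. m \<ge> n \<Longrightarrow> norm (X n - X m) \<le> e" "finite A" for n e A
  proof (rule LIMSEQ_le_const2)
    show "(\<lambda>m. \<Sum>x\<in>A. (cmod (l2_fun (X n) x - l2_fun (X m) x))\<^sup>2) \<longlonglongrightarrow> (\<Sum>x\<in>A. (cmod (l2_fun (X n) x - f x))\<^sup>2)"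
      by (intro tendsto_intros f)
    have "(\<Sum>x\<in>A. (cmod (l2_fun (X n) x - l2_fun (X m) x))\<^sup>2) \<le> e\<^sup>2" if "m \<ge> n" for m
    proof -
      have "(\<Sum>x\<in>A. (cmod (l2_fun (X n - X m) x))\<^sup>2) \<le> (norm (X n - X m))\<^sup>2"
        by (rule sum_cmod_squared_le_norm[OF \<open>finite A\<close>])
      also have "\<dots> \<le> e\<^sup>2"
        using \<open>\<And>m. m \<ge> n \<Longrightarrow> norm (X n - X m) \<le> e\<close>[OF that] by (intro power_mono) auto
      finally show ?thesis by simp
    qed
    then show "\<exists>N. \<forall>m\<ge>N. (\<Sum>x\<in>A. (cmod (l2_fun (X n) x - l2_fun (X m) x))\<^sup>2) \<le> e\<^sup>2" by blast
  qed
  have cau: "\<exists>N. \<forall>n\<ge>N. \<forall>m\<ge>n. norm (X n - X m) \<le> e" if e: "e > 0" for e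
  proof -
    obtain M where M: "\<forall>m\<ge>M. \<forall>n\<ge>M. norm (X m - X n) < e"
      using CauchyD[OF C e] by blast
    have "norm (X n - X m) \<le> e" if "n \<ge> M" "m \<ge> n" for n m
      using M[rule_format, of n m] that by simp
    then show ?thesis by blast
  qed
  have diff: "\<exists>N. \<forall>n\<ge>N. (\<lambda>x. (cmod (l2_fun (X n) x - f x))\<^sup>2) summable_on UNIV \<and>
     (\<Sum>\<^sub>\<infinity>x. (cmod (l2_fun (X n) x - f x))\<^sup>2) \<le> e\<^sup>2" if e: "e > 0" for e
  proof -
    obtain N where N: "\<forall>n\<ge>N. \<forall>m\<ge>n. norm (X n - X m) \<le> e" using cau[OF e] by blast
    show ?thesis
    proof (intro exI[of _ N] allI impI conjI)
      fix n assume "n \<ge> N"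
      then have *: "(\<Sum>x\<in>A. (cmod (l2_fun (X n) x - f x))\<^sup>2) \<le> e\<^sup>2" if "finite A" for A
        using fat[OF _ that] N by blast
      show "(\<lambda>x. (cmod (l2_fun (X n) x - f x))\<^sup>2) summable_on UNIV"
        and "(\<Sum>\<^sub>\<infinity>x. (cmod (l2_fun (X n) x - f x))\<^sup>2) \<le> e\<^sup>2"
        using square_summable_bounded[OF *] by blast+
    qed
  qed
  obtain N where "(\<lambda>x. (cmod (l2_fun (X N) x - f x))\<^sup>2) summable_on UNIV" using diff[of 1] by auto
  then have "(\<lambda>x. (cmod ((l2_fun (X N) x - f x) + - l2_fun (X N) x))\<^sup>2) summable_on UNIV"
    by (rule square_summable_add) (simp add: l2_fun_summable)
  then have fs: "(\<lambda>x. (cmod (f x))\<^sup>2) summable_on UNIV" by simp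
  define L where "L = Abs_l2 f"
  have L: "l2_fun L = f" unfolding L_def using fs by (simp add: Abs_l2_inverse)
  have "X \<longlonglongrightarrow> L"
  proof (rule LIMSEQ_I)
    fix e :: real assume "0 < e"
    then obtain N where "\<forall>n\<ge>N. (\<Sum>\<^sub>\<infinity>x. (cmod (l2_fun (X n) x - f x))\<^sup>2) \<le> (e/2)\<^sup>2" using diff[of "e/2"] by auto
    then have "\<forall>n\<ge>N. (norm (X n - L))\<^sup>2 \<le> (e/2)\<^sup>2" by (simp add: norm_l2_squared L)
    then have "norm (X n - L) \<le> e/2" if "n \<ge> N" for n
      using \<open>0 < e\<close> that by (intro power2_le_imp_le[of "norm (X n - L)" "e/2"]) auto
    then have "norm (X n - L) < e" if "n \<ge> N" for n
      using \<open>0 < e\<close> that by (intro le_less_trans[of "norm (X n - L)" "e/2" e]) auto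
    then show "\<exists>no. \<forall>n\<ge>no. norm (X n - L) < e" by blast
  qed
  then show "convergent X" by (auto simp: convergent_def)
qed

lemma tendsto_l2_fun: "(u \<longlongrightarrow> L) F \<Longrightarrow> ((\<lambda>n. l2_fun (u n) x) \<longlongrightarrow> l2_fun L x) F"
proof -
  assume "(u \<longlongrightarrow> L) F"
  then have "((\<lambda>n. norm (u n - L)) \<longlongrightarrow> 0) F" by (simp add: LIM_zero tendsto_norm_zero)
  then have "((\<lambda>n. l2_fun (u n) x - l2_fun L x) \<longlongrightarrow> 0) F"
  proof (rule Lim_null_comparison[rotated])
    show "\<forall>\<^sub>F n in F. norm (l2_fun (u n) x - l2_fun L x) \<le> norm (u n - L)"
      unfolding l2_fun_simps(4)[symmetric] by (intro always_eventually allI cmod_l2_fun_le_norm)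
  qed
  then show ?thesis by (simp add: LIM_zero_iff)
qed

lemma norm_cscale: "norm (cscale c u) = cmod c * norm u"
proof -
  have "(norm (cscale c u))\<^sup>2 = (cmod c * norm u)\<^sup>2"
    unfolding power_mult_distrib norm_l2_squared
    unfolding infsum_cmult_right'[symmetric] by (simp add: norm_mult power_mult_distrib)
  then show ?thesis by (rule power2_eq_imp_eq) simp_all
qed

lemma Re_cinner: "Re (cinner u v) = inner u v" by (simp add: inner_l2_def)

lemma Im_cinner: "Im (cinner u v) = - inner u (cscale \<i> v)"
  by (simp add: inner_l2_def cinner_cscale_right)

section \<open>Delta functions and their density\<close>

lift_definition l2_delta :: "'v \<Rightarrow> 'v l2" is "delta"
proof -
  fix v :: 'v
  let ?f = "\<lambda>x. (cmod (delta v x))\<^sup>2"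
  have "?f summable_on UNIV \<longleftrightarrow> ?f summable_on {v}"
    by (rule summable_on_cong_neutral) (auto simp: delta_def)
  then show "?f summable_on UNIV" by simp
qed

lemma l2_fun_delta [simp]: "l2_fun (l2_delta v) x = (if x = v then 1 else 0)"
  by (simp add: l2_delta.rep_eq delta_def)

lemma cinner_delta: "cinner (l2_delta v) u = l2_fun u v"
proof -
  have "cinner (l2_delta v) u = (\<Sum>\<^sub>\<infinity>x\<in>{v}. l2_fun u x)"
    unfolding cinner_def by (rule infsum_cong_neutral) auto
  then show ?thesis by simp
qed

lemma norm_l2_delta [simp]: "norm (l2_delta v) = 1"
  unfolding norm_l2_def inner_l2_def cinner_delta by simp

text \<open>Finite truncations of v converge to v in norm. The step offers only points x where v is
  nonzero, so that information on the support of v can be used there.\<close>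

lemma l2_delta_induct:
  assumes "P 0" "\<And>u c x. P u \<Longrightarrow> l2_fun v x \<noteq> 0 \<Longrightarrow> P (u + cscale c (l2_delta x))"
    and "\<And>X L. (\<And>n. P (X n)) \<Longrightarrow> X \<longlonglongrightarrow> L \<Longrightarrow> P (L :: 'v l2)"
  shows "P v"
proof -
  define R where "R A = (\<Sum>x\<in>A. cscale (l2_fun v x) (l2_delta x))" for A
  have Rf: "l2_fun (R A) x = (if x \<in> A then l2_fun v x else 0)" if "finite A" for A x
    using that unfolding R_def by (induction A) auto
  have PR: "P (R A)" if "finite A" for A
    using that
  proof (induction A)
    case (insert x A)
    show ?case
    proof (cases "l2_fun v x = 0")
      case True
      then have "cscale (l2_fun v x) (l2_delta x) = 0" by (intro l2_eqI) auto
      then have "R (insert x A) = R A" using insert.hyps by (simp add: R_def)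
      then show ?thesis using insert.IH by simp
    next
      case False
      have "R (insert x A) = R A + cscale (l2_fun v x) (l2_delta x)"
        using insert by (simp add: R_def add.commute)
      then show ?thesis using assms(2)[OF insert.IH False] by simp
    qed
  qed (simp add: R_def assms(1))
  have ex: "\<exists>A. finite A \<and> norm (R A - v) \<le> inverse (real (Suc n))" for n
  proof -
    let ?f = "\<lambda>x. (cmod (l2_fun v x))\<^sup>2"
    have "(sum ?f \<longlongrightarrow> (norm v)\<^sup>2) (finite_subsets_at_top UNIV)"
      unfolding norm_l2_squared using infsum_tendsto[OF l2_fun_summable] by blast
    then have "\<forall>\<^sub>F A in finite_subsets_at_top UNIV. (norm v)\<^sup>2 - (inverse (real (Suc n)))\<^sup>2 < sum ?f A"
      by (rule order_tendstoD(1)) (simp del: of_nat_Suc)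
    then obtain A where A: "finite A" "(norm v)\<^sup>2 - (inverse (real (Suc n)))\<^sup>2 < sum ?f A"
      unfolding eventually_finite_subsets_at_top by auto
    have "(norm (R A - v))\<^sup>2 = (\<Sum>\<^sub>\<infinity>x\<in>-A. ?f x)"
      unfolding norm_l2_squared by (rule infsum_cong_neutral) (auto simp: Rf[OF A(1)])
    also have "\<dots> = (\<Sum>\<^sub>\<infinity>x. ?f x) - infsum ?f A"
      using infsum_Diff[of ?f UNIV A] l2_fun_summable[of v] by (simp add: Compl_eq_Diff_UNIV)
    finally have "(norm (R A - v))\<^sup>2 \<le> (inverse (real (Suc n)))\<^sup>2"
      using A by (simp add: norm_l2_squared del: of_nat_Suc)
    then have "norm (R A - v) \<le> inverse (real (Suc n))"
      by (rule power2_le_imp_le) (simp del: of_nat_Suc)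
    then show ?thesis using A by blast
  qed
  then obtain A where A: "\<And>n. finite (A n)" "\<And>n. norm (R (A n) - v) \<le> inverse (real (Suc n))" by metis
  have "(\<lambda>n. R (A n) - v) \<longlonglongrightarrow> 0"
    by (rule Lim_null_comparison[OF _ LIMSEQ_inverse_real_of_nat]) (use A in auto)
  then have "(\<lambda>n. R (A n)) \<longlonglongrightarrow> v" by (simp add: LIM_zero_iff)
  then show ?thesis by (rule assms(3)[rotated]) (rule PR[OF A(1)])
qed

section \<open>Spectral measures of bounded symmetric operators\<close>

definition op_poly :: "('h::real_vector \<Rightarrow> 'h) \<Rightarrow> real poly \<Rightarrow> 'h \<Rightarrow> 'h" where
  "op_poly A p x = (\<Sum>i\<le>Polynomial.degree p. Polynomial.coeff p i *\<^sub>R (A ^^ i) x)"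

lemma op_poly_altdef:
  assumes "Polynomial.degree p \<le> n"
  shows "op_poly A p x = (\<Sum>i\<le>n. Polynomial.coeff p i *\<^sub>R (A ^^ i) x)"
  unfolding op_poly_def
  by (rule sum.mono_neutral_left) (use assms in \<open>auto simp: coeff_eq_0\<close>)

locale bounded_symmetric =
  fixes A :: "'h::{real_inner,complete_space} \<Rightarrow> 'h" and C :: real
  assumes lin: "linear A" and sym: "inner (A x) y = inner x (A y)"
    and bnd: "norm (A x) \<le> C * norm x" and Cpos: "C > 0"
begin

lemma A_0 [simp]: "A 0 = 0"
  by (rule linear_0[OF lin])

lemma op_poly_0 [simp]: "op_poly A 0 x = 0"
  by (simp add: op_poly_def)

lemma op_poly_pCons: "op_poly A (pCons a p) x = a *\<^sub>R x + A (op_poly A p x)"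
proof -
  have "op_poly A (pCons a p) x = (\<Sum>i\<le>Suc (Polynomial.degree p). Polynomial.coeff (pCons a p) i *\<^sub>R (A ^^ i) x)"
    by (rule op_poly_altdef) (rule degree_pCons_le)
  also have "\<dots> = a *\<^sub>R x + (\<Sum>i\<le>Polynomial.degree p. Polynomial.coeff p i *\<^sub>R A ((A ^^ i) x))"
    unfolding sum.atMost_Suc_shift by simp
  also have "(\<Sum>i\<le>Polynomial.degree p. Polynomial.coeff p i *\<^sub>R A ((A ^^ i) x)) = A (op_poly A p x)"
    unfolding op_poly_def linear_sum[OF lin] by (simp add: linear_cmul[OF lin])
  finally show ?thesis .
qed

lemma op_poly_1 [simp]: "op_poly A 1 x = x"
  by (simp add: op_poly_def)

lemma linear_op_poly: "linear (op_poly A p)"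
proof (induction p)
  case 0 then show ?case by (simp add: linear_iff)
next
  case (pCons a p)
  then show ?case
    unfolding linear_iff op_poly_pCons by (simp add: linear_add[OF lin] linear_cmul[OF lin] algebra_simps)
qed

lemma op_poly_add: "op_poly A (p + q) x = op_poly A p x + op_poly A q x"
proof -
  let ?n = "max (Polynomial.degree p) (Polynomial.degree q)"
  have "Polynomial.degree (p + q) \<le> ?n" by (rule degree_add_le_max)
  then show ?thesis
    by (simp add: op_poly_altdef[of _ ?n] scaleR_left_distrib sum.distrib)
qed

lemma op_poly_smult: "op_poly A (smult c p) x = c *\<^sub>R op_poly A p x"
  by (simp add: op_poly_altdef[of "smult c p" "Polynomial.degree p"] op_poly_def degree_smult_le scaleR_sum_right)

lemma op_poly_diff: "op_poly A (p - q) x = op_poly A p x - op_poly A q x"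
proof -
  have "p - q = p + smult (- 1) q" by simp
  then show ?thesis by (simp only: op_poly_add op_poly_smult) simp
qed

lemma op_poly_mult: "op_poly A (p * q) x = op_poly A p (op_poly A q x)"
  by (induction p) (auto simp: op_poly_add op_poly_smult op_poly_pCons)

lemma op_poly_commute: "op_poly A p (op_poly A q x) = op_poly A q (op_poly A p x)"
  by (metis op_poly_mult mult.commute)

lemma op_poly_sym: "inner (op_poly A p x) y = inner x (op_poly A p y)"
proof (induction p arbitrary: x y)
  case (pCons a p)
  have "op_poly A p (A y) = A (op_poly A p y)" for y
    using op_poly_commute[of p "[:0, 1:]" y] by (simp add: op_poly_pCons)
  then show ?case using pCons by (simp add: op_poly_pCons inner_add_left inner_add_right sym)
qed simp

lemma bounded_linear_op_poly: "bounded_linear (op_poly A p)"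
proof (induction p)
  case 0
  have "op_poly A 0 = (\<lambda>x. 0)" by (rule ext) simp
  then show ?case by (simp only: bounded_linear_zero)
next
  case (pCons a p)
  have A: "bounded_linear A"
  proof (rule bounded_linear_intro[where K = C])
    show "norm (A x) \<le> norm x * C" for x using bnd[of x] by (simp only: mult.commute)
  qed (rule linear_add[OF lin], rule linear_cmul[OF lin])
  have "bounded_linear (\<lambda>x. a *\<^sub>R x + A (op_poly A p x))"
    by (rule bounded_linear_add[OF bounded_linear_scaleR_right bounded_linear_compose[OF A pCons.IH]])
  moreover have "op_poly A (pCons a p) = (\<lambda>x. a *\<^sub>R x + A (op_poly A p x))"
    by (rule ext) (rule op_poly_pCons)
  ultimately show ?case by (simp only:)
qed

lemma norm_op_poly_squared: "(norm (op_poly A p x))\<^sup>2 = inner x (op_poly A (p * p) x)"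
  by (simp add: power2_norm_eq_inner op_poly_sym op_poly_mult)

lemma quadratic_form_bound: "\<bar>inner x (A x)\<bar> \<le> C * (norm x)\<^sup>2"
proof -
  have "\<bar>inner x (A x)\<bar> \<le> norm x * norm (A x)" by (rule Cauchy_Schwarz_ineq2)
  also have "\<dots> \<le> norm x * (C * norm x)" by (intro mult_left_mono bnd) simp
  finally show ?thesis by (simp add: power2_eq_square mult_ac)
qed

text \<open>The affine map b sends [-C, C] onto [0, 1], so b(A) and 1 - b(A) are nonnegative forms.
  Polynomials with a nonnegative form are closed under sums and under multiplication by squares,
  which reduces both exponents to 0 or 1. The mixed case is b (1 - b) = b^2 (1 - b) + (1 - b)^2
  b.\<close>

lemma Bernstein_form_nonneg:
  fixes k l :: nat
  defines "b \<equiv> [:1 / 2, 1 / (2 * C):]"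
  shows "inner x (op_poly A (b ^ k * (1 - b) ^ l) x) \<ge> 0"
proof -
  define Q where "Q = {q. \<forall>x. inner x (op_poly A q x) \<ge> 0}"
  have Qadd: "p + q \<in> Q" if "p \<in> Q" "q \<in> Q" for p q
    using that by (simp add: Q_def op_poly_add inner_add_right)
  have Qsq: "p * p * q \<in> Q" if "q \<in> Q" for p q
  proof -
    have "inner x (op_poly A (p * p * q) x) = inner (op_poly A p x) (op_poly A q (op_poly A p x))" for x
      by (simp only: mult.assoc op_poly_mult op_poly_sym op_poly_commute[of p q])
    then show ?thesis using that by (simp add: Q_def)
  qed
  have Q1: "1 \<in> Q" by (simp add: Q_def)
  define d where "d x = inner x (A x) / (2 * C)" for x
  have bx: "inner x (op_poly A b x) = (norm x)\<^sup>2 / 2 + d x" for x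
    by (simp add: d_def b_def op_poly_pCons inner_add_right linear_cmul[OF lin] power2_norm_eq_inner)
  have bd: "\<bar>d x\<bar> \<le> (norm x)\<^sup>2 / 2" for x
    using quadratic_form_bound[of x] Cpos by (simp add: d_def field_simps abs_mult)
  have bd': "- d x \<le> (norm x)\<^sup>2 / 2" "d x \<le> (norm x)\<^sup>2 / 2" for x
    using bd[of x] by (simp_all only: abs_le_iff)
  have Qb: "b \<in> Q" unfolding Q_def mem_Collect_eq bx
  proof
    show "0 \<le> (norm x)\<^sup>2 / 2 + d x" for x using bd'(1)[of x] by linarith
  qed
  have cx: "inner x (op_poly A (1 - b) x) = (norm x)\<^sup>2 / 2 - d x" for x
    unfolding op_poly_diff inner_diff_right bx by (simp add: power2_norm_eq_inner)
  have Qc: "1 - b \<in> Q" unfolding Q_def mem_Collect_eq cx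
  proof
    show "0 \<le> (norm x)\<^sup>2 / 2 - d x" for x using bd'(2)[of x] by linarith
  qed
  have Qbc: "b * (1 - b) \<in> Q"
  proof -
    have "b * (1 - b) = b * b * (1 - b) + (1 - b) * (1 - b) * b" by (simp add: algebra_simps)
    then show ?thesis using Qadd[OF Qsq[OF Qc] Qsq[OF Qb]] by metis
  qed
  have dec: "\<exists>r e. u ^ n = r * r * u ^ e \<and> e \<in> {0, 1::nat}" for u :: "real poly" and n
    by (rule exI[of _ "u ^ (n div 2)"], rule exI[of _ "n mod 2"])
       (auto simp flip: power_add simp: mult_2[symmetric])
  obtain r e where r: "b ^ k = r * r * b ^ e" "e \<in> {0, 1::nat}" using dec by blast
  obtain s e' where s: "(1 - b) ^ l = s * s * (1 - b) ^ e'" "e' \<in> {0, 1::nat}" using dec by blast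
  have "b ^ k * (1 - b) ^ l = (r * s) * (r * s) * (b ^ e * (1 - b) ^ e')"
    unfolding r s by (simp add: mult_ac)
  moreover have "b ^ e * (1 - b) ^ e' \<in> Q" using r(2) s(2) Q1 Qb Qc Qbc by auto
  ultimately have "b ^ k * (1 - b) ^ l \<in> Q" using Qsq by metis
  then show ?thesis by (simp add: Q_def)
qed

text \<open>Composition with b turns p \<mapsto> <f, p(A) f> into a functional that satisfies
  Hausdorff's condition after division by |f|^2. The resulting measure on [0, 1] is carried back to
  [-C, C] by t \<mapsto> 2 C t - C, the inverse of b, and rescaled. The vector 0 is treated apart
  because of the division.\<close>

lemma spectral_measure_exists:
  "\<exists>\<mu>. finite_measure \<mu> \<and> sets \<mu> = sets borel \<and> (AE t in \<mu>. \<bar>t\<bar> \<le> C) \<and>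
      (\<forall>p. (\<integral>t. poly p t \<partial>\<mu>) = inner f (op_poly A p f))"
proof (cases "f = 0")
  case True
  have "op_poly A p 0 = 0" for p using linear_0[OF linear_op_poly] .
  then show ?thesis using True
    by (intro exI[of _ "null_measure borel"]) (auto intro!: finite_measureI AE_I[of _ _ UNIV])
next
  case False
  define N where "N = (norm f)\<^sup>2"
  have N: "N > 0" using False by (simp add: N_def)
  define b where "b = [:1 / 2, 1 / (2 * C):]"
  define L where "L p = inner f (op_poly A (pcompose p b) f) / N" for p
  obtain M where M: "real_distribution M" "AE t in M. t \<in> {0..1}" "\<And>p. (\<integral>t. poly p t \<partial>M) = L p"
  proof (rule hausdorff_moment_normalized)
    show "L (p + q) = L p + L q" for p q
      by (simp add: L_def pcompose_add op_poly_add inner_add_right add_divide_distrib)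
    show "L (smult c p) = c * L p" for c p
      by (simp add: L_def pcompose_smult op_poly_smult)
    have "pcompose ([:0, 1:] ^ k * [:1, - 1:] ^ l) b = b ^ k * (1 - b) ^ l" for k l
    proof -
      have "pcompose (p ^ n) b = pcompose p b ^ n" for p and n :: nat
        by (induction n) (auto simp: pcompose_mult pcompose_1)
      then show ?thesis by (simp add: pcompose_mult pcompose_pCons one_pCons[symmetric] pcompose_1)
    qed
    then show "L ([:0, 1:] ^ k * [:1, - 1:] ^ l) \<ge> 0" for k l
      using Bernstein_form_nonneg[of f k l] N by (simp add: L_def b_def)
    show "L 1 = 1" using N by (simp add: L_def N_def pcompose_1 power2_norm_eq_inner)
  qed blast
  interpret M: real_distribution M by (rule M)
  let ?h = "\<lambda>t. 2 * C * t - C"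
  define M' where "M' = distr M borel ?h"
  define \<mu> where "\<mu> = density M' (\<lambda>_. ennreal N)"
  interpret M': prob_space M' unfolding M'_def by (rule M.prob_space_distr) simp
  have sM': "sets M' = sets borel" by (simp add: M'_def)
  have ae: "AE t in M'. \<bar>t\<bar> \<le> C"
    unfolding M'_def
  proof (subst AE_distr_iff)
    show "AE t in M. \<bar>?h t\<bar> \<le> C"
      using M(2)
    proof eventually_elim
      case (elim t)
      then have "2 * C * t \<le> 2 * C * 1" "0 \<le> 2 * C * t" using Cpos by (intro mult_left_mono, auto)
      then show ?case by (auto simp: abs_le_iff)
    qed
  qed auto
  have "finite_measure \<mu>"
    by (rule finite_measureI) (simp add: \<mu>_def emeasure_density M'.emeasure_space_1 ennreal_mult_eq_top_iff)
  moreover have "sets \<mu> = sets borel" by (simp add: \<mu>_def sM')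
  moreover have "AE t in \<mu>. \<bar>t\<bar> \<le> C"
    unfolding \<mu>_def by (subst AE_density) (use ae in auto)
  moreover have "(\<integral>t. poly p t \<partial>\<mu>) = inner f (op_poly A p f)" for p
  proof -
    have pm: "poly p \<in> borel_measurable borel"
      by (intro borel_measurable_continuous_onI continuous_intros)
    have "(\<integral>t. poly p t \<partial>\<mu>) = (\<integral>t. N * poly p t \<partial>M')"
      unfolding \<mu>_def by (subst integral_density) (use N pm sM' in \<open>auto cong: measurable_cong_sets\<close>)
    also have "\<dots> = N * (\<integral>t. poly p t \<partial>M')" by simp
    also have "(\<integral>t. poly p t \<partial>M') = (\<integral>t. poly p (?h t) \<partial>M)"
      unfolding M'_def by (subst integral_distr) (use pm in auto)
    also have "\<dots> = (\<integral>t. poly (pcompose p [:- C, 2 * C:]) t \<partial>M)"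
      by (simp add: poly_pcompose algebra_simps)
    also have "\<dots> = L (pcompose p [:- C, 2 * C:])" by (rule M)
    also have "\<dots> = inner f (op_poly A p f) / N"
    proof -
      have "pcompose [:- C, 2 * C:] b = [:0, 1:]" using Cpos by (simp add: b_def pcompose_pCons)
      then have "pcompose (pcompose p [:- C, 2 * C:]) b = p" by (simp add: pcompose_assoc[symmetric])
      then show ?thesis by (simp add: L_def)
    qed
    finally show ?thesis using N by simp
  qed
  ultimately show ?thesis by blast
qed

definition spec :: "'h \<Rightarrow> real measure" where
  "spec f = (SOME \<mu>. finite_measure \<mu> \<and> sets \<mu> = sets borel \<and> (AE t in \<mu>. \<bar>t\<bar> \<le> C) \<and>
      (\<forall>p. (\<integral>t. poly p t \<partial>\<mu>) = inner f (op_poly A p f)))"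

lemma
  shows finite_measure_spec: "finite_measure (spec f)"
    and sets_spec [simp, measurable_cong]: "sets (spec f) = sets borel"
    and AE_spec: "AE t in spec f. \<bar>t\<bar> \<le> C"
    and integral_poly_spec: "(\<integral>t. poly p t \<partial>spec f) = inner f (op_poly A p f)"
  using someI_ex[OF spectral_measure_exists[of f]] unfolding spec_def[symmetric] by blast+

lemma space_spec [simp]: "space (spec f) = UNIV"
  using sets_eq_imp_space_eq[OF sets_spec] by simp

lemma measure_spec_UNIV: "measure (spec f) UNIV = (norm f)\<^sup>2"
  using integral_poly_spec[of f 1] by (simp add: power2_norm_eq_inner)

lemma compact_cont_bound:
  fixes g :: "real \<Rightarrow> real"
  assumes "continuous_on UNIV g"
  obtains B where "\<And>t. \<bar>t\<bar> \<le> C \<Longrightarrow> \<bar>g t\<bar> \<le> B" "B \<ge> 0"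
proof -
  have "bounded (g ` {-C..C})"
    by (intro compact_imp_bounded compact_continuous_image continuous_on_subset[OF assms]) auto
  then obtain B where "\<And>y. y \<in> g ` {-C..C} \<Longrightarrow> \<bar>y\<bar> \<le> B" by (auto simp: bounded_iff)
  then have "\<And>t. \<bar>t\<bar> \<le> C \<Longrightarrow> \<bar>g t\<bar> \<le> B" by (auto simp: abs_le_iff)
  moreover have "B \<ge> 0" using calculation[of 0] Cpos by force
  ultimately show ?thesis using that by blast
qed

lemma integrable_spec:
  fixes g :: "real \<Rightarrow> real"
  assumes "continuous_on UNIV g"
  shows "integrable (spec f) g"
proof -
  interpret finite_measure "spec f" by (rule finite_measure_spec)
  obtain B where B: "\<And>t. \<bar>t\<bar> \<le> C \<Longrightarrow> \<bar>g t\<bar> \<le> B" using compact_cont_bound[OF assms] by metis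
  show ?thesis
  proof (rule integrable_const_bound[where B = B])
    show "AE t in spec f. norm (g t) \<le> B" using AE_spec by eventually_elim (simp add: B)
    have "g \<in> borel_measurable borel" by (rule borel_measurable_continuous_onI[OF assms])
    then show "g \<in> borel_measurable (spec f)" by (simp cong: measurable_cong_sets)
  qed
qed

lemma norm_op_poly_spec: "(norm (op_poly A p f))\<^sup>2 = (\<integral>t. (poly p t)\<^sup>2 \<partial>spec f)"
  unfolding norm_op_poly_squared integral_poly_spec[symmetric]
  by (intro Bochner_Integration.integral_cong) (simp_all add: power2_eq_square)

text \<open>The norm of p(A) f is the L2 norm of p against \<open>spec f\<close>, which lives on
  [-C, C]. Uniform approximation by polynomials therefore converges when applied to A.\<close>

lemma norm_op_poly_le:
  assumes "\<And>t. \<bar>t\<bar> \<le> C \<Longrightarrow> \<bar>poly p t\<bar> \<le> e" "e \<ge> 0"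
  shows "norm (op_poly A p f) \<le> e * norm f"
proof -
  interpret finite_measure "spec f" by (rule finite_measure_spec)
  have "(norm (op_poly A p f))\<^sup>2 = (\<integral>t. (poly p t)\<^sup>2 \<partial>spec f)" by (rule norm_op_poly_spec)
  also have "\<dots> \<le> (\<integral>t. e\<^sup>2 \<partial>spec f)"
  proof (rule integral_mono_AE)
    show "integrable (spec f) (\<lambda>t. (poly p t)\<^sup>2)" by (rule integrable_spec) (intro continuous_intros)
    show "AE t in spec f. (poly p t)\<^sup>2 \<le> e\<^sup>2"
      using AE_spec by eventually_elim (use assms in \<open>metis abs_ge_zero power2_abs power_mono\<close>)
  qed simp
  also have "\<dots> = (e * norm f)\<^sup>2" by (simp add: measure_spec_UNIV power_mult_distrib)
  finally show ?thesis by (rule power2_le_imp_le) (use assms in simp)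
qed

text \<open>Here \<Phi> plays the role of \<psi>(A), and \<open>Q n\<close> are Weierstrass
  approximations of \<psi> on [-C, C]. The isometry is stated with two polynomials s and t: it
  yields s(A) \<psi>(A) f = t(A) f whenever s \<psi> = t almost everywhere, and by polarization also
  inner products.\<close>

lemma continuous_calculus:
  fixes \<psi> :: "real \<Rightarrow> real"
  assumes cont: "continuous_on UNIV \<psi>"
  obtains Q \<Phi> where "\<And>f. (\<lambda>n. op_poly A (Q n) f) \<longlonglongrightarrow> \<Phi> f"
    and "\<And>f s t. (norm (op_poly A s (\<Phi> f) - op_poly A t f))\<^sup>2 = (\<integral>x. (poly s x * \<psi> x - poly t x)\<^sup>2 \<partial>spec f)"
    and "\<And>f. inner f (\<Phi> f) = (\<integral>x. \<psi> x \<partial>spec f)"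
proof -
  have "\<exists>q. \<forall>t. \<bar>t\<bar> \<le> C \<longrightarrow> \<bar>\<psi> t - poly q t\<bar> < e" if e: "e > 0" for e
  proof -
    obtain g where g: "real_polynomial_function g" "\<And>x. x \<in> {-C..C} \<Longrightarrow> \<bar>\<psi> x - g x\<bar> < e"
      by (rule Stone_Weierstrass_real_polynomial_function[OF compact_Icc[of "- C" C] continuous_on_subset[OF cont subset_UNIV] e]) blast
    then obtain a n where "g = (\<lambda>x. \<Sum>i\<le>n. a i * x^i)" by (auto simp: real_polynomial_function_iff_sum)
    then have "g x = poly (\<Sum>i\<le>n. monom (a i) i) x" for x by (simp add: poly_sum poly_monom)
    then show ?thesis using g(2) by (intro exI[of _ "\<Sum>i\<le>n. monom (a i) i"]) (simp add: abs_le_iff)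
  qed
  then have "\<forall>n. \<exists>q. \<forall>t. \<bar>t\<bar> \<le> C \<longrightarrow> \<bar>\<psi> t - poly q t\<bar> < inverse (real (Suc n))"
    by (metis inverse_positive_iff_positive of_nat_0_less_iff zero_less_Suc)
  then obtain Q where Q: "\<And>n t. \<bar>t\<bar> \<le> C \<Longrightarrow> \<bar>\<psi> t - poly (Q n) t\<bar> < inverse (real (Suc n))" by metis
  have cau: "Cauchy (\<lambda>n. op_poly A (Q n) f)" for f
  proof (rule metric_CauchyI)
    fix e :: real assume e: "e > 0"
    then obtain N where N: "inverse (real (Suc N)) < e / (2 * (norm f + 1))"
      using reals_Archimedean[of "e / (2 * (norm f + 1))"] by (auto simp: add_nonneg_pos)
    have "dist (op_poly A (Q m) f) (op_poly A (Q n) f) < e" if "m \<ge> N" "n \<ge> N" for m n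
    proof -
      have mono: "inverse (real (Suc k)) \<le> inverse (real (Suc N))" if "k \<ge> N" for k
        using that by (simp add: field_simps)
      have "norm (op_poly A (Q m - Q n) f) \<le> (2 * inverse (real (Suc N))) * norm f"
      proof (rule norm_op_poly_le)
        fix t assume t: "\<bar>t\<bar> \<le> C"
        show "\<bar>poly (Q m - Q n) t\<bar> \<le> 2 * inverse (real (Suc N))"
          using Q[OF t, of m] Q[OF t, of n] mono[OF that(1)] mono[OF that(2)] unfolding poly_diff by linarith
      qed simp
      also have "\<dots> \<le> (2 * inverse (real (Suc N))) * (norm f + 1)" by (intro mult_left_mono) auto
      also have "\<dots> = inverse (real (Suc N)) * (2 * (norm f + 1))" by simp
      also have "\<dots> < e" using N by (subst (asm) pos_less_divide_eq) (auto simp: add_nonneg_pos)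
      finally show ?thesis by (simp add: dist_norm op_poly_diff)
    qed
    then show "\<exists>M. \<forall>m\<ge>M. \<forall>n\<ge>M. dist (op_poly A (Q m) f) (op_poly A (Q n) f) < e" by blast
  qed
  define \<Phi> where "\<Phi> f = lim (\<lambda>n. op_poly A (Q n) f)" for f
  have lim: "(\<lambda>n. op_poly A (Q n) f) \<longlonglongrightarrow> \<Phi> f" for f
    unfolding \<Phi>_def using Cauchy_convergent[OF cau] convergent_LIMSEQ_iff by blast
  have Qlim: "(\<lambda>n. poly (Q n) t) \<longlonglongrightarrow> \<psi> t" if "\<bar>t\<bar> \<le> C" for t
  proof -
    have "(\<lambda>n. poly (Q n) t - \<psi> t) \<longlonglongrightarrow> 0"
      by (rule Lim_null_comparison[OF _ LIMSEQ_inverse_real_of_nat])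
         (use Q[OF that] in \<open>auto simp: abs_minus_commute intro!: always_eventually less_imp_le\<close>)
    then show ?thesis by (simp add: LIM_zero_iff)
  qed
  obtain B\<psi> where B\<psi>: "\<And>t. \<bar>t\<bar> \<le> C \<Longrightarrow> \<bar>\<psi> t\<bar> \<le> B\<psi>" "B\<psi> \<ge> 0" using compact_cont_bound[OF cont] by metis
  have QB: "\<bar>poly (Q n) t\<bar> \<le> B\<psi> + 1" if "\<bar>t\<bar> \<le> C" for n t
  proof -
    have "inverse (real (Suc n)) \<le> 1" by (simp add: field_simps)
    then show ?thesis using B\<psi>(1)[OF that] Q[OF that, of n] by linarith
  qed
  \<comment> \<open>One dominated convergence argument serves all integrands used below: g is
    jointly continuous, and the approximants stay in a compact interval on [-C, C], so g is bounded
    on a compact rectangle.\<close>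
  have dom: "(\<lambda>n. \<integral>x. g (poly (Q n) x) x \<partial>spec f) \<longlonglongrightarrow> (\<integral>x. g (\<psi> x) x \<partial>spec f)"
    if gc: "continuous_on UNIV (\<lambda>p. g (fst p) (snd p))" for g :: "real \<Rightarrow> real \<Rightarrow> real" and f
  proof -
    interpret finite_measure "spec f" by (rule finite_measure_spec)
    have comp: "continuous_on UNIV (\<lambda>x. g (h x) x)" if "continuous_on UNIV h" for h
      using continuous_on_compose2[OF gc continuous_on_Pair[OF that continuous_on_id]] by simp
    have "bounded ((\<lambda>p. g (fst p) (snd p)) ` ({- (B\<psi> + 1)..B\<psi> + 1} \<times> {-C..C}))"
      by (intro compact_imp_bounded compact_continuous_image continuous_on_subset[OF gc] compact_Times) auto
    then obtain B where B0: "\<forall>z \<in> (\<lambda>p. g (fst p) (snd p)) ` ({- (B\<psi> + 1)..B\<psi> + 1} \<times> {-C..C}). norm z \<le> B"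
      unfolding bounded_iff by blast
    have B: "\<bar>g y x\<bar> \<le> B" if "\<bar>y\<bar> \<le> B\<psi> + 1" "\<bar>x\<bar> \<le> C" for y x
    proof -
      have "(y, x) \<in> {- (B\<psi> + 1)..B\<psi> + 1} \<times> {-C..C}" using that unfolding abs_le_iff by auto
      from bspec[OF B0 imageI[OF this]] show ?thesis by simp
    qed
    show ?thesis
    proof (rule integral_dominated_convergence[where w = "\<lambda>_. B"])
      show "(\<lambda>x. g (\<psi> x) x) \<in> borel_measurable (spec f)"
        using borel_measurable_continuous_onI[OF comp[OF cont]] by (simp cong: measurable_cong_sets)
      show "(\<lambda>x. g (poly (Q n) x) x) \<in> borel_measurable (spec f)" for n
        using borel_measurable_continuous_onI[OF comp[OF continuous_on_poly[OF continuous_on_id]], of "Q n"]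
        by (simp cong: measurable_cong_sets)
      show "integrable (spec f) (\<lambda>_. B)" by simp
      show "AE x in spec f. (\<lambda>n. g (poly (Q n) x) x) \<longlonglongrightarrow> g (\<psi> x) x"
        using AE_spec
      proof eventually_elim
        case (elim x)
        have "isCont (\<lambda>p. g (fst p) (snd p)) (\<psi> x, x)"
          using gc by (simp add: continuous_on_eq_continuous_at)
        from isCont_tendsto_compose[OF this tendsto_Pair[OF Qlim[OF elim] tendsto_const]]
        show ?case by simp
      qed
      show "AE x in spec f. norm (g (poly (Q n) x) x) \<le> B" for n
        using AE_spec by eventually_elim (use B QB in auto)
    qed
  qed
  show ?thesis
  proof (rule that[OF lim])
    fix f s t
    have "(\<lambda>n. (norm (op_poly A s (op_poly A (Q n) f) - op_poly A t f))\<^sup>2)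
        \<longlonglongrightarrow> (norm (op_poly A s (\<Phi> f) - op_poly A t f))\<^sup>2"
      by (intro tendsto_intros bounded_linear.tendsto[OF bounded_linear_op_poly] lim)
    moreover have "(norm (op_poly A s (op_poly A (Q n) f) - op_poly A t f))\<^sup>2
        = (\<integral>x. (poly s x * poly (Q n) x - poly t x)\<^sup>2 \<partial>spec f)" for n
      using norm_op_poly_spec[of "s * Q n - t" f] by (simp add: op_poly_diff op_poly_mult)
    moreover have "(\<lambda>n. \<integral>x. (poly s x * poly (Q n) x - poly t x)\<^sup>2 \<partial>spec f)
        \<longlonglongrightarrow> (\<integral>x. (poly s x * \<psi> x - poly t x)\<^sup>2 \<partial>spec f)"
      by (rule dom) (intro continuous_intros)
    ultimately show "(norm (op_poly A s (\<Phi> f) - op_poly A t f))\<^sup>2 = (\<integral>x. (poly s x * \<psi> x - poly t x)\<^sup>2 \<partial>spec f)"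
      using LIMSEQ_unique by simp
  next
    fix f
    have "(\<lambda>n. inner f (op_poly A (Q n) f)) \<longlonglongrightarrow> inner f (\<Phi> f)" by (intro tendsto_intros lim)
    moreover have "(\<lambda>n. \<integral>x. poly (Q n) x \<partial>spec f) \<longlonglongrightarrow> (\<integral>x. \<psi> x \<partial>spec f)"
      by (rule dom) (intro continuous_intros)
    ultimately show "inner f (\<Phi> f) = (\<integral>x. \<psi> x \<partial>spec f)"
      unfolding integral_poly_spec using LIMSEQ_unique by blast
  qed
qed

end

section \<open>Boundary behaviour of Poisson integrals\<close>

text \<open>Tent functions of the distance to K. The convergence is stated for the squares because
  the integral of \<psi>^2 against \<open>spec f\<close> is the squared norm of \<psi>(A) f.\<close>

lemma closed_indicator_approx:
  fixes K :: "real set"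
  assumes "closed K"
  obtains \<psi> :: "nat \<Rightarrow> real \<Rightarrow> real" where "\<And>n. continuous_on UNIV (\<psi> n)" "\<And>n t. 0 \<le> \<psi> n t" "\<And>n t. \<psi> n t \<le> 1"
    "\<And>t. (\<lambda>n. (\<psi> n t)\<^sup>2) \<longlonglongrightarrow> indicator K t"
proof (cases "K = {}")
  case True
  then show ?thesis by (intro that[of "\<lambda>_ _. 0"]) auto
next
  case False
  define \<psi> :: "nat \<Rightarrow> real \<Rightarrow> real" where "\<psi> n t = max 0 (1 - real n * infdist t K)" for n t
  have "(\<lambda>n. (\<psi> n t)\<^sup>2) \<longlonglongrightarrow> indicator K t" for t
  proof (cases "t \<in> K")
    case True
    then show ?thesis by (simp add: \<psi>_def)
  next
    case out: False
    then have pos: "infdist t K > 0" using in_closed_iff_infdist_zero[OF assms False, of t] infdist_nonneg[of t K] by linarith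
    obtain N where N: "real N * infdist t K > 1" using reals_Archimedean3[OF pos] by blast
    have "(\<psi> n t)\<^sup>2 = 0" if "n \<ge> N" for n
    proof -
      have "real N * infdist t K \<le> real n * infdist t K" using that pos by (intro mult_right_mono) auto
      then show ?thesis using N by (simp add: \<psi>_def)
    qed
    then have "(\<lambda>n. (\<psi> n t)\<^sup>2) \<longlonglongrightarrow> 0"
      by (intro tendsto_eventually) (auto simp: eventually_sequentially)
    then show ?thesis using out by simp
  qed
  moreover have "continuous_on UNIV (\<psi> n)" for n
    unfolding \<psi>_def by (intro continuous_intros)
  moreover have "\<psi> n t \<le> 1" for n t using infdist_nonneg[of t K] by (simp add: \<psi>_def)
  ultimately show ?thesis by (intro that[of \<psi>]) (auto simp: \<psi>_def)
qed

section \<open>Vectors whose spectral measure does not charge a closed set\<close>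

context bounded_symmetric
begin

lemma measure_closed_limit:
  assumes "closed K" and \<psi>: "\<And>n. continuous_on UNIV (\<psi> n)" "\<And>n t. 0 \<le> \<psi> n t" "\<And>n t. \<psi> n t \<le> 1"
    "\<And>t. (\<lambda>n. (\<psi> n t)\<^sup>2) \<longlonglongrightarrow> indicator K t"
  shows "(\<lambda>n. \<integral>t. (\<psi> n t)\<^sup>2 \<partial>spec f) \<longlonglongrightarrow> measure (spec f) K"
proof -
  interpret finite_measure "spec f" by (rule finite_measure_spec)
  have "(\<lambda>n. \<integral>t. (\<psi> n t)\<^sup>2 \<partial>spec f) \<longlonglongrightarrow> (\<integral>t. indicator K t \<partial>spec f)"
  proof (rule integral_dominated_convergence[where w = "\<lambda>_. 1"])
    have "(\<lambda>t. (\<psi> n t)\<^sup>2) \<in> borel_measurable borel" for n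
      by (intro borel_measurable_continuous_onI continuous_intros \<psi>)
    then show "(\<lambda>t. (\<psi> n t)\<^sup>2) \<in> borel_measurable (spec f)" for n by (simp cong: measurable_cong_sets)
    show "AE t in spec f. norm ((\<psi> n t)\<^sup>2) \<le> 1" for n
      using \<psi>(2,3) by (auto simp: power_le_one)
    show "indicator K \<in> borel_measurable (spec f)"
      using assms(1) by (intro borel_measurable_indicator) simp
  qed (use \<psi>(4) in auto)
  then show ?thesis using assms(1) by simp
qed

text \<open>Spectral measures are quadratic in the vector, which explains the factor 2. The
  inequality comes from linearity of f \<mapsto> \<psi>(A) f and shows that vectors without mass in
  K are closed under sums.\<close>

lemma measure_spec_add:
  assumes "closed K"
  shows "measure (spec (f + g)) K \<le> 2 * measure (spec f) K + 2 * measure (spec g) K"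
proof -
  obtain \<psi> :: "nat \<Rightarrow> real \<Rightarrow> real" where \<psi>: "\<And>n. continuous_on UNIV (\<psi> n)" "\<And>n t. 0 \<le> \<psi> n t" "\<And>n t. \<psi> n t \<le> 1"
    "\<And>t. (\<lambda>n. (\<psi> n t)\<^sup>2) \<longlonglongrightarrow> indicator K t" by (rule closed_indicator_approx[OF assms]) blast
  have "(\<integral>t. (\<psi> n t)\<^sup>2 \<partial>spec (f + g)) \<le> 2 * (\<integral>t. (\<psi> n t)\<^sup>2 \<partial>spec f) + 2 * (\<integral>t. (\<psi> n t)\<^sup>2 \<partial>spec g)" for n
  proof -
    obtain Q \<Phi> where lim: "\<And>f. (\<lambda>n. op_poly A (Q n) f) \<longlonglongrightarrow> \<Phi> f"
      and nrm: "\<And>f s t. (norm (op_poly A s (\<Phi> f) - op_poly A t f))\<^sup>2 = (\<integral>x. (poly s x * \<psi> n x - poly t x)\<^sup>2 \<partial>spec f)"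
      and "\<And>f. inner f (\<Phi> f) = (\<integral>x. \<psi> n x \<partial>spec f)"
      by (rule continuous_calculus[OF \<psi>(1)[of n]]) blast
    have n2: "(\<integral>t. (\<psi> n t)\<^sup>2 \<partial>spec h) = (norm (\<Phi> h))\<^sup>2" for h
      using nrm[of 1 h 0] by simp
    have "(\<lambda>m. op_poly A (Q m) f + op_poly A (Q m) g) \<longlonglongrightarrow> \<Phi> f + \<Phi> g" by (intro tendsto_add lim)
    then have "\<Phi> (f + g) = \<Phi> f + \<Phi> g"
      using LIMSEQ_unique[OF lim[of "f + g"]] by (simp add: linear_add[OF linear_op_poly])
    then have "norm (\<Phi> (f + g)) \<le> norm (\<Phi> f) + norm (\<Phi> g)" by (simp add: norm_triangle_ineq)
    then have "(norm (\<Phi> (f + g)))\<^sup>2 \<le> (norm (\<Phi> f) + norm (\<Phi> g))\<^sup>2" by (intro power_mono) auto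
    also have "\<dots> \<le> 2 * (norm (\<Phi> f))\<^sup>2 + 2 * (norm (\<Phi> g))\<^sup>2"
      using sum_squares_bound[of "norm (\<Phi> f)" "norm (\<Phi> g)"] by (simp add: power2_sum)
    finally show ?thesis by (simp only: n2)
  qed
  then show ?thesis
    by (intro LIMSEQ_le[OF measure_closed_limit[OF assms \<psi>]
         tendsto_add[OF tendsto_mult[OF tendsto_const measure_closed_limit[OF assms \<psi>]]
           tendsto_mult[OF tendsto_const measure_closed_limit[OF assms \<psi>]]]]) auto
qed

text \<open>An operator commuting with A commutes with every polynomial in A, hence with the limits
  \<psi>(A). It will be applied to multiplication by a complex scalar, which the real structure does
  not cover.\<close>

lemma measure_spec_commuting:
  assumes "closed K" and T: "bounded_linear T" "\<And>x. A (T x) = T (A x)" "\<And>x. norm (T x) \<le> k * norm x" "k \<ge> 0"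
  shows "measure (spec (T f)) K \<le> k\<^sup>2 * measure (spec f) K"
proof -
  obtain \<psi> :: "nat \<Rightarrow> real \<Rightarrow> real" where \<psi>: "\<And>n. continuous_on UNIV (\<psi> n)" "\<And>n t. 0 \<le> \<psi> n t" "\<And>n t. \<psi> n t \<le> 1"
    "\<And>t. (\<lambda>n. (\<psi> n t)\<^sup>2) \<longlonglongrightarrow> indicator K t" by (rule closed_indicator_approx[OF assms(1)]) blast
  interpret T: bounded_linear T by (rule T)
  have comm: "op_poly A p (T x) = T (op_poly A p x)" for p x
    by (induction p) (auto simp: op_poly_pCons T T.add T.scaleR)
  have "(\<integral>t. (\<psi> n t)\<^sup>2 \<partial>spec (T f)) \<le> k\<^sup>2 * (\<integral>t. (\<psi> n t)\<^sup>2 \<partial>spec f)" for n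
  proof -
    obtain Q \<Phi> where lim: "\<And>f. (\<lambda>n. op_poly A (Q n) f) \<longlonglongrightarrow> \<Phi> f"
      and nrm: "\<And>f s t. (norm (op_poly A s (\<Phi> f) - op_poly A t f))\<^sup>2 = (\<integral>x. (poly s x * \<psi> n x - poly t x)\<^sup>2 \<partial>spec f)"
      and "\<And>f. inner f (\<Phi> f) = (\<integral>x. \<psi> n x \<partial>spec f)"
      by (rule continuous_calculus[OF \<psi>(1)[of n]]) blast
    have n2: "(\<integral>t. (\<psi> n t)\<^sup>2 \<partial>spec h) = (norm (\<Phi> h))\<^sup>2" for h
      using nrm[of 1 h 0] by simp
    have "\<Phi> (T f) = T (\<Phi> f)"
      using LIMSEQ_unique[OF lim[of "T f"] T.tendsto[OF lim[of f], folded comm]] .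
    then have "(norm (\<Phi> (T f)))\<^sup>2 \<le> (k * norm (\<Phi> f))\<^sup>2" using T(3) by (intro power_mono) auto
    then show ?thesis by (simp only: n2 power_mult_distrib)
  qed
  then show ?thesis
    by (intro LIMSEQ_le[OF measure_closed_limit[OF assms(1) \<psi>]
         tendsto_mult[OF tendsto_const measure_closed_limit[OF assms(1) \<psi>]]]) auto
qed

text \<open>The total mass of \<open>spec (f - X n)\<close> is the squared norm of f - X n, which
  tends to 0; \<open>measure_spec_add\<close> compares f with X n.\<close>

lemma measure_spec_limit_zero:
  assumes "closed K" "\<And>n. measure (spec (X n)) K = 0" "X \<longlonglongrightarrow> f"
  shows "measure (spec f) K = 0"
proof -
  have "measure (spec f) K \<le> 2 * (norm (f - X n))\<^sup>2" for n
  proof -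
    have "measure (spec (X n + (f - X n))) K \<le> 2 * measure (spec (X n)) K + 2 * measure (spec (f - X n)) K"
      by (rule measure_spec_add[OF assms(1)])
    moreover have "measure (spec (f - X n)) K \<le> (norm (f - X n))\<^sup>2"
      unfolding measure_spec_UNIV[symmetric] using finite_measure.bounded_measure[OF finite_measure_spec] by simp
    ultimately show ?thesis using assms(2)[of n] by simp
  qed
  moreover have "(\<lambda>n. 2 * (norm (f - X n))\<^sup>2) \<longlonglongrightarrow> 2 * (norm (f - f))\<^sup>2"
    by (intro tendsto_intros assms)
  ultimately have "measure (spec f) K \<le> 2 * (norm (f - f))\<^sup>2"
    using LIMSEQ_le_const by blast
  then show ?thesis using measure_nonneg[of "spec f" K] by simp
qed

end

text \<open>The imaginary part of the integral of 1 / (t - z) at z = a + i b, without the customary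
  factor 1 / pi. For spectral measures it is the imaginary part of a Green function.\<close>

definition poisson :: "real measure \<Rightarrow> real \<Rightarrow> real \<Rightarrow> real" where
  "poisson \<mu> a b = (\<integral>t. b / ((t - a)\<^sup>2 + b\<^sup>2) \<partial>\<mu>)"

lemma poisson_kernel_pos:
  fixes a b t :: real assumes "b > 0" shows "(t - a)\<^sup>2 + b\<^sup>2 > 0"
  using assms by (simp add: add_nonneg_pos)

lemma poisson_kernel_integrable:
  fixes a b :: real
  assumes "finite_measure \<mu>" "sets \<mu> = sets borel" "b > 0"
  shows "integrable \<mu> (\<lambda>t. b / ((t - a)\<^sup>2 + b\<^sup>2))"
proof -
  interpret finite_measure \<mu> by fact
  show ?thesis
  proof (rule integrable_const_bound[where B = "1 / b"])
    have "norm (b / ((t - a)\<^sup>2 + b\<^sup>2)) \<le> 1 / b" for t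
    proof -
      have "b / ((t - a)\<^sup>2 + b\<^sup>2) \<le> b / b\<^sup>2" using assms(3) by (intro divide_left_mono) (auto simp: add_nonneg_pos)
      then show ?thesis using assms(3) poisson_kernel_pos[OF assms(3), of t a] by (simp add: power2_eq_square)
    qed
    then show "AE t in \<mu>. norm (b / ((t - a)\<^sup>2 + b\<^sup>2)) \<le> 1 / b" by simp
    have "(\<lambda>t. b / ((t - a)\<^sup>2 + b\<^sup>2)) \<in> borel_measurable borel" by measurable
    then show "(\<lambda>t. b / ((t - a)\<^sup>2 + b\<^sup>2)) \<in> borel_measurable \<mu>" using assms(2) by (simp cong: measurable_cong_sets)
  qed
qed

text \<open>Within distance b of a the kernel is at least 1 / (2 b).\<close>

lemma measure_interval_le_poisson:
  assumes "finite_measure \<mu>" "sets \<mu> = sets borel" "b > 0"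
  shows "measure \<mu> {a - b..a + b} \<le> 2 * b * poisson \<mu> a b"
proof -
  interpret finite_measure \<mu> by fact
  have "measure \<mu> {a - b..a + b} = (\<integral>t. indicator {a - b..a + b} t \<partial>\<mu>)" using assms(2) by simp
  also have "\<dots> \<le> (\<integral>t. 2 * b * (b / ((t - a)\<^sup>2 + b\<^sup>2)) \<partial>\<mu>)"
  proof (rule integral_mono)
    show "integrable \<mu> (indicator {a - b..a + b} :: real \<Rightarrow> real)"
      using assms(2) by (intro integrable_real_indicator) (auto simp: emeasure_eq_measure)
    show "integrable \<mu> (\<lambda>t. 2 * b * (b / ((t - a)\<^sup>2 + b\<^sup>2)))"
      by (intro integrable_mult_right poisson_kernel_integrable assms)
    fix t
    show "indicator {a - b..a + b} t \<le> 2 * b * (b / ((t - a)\<^sup>2 + b\<^sup>2))"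
    proof (cases "t \<in> {a - b..a + b}")
      case True
      then have "\<bar>t - a\<bar> \<le> \<bar>b\<bar>" using assms(3) by auto
      then have "(t - a)\<^sup>2 \<le> b\<^sup>2" by (simp only: abs_le_square_iff)
      then have "1 \<le> 2 * b * (b / ((t - a)\<^sup>2 + b\<^sup>2))"
        using poisson_kernel_pos[OF assms(3), of t a] by (simp add: field_simps power2_eq_square)
      then show ?thesis using True by simp
    next
      case False
      then show ?thesis using assms(3) poisson_kernel_pos[OF assms(3), of t a] by simp
    qed
  qed
  also have "\<dots> = 2 * b * poisson \<mu> a b" unfolding poisson_def by (rule integral_mult_right_zero)
  finally show ?thesis .
qed

text \<open>The distribution function has derivative zero throughout the interval.\<close>

lemma measure_interval_zero:
  assumes fin: "finite_measure \<mu>" "sets \<mu> = sets borel"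
    and lim: "\<And>l e. c < l \<Longrightarrow> l < d \<Longrightarrow> e > 0 \<Longrightarrow> \<exists>\<delta>>0. \<forall>b. 0 < b \<longrightarrow> b < \<delta> \<longrightarrow> poisson \<mu> l b \<le> e"
  shows "measure \<mu> {c<..<d} = 0"
proof -
  interpret finite_measure \<mu> by fact
  define \<Phi> where "\<Phi> t = measure \<mu> {..t}" for t
  have diff: "\<Phi> y - \<Phi> x = measure \<mu> {x<..y}" if "x \<le> y" for x y
  proof -
    have "{..y} = {..x} \<union> {x<..y}" using that by auto
    then have "\<Phi> y = measure \<mu> {..x} + measure \<mu> {x<..y}"
      unfolding \<Phi>_def using assms(2) by (simp only:) (intro finite_measure_Union, auto)
    then show ?thesis by (simp add: \<Phi>_def)
  qed
  have der: "(\<Phi> has_real_derivative 0) (at l)" if l: "c < l" "l < d" for l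
    unfolding DERIV_LIM_iff[symmetric] DERIV_def
  proof (rule LIM_I)
    fix e :: real assume e: "e > 0"
    obtain \<delta> where \<delta>: "\<delta> > 0" "\<And>b. 0 < b \<Longrightarrow> b < \<delta> \<Longrightarrow> poisson \<mu> l b \<le> e / 4"
      using lim[OF l, of "e / 4"] e by auto
    have "norm ((\<Phi> (l + h) - \<Phi> l) / h - 0) < e" if h: "h \<noteq> 0" "norm (h - 0) < \<delta>" for h
    proof -
      let ?b = "\<bar>h\<bar>"
      have "\<bar>\<Phi> (l + h) - \<Phi> l\<bar> \<le> measure \<mu> {l - ?b..l + ?b}"
      proof (cases "h > 0")
        case True
        have "\<bar>\<Phi> (l + h) - \<Phi> l\<bar> = measure \<mu> {l<..l + h}" using diff[of l "l + h"] True by simp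
        also have "\<dots> \<le> measure \<mu> {l - ?b..l + ?b}"
          by (rule finite_measure_mono) (use True in \<open>auto simp: assms(2)\<close>)
        finally show ?thesis .
      next
        case False
        have "\<Phi> l - \<Phi> (l + h) = measure \<mu> {l + h<..l}" using diff[of "l + h" l] False by simp
        then have "\<bar>\<Phi> (l + h) - \<Phi> l\<bar> = measure \<mu> {l + h<..l}" using measure_nonneg[of \<mu> "{l + h<..l}"] by linarith
        also have "\<dots> \<le> measure \<mu> {l - ?b..l + ?b}"
          by (rule finite_measure_mono) (use False in \<open>auto simp: assms(2)\<close>)
        finally show ?thesis .
      qed
      also have "\<dots> \<le> 2 * ?b * poisson \<mu> l ?b" by (rule measure_interval_le_poisson) (use h fin in auto)
      also have "\<dots> \<le> 2 * ?b * (e / 4)" using \<delta>(2)[of ?b] h by (intro mult_left_mono) auto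
      also have "\<dots> < ?b * e" using e h by simp
      finally show ?thesis using h by (simp add: field_simps)
    qed
    then show "\<exists>s>0. \<forall>h. h \<noteq> 0 \<and> norm (h - 0) < s \<longrightarrow> norm ((\<Phi> (l + h) - \<Phi> l) / h - 0) < e"
      using \<delta>(1) by blast
  qed
  have zero: "measure \<mu> {x<..y} = 0" if "c < x" "x < y" "y < d" for x y
  proof -
    have "\<Phi> y = \<Phi> x"
    proof (rule DERIV_isconst_end[OF that(2)])
      show "continuous_on {x..y} \<Phi>"
        by (intro continuous_at_imp_continuous_on ballI DERIV_isCont[OF der]) (use that in auto)
      show "(\<Phi> has_real_derivative 0) (at t)" if "x < t" "t < y" for t
        using der[of t] that \<open>c < x\<close> \<open>y < d\<close> by simp
    qed
    then show ?thesis using diff[of x y] that by simp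
  qed
  show ?thesis
  proof (cases "c < d")
    case True
    define m where "m = (c + d) / 2"
    \<comment> \<open>The offset 3 keeps the piece cut off at each end shorter than half of the
      interval.\<close>
    define B where "B n = {c + (d - c) / real (n + 3)<..d - (d - c) / real (n + 3)}" for n :: nat
    have bnd: "0 < (d - c) / real (n + 3)" "(d - c) / real (n + 3) < (d - c) / 2" for n
      using True by (simp, intro divide_strict_left_mono, auto)
    have aux: "c < c + q" "c + q < d - q" "d - q < d" if "0 < q" "q < (d - c) / 2" for q
      using that by auto
    have "{c<..<d} \<subseteq> (\<Union>n. B n)"
    proof
      fix x assume x: "x \<in> {c<..<d}"
      define e where "e = min (x - c) (d - x)"
      have e: "e > 0" using x by (simp add: e_def)
      obtain n :: nat where n: "real n > (d - c) / e" using reals_Archimedean2 by blast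
      then have "d - c < real n * e" using e by (simp add: divide_less_eq)
      also have "\<dots> \<le> real (n + 3) * e" using e by (intro mult_right_mono) auto
      finally have "(d - c) / real (n + 3) < e" by (simp add: divide_less_eq mult.commute)
      then have "x \<in> B n" unfolding B_def e_def by auto
      then show "x \<in> (\<Union>n. B n)" by blast
    qed
    moreover have "measure \<mu> (B n) = 0" for n
      unfolding B_def by (rule zero) (rule aux[OF bnd])+
    then have "B n \<in> null_sets \<mu>" for n
      using assms(2) by (auto simp: null_sets_def emeasure_eq_measure B_def)
    then have "(\<Union>n. B n) \<in> null_sets \<mu>" by (rule null_sets_UN)
    ultimately have "{c<..<d} \<in> null_sets \<mu>" using assms(2) by (auto intro: null_sets_subset)
    then show ?thesis by (auto simp: measure_def)
  qed simp
qed

text \<open>A bound for the Poisson integrals at all small heights gives every subinterval of [c, d]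
  mass at most |B| times its length; the height used is half the length, which d - c < \<delta>
  permits. An outer cover of N by intervals then bounds its mass by |B| times an arbitrarily small
  number.\<close>

lemma measure_null_set_zero:
  assumes fin: "finite_measure \<mu>" "sets \<mu> = sets borel"
    and bound: "\<And>l b. c \<le> l \<Longrightarrow> l \<le> d \<Longrightarrow> 0 < b \<Longrightarrow> b < \<delta> \<Longrightarrow> poisson \<mu> l b \<le> B"
    and cd: "d - c < \<delta>" and N: "N \<in> sets borel" "N \<subseteq> {c..d}" "emeasure lborel N = 0"
  shows "measure \<mu> N = 0"
proof -
  interpret finite_measure \<mu> by fact
  have small: "measure \<mu> {u..v} \<le> \<bar>B\<bar> * (v - u)" if "c \<le> u" "v \<le> d" "u < v" for u v
  proof -
    have "measure \<mu> {(u+v)/2 - (v-u)/2..(u+v)/2 + (v-u)/2} \<le> 2 * ((v-u)/2) * poisson \<mu> ((u+v)/2) ((v-u)/2)"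
      by (rule measure_interval_le_poisson) (use that fin in auto)
    also have "\<dots> \<le> 2 * ((v-u)/2) * \<bar>B\<bar>"
      using that cd by (intro mult_left_mono order_trans[OF bound]) auto
    finally show ?thesis by (simp add: field_simps)
  qed
  have pt: "measure \<mu> {p} = 0" if p: "p \<in> {c..d}" for p
  proof -
    have "measure \<mu> {p} \<le> 2 * b * \<bar>B\<bar>" if "0 < b" "b < \<delta>" for b
    proof -
      have "measure \<mu> {p} \<le> measure \<mu> {p - b..p + b}" by (rule finite_measure_mono) (use that in \<open>auto simp: assms(2)\<close>)
      also have "\<dots> \<le> 2 * b * poisson \<mu> p b" by (rule measure_interval_le_poisson) (use that fin in auto)
      also have "\<dots> \<le> 2 * b * \<bar>B\<bar>" using that p by (intro mult_left_mono order_trans[OF bound]) auto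
      finally show ?thesis .
    qed
    moreover have "\<forall>\<^sub>F b in at_right 0. b \<in> {0<..<\<delta>}" using cd p by (intro eventually_at_right_real) auto
    ultimately have "\<forall>\<^sub>F b in at_right 0. measure \<mu> {p} \<le> 2 * b * \<bar>B\<bar>" by (auto elim!: eventually_mono)
    moreover have "((\<lambda>b. 2 * b * \<bar>B\<bar>) \<longlongrightarrow> 2 * 0 * \<bar>B\<bar>) (at_right 0)" by (intro tendsto_intros)
    ultimately have "measure \<mu> {p} \<le> 2 * 0 * \<bar>B\<bar>" by (intro tendsto_lowerbound) auto
    then show ?thesis using measure_nonneg[of \<mu> "{p}"] by simp
  qed
  show ?thesis
  proof (cases "c < d")
    case True
    have lN: "N \<in> lmeasurable"
      using N by (intro fmeasurableI) auto
    have "measure \<mu> N \<le> \<bar>B\<bar> * e" if e: "e > 0" for e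
    proof -
      have mN: "measure lebesgue N = 0" using N by (simp add: measure_def)
      obtain \<D> where D: "countable \<D>" "\<And>K. K \<in> \<D> \<Longrightarrow> K \<subseteq> cbox c d \<and> K \<noteq> {} \<and> (\<exists>u v. K = cbox u v)"
        "pairwise (\<lambda>A B. interior A \<inter> interior B = {}) \<D>"
        "\<And>u v. cbox u v \<in> \<D> \<Longrightarrow> \<exists>n. \<forall>i \<in> Basis. v \<bullet> i - u \<bullet> i = (d \<bullet> i - c \<bullet> i)/2^n"
        "\<And>K. \<lbrakk>K \<in> \<D>; box c d \<noteq> {}\<rbrakk> \<Longrightarrow> interior K \<noteq> {}"
        "N \<subseteq> \<Union>\<D>" "\<Union>\<D> \<in> lmeasurable" "measure lebesgue (\<Union>\<D>) \<le> measure lebesgue N + e"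
        by (rule measurable_outer_intervals_bounded[OF lN _ e, of c d]) (use N in auto)
      have Kint: "\<exists>u v. K = {u..v} \<and> c \<le> u \<and> v \<le> d \<and> u < v" if K: "K \<in> \<D>" for K
      proof -
        obtain u v where uv: "K = {u..v}" using D(2)[OF K] by auto
        have "u < v" using D(5)[OF K] True uv by (auto simp: box_real)
        moreover have "c \<le> u" "v \<le> d" using D(2)[OF K] uv calculation by auto
        ultimately show ?thesis using uv by blast
      qed
      have Kle: "emeasure \<mu> (interior K) \<le> ennreal \<bar>B\<bar> * emeasure lborel (interior K)" if K: "K \<in> \<D>" for K
      proof -
        obtain u v where uv: "K = {u..v}" "c \<le> u" "v \<le> d" "u < v" using Kint[OF K] by blast
        have "emeasure \<mu> (interior K) \<le> emeasure \<mu> {u..v}"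
          unfolding uv by (rule emeasure_mono) (auto simp: assms(2))
        also have "\<dots> \<le> ennreal (\<bar>B\<bar> * (v - u))"
          using small[OF uv(2,3,4)] by (simp add: emeasure_eq_measure ennreal_leI)
        finally show ?thesis using uv by (simp add: ennreal_mult interior_atLeastAtMost_real)
      qed
      \<comment> \<open>The covering intervals have disjoint interiors only. Their endpoints form a
        countable set, null because single points carry no mass, and countable additivity applies to
        the interiors.\<close>
      define P where "P = (\<Union>K\<in>\<D>. \<Union>p\<in>{p. (p = Inf K \<or> p = Sup K) \<and> p \<in> {c..d}}. {p})"
      have P0: "P \<in> null_sets \<mu>"
        unfolding P_def
      proof (intro null_sets_UN' D(1))
        fix K
        have "{p. (p = Inf K \<or> p = Sup K) \<and> p \<in> {c..d}} \<subseteq> {Inf K, Sup K}" by auto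
        then show "countable {p. (p = Inf K \<or> p = Sup K) \<and> p \<in> {c..d}}"
          by (meson countable_finite finite.emptyI finite.insertI finite_subset)
      next
        fix K p assume "p \<in> {p. (p = Inf K \<or> p = Sup K) \<and> p \<in> {c..d}}"
        then show "{p} \<in> null_sets \<mu>" using pt[of p] by (simp add: null_sets_def emeasure_eq_measure assms(2))
      qed
      have sub: "N \<subseteq> (\<Union>K\<in>\<D>. interior K) \<union> P"
      proof
        fix x assume "x \<in> N"
        then obtain K where K: "K \<in> \<D>" "x \<in> K" using D(6) by blast
        obtain u v where uv: "K = {u..v}" "c \<le> u" "v \<le> d" "u < v" using Kint[OF K(1)] by blast
        have "Inf K = u" "Sup K = v" using uv by auto
        then have "x \<in> interior K \<or> x = Inf K \<or> x = Sup K" using K(2) uv by (auto simp: interior_atLeastAtMost_real)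
        moreover have "x \<in> P" if "x = Inf K \<or> x = Sup K"
          using that K uv unfolding P_def by (intro UN_I[of K]) auto
        ultimately show "x \<in> (\<Union>K\<in>\<D>. interior K) \<union> P" using K(1) by blast
      qed
      have oI: "open (\<Union>K\<in>\<D>. interior K)" by (intro open_UN) simp
      have "emeasure \<mu> N \<le> emeasure \<mu> ((\<Union>K\<in>\<D>. interior K) \<union> P)"
        by (rule emeasure_mono[OF sub]) (use P0 borel_open[OF oI] in \<open>auto simp: assms(2) null_sets_def\<close>)
      also have "\<dots> = emeasure \<mu> (\<Union>K\<in>\<D>. interior K)"
        by (rule emeasure_Un_null_set[OF _ P0]) (use borel_open[OF oI] in \<open>simp add: assms(2)\<close>)
      also have "\<dots> = (\<integral>\<^sup>+K. emeasure \<mu> (interior K) \<partial>count_space \<D>)"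
        using D(3) by (intro emeasure_UN_countable D(1)) (auto simp: disjoint_family_on_def pairwise_def assms(2))
      also have "\<dots> \<le> (\<integral>\<^sup>+K. ennreal \<bar>B\<bar> * emeasure lborel (interior K) \<partial>count_space \<D>)"
        by (intro nn_integral_mono) (auto simp: Kle)
      also have "\<dots> = ennreal \<bar>B\<bar> * (\<integral>\<^sup>+K. emeasure lborel (interior K) \<partial>count_space \<D>)"
        by (rule nn_integral_cmult) simp
      also have "(\<integral>\<^sup>+K. emeasure lborel (interior K) \<partial>count_space \<D>) = emeasure lborel (\<Union>K\<in>\<D>. interior K)"
        using D(3) by (intro emeasure_UN_countable[symmetric] D(1)) (auto simp: disjoint_family_on_def pairwise_def)
      also have "\<dots> \<le> emeasure lebesgue (\<Union>\<D>)"
      proof -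
        have "emeasure lborel (\<Union>K\<in>\<D>. interior K) = emeasure lebesgue (\<Union>K\<in>\<D>. interior K)"
          using borel_open[OF oI] by simp
        also have "\<dots> \<le> emeasure lebesgue (\<Union>\<D>)"
          using D(7) interior_subset by (intro emeasure_mono) (auto simp: fmeasurable_def)
        finally show ?thesis .
      qed
      also have "\<dots> = ennreal (measure lebesgue (\<Union>\<D>))"
        using D(7) by (simp add: emeasure_eq_measure2)
      also have "\<dots> \<le> ennreal e" using D(8) mN by (intro ennreal_leI) simp
      finally have "emeasure \<mu> N \<le> ennreal \<bar>B\<bar> * ennreal e" by (simp add: mult_left_mono)
      then have "ennreal (measure \<mu> N) \<le> ennreal (\<bar>B\<bar> * e)" using e by (simp add: emeasure_eq_measure ennreal_mult)
      then show ?thesis using e by (subst (asm) ennreal_le_iff) auto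
    qed
    note le = this
    have "measure \<mu> N \<le> 0 + e" if "e > 0" for e
    proof -
      have "\<bar>B\<bar> * (e / (\<bar>B\<bar> + 1)) \<le> e" using that by (simp add: field_simps)
      then show ?thesis using le[of "e / (\<bar>B\<bar> + 1)"] that by (simp add: add_nonneg_pos)
    qed
    then have "measure \<mu> N \<le> 0" by (rule field_le_epsilon)
    then show ?thesis using measure_nonneg[of \<mu> N] by linarith
  next
    case False
    then have "{c..d} \<subseteq> {c}" by auto
    then have "N = {} \<or> (N = {c} \<and> c \<in> {c..d})" using N(2) by blast
    then show ?thesis using pt by auto
  qed
qed

text \<open>Height times kernel is b^2 / ((t - l)^2 + b^2), which is bounded by 1 and tends to the
  indicator of l. So an atom is determined by the Green function near the real axis.\<close>

lemma poisson_atom: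
  assumes "finite_measure \<mu>" "sets \<mu> = sets borel"
  shows "(\<lambda>n. inverse (real (Suc n)) * poisson \<mu> l (inverse (real (Suc n)))) \<longlonglongrightarrow> measure \<mu> {l}"
proof -
  interpret finite_measure \<mu> by fact
  define g where "g n t = inverse (real (Suc n)) * (inverse (real (Suc n)) / ((t - l)\<^sup>2 + (inverse (real (Suc n)))\<^sup>2))" for n t
  have b0: "inverse (real (Suc n)) > 0" for n by simp
  have eq: "inverse (real (Suc n)) * poisson \<mu> l (inverse (real (Suc n))) = integral\<^sup>L \<mu> (g n)" for n
    unfolding poisson_def g_def by (subst integral_mult_right_zero) simp
  have "(\<lambda>n. integral\<^sup>L \<mu> (g n)) \<longlonglongrightarrow> (\<integral>t. indicator {l} t \<partial>\<mu>)"
  proof (rule integral_dominated_convergence[where w = "\<lambda>_. 1"])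
    have "g n \<in> borel_measurable borel" for n unfolding g_def by measurable
    then show "g n \<in> borel_measurable \<mu>" for n using assms(2) by (simp cong: measurable_cong_sets)
    show "indicator {l} \<in> borel_measurable \<mu>" using assms(2) by (intro borel_measurable_indicator) simp
    have "norm (g n t) \<le> 1" for n t
    proof -
      have "g n t = (inverse (real (Suc n)))\<^sup>2 / ((t - l)\<^sup>2 + (inverse (real (Suc n)))\<^sup>2)"
        by (simp add: g_def power2_eq_square)
      then show ?thesis using poisson_kernel_pos[OF b0, of t l n] by (simp add: divide_le_eq)
    qed
    then show "AE t in \<mu>. norm (g n t) \<le> 1" for n by simp
    have "(\<lambda>n. g n t) \<longlonglongrightarrow> indicator {l} t" for t
    proof (cases "t = l")
      case True
      then have "g n t = 1" for n using b0[of n] by (simp add: g_def power2_eq_square del: of_nat_Suc)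
      then show ?thesis using True by simp
    next
      case False
      have "(\<lambda>n. g n t) \<longlonglongrightarrow> 0 * (0 / ((t - l)\<^sup>2 + 0\<^sup>2))"
        unfolding g_def by (intro tendsto_intros LIMSEQ_inverse_real_of_nat) (use False in auto)
      then show ?thesis using False by simp
    qed
    then show "AE t in \<mu>. (\<lambda>n. g n t) \<longlonglongrightarrow> indicator {l} t" by simp
  qed simp
  moreover have "(\<integral>t. indicator {l} t \<partial>\<mu>) = measure \<mu> {l}" using assms(2) by simp
  ultimately show ?thesis unfolding eq by simp
qed

text \<open>Sokal's gliding hump.\<close>

lemma uniform_boundedness_inner:
  fixes b :: "nat \<Rightarrow> 'h::{real_inner,complete_space}"
  assumes "\<And>g. \<exists>K. \<forall>n. \<bar>inner (b n) g\<bar> \<le> K"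
  shows "\<exists>K. \<forall>n. norm (b n) \<le> K"
proof (rule ccontr)
  assume unb: "\<not> (\<exists>K. \<forall>n. norm (b n) \<le> K)"
  \<comment> \<open>Growth 4^k is played against steps of length (1/3)^k: all later steps together
    move the point by at most half of (1/3)^k, and the remaining (4/3)^k / 2 still diverges.\<close>
  then have "\<forall>k. \<exists>n. norm (b n) > 4 ^ k" by (meson not_le_imp_less)
  then obtain m where m: "\<And>k. norm (b (m k)) > 4 ^ k" by metis
  have bpos: "norm (b (m k)) > 0" for k using m[of k] by (meson less_trans zero_less_numeral zero_less_power)
  define v where "v k = (1 / 3) ^ k *\<^sub>R sgn (b (m k))" for k
  have nv: "norm (v k) = (1 / 3) ^ k" for k using bpos[of k] by (simp add: v_def norm_sgn)
  have iv: "inner (b (m k)) (v k) = (1 / 3) ^ k * norm (b (m k))" for k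
    using bpos[of k] by (simp add: v_def sgn_div_norm power2_norm_eq_inner[symmetric] power2_eq_square)
  \<comment> \<open>For any point y, one of y + v and y - v gives the k-th functional a value of
    modulus at least its value on v. The recursion picks the sign accordingly.\<close>
  define x where "x = rec_nat 0 (\<lambda>k y. if \<bar>inner (b (m k)) (y + v k)\<bar> \<ge> (1 / 3) ^ k * norm (b (m k)) then y + v k else y - v k)"
  have xS: "x (Suc k) = (if \<bar>inner (b (m k)) (x k + v k)\<bar> \<ge> (1 / 3) ^ k * norm (b (m k)) then x k + v k else x k - v k)" for k
    by (simp add: x_def)
  have big: "\<bar>inner (b (m k)) (x (Suc k))\<bar> \<ge> (1 / 3) ^ k * norm (b (m k))" for k
  proof (cases "\<bar>inner (b (m k)) (x k + v k)\<bar> \<ge> (1 / 3) ^ k * norm (b (m k))")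
    case False
    then have "\<bar>inner (b (m k)) (x k) + (1 / 3) ^ k * norm (b (m k))\<bar> < (1 / 3) ^ k * norm (b (m k))"
      by (simp add: inner_add_right iv)
    then have "\<bar>inner (b (m k)) (x k) - (1 / 3) ^ k * norm (b (m k))\<bar> \<ge> (1 / 3) ^ k * norm (b (m k))" by linarith
    then show ?thesis using False by (simp add: xS inner_diff_right iv)
  qed (simp add: xS)
  have step: "dist (x k) (x (Suc k)) = (1 / 3) ^ k" for k
    by (simp add: xS dist_norm nv)
  have tail: "dist (x k) (x (k + j)) \<le> (3 / 2) * ((1 / 3) ^ k - (1 / 3) ^ (k + j))" for k j
  proof (induction j)
    case (Suc j)
    have "dist (x k) (x (k + Suc j)) \<le> dist (x k) (x (k + j)) + dist (x (k + j)) (x (Suc (k + j)))"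
      by (simp add: dist_triangle)
    also have "\<dots> \<le> (3 / 2) * ((1 / 3) ^ k - (1 / 3) ^ (k + j)) + (1 / 3) ^ (k + j)"
      using Suc by (simp add: step)
    also have "\<dots> = (3 / 2) * ((1 / 3) ^ k - (1 / 3) ^ (k + Suc j))" by (simp add: field_simps)
    finally show ?case .
  qed simp
  have tail': "dist (x k) (x n) \<le> (3 / 2) * (1 / 3) ^ k" if "n \<ge> k" for k n
    using tail[of k "n - k"] that by (auto elim!: order_trans)
  have "Cauchy x"
  proof (rule CauchyI')
    fix e :: real assume "e > 0"
    have l: "(\<lambda>k. (3 / 2) * (1 / 3 :: real) ^ k) \<longlonglongrightarrow> (3 / 2) * 0"
      by (intro tendsto_intros LIMSEQ_power_zero) simp
    obtain N where N: "\<And>k. k \<ge> N \<Longrightarrow> (3 / 2) * (1 / 3 :: real) ^ k < e"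
      using order_tendstoD(2)[OF l, of e] \<open>e > 0\<close> unfolding eventually_sequentially by auto
    show "\<exists>M. \<forall>m\<ge>M. \<forall>n>m. dist (x m) (x n) < e"
    proof (intro exI[of _ N] allI impI)
      fix p n assume "N \<le> p" "p < n"
      then show "dist (x p) (x n) < e" using tail'[of p n] N[of p] by linarith
    qed
  qed
  then obtain X where X: "x \<longlonglongrightarrow> X" using Cauchy_convergent convergent_def by blast
  have dX: "dist (x k) X \<le> (3 / 2) * (1 / 3) ^ k" for k
  proof (rule LIMSEQ_le_const2)
    show "(\<lambda>n. dist (x k) (x n)) \<longlonglongrightarrow> dist (x k) X" by (intro tendsto_intros X)
  qed (use tail' in blast)
  obtain K where K: "\<And>n. \<bar>inner (b n) X\<bar> \<le> K" using assms by blast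
  have "(4 / 3) ^ k / 2 \<le> K" for k
  proof -
    have "\<bar>inner (b (m k)) (x (Suc k) - X)\<bar> \<le> norm (b (m k)) * norm (x (Suc k) - X)" by (rule Cauchy_Schwarz_ineq2)
    also have "\<dots> \<le> norm (b (m k)) * ((3 / 2) * (1 / 3) ^ Suc k)"
      using dX[of "Suc k"] by (intro mult_left_mono) (auto simp: dist_norm)
    also have "\<dots> = (1 / 3) ^ k * norm (b (m k)) / 2" by simp
    finally have "(1 / 3) ^ k * norm (b (m k)) / 2 \<le> \<bar>inner (b (m k)) X\<bar>"
      using big[of k] unfolding inner_diff_right by linarith
    moreover have "(1 / 3) ^ k * 4 ^ k \<le> (1 / 3) ^ k * norm (b (m k))" using m[of k] by (intro mult_left_mono) auto
    moreover have "(1 / 3 :: real) ^ k * 4 ^ k = (4 / 3) ^ k" by (simp add: power_mult_distrib[symmetric])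
    ultimately show ?thesis using K[of "m k"] by linarith
  qed
  moreover obtain k where "(4 / 3 :: real) ^ k > 2 * K" using real_arch_pow[of "4 / 3" "2 * K"] by auto
  ultimately show False by (smt (verit) field_sum_of_halves)
qed

section \<open>Schroedinger operators on sets of lists\<close>

context bounded_symmetric
begin

text \<open>Polarization of the isometry in \<open>continuous_calculus\<close>; the hypothesis
  \<open>nrm\<close> is that isometry for one fixed vector u = \<psi>(A) f.\<close>

lemma continuous_calculus_inner:
  fixes \<psi> :: "real \<Rightarrow> real"
  assumes cont: "continuous_on UNIV \<psi>"
    and nrm: "\<And>s t. (norm (op_poly A s u - op_poly A t f))\<^sup>2 = (\<integral>x. (poly s x * \<psi> x - poly t x)\<^sup>2 \<partial>spec f)"
  shows "inner (op_poly A t f) (op_poly A s u) = (\<integral>x. poly t x * poly s x * \<psi> x \<partial>spec f)"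
proof -
  have "2 * inner (op_poly A t f) (op_poly A s u)
      = (norm (op_poly A s u))\<^sup>2 + (norm (op_poly A t f))\<^sup>2 - (norm (op_poly A s u - op_poly A t f))\<^sup>2"
    by (simp add: power2_norm_eq_inner inner_diff_left inner_diff_right inner_commute)
  also have "(norm (op_poly A s u))\<^sup>2 = (\<integral>x. (poly s x * \<psi> x)\<^sup>2 \<partial>spec f)" using nrm[of s 0] by simp
  also have "(norm (op_poly A t f))\<^sup>2 = (\<integral>x. (poly t x)\<^sup>2 \<partial>spec f)" by (rule norm_op_poly_spec)
  also have "(norm (op_poly A s u - op_poly A t f))\<^sup>2 = (\<integral>x. (poly s x * \<psi> x - poly t x)\<^sup>2 \<partial>spec f)" by (rule nrm)
  also have "(\<integral>x. (poly s x * \<psi> x)\<^sup>2 \<partial>spec f) + (\<integral>x. (poly t x)\<^sup>2 \<partial>spec f) - (\<integral>x. (poly s x * \<psi> x - poly t x)\<^sup>2 \<partial>spec f)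
      = (\<integral>x. (poly s x * \<psi> x)\<^sup>2 + (poly t x)\<^sup>2 - (poly s x * \<psi> x - poly t x)\<^sup>2 \<partial>spec f)"
    by (subst Bochner_Integration.integral_diff Bochner_Integration.integral_add;
        (intro integrable_spec Bochner_Integration.integrable_add continuous_intros cont)?)+ simp
  also have "\<dots> = (\<integral>x. 2 * (poly t x * poly s x * \<psi> x) \<partial>spec f)"
    by (intro Bochner_Integration.integral_cong) (auto simp: power2_eq_square algebra_simps)
  also have "\<dots> = 2 * (\<integral>x. poly t x * poly s x * \<psi> x \<partial>spec f)" by (rule integral_mult_right_zero)
  finally show ?thesis by simp
qed

end

text \<open>For \<phi> injective on B this is a partial isometry whose adjoint is the shift along
  the inverse map. Tree adjacency is a finite sum of such shifts: appending a letter and deleting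
  the last one.\<close>

definition shift_op :: "'v set \<Rightarrow> ('v \<Rightarrow> 'v) \<Rightarrow> 'v l2 \<Rightarrow> 'v l2" where
  "shift_op B \<phi> u = Abs_l2 (\<lambda>x. if x \<in> B then l2_fun u (\<phi> x) else 0)"

lemma
  assumes "inj_on \<phi> B"
  shows l2_fun_shift_op: "l2_fun (shift_op B \<phi> u) x = (if x \<in> B then l2_fun u (\<phi> x) else 0)"
    and norm_shift_op: "norm (shift_op B \<phi> u) \<le> norm u"
proof -
  have le: "(\<Sum>x\<in>F. (cmod (if x \<in> B then l2_fun u (\<phi> x) else 0))\<^sup>2) \<le> (norm u)\<^sup>2" if "finite F" for F
  proof -
    have "(\<Sum>x\<in>F. (cmod (if x \<in> B then l2_fun u (\<phi> x) else 0))\<^sup>2) = (\<Sum>x\<in>F \<inter> B. (cmod (l2_fun u (\<phi> x)))\<^sup>2)"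
      using that by (intro sum.mono_neutral_cong_right) auto
    also have "\<dots> = (\<Sum>y\<in>\<phi> ` (F \<inter> B). (cmod (l2_fun u y))\<^sup>2)"
      using assms by (subst sum.reindex) (auto intro: inj_on_subset)
    also have "\<dots> \<le> (norm u)\<^sup>2" using that by (intro sum_cmod_squared_le_norm) auto
    finally show ?thesis .
  qed
  note s = square_summable_bounded[OF le]
  show f: "l2_fun (shift_op B \<phi> u) x = (if x \<in> B then l2_fun u (\<phi> x) else 0)" for x
    unfolding shift_op_def using s(1) by (simp add: Abs_l2_inverse)
  have "(norm (shift_op B \<phi> u))\<^sup>2 \<le> (norm u)\<^sup>2" unfolding norm_l2_squared[of "shift_op B \<phi> u"] f by (rule s(2))
  then show "norm (shift_op B \<phi> u) \<le> norm u" by (rule power2_le_imp_le) simp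
qed

lemma cinner_shift_op:
  assumes "inj_on \<phi> B" "inj_on \<kappa> D" "D = \<phi> ` B" "\<And>x. x \<in> B \<Longrightarrow> \<kappa> (\<phi> x) = x"
  shows "cinner (shift_op B \<phi> u) v = cinner u (shift_op D \<kappa> v)"
proof -
  have "cinner (shift_op B \<phi> u) v = (\<Sum>\<^sub>\<infinity>x\<in>B. cnj (l2_fun u (\<phi> x)) * l2_fun v x)"
    unfolding cinner_def by (rule infsum_cong_neutral) (auto simp: l2_fun_shift_op[OF assms(1)])
  also have "\<dots> = (\<Sum>\<^sub>\<infinity>x\<in>B. ((\<lambda>y. cnj (l2_fun u y) * l2_fun v (\<kappa> y)) \<circ> \<phi>) x)"
    by (rule infsum_cong) (simp add: assms(4))
  also have "\<dots> = (\<Sum>\<^sub>\<infinity>y\<in>D. cnj (l2_fun u y) * l2_fun v (\<kappa> y))"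
    unfolding assms(3) by (rule infsum_reindex[symmetric]) (rule assms(1))
  also have "\<dots> = cinner u (shift_op D \<kappa> v)"
    unfolding cinner_def by (rule infsum_cong_neutral) (auto simp: l2_fun_shift_op[OF assms(2)])
  finally show ?thesis .
qed

lemma cinner_add_left: "cinner (u + v) w = cinner u w + cinner v w"
  by (metis cinner_add_right cinner_commute complex_cnj_add)

lemma cinner_zero [simp]: "cinner 0 v = 0" "cinner v 0 = 0"
  by (simp_all add: cinner_def)

lemma cinner_sum_left: "cinner (\<Sum>i\<in>I. f i) v = (\<Sum>i\<in>I. cinner (f i) v)"
  by (induction I rule: infinite_finite_induct) (auto simp: cinner_add_left)

lemma cinner_sum_right: "cinner v (\<Sum>i\<in>I. f i) = (\<Sum>i\<in>I. cinner v (f i))"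
  by (induction I rule: infinite_finite_induct) (auto simp: cinner_add_right)

lemma l2_fun_sum: "l2_fun (\<Sum>i\<in>I. f i) x = (\<Sum>i\<in>I. l2_fun (f i) x)"
  by (induction I rule: infinite_finite_induct) auto

text \<open>S is an arbitrary set of nonempty words over a finite alphabet, so the same operator
  theory serves the whole tree, its cut components and the cones.\<close>

locale list_graph =
  fixes V :: "'a set" and W :: "'a \<Rightarrow> real" and S :: "'a list set"
  assumes finV: "finite V" and SV: "p \<in> S \<Longrightarrow> p \<noteq> [] \<and> set p \<subseteq> V"
begin

abbreviation "Wt \<equiv> W \<circ> last"

definition "down_op c = shift_op {x \<in> S. x @ [c] \<in> S} (\<lambda>x. x @ [c])"
definition "up_op c = shift_op {x \<in> S. last x = c \<and> butlast x \<in> S} butlast"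
definition "pot_bound = (\<Sum>c\<in>V. \<bar>W c\<bar>)"
definition "pot_op u = Abs_l2 (\<lambda>x. if x \<in> S then complex_of_real (W (last x)) * l2_fun u x else 0)"
text \<open>Written as a sum over the alphabet, the operator inherits boundedness and symmetry from
  the shifts; \<open>l2_fun_Hop\<close> identifies it with \<open>Hsub\<close>.\<close>

definition "Hop u = (\<Sum>c\<in>V. down_op c u + up_op c u) + pot_op u"
text \<open>Each letter contributes two shifts of norm at most 1. The final 1 makes the bound
  strictly positive.\<close>

definition "Cbound = 2 * real (card V) + pot_bound + 1"

lemma last_in_V: "p \<in> S \<Longrightarrow> last p \<in> V"
  using SV last_in_set by blast

lemma pot_bound_nonneg: "pot_bound \<ge> 0"
  unfolding pot_bound_def by (rule sum_nonneg) simp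

lemma inj_down: "inj_on (\<lambda>x. x @ [c]) {x \<in> S. x @ [c] \<in> S}"
  by (auto simp: inj_on_def)

lemma inj_up: "inj_on butlast {x \<in> S. last x = c \<and> butlast x \<in> S}"
  unfolding inj_on_def using SV by (metis (mono_tags, lifting) append_butlast_last_id mem_Collect_eq)

lemmas l2_fun_down = l2_fun_shift_op[OF inj_down, folded down_op_def]
  and l2_fun_up = l2_fun_shift_op[OF inj_up, folded up_op_def]
  and norm_down = norm_shift_op[OF inj_down, folded down_op_def]
  and norm_up = norm_shift_op[OF inj_up, folded up_op_def]

lemma W_le: "p \<in> S \<Longrightarrow> \<bar>W (last p)\<bar> \<le> pot_bound"
  unfolding pot_bound_def using member_le_sum[of "last p" V "\<lambda>c. \<bar>W c\<bar>"] last_in_V finV by simp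

lemma
  shows l2_fun_pot: "l2_fun (pot_op u) x = (if x \<in> S then complex_of_real (W (last x)) * l2_fun u x else 0)"
    and norm_pot: "norm (pot_op u) \<le> pot_bound * norm u"
proof -
  have pw: "(cmod (if x \<in> S then complex_of_real (W (last x)) * l2_fun u x else 0))\<^sup>2 \<le> pot_bound\<^sup>2 * (cmod (l2_fun u x))\<^sup>2" for x
  proof (cases "x \<in> S")
    case True
    have "(\<bar>W (last x)\<bar> * cmod (l2_fun u x))\<^sup>2 \<le> (pot_bound * cmod (l2_fun u x))\<^sup>2"
      by (intro power_mono mult_right_mono W_le True) auto
    then show ?thesis using True by (simp add: norm_mult power_mult_distrib)
  qed simp
  have s: "(\<lambda>x. pot_bound\<^sup>2 * (cmod (l2_fun u x))\<^sup>2) summable_on UNIV"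
    by (intro summable_on_cmult_right l2_fun_summable)
  show f: "l2_fun (pot_op u) x = (if x \<in> S then complex_of_real (W (last x)) * l2_fun u x else 0)" for x
    unfolding pot_op_def using square_summable_comparison[OF s pw] by (simp add: Abs_l2_inverse)
  have "(norm (pot_op u))\<^sup>2 \<le> (\<Sum>\<^sub>\<infinity>x. pot_bound\<^sup>2 * (cmod (l2_fun u x))\<^sup>2)"
    unfolding norm_l2_squared by (rule infsum_mono[OF l2_fun_summable s]) (simp only: f pw)
  also have "\<dots> = (pot_bound * norm u)\<^sup>2"
    unfolding power_mult_distrib norm_l2_squared by (rule infsum_cmult_right')
  finally show "norm (pot_op u) \<le> pot_bound * norm u"
    by (rule power2_le_imp_le) (simp add: pot_bound_nonneg)
qed

lemma neighbours_eq:
  assumes "p \<in> S"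
  shows "{q \<in> S. tadj p q} = (\<lambda>c. p @ [c]) ` {c \<in> V. p @ [c] \<in> S} \<union> (if butlast p \<in> S then {butlast p} else {})"
proof
  show "{q \<in> S. tadj p q} \<subseteq> (\<lambda>c. p @ [c]) ` {c \<in> V. p @ [c] \<in> S} \<union> (if butlast p \<in> S then {butlast p} else {})"
    unfolding tadj_def using SV by fastforce
  have "tadj p (butlast p)" unfolding tadj_def using SV[OF assms] by (metis append_butlast_last_id)
  then show "(\<lambda>c. p @ [c]) ` {c \<in> V. p @ [c] \<in> S} \<union> (if butlast p \<in> S then {butlast p} else {}) \<subseteq> {q \<in> S. tadj p q}"
    by (auto simp: tadj_def)
qed

lemma finite_neighbours: "p \<in> S \<Longrightarrow> finite {q \<in> S. tadj p q}"
  using neighbours_eq finV by simp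

lemma l2_fun_Hop: "l2_fun (Hop u) x = Hsub Wt S (l2_fun u) x"
proof (cases "x \<in> S")
  case True
  have "butlast x \<notin> (\<lambda>c. x @ [c]) ` {c \<in> V. x @ [c] \<in> S}"
  proof
    assume "butlast x \<in> (\<lambda>c. x @ [c]) ` {c \<in> V. x @ [c] \<in> S}"
    then obtain c where "butlast x = x @ [c]" by blast
    then have "length (butlast x) = length (x @ [c])" by (rule arg_cong)
    then show False by simp
  qed
  then have "(\<Sum>q\<in>{q \<in> S. tadj x q}. l2_fun u q)
      = (\<Sum>q\<in>(\<lambda>c. x @ [c]) ` {c \<in> V. x @ [c] \<in> S}. l2_fun u q) + (if butlast x \<in> S then l2_fun u (butlast x) else 0)"
    unfolding neighbours_eq[OF True] using finV by (simp add: add.commute)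
  also have "(\<Sum>q\<in>(\<lambda>c. x @ [c]) ` {c \<in> V. x @ [c] \<in> S}. l2_fun u q) = (\<Sum>c\<in>{c \<in> V. x @ [c] \<in> S}. l2_fun u (x @ [c]))"
    by (subst sum.reindex) (auto simp: inj_on_def)
  also have "\<dots> = (\<Sum>c\<in>V. l2_fun (down_op c u) x)"
    using finV True by (simp add: l2_fun_down sum.inter_filter)
  also have "(if butlast x \<in> S then l2_fun u (butlast x) else 0)
      = (\<Sum>c\<in>V. if c = last x then (if butlast x \<in> S then l2_fun u (butlast x) else 0) else 0)"
    using finV last_in_V[OF True] by simp
  also have "\<dots> = (\<Sum>c\<in>V. l2_fun (up_op c u) x)"
    using True by (intro sum.cong) (auto simp: l2_fun_up)
  finally show ?thesis using True by (simp add: Hop_def Hsub_def l2_fun_sum l2_fun_pot sum.distrib)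
next
  case False
  then show ?thesis by (simp add: Hop_def Hsub_def l2_fun_sum l2_fun_pot l2_fun_up l2_fun_down)
qed

lemma cinner_pot: "cinner (pot_op u) v = cinner u (pot_op v)"
  unfolding cinner_def by (rule infsum_cong) (auto simp: l2_fun_pot)

lemma cinner_down: "cinner (down_op c u) v = cinner u (up_op c v)"
  unfolding down_op_def up_op_def
  by (rule cinner_shift_op[OF inj_down inj_up]) (use SV in \<open>auto simp: image_iff intro!: exI[of _ "butlast _"]\<close>)

lemma cinner_up: "cinner (up_op c u) v = cinner u (down_op c v)"
  by (metis cinner_commute cinner_down)

lemma cinner_Hop: "cinner (Hop u) v = cinner u (Hop v)"
  unfolding Hop_def
  by (simp add: cinner_add_left cinner_add_right cinner_sum_left cinner_sum_right cinner_pot cinner_up cinner_down add.commute)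

lemma Hop_cscale: "Hop (cscale c u) = cscale c (Hop u)"
  by (rule l2_eqI) (simp add: l2_fun_Hop Hsub_def sum_distrib_left algebra_simps)

lemma norm_Hop: "norm (Hop u) \<le> Cbound * norm u"
proof -
  have "norm (Hop u) \<le> norm (\<Sum>c\<in>V. down_op c u + up_op c u) + norm (pot_op u)"
    unfolding Hop_def by (rule norm_triangle_ineq)
  also have "norm (\<Sum>c\<in>V. down_op c u + up_op c u) \<le> (\<Sum>c\<in>V. norm u + norm u)"
    by (intro sum_norm_le order_trans[OF norm_triangle_ineq] add_mono norm_down norm_up)
  also have "(\<Sum>c\<in>V. norm u + norm u) + norm (pot_op u) \<le> 2 * real (card V) * norm u + pot_bound * norm u"
    using norm_pot[of u] by simp
  also have "\<dots> \<le> Cbound * norm u" by (simp add: Cbound_def algebra_simps)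
  finally show ?thesis by simp
qed

lemma Cbound_pos: "Cbound > 0"
  unfolding Cbound_def using pot_bound_nonneg by (simp add: add_nonneg_pos)

lemma linear_Hop: "linear Hop"
  unfolding linear_iff
  by (intro conjI allI l2_eqI) (auto simp: l2_fun_Hop Hsub_def sum_distrib_left sum.distrib algebra_simps)

lemma inner_Hop: "inner (Hop x) y = inner x (Hop y)"
  by (simp add: inner_l2_def cinner_Hop)

sublocale bounded_symmetric Hop Cbound
  by (intro bounded_symmetric.intro linear_Hop inner_Hop norm_Hop Cbound_pos)

definition supp :: "'a list l2 \<Rightarrow> bool" where "supp u \<longleftrightarrow> (\<forall>x. x \<notin> S \<longrightarrow> l2_fun u x = 0)"

lemma ell2_iff: "ell2 S f \<longleftrightarrow> (\<exists>u. supp u \<and> f = l2_fun u)"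
proof
  assume f: "ell2 S f"
  then have "(\<lambda>x. (cmod (f x))\<^sup>2) summable_on S" by (simp add: ell2_def)
  also have "(\<lambda>x. (cmod (f x))\<^sup>2) summable_on S \<longleftrightarrow> (\<lambda>x. (cmod (f x))\<^sup>2) summable_on UNIV"
    by (rule summable_on_cong_neutral) (use f in \<open>auto simp: ell2_def\<close>)
  finally have "f = l2_fun (Abs_l2 f)" by (simp add: Abs_l2_inverse)
  then show "\<exists>u. supp u \<and> f = l2_fun u" using f unfolding supp_def ell2_def by metis
qed (auto simp: supp_def ell2_def l2_fun_summable)

lemma supp_Hop: "supp (Hop u)"
  by (simp add: supp_def l2_fun_Hop Hsub_def)

lemma supp_delta: "v \<in> S \<Longrightarrow> supp (l2_delta v)"
  by (auto simp: supp_def)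

lemma solution_iff:
  assumes "supp u" "supp g"
  shows "(\<forall>x\<in>S. Hsub Wt S (l2_fun u) x - z * l2_fun u x = l2_fun g x) \<longleftrightarrow> Hop u - cscale z u = g"
proof
  assume *: "\<forall>x\<in>S. Hsub Wt S (l2_fun u) x - z * l2_fun u x = l2_fun g x"
  show "Hop u - cscale z u = g"
  proof (rule l2_eqI)
    fix x
    show "l2_fun (Hop u - cscale z u) x = l2_fun g x"
      using * assms supp_Hop[of u] by (cases "x \<in> S") (auto simp: l2_fun_Hop[symmetric] supp_def)
  qed
next
  assume *: "Hop u - cscale z u = g"
  have "l2_fun (Hop u - cscale z u) x = l2_fun g x" for x by (simp only: *)
  then show "\<forall>x\<in>S. Hsub Wt S (l2_fun u) x - z * l2_fun u x = l2_fun g x" by (simp add: l2_fun_Hop)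
qed

lemma Im_cinner_Hop: "Im (cinner u (Hop u)) = 0"
  using cinner_commute[of "Hop u" u] by (simp add: cinner_Hop complex_eq_iff)

lemma solution_unique:
  assumes "Im z \<noteq> 0" "Hop u - cscale z u = 0"
  shows "u = 0"
proof -
  have "cinner u (Hop u) = z * cinner u u" using assms(2) by (simp add: cinner_cscale_right[symmetric])
  then have "Im z * (norm u)\<^sup>2 = 0" using Im_cinner_Hop[of u] by (simp add: cinner_self norm_l2_squared)
  then show ?thesis using assms by simp
qed

text \<open>With z = a + i b the inverse of H - z is (H - cnj z) times the inverse of (H - a)^2 +
  b^2. The second factor is a real continuous function of H, so the real functional calculus
  suffices.\<close>

lemma resolvent_exists:
  assumes z: "Im z \<noteq> 0"
  shows "\<exists>f. Hop f - cscale z f = g \<and>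
    integrable (spec g) (\<lambda>t. 1 / (complex_of_real t - z)) \<and>
    cinner g f = (\<integral>t. 1 / (complex_of_real t - z) \<partial>spec g)"
proof -
  define a b where "a = Re z" and "b = Im z"
  have zab: "z = Complex a b" by (simp add: a_def b_def)
  define s where "s = [:a\<^sup>2 + b\<^sup>2, - 2 * a, 1:]"
  have ps: "poly s t = (t - a)\<^sup>2 + b\<^sup>2" for t by (simp add: s_def power2_eq_square algebra_simps)
  have pos: "poly s t > 0" for t using z unfolding ps b_def[symmetric] by (simp add: add_nonneg_pos)
  define \<psi> where "\<psi> t = 1 / poly s t" for t
  have c\<psi>: "continuous_on UNIV \<psi>"
    unfolding \<psi>_def using pos by (intro continuous_intros) (auto simp: less_le)
  obtain Q \<Phi> where lim: "\<And>f. (\<lambda>n. op_poly Hop (Q n) f) \<longlonglongrightarrow> \<Phi> f"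
    and nrm: "\<And>f s t. (norm (op_poly Hop s (\<Phi> f) - op_poly Hop t f))\<^sup>2 = (\<integral>x. (poly s x * \<psi> x - poly t x)\<^sup>2 \<partial>spec f)"
    and inn: "\<And>f. inner f (\<Phi> f) = (\<integral>x. \<psi> x \<partial>spec f)"
    by (rule continuous_calculus[OF c\<psi>]) blast
  define u where "u = \<Phi> g"
  have "(norm (op_poly Hop s u - op_poly Hop 1 g))\<^sup>2 = 0"
    unfolding u_def nrm \<psi>_def using pos by (simp add: less_imp_neq[THEN not_sym])
  then have su: "op_poly Hop s u = g" by simp
  have su': "op_poly Hop s u = (a\<^sup>2 + b\<^sup>2) *\<^sub>R u - (2 * a) *\<^sub>R Hop u + Hop (Hop u)"
    unfolding s_def op_poly_pCons by (simp add: linear_add[OF lin] linear_cmul[OF lin] linear_diff[OF lin] linear_neg[OF lin])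
  define f where "f = Hop u - cscale (cnj z) u"
  have "Hop f - cscale z f = g"
  proof (rule l2_eqI)
    fix x
    have "l2_fun g x = (complex_of_real (a\<^sup>2 + b\<^sup>2)) * l2_fun u x - complex_of_real (2 * a) * l2_fun (Hop u) x + l2_fun (Hop (Hop u)) x"
      unfolding su[symmetric] su' by simp
    moreover have "z * cnj z = complex_of_real (a\<^sup>2 + b\<^sup>2)" "z + cnj z = complex_of_real (2 * a)"
      by (simp_all add: zab complex_eq_iff power2_eq_square)
    moreover have "l2_fun (Hop f - cscale z f) x
        = (z * cnj z) * l2_fun u x - (z + cnj z) * l2_fun (Hop u) x + l2_fun (Hop (Hop u)) x"
      unfolding f_def linear_diff[OF lin] Hop_cscale by (simp add: algebra_simps)
    ultimately show "l2_fun (Hop f - cscale z f) x = l2_fun g x" by (simp only:)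
  qed
  moreover have eq: "1 / (complex_of_real t - z) = complex_of_real ((t - a) * \<psi> t) + \<i> * complex_of_real (b * \<psi> t)" for t
  proof -
    have "complex_of_real t - z \<noteq> 0" using z by (metis Im_complex_of_real eq_iff_diff_eq_0)
    moreover have "(complex_of_real t - z) * (complex_of_real ((t - a)) + \<i> * complex_of_real b) = complex_of_real (poly s t)"
      by (simp add: zab ps complex_eq_iff power2_eq_square algebra_simps)
    moreover have "complex_of_real (poly s t) \<noteq> 0" using pos[of t] by simp
    ultimately show ?thesis unfolding \<psi>_def
      by (simp add: field_simps) 
  qed
  have i1: "integrable (spec g) (\<lambda>t. (t - a) * \<psi> t)" "integrable (spec g) (\<lambda>t. b * \<psi> t)"
    by (intro integrable_spec continuous_intros c\<psi>)+
  have "integrable (spec g) (\<lambda>t. 1 / (complex_of_real t - z))"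
    unfolding eq by (intro Bochner_Integration.integrable_add integrable_mult_right integrable_of_real i1)
  moreover have "cinner g f = (\<integral>t. 1 / (complex_of_real t - z) \<partial>spec g)"
  proof -
    \<comment> \<open>Vectors p(H) u with real p pair to real numbers, since real polynomials in H
      are symmetric and commute. The real inner products given by the calculus therefore determine
      the complex ones.\<close>
    have r: "Im (cinner (op_poly Hop p u) (op_poly Hop q u)) = 0" for p q
    proof -
      have cs: "cinner (op_poly Hop p x) y = cinner x (op_poly Hop p y)" for p x y
      proof -
        have "op_poly Hop p (cscale c x) = cscale c (op_poly Hop p x)" for c x
          by (induction p) (auto simp: op_poly_pCons Hop_cscale intro!: l2_eqI simp: algebra_simps)
        then have "Im (cinner (op_poly Hop p x) y) = Im (cinner x (op_poly Hop p y))"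
          by (simp add: Im_cinner op_poly_sym)
        then show ?thesis by (simp add: complex_eq_iff Re_cinner op_poly_sym)
      qed
      have "cinner (op_poly Hop p u) (op_poly Hop q u) = cnj (cinner (op_poly Hop p u) (op_poly Hop q u))"
        unfolding cinner_commute[symmetric] by (simp add: cs op_poly_commute)
      then show ?thesis by (simp add: complex_eq_iff)
    qed
    have Hu: "Hop u = op_poly Hop [:0, 1:] u" by (simp add: op_poly_pCons)
    have "Im (cinner g u) = 0" using r[of s 1] by (simp add: su)
    moreover have "Re (cinner g u) = (\<integral>x. \<psi> x \<partial>spec g)" by (simp add: Re_cinner u_def inn)
    ultimately have gu: "cinner g u = complex_of_real (\<integral>x. \<psi> x \<partial>spec g)" by (simp add: complex_eq_iff)
    have "Im (cinner g (Hop u)) = 0" using r[of s "[:0, 1:]"] by (simp add: su op_poly_pCons)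
    moreover have "Re (cinner g (Hop u)) = (\<integral>x. x * \<psi> x \<partial>spec g)"
      using continuous_calculus_inner[OF c\<psi> nrm[of _ g], of 1 "[:0, 1:]"] by (simp add: Re_cinner u_def op_poly_pCons)
    ultimately have gHu: "cinner g (Hop u) = complex_of_real (\<integral>x. x * \<psi> x \<partial>spec g)" by (simp add: complex_eq_iff)
    have "cinner g f = cinner g (Hop u) - cnj z * cinner g u"
      unfolding f_def using cinner_add_right[of g "Hop u" "cscale (- cnj z) u"]
      by (simp add: cinner_cscale_right) (metis (no_types, lifting) l2_eqI add_uminus_conv_diff l2_fun_simps(2) l2_fun_simps(4) l2_fun_simps(6) mult_minus_left)
    also have "\<dots> = complex_of_real ((\<integral>x. x * \<psi> x \<partial>spec g) - a * (\<integral>x. \<psi> x \<partial>spec g)) + \<i> * complex_of_real (b * (\<integral>x. \<psi> x \<partial>spec g))"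
      unfolding gu gHu by (simp add: zab complex_eq_iff)
    also have "(\<integral>x. x * \<psi> x \<partial>spec g) - a * (\<integral>x. \<psi> x \<partial>spec g) = (\<integral>x. (x - a) * \<psi> x \<partial>spec g)"
    proof -
      have "(\<integral>x. (x - a) * \<psi> x \<partial>spec g) = (\<integral>x. x * \<psi> x - a * \<psi> x \<partial>spec g)" by (simp add: left_diff_distrib)
      also have "\<dots> = (\<integral>x. x * \<psi> x \<partial>spec g) - (\<integral>x. a * \<psi> x \<partial>spec g)"
        by (intro Bochner_Integration.integral_diff integrable_spec continuous_intros c\<psi>)
      finally show ?thesis by simp
    qed
    also have "b * (\<integral>x. \<psi> x \<partial>spec g) = (\<integral>x. b * \<psi> x \<partial>spec g)" by simp
    also have "complex_of_real (\<integral>x. (x - a) * \<psi> x \<partial>spec g) + \<i> * complex_of_real (\<integral>x. b * \<psi> x \<partial>spec g)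
       = (\<integral>t. 1 / (complex_of_real t - z) \<partial>spec g)"
      unfolding eq
      by (subst Bochner_Integration.integral_add)
         (auto simp del: of_real_mult intro!: integrable_mult_right integrable_of_real i1)
    finally show ?thesis .
  qed
  ultimately show ?thesis by blast
qed

text \<open>The resolvent on functions of all words. Off S the operator is 0, so there it divides by
  - z; on vectors supported in S it agrees with \<open>resolvent\<close>.\<close>

definition res :: "complex \<Rightarrow> 'a list l2 \<Rightarrow> 'a list l2" where
  "res z g = (THE f. Hop f - cscale z f = g)"

lemma res_eq:
  assumes "Im z \<noteq> 0"
  shows "Hop (res z g) - cscale z (res z g) = g"
    and res_unique: "Hop f - cscale z f = g \<Longrightarrow> f = res z g"
    and integrable_stieltjes: "integrable (spec g) (\<lambda>t. 1 / (complex_of_real t - z))"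
    and cinner_res: "cinner g (res z g) = (\<integral>t. 1 / (complex_of_real t - z) \<partial>spec g)"
proof -
  obtain f where f: "Hop f - cscale z f = g" "integrable (spec g) (\<lambda>t. 1 / (complex_of_real t - z))"
    "cinner g f = (\<integral>t. 1 / (complex_of_real t - z) \<partial>spec g)" using resolvent_exists[OF assms] by blast
  have uniq: "h = f" if "Hop h - cscale z h = g" for h
  proof -
    have "Hop (h - f) - cscale z (h - f) = 0"
    proof (rule l2_eqI)
      fix x
      have "l2_fun (Hop h - cscale z h) x = l2_fun (Hop f - cscale z f) x" by (simp only: that f)
      then show "l2_fun (Hop (h - f) - cscale z (h - f)) x = l2_fun 0 x"
        by (simp add: linear_diff[OF lin] algebra_simps)
    qed
    from solution_unique[OF assms this] show ?thesis by simp
  qed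
  have rf: "res z g = f" unfolding res_def by (rule the_equality, rule f(1), rule uniq)
  show "Hop (res z g) - cscale z (res z g) = g" "Hop h - cscale z h = g \<Longrightarrow> h = res z g"
    "integrable (spec g) (\<lambda>t. 1 / (complex_of_real t - z))"
    "cinner g (res z g) = (\<integral>t. 1 / (complex_of_real t - z) \<partial>spec g)" for h
    unfolding rf by (rule f uniq | assumption)+
qed

lemma supp_res:
  assumes "Im z \<noteq> 0" "supp g"
  shows "supp (res z g)"
  unfolding supp_def
proof (intro allI impI)
  fix x assume "x \<notin> S"
  then have "l2_fun (Hop (res z g) - cscale z (res z g)) x = 0" using res_eq(1)[OF assms(1)] assms(2) by (simp add: supp_def)
  then show "l2_fun (res z g) x = 0"
    using supp_Hop[of "res z g"] \<open>x \<notin> S\<close> assms(1) by (auto simp: supp_def)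
qed

lemma ex1_solution:
  assumes "Im z \<noteq> 0" "supp g"
  shows "\<exists>!f. ell2 S f \<and> (\<forall>x\<in>S. Hsub Wt S f x - z * f x = l2_fun g x)"
    and resolvent_eq: "resolvent Wt S z (l2_fun g) = l2_fun (res z g)"
proof -
  have *: "ell2 S f \<and> (\<forall>x\<in>S. Hsub Wt S f x - z * f x = l2_fun g x) \<longleftrightarrow> f = l2_fun (res z g)" for f
  proof
    assume f: "ell2 S f \<and> (\<forall>x\<in>S. Hsub Wt S f x - z * f x = l2_fun g x)"
    obtain u where u: "supp u" "f = l2_fun u" using f ell2_iff by blast
    have "Hop u - cscale z u = g" using f unfolding u(2) solution_iff[OF u(1) assms(2)] by (rule conjunct2)
    from res_unique[OF assms(1) this] show "f = l2_fun (res z g)" using u(2) by simp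
  next
    assume "f = l2_fun (res z g)"
    then show "ell2 S f \<and> (\<forall>x\<in>S. Hsub Wt S f x - z * f x = l2_fun g x)"
      using supp_res[OF assms] solution_iff[OF supp_res[OF assms] assms(2)] res_eq(1)[OF assms(1)] ell2_iff by blast
  qed
  show "\<exists>!f. ell2 S f \<and> (\<forall>x\<in>S. Hsub Wt S f x - z * f x = l2_fun g x)" unfolding * by simp
  show "resolvent Wt S z (l2_fun g) = l2_fun (res z g)" unfolding resolvent_def * by simp
qed

lemma nonreal_not_spectrum: "Im z \<noteq> 0 \<Longrightarrow> z \<notin> spectrum_op Wt S"
  unfolding spectrum_op_def mem_Collect_eq not_not using ex1_solution(1) ell2_iff by metis

lemma green_eq: "Im z \<noteq> 0 \<Longrightarrow> v \<in> S \<Longrightarrow> green Wt S z x v = l2_fun (res z (l2_delta v)) x"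
  unfolding green_def using resolvent_eq[OF _ supp_delta] by (simp add: l2_delta.rep_eq)

lemma green_diag: "Im z \<noteq> 0 \<Longrightarrow> v \<in> S \<Longrightarrow> green Wt S z v v = (\<integral>t. 1 / (complex_of_real t - z) \<partial>spec (l2_delta v))"
  by (simp add: green_eq cinner_res[symmetric] cinner_delta)

text \<open>In the pairing of g = (H - z) f with f = \<open>res z g\<close> the term with H is real,
  so that only Im z times |f|^2 is left in the imaginary part.\<close>

lemma Im_cinner_res: "Im z \<noteq> 0 \<Longrightarrow> Im (cinner g (res z g)) = Im z * (norm (res z g))\<^sup>2"
proof -
  assume z: "Im z \<noteq> 0"
  let ?f = "res z g"
  have "cinner g ?f = cinner (Hop ?f + cscale (- z) ?f) ?f"
    using res_eq(1)[OF z, of g] by (metis (no_types, lifting) l2_eqI add_uminus_conv_diff l2_fun_simps(2) l2_fun_simps(4) l2_fun_simps(6) mult_minus_left)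
  also have "\<dots> = cinner ?f (Hop ?f) + cnj (- z) * cinner ?f ?f"
    unfolding cinner_add_left cinner_Hop cinner_commute[of "cscale (- z) ?f" ?f] by (simp add: cinner_cscale_right cinner_self)
  finally show ?thesis using Im_cinner_Hop[of ?f] by (simp add: cinner_self norm_l2_squared)
qed

lemma poisson_spec:
  assumes "b > 0"
  shows "poisson (spec g) a b = Im (cinner g (res (Complex a b) g))"
proof -
  have z: "Im (Complex a b) \<noteq> 0" using assms by simp
  have "Im (cinner g (res (Complex a b) g)) = (\<integral>t. Im (1 / (complex_of_real t - Complex a b)) \<partial>spec g)"
    unfolding cinner_res[OF z] by (rule integral_Im[OF integrable_stieltjes[OF z], symmetric])
  also have "\<dots> = poisson (spec g) a b"
    unfolding poisson_def
    by (intro Bochner_Integration.integral_cong refl) (simp add: Im_divide power2_eq_square)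
  finally show ?thesis by simp
qed

lemma poisson_delta:
  "b > 0 \<Longrightarrow> v \<in> S \<Longrightarrow> poisson (spec (l2_delta v)) a b = Im (green Wt S (Complex a b) v v)"
  by (simp add: poisson_spec green_eq cinner_delta)

lemma spectral_measure_spec:
  assumes "supp g"
  shows "is_spectral_measure Wt S (l2_fun g) (spec g)"
  unfolding is_spectral_measure_def
proof (intro conjI allI impI finite_measure_spec sets_spec)
  fix z :: complex assume z: "Im z \<noteq> 0"
  show "integrable (spec g) (\<lambda>t. 1 / (complex_of_real t - z))" by (rule integrable_stieltjes[OF z])
  have "l2_inner S (l2_fun g) (resolvent Wt S z (l2_fun g)) = cinner g (res z g)"
    unfolding resolvent_eq[OF z assms] l2_inner_def cinner_def
    by (rule infsum_cong_neutral) (use assms in \<open>auto simp: supp_def\<close>)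
  then show "l2_inner S (l2_fun g) (resolvent Wt S z (l2_fun g)) = (\<integral>t. 1 / (complex_of_real t - z) \<partial>spec g)"
    by (simp add: cinner_res[OF z])
qed

end

section \<open>Spectral criteria\<close>

lemma bounded_linear_cscale: "bounded_linear (cscale c)"
  by (rule bounded_linear_intro[where K = "cmod c"]) (auto simp: norm_cscale algebra_simps intro!: l2_eqI)

lemma cinner_cscale_left: "cinner (cscale c u) v = cnj c * cinner u v"
  by (metis cinner_commute cinner_cscale_right complex_cnj_mult complex_cnj_cnj)

context list_graph
begin

text \<open>Vectors without mass in the closed set K are stable under sums, complex multiples and
  norm limits, so delta functions decide.\<close>

lemma spec_null_extend:
  assumes "closed K" "\<And>v. v \<in> S \<Longrightarrow> measure (spec (l2_delta v)) K = 0" "supp f"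
  shows "measure (spec f) K = 0"
proof (rule l2_delta_induct[where v = f and P = "\<lambda>u. measure (spec u) K = 0"])
  interpret finite_measure "spec 0" by (rule finite_measure_spec)
  show "measure (spec 0) K = 0"
    using bounded_measure[of K] measure_spec_UNIV[of 0] measure_nonneg[of "spec 0" K] by simp
next
  fix u c x assume u: "measure (spec u) K = 0" and x: "l2_fun f x \<noteq> 0"
  have "x \<in> S" using x assms(3) by (auto simp: supp_def)
  then have "measure (spec (cscale c (l2_delta x))) K \<le> (cmod c)\<^sup>2 * 0"
    using measure_spec_commuting[OF assms(1) bounded_linear_cscale Hop_cscale, of c "cmod c" "l2_delta x"] assms(2)
    by (simp add: norm_cscale)
  then show "measure (spec (u + cscale c (l2_delta x))) K = 0"
    using measure_spec_add[OF assms(1), of u "cscale c (l2_delta x)"] u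
      measure_nonneg[of "spec (u + cscale c (l2_delta x))" K] by linarith
qed (rule measure_spec_limit_zero[OF assms(1)])

text \<open>The spectrum asks for solutions supported in S, and the functional calculus may produce
  values off S. Cutting them away does not change the image under \<open>Hop\<close>.\<close>

definition restr :: "'a list l2 \<Rightarrow> 'a list l2" where "restr u = shift_op S id u"

lemma l2_fun_restr: "l2_fun (restr u) x = (if x \<in> S then l2_fun u x else 0)"
  unfolding restr_def by (subst l2_fun_shift_op) auto

lemma supp_restr: "supp (restr u)"
  by (simp add: supp_def l2_fun_restr)

lemma Hop_restr: "Hop (restr u) = Hop u"
  by (rule l2_eqI) (auto simp: l2_fun_Hop Hsub_def l2_fun_restr intro!: sum.cong)

lemma not_in_spectrum_iff:
  "z \<notin> spectrum_op Wt S \<longleftrightarrow> (\<forall>g. supp g \<longrightarrow> (\<exists>!u. supp u \<and> Hop u - cscale z u = g))"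
proof -
  have *: "(\<exists>!f. ell2 S f \<and> (\<forall>x\<in>S. Hsub Wt S f x - z * f x = l2_fun g x)) \<longleftrightarrow> (\<exists>!u. supp u \<and> Hop u - cscale z u = g)"
    if g: "supp g" for g
  proof
    assume "\<exists>!f. ell2 S f \<and> (\<forall>x\<in>S. Hsub Wt S f x - z * f x = l2_fun g x)"
    then obtain f where f: "ell2 S f" "\<forall>x\<in>S. Hsub Wt S f x - z * f x = l2_fun g x"
      and uniq: "\<And>h. ell2 S h \<Longrightarrow> \<forall>x\<in>S. Hsub Wt S h x - z * h x = l2_fun g x \<Longrightarrow> h = f" unfolding Ex1_def by blast
    obtain u where u: "supp u" "f = l2_fun u" using f(1) ell2_iff by blast
    show "\<exists>!u. supp u \<and> Hop u - cscale z u = g"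
    proof (rule ex1I[of _ u])
      show "supp u \<and> Hop u - cscale z u = g" using u f(2) solution_iff[OF u(1) g] by simp
      fix w assume w: "supp w \<and> Hop w - cscale z w = g"
      then have "l2_fun w = f" using uniq[of "l2_fun w"] solution_iff[of w g z] g ell2_iff by blast
      then show "w = u" using u(2) by (simp add: l2_fun_inject)
    qed
  next
    assume "\<exists>!u. supp u \<and> Hop u - cscale z u = g"
    then obtain u where u: "supp u" "Hop u - cscale z u = g"
      and uniq: "\<And>w. supp w \<Longrightarrow> Hop w - cscale z w = g \<Longrightarrow> w = u" unfolding Ex1_def by blast
    show "\<exists>!f. ell2 S f \<and> (\<forall>x\<in>S. Hsub Wt S f x - z * f x = l2_fun g x)"
    proof (rule ex1I[of _ "l2_fun u"])
      show "ell2 S (l2_fun u) \<and> (\<forall>x\<in>S. Hsub Wt S (l2_fun u) x - z * l2_fun u x = l2_fun g x)"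
        using u solution_iff[OF u(1) g] ell2_iff by blast
      fix f assume f: "ell2 S f \<and> (\<forall>x\<in>S. Hsub Wt S f x - z * f x = l2_fun g x)"
      obtain w where w: "supp w" "f = l2_fun w" using f ell2_iff by blast
      have "Hop w - cscale z w = g" using f unfolding w(2) solution_iff[OF w(1) g] by (rule conjunct2)
      then show "f = l2_fun u" using uniq w by blast
    qed
  qed
  show ?thesis unfolding spectrum_op_def mem_Collect_eq not_not
  proof (intro iffI allI impI)
    fix g :: "'a list l2" assume "\<forall>g. ell2 S g \<longrightarrow> (\<exists>!f. ell2 S f \<and> (\<forall>x\<in>S. Hsub Wt S f x - z * f x = g x))" "supp g"
    then show "\<exists>!u. supp u \<and> Hop u - cscale z u = g" using *[of g] ell2_iff[of "l2_fun g"] by blast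
  next
    fix g assume a: "\<forall>g. supp g \<longrightarrow> (\<exists>!u. supp u \<and> Hop u - cscale z u = g)" and "ell2 S g"
    then obtain u where u: "supp u" "g = l2_fun u" using ell2_iff by blast
    show "\<exists>!f. ell2 S f \<and> (\<forall>x\<in>S. Hsub Wt S f x - z * f x = g x)" unfolding u(2) *[OF u(1)] using a u(1) by blast
  qed
qed

lemma poly_shift_op: "op_poly Hop [:- l, 1:] u = Hop u - l *\<^sub>R u"
  by (simp add: op_poly_pCons)

text \<open>The function \<psi> equals 1 / (t - l) outside the gap and is continuous across it, so
  \<psi>(H) g solves the equation for each g supported in S. Uniqueness: a solution w of the
  homogeneous equation satisfies e^2 |w|^2 \<le> |(H - l) w|^2 = 0.\<close>

lemma gap_not_spectrum:
  assumes "e > 0" "\<And>v. v \<in> S \<Longrightarrow> measure (spec (l2_delta v)) {l - e..l + e} = 0"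
  shows "complex_of_real l \<notin> spectrum_op Wt S"
  unfolding not_in_spectrum_iff cscale_of_real
proof (intro allI impI)
  fix g :: "'a list l2" assume g: "supp g"
  have AE: "AE t in spec f. \<bar>t - l\<bar> > e" if "supp f" for f
  proof -
    interpret finite_measure "spec f" by (rule finite_measure_spec)
    have "{l - e..l + e} \<in> null_sets (spec f)"
      using spec_null_extend[OF _ assms(2) that] by (simp add: null_sets_def emeasure_eq_measure)
    then show ?thesis by (rule AE_I') (auto simp: abs_le_iff not_less)
  qed
  define \<psi> where "\<psi> t = (t - l) / max ((t - l)\<^sup>2) (e\<^sup>2)" for t
  have mpos: "max ((t - l)\<^sup>2) (e\<^sup>2) > 0" for t using assms(1) by (simp add: less_max_iff_disj)
  have c\<psi>: "continuous_on UNIV \<psi>"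
    unfolding \<psi>_def using mpos by (intro continuous_intros) (auto simp: less_le)
  obtain Q \<Phi> where lim: "\<And>f. (\<lambda>n. op_poly Hop (Q n) f) \<longlonglongrightarrow> \<Phi> f"
    and nrm: "\<And>f s t. (norm (op_poly Hop s (\<Phi> f) - op_poly Hop t f))\<^sup>2 = (\<integral>x. (poly s x * \<psi> x - poly t x)\<^sup>2 \<partial>spec f)"
    and inn: "\<And>f. inner f (\<Phi> f) = (\<integral>x. \<psi> x \<partial>spec f)"
    by (rule continuous_calculus[OF c\<psi>]) blast
  have "(norm (op_poly Hop [:- l, 1:] (\<Phi> g) - op_poly Hop 1 g))\<^sup>2 = (\<integral>x. 0 \<partial>spec g)"
    unfolding nrm
  proof (rule integral_cong_AE)
    show "(\<lambda>x. (poly [:- l, 1:] x * \<psi> x - poly 1 x)\<^sup>2) \<in> borel_measurable (spec g)"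
      by (rule borel_measurable_integrable, rule integrable_spec) (intro continuous_intros c\<psi>)
    show "AE x in spec g. (poly [:- l, 1:] x * \<psi> x - poly 1 x)\<^sup>2 = 0"
      using AE[OF g]
    proof eventually_elim
      case (elim x)
      then have "\<bar>e\<bar> \<le> \<bar>x - l\<bar>" using assms(1) by linarith
      then have "e\<^sup>2 \<le> (x - l)\<^sup>2" by (simp only: abs_le_square_iff)
      then have "\<psi> x = (x - l) / (x - l)\<^sup>2" by (simp add: \<psi>_def max_def)
      moreover have "x - l \<noteq> 0" using elim assms(1) by auto
      ultimately show ?case by (simp add: power2_eq_square)
    qed
  qed simp
  then have sol: "Hop (\<Phi> g) - l *\<^sub>R \<Phi> g = g" by (simp add: poly_shift_op)
  have sol': "Hop (restr (\<Phi> g)) - l *\<^sub>R restr (\<Phi> g) = g"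
  proof (rule l2_eqI)
    fix x
    have "l2_fun (Hop (\<Phi> g) - l *\<^sub>R \<Phi> g) x = l2_fun g x" by (simp only: sol)
    then show "l2_fun (Hop (restr (\<Phi> g)) - l *\<^sub>R restr (\<Phi> g)) x = l2_fun g x"
      using g supp_Hop[of "\<Phi> g"] by (auto simp: Hop_restr l2_fun_restr supp_def)
  qed
  show "\<exists>!u. supp u \<and> Hop u - l *\<^sub>R u = g"
  proof (rule ex1I[of _ "restr (\<Phi> g)"])
    fix u assume u: "supp u \<and> Hop u - l *\<^sub>R u = g"
    define w where "w = u - restr (\<Phi> g)"
    have sw: "supp w" using u supp_restr[of "\<Phi> g"] by (simp add: w_def supp_def)
    have "Hop w - l *\<^sub>R w = 0"
      using u sol' by (simp add: w_def linear_diff[OF lin] algebra_simps)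
    then have "(\<integral>x. (poly [:- l, 1:] x)\<^sup>2 \<partial>spec w) = 0"
      unfolding norm_op_poly_spec[symmetric] poly_shift_op by simp
    moreover have "(\<integral>x. e\<^sup>2 \<partial>spec w) \<le> (\<integral>x. (poly [:- l, 1:] x)\<^sup>2 \<partial>spec w)"
    proof (rule integral_mono_AE)
      show "integrable (spec w) (\<lambda>x. e\<^sup>2)" by (rule integrable_spec) (rule continuous_on_const)
      show "integrable (spec w) (\<lambda>x. (poly [:- l, 1:] x)\<^sup>2)" by (rule integrable_spec) (intro continuous_intros)
      show "AE x in spec w. e\<^sup>2 \<le> (poly [:- l, 1:] x)\<^sup>2"
        using AE[OF sw]
      proof eventually_elim
        case (elim x)
        then have "\<bar>e\<bar> \<le> \<bar>x - l\<bar>" using assms(1) by linarith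
        then have "e\<^sup>2 \<le> (x - l)\<^sup>2" by (simp only: abs_le_square_iff)
        then show ?case by simp
      qed
    qed
    ultimately have "e\<^sup>2 * (norm w)\<^sup>2 \<le> 0" by (simp add: measure_spec_UNIV mult.commute)
    then have "w = 0" using assms(1) by (simp add: mult_le_0_iff)
    then show "u = restr (\<Phi> g)" by (simp add: w_def)
  qed (use sol' supp_restr in auto)
qed

text \<open>The definition of the spectrum asks for unique solvability without bounding the inverse;
  the bound comes from uniform boundedness. Were there none, rescaled vectors b n with |(H - l) b n|
  = 1 would have unbounded norms. But they are weakly bounded: writing the restriction of g as (H -
  l) w gives <b n, g> = <(H - l) b n, w>.\<close>

lemma resolvent_set_bounded_below:
  assumes "complex_of_real l \<notin> spectrum_op Wt S"
  shows "\<exists>c>0. \<forall>f. supp f \<longrightarrow> c * norm f \<le> norm (Hop f - l *\<^sub>R f)"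
proof (rule ccontr)
  assume neg: "\<not> ?thesis"
  have bij: "\<exists>!u. supp u \<and> Hop u - l *\<^sub>R u = g" if "supp g" for g
    using assms that unfolding not_in_spectrum_iff cscale_of_real by blast
  have "\<exists>f. supp f \<and> norm (Hop f - l *\<^sub>R f) < inverse (real (Suc n)) * norm f" for n
    using neg by (metis inverse_positive_iff_positive not_le_imp_less of_nat_0_less_iff zero_less_Suc)
  then obtain f where f: "\<And>n. supp (f n)" "\<And>n. norm (Hop (f n) - l *\<^sub>R f n) < inverse (real (Suc n)) * norm (f n)"
    by metis
  have supp0: "supp 0" by (simp add: supp_def)
  have nz: "Hop (f n) - l *\<^sub>R f n \<noteq> 0" for n
  proof
    assume 0: "Hop (f n) - l *\<^sub>R f n = 0"
    have "Hop 0 - l *\<^sub>R 0 = 0" by simp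
    then have "f n = 0" using bij[OF supp0] f(1)[of n] 0 supp0 by blast
    then show False using f(2)[of n] 0 by simp
  qed
  define b where "b n = f n /\<^sub>R norm (Hop (f n) - l *\<^sub>R f n)" for n
  have sb: "supp (b n)" for n using f(1)[of n] by (simp add: b_def supp_def)
  have Hb: "norm (Hop (b n) - l *\<^sub>R b n) = 1" for n
  proof -
    have "Hop (b n) - l *\<^sub>R b n = (Hop (f n) - l *\<^sub>R f n) /\<^sub>R norm (Hop (f n) - l *\<^sub>R f n)"
      by (simp add: b_def linear_cmul[OF lin] scaleR_diff_right)
    then show ?thesis using nz[of n] by simp
  qed
  have "\<exists>K. \<forall>n. norm (b n) \<le> K"
  proof (rule uniform_boundedness_inner)
    fix g :: "'a list l2"
    obtain w where w: "supp w" "Hop w - l *\<^sub>R w = restr g" using bij[OF supp_restr] by blast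
    have "\<bar>inner (b n) g\<bar> \<le> norm w" for n
    proof -
      have "cinner (b n) g = cinner (b n) (restr g)"
        unfolding cinner_def by (rule infsum_cong) (use sb[of n] in \<open>auto simp: l2_fun_restr supp_def\<close>)
      then have "inner (b n) g = inner (b n) (Hop w - l *\<^sub>R w)" by (simp add: inner_l2_def w)
      also have "\<dots> = inner (Hop (b n) - l *\<^sub>R b n) w"
        by (simp add: inner_diff_left inner_diff_right inner_Hop)
      also have "\<bar>\<dots>\<bar> \<le> norm (Hop (b n) - l *\<^sub>R b n) * norm w" by (rule Cauchy_Schwarz_ineq2)
      finally show ?thesis by (simp add: Hb)
    qed
    then show "\<exists>K. \<forall>n. \<bar>inner (b n) g\<bar> \<le> K" by blast
  qed
  then obtain K where K: "\<And>n. norm (b n) \<le> K" by blast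
  have "real (Suc n) < norm (b n)" for n
  proof -
    have p: "norm (Hop (f n) - l *\<^sub>R f n) > 0" using nz[of n] by simp
    have "real (Suc n) * norm (Hop (f n) - l *\<^sub>R f n) < norm (f n)"
      using f(2)[of n] by (simp add: field_simps)
    then show ?thesis using p by (simp add: b_def pos_less_divide_eq divide_inverse[symmetric] del: of_nat_Suc) (simp add: field_simps)
  qed
  moreover obtain n where "K < real n" using reals_Archimedean2 by blast
  ultimately show False using K[of n] by (smt (verit) of_nat_Suc)
qed

text \<open>If H - l is bounded below by c, then H - l' is bounded below by c / 2 for l' within c /
  2. This bounds the resolvent vector R uniformly in \<eta>, and the imaginary part of the Green
  function, which is \<eta> |R|^2, tends to 0.\<close>

lemma in_spectrum:
  assumes "v \<in> S"
    and "\<And>e. e > 0 \<Longrightarrow> \<exists>l' L. \<bar>l' - l\<bar> < e \<and> ((\<lambda>\<eta>. Im (green Wt S (Complex l' \<eta>) v v)) \<longlongrightarrow> L) (at_right 0) \<and> L \<noteq> 0"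
  shows "complex_of_real l \<in> spectrum_op Wt S"
proof (rule ccontr)
  assume "complex_of_real l \<notin> spectrum_op Wt S"
  then obtain c where c: "c > 0" "\<And>f. supp f \<Longrightarrow> c * norm f \<le> norm (Hop f - l *\<^sub>R f)"
    using resolvent_set_bounded_below by blast
  obtain l' L where l': "\<bar>l' - l\<bar> < c / 2" "((\<lambda>\<eta>. Im (green Wt S (Complex l' \<eta>) v v)) \<longlongrightarrow> L) (at_right 0)" "L \<noteq> 0"
    using assms(2)[of "c / 2"] c(1) by auto
  have bd: "norm (Im (green Wt S (Complex l' \<eta>) v v)) \<le> \<eta> * (2 / c)\<^sup>2" if "\<eta> > 0" for \<eta>
  proof -
    let ?z = "Complex l' \<eta>"
    have z: "Im ?z \<noteq> 0" using that by simp
    define R where "R = res ?z (l2_delta v)"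
    have sR: "supp R" unfolding R_def by (rule supp_res[OF z supp_delta[OF assms(1)]])
    define X where "X = Hop R - l' *\<^sub>R R"
    have dX: "X - cscale (\<i> * complex_of_real \<eta>) R = l2_delta v"
    proof (rule l2_eqI)
      fix x
      have "l2_fun (Hop R - cscale ?z R) x = l2_fun (l2_delta v) x" unfolding R_def res_eq(1)[OF z] ..
      then show "l2_fun (X - cscale (\<i> * complex_of_real \<eta>) R) x = l2_fun (l2_delta v) x"
        unfolding X_def by (simp add: Complex_eq algebra_simps)
    qed
    \<comment> \<open>Symmetry makes (H - l') R and i \<eta> R orthogonal for the real inner
      product. Their difference is a delta function of norm 1, so Pythagoras bounds both.\<close>
    have orth: "inner X (cscale (\<i> * complex_of_real \<eta>) R) = 0"
    proof -
      have "X = Hop R + cscale (complex_of_real (- l')) R" by (rule l2_eqI) (simp add: X_def)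
      then have "cinner X R = cinner R (Hop R) + complex_of_real (- l') * cinner R R"
        by (simp only: cinner_add_left cinner_Hop cinner_cscale_left complex_cnj_complex_of_real)
      then have "Im (cinner X R) = 0" using Im_cinner_Hop[of R] by (simp add: cinner_self)
      then show ?thesis by (simp add: Re_cinner[symmetric] cinner_cscale_right)
    qed
    have "1 = (norm (X - cscale (\<i> * complex_of_real \<eta>) R))\<^sup>2" by (simp add: dX)
    also have "\<dots> = (norm X)\<^sup>2 + (norm (cscale (\<i> * complex_of_real \<eta>) R))\<^sup>2"
      using orth by (simp add: power2_norm_eq_inner inner_diff_left inner_diff_right inner_commute)
    finally have "(norm X)\<^sup>2 \<le> 1\<^sup>2" using zero_le_power2[of "norm (cscale (\<i> * complex_of_real \<eta>) R)"] unfolding one_power2 by linarith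
    then have X1: "norm X \<le> 1" by (rule power2_le_imp_le) simp
    have "c * norm R \<le> norm (Hop R - l *\<^sub>R R)" by (rule c(2)[OF sR])
    also have "Hop R - l *\<^sub>R R = X + (l' - l) *\<^sub>R R" by (simp add: X_def algebra_simps)
    also have "norm \<dots> \<le> norm X + \<bar>l' - l\<bar> * norm R" using norm_triangle_ineq[of X "(l' - l) *\<^sub>R R"] by simp
    also have "\<dots> \<le> 1 + c / 2 * norm R" using X1 l'(1) by (intro add_mono mult_right_mono) auto
    finally have "norm R \<le> 2 / c" using c(1) by (simp add: field_simps)
    then have "(norm R)\<^sup>2 \<le> (2 / c)\<^sup>2" by (intro power_mono) auto
    moreover have "Im (green Wt S ?z v v) = \<eta> * (norm R)\<^sup>2"
      using Im_cinner_res[OF z, of "l2_delta v"] by (simp add: green_eq[OF z assms(1)] cinner_delta R_def)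
    ultimately show ?thesis using that by simp
  qed
  have lim0: "((\<lambda>\<eta>. \<eta> * (2 / c)\<^sup>2) \<longlongrightarrow> 0 * (2 / c)\<^sup>2) (at_right 0)" by (intro tendsto_intros)
  have "((\<lambda>\<eta>. Im (green Wt S (Complex l' \<eta>) v v)) \<longlongrightarrow> 0) (at_right 0)"
  proof (rule Lim_null_comparison)
    show "\<forall>\<^sub>F \<eta> in at_right 0. norm (Im (green Wt S (Complex l' \<eta>) v v)) \<le> \<eta> * (2 / c)\<^sup>2"
      using eventually_at_right_less[of "0::real"] by eventually_elim (rule bd)
    show "((\<lambda>\<eta>. \<eta> * (2 / c)\<^sup>2) \<longlongrightarrow> 0) (at_right 0)" using lim0 by simp
  qed
  then show False using tendsto_unique[OF _ l'(2)] l'(3) by (simp add: trivial_limit_at_right_real)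
qed

lemma gap_no_mass:
  assumes "v \<in> S" "\<And>l. c < l \<Longrightarrow> l < d \<Longrightarrow> ((\<lambda>\<eta>. Im (green Wt S (Complex l \<eta>) v v)) \<longlongrightarrow> 0) (at_right 0)"
  shows "measure (spec (l2_delta v)) {c<..<d} = 0"
proof (rule measure_interval_zero[OF finite_measure_spec sets_spec])
  fix l e :: real assume l: "c < l" "l < d" and e: "e > 0"
  have "\<forall>\<^sub>F \<eta> in at_right 0. Im (green Wt S (Complex l \<eta>) v v) < e"
    using order_tendstoD(2)[OF assms(2)[OF l]] e by blast
  then obtain \<delta> where "\<delta> > 0" "\<And>\<eta>. 0 < \<eta> \<Longrightarrow> \<eta> < \<delta> \<Longrightarrow> Im (green Wt S (Complex l \<eta>) v v) < e"
    unfolding eventually_at_right_field by auto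
  then show "\<exists>\<delta>>0. \<forall>b. 0 < b \<longrightarrow> b < \<delta> \<longrightarrow> poisson (spec (l2_delta v)) l b \<le> e"
    using poisson_delta[OF _ assms(1)] by (intro exI[of _ \<delta>]) (auto intro: less_imp_le)
qed

text \<open>Inner regularity comes first because \<open>spec_null_extend\<close> speaks of closed
  sets. A compact null set is then covered by finitely many short intervals, on each of which the
  local bound and \<open>measure_null_set_zero\<close> apply to delta functions.\<close>

lemma purely_ac_onI:
  assumes "\<And>v l. v \<in> S \<Longrightarrow> c \<le> l \<Longrightarrow> l \<le> d \<Longrightarrow>
     \<exists>\<delta>>0. \<exists>B. \<forall>a b. \<bar>a - l\<bar> < \<delta> \<longrightarrow> 0 < b \<longrightarrow> b < \<delta> \<longrightarrow> Im (green Wt S (Complex a b) v v) \<le> B"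
  shows "purely_ac_on Wt S {c..d}"
  unfolding purely_ac_on_def
proof (intro allI impI)
  fix f assume "ell2 S f"
  then obtain u where u: "supp u" "f = l2_fun u" using ell2_iff by blast
  interpret finite_measure "spec u" by (rule finite_measure_spec)
  have "emeasure (spec u) A = 0" if A: "A \<in> sets borel" "A \<subseteq> {c..d}" "emeasure lborel A = 0" for A
  proof -
    have "emeasure (spec u) K = 0" if K: "K \<subseteq> A" "compact K" for K
    proof -
      have clK: "closed K" using K by (simp add: compact_imp_closed)
      have K0: "emeasure lborel K = 0"
        using emeasure_mono[OF K(1), of lborel] A by simp
      have "measure (spec (l2_delta v)) K = 0" if v: "v \<in> S" for v
      proof -
        have "\<exists>e>0. measure (spec (l2_delta v)) (K \<inter> {l - e..l + e}) = 0" if l: "l \<in> K" for l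
        proof -
          obtain \<delta> B where \<delta>: "\<delta> > 0" "\<And>a b. \<bar>a - l\<bar> < \<delta> \<Longrightarrow> 0 < b \<Longrightarrow> b < \<delta> \<Longrightarrow> Im (green Wt S (Complex a b) v v) \<le> B"
          proof -
            have "c \<le> l" "l \<le> d" using l K(1) A(2) by auto
            from assms[OF v this] show ?thesis using that by blast
          qed
          \<comment> \<open>Radius \<delta> / 3 makes the interval shorter than \<delta>, as
            \<open>measure_null_set_zero\<close> requires.\<close>
          have "measure (spec (l2_delta v)) (K \<inter> {l - \<delta>/3..l + \<delta>/3}) = 0"
          proof (rule measure_null_set_zero[OF finite_measure_spec sets_spec])
            show "poisson (spec (l2_delta v)) a b \<le> B" if "l - \<delta>/3 \<le> a" "a \<le> l + \<delta>/3" "0 < b" "b < \<delta>" for a b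
            proof -
              have "\<bar>a - l\<bar> \<le> \<delta>/3" using that unfolding abs_le_iff by linarith
              then have "\<bar>a - l\<bar> < \<delta>" using \<delta>(1) by linarith
              then show ?thesis using \<delta>(2) that poisson_delta[OF _ v] by simp
            qed
            show "l + \<delta>/3 - (l - \<delta>/3) < \<delta>" using \<delta>(1) by simp
            show "K \<inter> {l - \<delta>/3..l + \<delta>/3} \<in> sets borel" using clK by (intro sets.Int borel_closed) auto
            show "emeasure lborel (K \<inter> {l - \<delta>/3..l + \<delta>/3}) = 0"
              using emeasure_mono[of "K \<inter> {l - \<delta>/3..l + \<delta>/3}" K lborel] K0 clK by (simp add: borel_closed)
          qed auto
          then show ?thesis using \<delta>(1) by (intro exI[of _ "\<delta>/3"]) simp
        qed
        then obtain e where e: "\<And>l. l \<in> K \<Longrightarrow> e l > 0" "\<And>l. l \<in> K \<Longrightarrow> measure (spec (l2_delta v)) (K \<inter> {l - e l..l + e l}) = 0"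
          by metis
        obtain F where F: "F \<subseteq> K" "finite F" "K \<subseteq> (\<Union>l\<in>F. {l - e l<..<l + e l})"
        proof (rule compactE_image[OF K(2), of K "\<lambda>l. {l - e l<..<l + e l}"])
          show "K \<subseteq> (\<Union>l\<in>K. {l - e l<..<l + e l})" using e(1) by force
        qed (use that in auto)
        interpret D: finite_measure "spec (l2_delta v)" by (rule finite_measure_spec)
        have "K \<inter> {l - e l..l + e l} \<in> null_sets (spec (l2_delta v))" if "l \<in> F" for l
          using e(2)[of l] that F(1) clK by (auto simp: null_sets_def D.emeasure_eq_measure intro!: sets.Int borel_closed)
        then have "(\<Union>l\<in>F. K \<inter> {l - e l..l + e l}) \<in> null_sets (spec (l2_delta v))"
          using F(2) by (intro null_sets.finite_UN) auto
        moreover have "K = (\<Union>l\<in>F. K \<inter> {l - e l..l + e l})"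
        proof -
          have "(\<Union>l\<in>F. {l - e l<..<l + e l}) \<subseteq> (\<Union>l\<in>F. {l - e l..l + e l})" by (intro UN_mono) auto
          then have "K \<subseteq> (\<Union>l\<in>F. {l - e l..l + e l})" using F(3) by blast
          then show ?thesis by blast
        qed
        ultimately have "K \<in> null_sets (spec (l2_delta v))" by simp
        then show ?thesis by (simp add: null_sets_def D.emeasure_eq_measure)
      qed
      then have "measure (spec u) K = 0" using spec_null_extend[OF clK _ u(1)] by blast
      then show ?thesis by (simp add: emeasure_eq_measure)
    qed
    moreover have "emeasure (spec u) A = (SUP K\<in>{K. K \<subseteq> A \<and> compact K}. emeasure (spec u) K)"
      by (rule inner_regular) (use A in \<open>auto simp: emeasure_eq_measure\<close>)
    ultimately show ?thesis by (auto intro!: SUP_eq_const simp: bot_ennreal)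
  qed
  then show "\<exists>\<mu>. is_spectral_measure Wt S f \<mu> \<and> (\<forall>A\<in>sets borel. A \<subseteq> {c..d} \<longrightarrow> emeasure lborel A = 0 \<longrightarrow> emeasure \<mu> A = 0)"
    using spectral_measure_spec[OF u(1)] u(2) by blast
qed

lemma cinner_op_poly: "cinner (op_poly Hop p x) y = cinner x (op_poly Hop p y)"
proof -
  have "op_poly Hop p (cscale c x) = cscale c (op_poly Hop p x)" for c x
    by (induction p) (auto simp: op_poly_pCons Hop_cscale intro!: l2_eqI simp: algebra_simps)
  then have "Im (cinner (op_poly Hop p x) y) = Im (cinner x (op_poly Hop p y))"
    by (simp add: Im_cinner op_poly_sym)
  then show ?thesis by (simp add: complex_eq_iff Re_cinner op_poly_sym)
qed

lemma finite_large_values: "e > 0 \<Longrightarrow> finite {x. cmod (l2_fun u x) \<ge> e}"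
proof (rule ccontr)
  assume e: "e > 0" and inf: "infinite {x. cmod (l2_fun u x) \<ge> e}"
  obtain n :: nat where n: "real n > (norm u)\<^sup>2 / e\<^sup>2" using reals_Archimedean2 by blast
  obtain F where F: "finite F" "card F = n" "F \<subseteq> {x. cmod (l2_fun u x) \<ge> e}"
    using infinite_arbitrarily_large[OF inf] by blast
  have "real n * e\<^sup>2 = (\<Sum>x\<in>F. e\<^sup>2)" using F by simp
  also have "\<dots> \<le> (\<Sum>x\<in>F. (cmod (l2_fun u x))\<^sup>2)" using F(3) e by (intro sum_mono power_mono) auto
  also have "\<dots> \<le> (norm u)\<^sup>2" by (rule sum_cmod_squared_le_norm[OF F(1)])
  finally show False using n e by (simp add: divide_less_eq)
qed

lemma supp_op_poly: "supp u \<Longrightarrow> supp (op_poly Hop p u)"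
proof (induction p)
  case (pCons a p)
  then show ?case using supp_Hop[of "op_poly Hop p u"] by (simp add: op_poly_pCons supp_def)
qed (simp add: supp_def)

text \<open>The tent \<psi> of radius e agrees almost everywhere with the indicator of l, so
  \<open>U y\<close> is the spectral projection at l applied to the delta at y: an eigenvector with
  diagonal entry at least c0 in modulus. Each \<open>U x\<close> is large at finitely many points
  and moduli are symmetric in x and y, so an infinite Y offers arbitrarily many points with small
  mutual entries.\<close>

lemma isolated_eigenvalue:
  assumes e: "e > 0"
    and gap: "\<And>v. v \<in> S \<Longrightarrow> measure (spec (l2_delta v)) {l - e<..<l} = 0"
       "\<And>v. v \<in> S \<Longrightarrow> measure (spec (l2_delta v)) {l<..<l + e} = 0"
    and Y: "Y \<subseteq> S" "infinite Y" "\<And>y. y \<in> Y \<Longrightarrow> measure (spec (l2_delta y)) {l} = c0" "c0 > 0"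
  shows "eigenvalue_inf_mult Wt S l"
proof -
  define \<psi> where "\<psi> t = max 0 (1 - \<bar>t - l\<bar> / e)" for t
  have c\<psi>: "continuous_on UNIV \<psi>" unfolding \<psi>_def using e by (intro continuous_intros) auto
  obtain Q \<Phi> where lim: "\<And>f. (\<lambda>n. op_poly Hop (Q n) f) \<longlonglongrightarrow> \<Phi> f"
    and nrm: "\<And>f s t. (norm (op_poly Hop s (\<Phi> f) - op_poly Hop t f))\<^sup>2 = (\<integral>x. (poly s x * \<psi> x - poly t x)\<^sup>2 \<partial>spec f)"
    and inn: "\<And>f. inner f (\<Phi> f) = (\<integral>x. \<psi> x \<partial>spec f)"
    by (rule continuous_calculus[OF c\<psi>]) blast
  have AE: "AE t in spec (l2_delta v). t = l \<or> \<psi> t = 0" if v: "v \<in> S" for v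
  proof -
    interpret D: finite_measure "spec (l2_delta v)" by (rule finite_measure_spec)
    have "{l - e<..<l} \<union> {l<..<l + e} \<in> null_sets (spec (l2_delta v))"
      using gap[OF v] by (intro null_sets.Un) (auto simp: null_sets_def D.emeasure_eq_measure)
    moreover have "t = l \<or> \<psi> t = 0" if "t \<notin> {l - e<..<l} \<union> {l<..<l + e}" for t
    proof -
      have "t = l \<or> \<bar>t - l\<bar> \<ge> e" using that by auto
      then show ?thesis using e by (auto simp: \<psi>_def max_def field_simps)
    qed
    ultimately show ?thesis by (intro AE_I'[of "{l - e<..<l} \<union> {l<..<l + e}"]) blast+
  qed
  define U where "U y = \<Phi> (l2_delta y)" for y
  have eig: "Hop (U y) = l *\<^sub>R U y" if "y \<in> S" for y
  proof -
    have "(norm (op_poly Hop [:- l, 1:] (U y) - op_poly Hop 0 (l2_delta y)))\<^sup>2 = (\<integral>x. 0 \<partial>spec (l2_delta y))"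
      unfolding U_def nrm
    proof (rule integral_cong_AE)
      show "(\<lambda>x. (poly [:- l, 1:] x * \<psi> x - poly 0 x)\<^sup>2) \<in> borel_measurable (spec (l2_delta y))"
        by (rule borel_measurable_integrable, rule integrable_spec) (intro continuous_intros c\<psi>)
      show "AE x in spec (l2_delta y). (poly [:- l, 1:] x * \<psi> x - poly 0 x)\<^sup>2 = 0"
        using AE[OF that] by eventually_elim auto
    qed simp
    then show ?thesis by (simp add: poly_shift_op)
  qed
  have sU: "supp (U y)" if "y \<in> S" for y
    unfolding supp_def
  proof (intro allI impI)
    fix x assume x: "x \<notin> S"
    have "(\<lambda>n. l2_fun (op_poly Hop (Q n) (l2_delta y)) x) \<longlonglongrightarrow> l2_fun (U y) x"
      unfolding U_def by (intro tendsto_l2_fun lim)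
    moreover have "l2_fun (op_poly Hop (Q n) (l2_delta y)) x = 0" for n
      using supp_op_poly[OF supp_delta[OF that]] x by (simp add: supp_def)
    ultimately show "l2_fun (U y) x = 0" by (simp add: LIMSEQ_const_iff)
  qed
  have diag: "cmod (l2_fun (U y) y) \<ge> c0" if y: "y \<in> Y" for y
  proof -
    have yS: "y \<in> S" using y Y by blast
    have "Re (l2_fun (U y) y) = (\<integral>x. \<psi> x \<partial>spec (l2_delta y))"
      using inn[of "l2_delta y"] by (simp add: Re_cinner[symmetric] cinner_delta U_def)
    also have "\<dots> = (\<integral>x. indicator {l} x \<partial>spec (l2_delta y))"
    proof (rule integral_cong_AE)
      show "\<psi> \<in> borel_measurable (spec (l2_delta y))"
        by (rule borel_measurable_integrable, rule integrable_spec) (rule c\<psi>)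
      show "AE x in spec (l2_delta y). \<psi> x = indicator {l} x"
        using AE[OF yS] by eventually_elim (auto simp: \<psi>_def indicator_def)
    qed simp
    also have "\<dots> = c0" using Y(3)[OF y] by simp
    finally show ?thesis using complex_Re_le_cmod[of "l2_fun (U y) y"] by simp
  qed
  have symU: "cmod (l2_fun (U x) y) = cmod (l2_fun (U y) x)" for x y
  proof -
    have cv: "(\<lambda>n. cmod (l2_fun (op_poly Hop (Q n) (l2_delta x)) y)) \<longlonglongrightarrow> cmod (l2_fun (U x) y)" for x y
      unfolding U_def by (intro tendsto_norm tendsto_l2_fun lim)
    have sw: "cmod (l2_fun (op_poly Hop p (l2_delta x)) y) = cmod (l2_fun (op_poly Hop p (l2_delta y)) x)" for p x y
    proof -
      have "l2_fun (op_poly Hop p (l2_delta x)) y = cinner (op_poly Hop p (l2_delta y)) (l2_delta x)"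
        by (simp add: cinner_delta[symmetric] cinner_op_poly)
      also have "\<dots> = cnj (l2_fun (op_poly Hop p (l2_delta y)) x)"
        by (subst cinner_commute) (simp add: cinner_delta)
      finally show ?thesis by simp
    qed
    show ?thesis
      using LIMSEQ_unique[OF cv[of x y]] cv[of y x] unfolding sw[of _ y x] by blast
  qed
  have pick: "\<exists>F. finite F \<and> card F = n \<and> F \<subseteq> Y \<and> (\<forall>x\<in>F. \<forall>y\<in>F. x \<noteq> y \<longrightarrow> cmod (l2_fun (U x) y) < d)"
    if d: "d > 0" for d n
  proof (induction n)
    case (Suc n)
    then obtain F where F: "finite F" "card F = n" "F \<subseteq> Y"
      and small: "\<forall>x\<in>F. \<forall>y\<in>F. x \<noteq> y \<longrightarrow> cmod (l2_fun (U x) y) < d"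
      by (elim exE conjE) (rule that)
    have "finite (\<Union>x\<in>F. {y. cmod (l2_fun (U x) y) \<ge> d})"
      by (rule finite_UN_I[OF F(1)]) (rule finite_large_values[OF d])
    then have "finite (F \<union> (\<Union>x\<in>F. {y. cmod (l2_fun (U x) y) \<ge> d}))" using F(1) by (rule finite_UnI[rotated])
    then have "\<not> Y \<subseteq> F \<union> (\<Union>x\<in>F. {y. cmod (l2_fun (U x) y) \<ge> d})"
      using Y(2) finite_subset by blast
    then obtain y where y: "y \<in> Y" "y \<notin> F" "\<And>x. x \<in> F \<Longrightarrow> \<not> d \<le> cmod (l2_fun (U x) y)" by blast
    have ynew: "cmod (l2_fun (U x) y) < d" "cmod (l2_fun (U y) x) < d" if "x \<in> F" for x
      using y(3)[OF that] symU[of x y] by linarith+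
    have "\<forall>x\<in>insert y F. \<forall>x'\<in>insert y F. x \<noteq> x' \<longrightarrow> cmod (l2_fun (U x) x') < d"
      unfolding ball_simps using small ynew by blast
    moreover have "finite (insert y F)" "card (insert y F) = Suc n" "insert y F \<subseteq> Y" using F y by simp_all
    ultimately show ?case by (intro exI[of _ "insert y F"] conjI)
  qed (auto intro!: exI[of _ "{}"])
  show ?thesis
    unfolding eigenvalue_inf_mult_def
  proof
    fix n
    \<comment> \<open>Fewer than n off-diagonal entries below c0 / (n + 1) add up to less than c0.
      The matrix of the chosen eigenvectors at the chosen points is diagonally dominant, and looking
      at the largest coefficient gives independence.\<close>
    define d where "d = c0 / real (n + 1)"
    have d: "d > 0" "d \<le> c0" using Y(4) by (auto simp: d_def field_simps)
    obtain F where F: "finite F" "card F = n" "F \<subseteq> Y" and small: "\<forall>x\<in>F. \<forall>y\<in>F. x \<noteq> y \<longrightarrow> cmod (l2_fun (U x) y) < d"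
      using pick[OF d(1), of n] by (elim exE conjE) (rule that)
    have inj: "inj_on (\<lambda>y. l2_fun (U y)) F"
    proof (rule inj_onI, rule ccontr)
      fix x y assume xy: "x \<in> F" "y \<in> F" "l2_fun (U x) = l2_fun (U y)" "x \<noteq> y"
      have "c0 \<le> cmod (l2_fun (U x) x)" using diag xy F by blast
      also have "\<dots> = cmod (l2_fun (U y) x)" using xy by simp
      also have "\<dots> < d" using small[rule_format, OF xy(2) xy(1)] xy(4) by simp
      finally show False using d by simp
    qed
    show "\<exists>B. finite B \<and> card B = n \<and>
         (\<forall>f\<in>B. ell2 S f \<and> (\<forall>x\<in>S. Hsub Wt S f x = complex_of_real l * f x)) \<and>
         (\<forall>c. (\<forall>x. (\<Sum>f\<in>B. c f * f x) = 0) \<longrightarrow> (\<forall>f\<in>B. c f = 0))"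
    proof (intro exI[of _ "(\<lambda>y. l2_fun (U y)) ` F"] conjI ballI allI impI)
      show "finite ((\<lambda>y. l2_fun (U y)) ` F)" "card ((\<lambda>y. l2_fun (U y)) ` F) = n"
        using F inj by (auto simp: card_image)
      fix f assume "f \<in> (\<lambda>y. l2_fun (U y)) ` F"
      then obtain y where y: "y \<in> F" "f = l2_fun (U y)" by blast
      then have yS: "y \<in> S" using F Y by blast
      show "ell2 S f" using sU[OF yS] y ell2_iff by blast
      show "Hsub Wt S f x = complex_of_real l * f x" for x
        using arg_cong[OF eig[OF yS], of "\<lambda>u. l2_fun u x"] by (simp add: y l2_fun_Hop)
    next
      fix c f assume c: "\<forall>x. (\<Sum>f\<in>(\<lambda>y. l2_fun (U y)) ` F. c f * f x) = 0" and f: "f \<in> (\<lambda>y. l2_fun (U y)) ` F"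
      define k where "k y = c (l2_fun (U y))" for y
      have sum0: "(\<Sum>y\<in>F. k y * l2_fun (U y) x) = 0" for x
        using c by (simp add: sum.reindex[OF inj] k_def)
      have Fne: "F \<noteq> {}" using f by auto
      obtain m where m: "m \<in> F" "\<And>y. y \<in> F \<Longrightarrow> cmod (k y) \<le> cmod (k m)"
      proof -
        have "Max ((\<lambda>y. cmod (k y)) ` F) \<in> (\<lambda>y. cmod (k y)) ` F" using F(1) Fne by (intro Max_in) auto
        then obtain m where "m \<in> F" "Max ((\<lambda>y. cmod (k y)) ` F) = cmod (k m)" by auto
        moreover have "cmod (k y) \<le> Max ((\<lambda>y. cmod (k y)) ` F)" if "y \<in> F" for y using F(1) that by (intro Max_ge) auto
        ultimately show ?thesis using that by metis
      qed
      have "k m * l2_fun (U m) m = - (\<Sum>y\<in>F - {m}. k y * l2_fun (U y) m)"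
        using sum0[of m] sum.remove[OF F(1) m(1), of "\<lambda>y. k y * l2_fun (U y) m"] by (simp add: add_eq_0_iff)
      then have "cmod (k m) * cmod (l2_fun (U m) m) = cmod (\<Sum>y\<in>F - {m}. k y * l2_fun (U y) m)"
        by (metis norm_minus_cancel norm_mult)
      also have "\<dots> \<le> (\<Sum>y\<in>F - {m}. cmod (k m) * d)"
      proof (rule sum_norm_le)
        fix y assume y: "y \<in> F - {m}"
        then have "cmod (l2_fun (U y) m) < d" using small m(1) by blast
        then show "cmod (k y * l2_fun (U y) m) \<le> cmod (k m) * d"
          unfolding norm_mult using m(2) y by (intro mult_mono) auto
      qed
      also have "\<dots> \<le> real n * (cmod (k m) * d)"
        using F(1,2) m(1) d(1) by (simp add: card_Diff_singleton mult_right_mono)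
      finally have "cmod (k m) * c0 \<le> cmod (k m) * (real n * d)"
        using mult_left_mono[OF diag[of m], of "cmod (k m)"] m(1) F(3) by (auto simp: mult_ac)
      moreover have "real n * d < c0" using Y(4) by (simp add: d_def field_simps)
      ultimately have "\<not> 0 < cmod (k m)" by (metis mult_le_cancel_left_pos not_le)
      then have "cmod (k m) = 0" by simp
      then have "k y = 0" if "y \<in> F" for y using m(2)[OF that] by simp
      then show "c f = 0" using f by (auto simp: k_def)
    qed
  qed
qed

text \<open>In k steps from the root a word of length k + 1 is reached along exactly one path, the
  one through its prefixes, and longer words are not reached at all.\<close>

lemma power_Hop_delta_root:
  assumes root: "[r] \<in> S" "\<And>q. q \<in> S \<Longrightarrow> length q = 1 \<Longrightarrow> q = [r]"
    and cl: "\<And>q. q \<in> S \<Longrightarrow> length q > 1 \<Longrightarrow> butlast q \<in> S"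
  shows "q \<in> S \<Longrightarrow> length q \<ge> Suc k \<Longrightarrow> l2_fun ((Hop ^^ k) (l2_delta [r])) q = (if length q = Suc k then 1 else 0)"
proof (induction k arbitrary: q)
  case 0
  then show ?case using root(2)[of q] by (cases "length q = 1") auto
next
  case (Suc k)
  let ?u = "(Hop ^^ k) (l2_delta [r])"
  have q: "q \<in> S" "length q > 1" using Suc.prems by auto
  have bq: "butlast q \<in> S" by (rule cl[OF q])
  have "l2_fun (Hop ?u) q = (\<Sum>p\<in>{p \<in> S. tadj q p}. l2_fun ?u p) + complex_of_real (W (last q)) * l2_fun ?u q"
    using q by (simp add: l2_fun_Hop Hsub_def)
  also have "l2_fun ?u q = 0" using Suc.IH[OF q(1)] Suc.prems by simp
  also have "(\<Sum>p\<in>{p \<in> S. tadj q p}. l2_fun ?u p) = (\<Sum>p\<in>{butlast q}. l2_fun ?u p)"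
  proof (rule sum.mono_neutral_right)
    show "\<forall>p\<in>{p \<in> S. tadj q p} - {butlast q}. l2_fun ?u p = 0"
    proof
      fix p assume "p \<in> {p \<in> S. tadj q p} - {butlast q}"
      then obtain c where "p = q @ [c]" "p \<in> S" using bq neighbours_eq[OF q(1)] by auto
      then show "l2_fun ?u p = 0" using Suc.IH[of p] Suc.prems by simp
    qed
    show "{butlast q} \<subseteq> {p \<in> S. tadj q p}" using neighbours_eq[OF q(1)] bq by auto
  qed (rule finite_neighbours[OF q(1)])
  also have "\<dots> = (if length q = Suc (Suc k) then 1 else 0)"
    using Suc.IH[OF bq] Suc.prems by auto
  finally show ?case by simp
qed

text \<open>A polynomial vanishing on X would annihilate the delta at the root. At a word whose
  depth is the degree of that polynomial, only the leading coefficient contributes.\<close>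

lemma spectral_measure_not_finite_support:
  assumes root: "[r] \<in> S" "\<And>q. q \<in> S \<Longrightarrow> length q = 1 \<Longrightarrow> q = [r]"
    and cl: "\<And>q. q \<in> S \<Longrightarrow> length q > 1 \<Longrightarrow> butlast q \<in> S"
    and long: "\<And>n. \<exists>q\<in>S. length q = Suc n"
    and X: "finite X"
  shows "\<not> (AE t in spec (l2_delta [r]). t \<in> X)"
proof
  assume AE: "AE t in spec (l2_delta [r]). t \<in> X"
  define p where "p = (\<Prod>x\<in>X. [:- x, 1:])"
  have p0: "p \<noteq> 0" using X by (simp add: p_def)
  have roots: "poly p t = 0" if "t \<in> X" for t using that X by (auto simp: p_def poly_prod)
  have "AE t in spec (l2_delta [r]). (poly p t)\<^sup>2 = 0" using AE by eventually_elim (simp add: roots)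
  then have "(\<integral>t. (poly p t)\<^sup>2 \<partial>spec (l2_delta [r])) = 0" by (rule integral_eq_zero_AE)
  then have "op_poly Hop p (l2_delta [r]) = 0" unfolding norm_op_poly_spec[symmetric] by simp
  moreover obtain q where q: "q \<in> S" "length q = Suc (Polynomial.degree p)" using long by blast
  have "l2_fun (op_poly Hop p (l2_delta [r])) q
      = (\<Sum>i\<le>Polynomial.degree p. if i = Polynomial.degree p then complex_of_real (Polynomial.coeff p i) else 0)"
    unfolding op_poly_def l2_fun_sum
  proof (rule sum.cong[OF refl])
    fix i assume i: "i \<in> {..Polynomial.degree p}"
    show "l2_fun (Polynomial.coeff p i *\<^sub>R (Hop ^^ i) (l2_delta [r])) q = (if i = Polynomial.degree p then complex_of_real (Polynomial.coeff p i) else 0)"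
      using power_Hop_delta_root[OF root cl q(1), of i] i q(2) by auto
  qed
  then have "l2_fun (op_poly Hop p (l2_delta [r])) q = complex_of_real (lead_coeff p)" by simp
  ultimately show False using p0 by simp
qed

end

section \<open>Non-backtracking walks and Green functions\<close>

lemma tadj_sym: "tadj p q \<longleftrightarrow> tadj q p"
  by (auto simp: tadj_def)

text \<open>S' hangs on the rest of S by the single edge between u and p. Restricted to S', the
  column g of the resolvent misses exactly the contribution of that edge, so it solves the equation
  on S' with right-hand side - g(p) times the delta at u.\<close>

lemma green_restrict:
  assumes S: "list_graph V S" and z: "Im z \<noteq> 0"
    and sub: "S' \<subseteq> S" and u: "u \<in> S'" and p: "p \<in> S" "p \<notin> S'" "tadj u p" and v: "v \<in> S" "v \<notin> S'"
    and edge: "\<And>x q. x \<in> S' \<Longrightarrow> q \<in> S \<Longrightarrow> q \<notin> S' \<Longrightarrow> tadj x q \<Longrightarrow> x = u \<and> q = p"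
  shows "green (W \<circ> last) S z u v = - green (W \<circ> last) S z p v * green (W \<circ> last) S' z u u"
proof -
  interpret S: list_graph V W S by (rule S)
  interpret S': list_graph V W S' using S.finV S.SV sub by unfold_locales auto
  define g where "g = S.res z (l2_delta v)"
  have uS: "u \<in> S" using u sub by blast
  define h where "h = S'.restr g"
  have eq: "S.Hop g - cscale z g = l2_delta v" unfolding g_def by (rule S.res_eq(1)[OF z])
  have "S'.Hop h - cscale z h = cscale (- l2_fun g p) (l2_delta u)"
  proof (rule l2_eqI)
    fix x
    show "l2_fun (S'.Hop h - cscale z h) x = l2_fun (cscale (- l2_fun g p) (l2_delta u)) x"
    proof (cases "x \<in> S'")
      case True
      then have xS: "x \<in> S" using sub by blast
      have "l2_fun (S.Hop g - cscale z g) x = 0" unfolding eq using v True by auto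
      then have 0: "(\<Sum>q\<in>{q \<in> S. tadj x q}. l2_fun g q) + complex_of_real (W (last x)) * l2_fun g x - z * l2_fun g x = 0"
        using xS by (simp add: S.l2_fun_Hop Hsub_def)
      have split: "{q \<in> S. tadj x q} = {q \<in> S'. tadj x q} \<union> {q \<in> S - S'. tadj x q}" using sub by blast
      have "(\<Sum>q\<in>{q \<in> S. tadj x q}. l2_fun g q) = (\<Sum>q\<in>{q \<in> S'. tadj x q}. l2_fun g q) + (\<Sum>q\<in>{q \<in> S - S'. tadj x q}. l2_fun g q)"
      proof -
        have fin: "finite {q \<in> S'. tadj x q}" "finite {q \<in> S - S'. tadj x q}"
          by (rule finite_subset[OF _ S.finite_neighbours[OF xS]], use sub in blast)+
        have disj: "{q \<in> S'. tadj x q} \<inter> {q \<in> S - S'. tadj x q} = {}" by blast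
        from arg_cong[OF split, of "sum (l2_fun g)"] show ?thesis
          unfolding sum.union_disjoint[OF fin disj] .
      qed
      also have "{q \<in> S - S'. tadj x q} = (if x = u then {p} else {})"
      proof (cases "x = u")
        case xu: True
        have "q = p" if "q \<in> S" "q \<notin> S'" "tadj u q" for q using edge[OF u that] by blast
        then have "{q \<in> S - S'. tadj x q} = {p}" unfolding xu using p by blast
        then show ?thesis using xu by simp
      next
        case False
        have "\<not> tadj x q" if "q \<in> S" "q \<notin> S'" for q using edge[OF True that] False by blast
        then show ?thesis using False by auto
      qed
      also have "(\<Sum>q\<in>(if x = u then {p} else {}). l2_fun g q) = (if x = u then l2_fun g p else 0)" by simp
      finally have "(\<Sum>q\<in>{q \<in> S'. tadj x q}. l2_fun g q) = - (complex_of_real (W (last x)) * l2_fun g x - z * l2_fun g x) - (if x = u then l2_fun g p else 0)"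
        using 0 by (simp add: algebra_simps)
      moreover have "(\<Sum>q\<in>{q \<in> S'. tadj x q}. l2_fun h q) = (\<Sum>q\<in>{q \<in> S'. tadj x q}. l2_fun g q)"
        by (rule sum.cong) (auto simp: h_def S'.l2_fun_restr)
      ultimately show ?thesis using True
        by (simp add: S'.l2_fun_Hop Hsub_def h_def S'.l2_fun_restr)
    next
      case False
      then show ?thesis using u by (auto simp: S'.l2_fun_Hop Hsub_def h_def S'.l2_fun_restr)
    qed
  qed
  then have "h = S'.res z (cscale (- l2_fun g p) (l2_delta u))" by (rule S'.res_unique[OF z])
  also have "\<dots> = cscale (- l2_fun g p) (S'.res z (l2_delta u))"
  proof (rule S'.res_unique[OF z, symmetric])
    have "S'.Hop (cscale (- l2_fun g p) (S'.res z (l2_delta u))) - cscale z (cscale (- l2_fun g p) (S'.res z (l2_delta u)))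
       = cscale (- l2_fun g p) (S'.Hop (S'.res z (l2_delta u)) - cscale z (S'.res z (l2_delta u)))"
      unfolding S'.Hop_cscale by (rule l2_eqI) (simp add: algebra_simps)
    then show "S'.Hop (cscale (- l2_fun g p) (S'.res z (l2_delta u))) - cscale z (cscale (- l2_fun g p) (S'.res z (l2_delta u)))
       = cscale (- l2_fun g p) (l2_delta u)" by (simp only: S'.res_eq(1)[OF z])
  qed
  finally have "l2_fun h u = - l2_fun g p * l2_fun (S'.res z (l2_delta u)) u" by simp
  then show ?thesis
    using u by (simp add: h_def S'.l2_fun_restr S.green_eq[OF z v(1)] S'.green_eq[OF z u] g_def)
qed

text \<open>The resolvent equation at v itself, with each neighbouring value expressed through the
  branch \<open>B u\<close> beyond u by \<open>green_restrict\<close>. It is the Schur complement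
  formula for a tree.\<close>

lemma green_root:
  assumes S: "list_graph V S" and z: "Im z \<noteq> 0" and v: "v \<in> S"
    and B: "\<And>u. u \<in> S \<Longrightarrow> tadj v u \<Longrightarrow> B u \<subseteq> S \<and> u \<in> B u \<and> v \<notin> B u \<and>
        (\<forall>x\<in>B u. \<forall>q\<in>S - B u. tadj x q \<longrightarrow> x = u \<and> q = v)"
  shows "(- green (W \<circ> last) S z v v) *
     (z - complex_of_real (W (last v)) - (\<Sum>u\<in>{u \<in> S. tadj v u}. - green (W \<circ> last) (B u) z u u)) = 1"
proof -
  interpret S: list_graph V W S by (rule S)
  let ?g = "green (W \<circ> last) S z"
  have "l2_fun (S.Hop (S.res z (l2_delta v)) - cscale z (S.res z (l2_delta v))) v = 1"
    unfolding S.res_eq(1)[OF z] by simp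
  then have 1: "(\<Sum>u\<in>{u \<in> S. tadj v u}. ?g u v) + complex_of_real (W (last v)) * ?g v v - z * ?g v v = 1"
    using v by (simp add: S.l2_fun_Hop Hsub_def S.green_eq[OF z v])
  have "(\<Sum>u\<in>{u \<in> S. tadj v u}. ?g u v) = (\<Sum>u\<in>{u \<in> S. tadj v u}. - ?g v v * green (W \<circ> last) (B u) z u u)"
  proof (rule sum.cong[OF refl])
    fix u assume "u \<in> {u \<in> S. tadj v u}"
    then have u: "u \<in> S" "tadj v u" by auto
    show "?g u v = - ?g v v * green (W \<circ> last) (B u) z u u"
      by (rule green_restrict[OF S z]) (use B[OF u] u v tadj_sym in auto)
  qed
  also have "\<dots> = - ?g v v * (\<Sum>u\<in>{u \<in> S. tadj v u}. green (W \<circ> last) (B u) z u u)" by (simp only: sum_distrib_left)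
  finally show ?thesis using 1 by (simp add: sum_negf algebra_simps)
qed

lemma tadj_append: "tadj (w @ p) (w @ q) \<longleftrightarrow> tadj p q"
  by (auto simp: tadj_def)

text \<open>Prefixing nonempty words by w preserves adjacency and the last letter, hence the
  potential.\<close>

lemma green_translate:
  assumes S: "list_graph V S" and z: "Im z \<noteq> 0" and w: "set w \<subseteq> V" and y: "y \<in> S" and x: "x \<in> S"
  shows "green (W \<circ> last) ((@) w ` S) z (w @ x) (w @ y) = green (W \<circ> last) S z x y"
proof -
  interpret S: list_graph V W S by (rule S)
  interpret S': list_graph V W "(@) w ` S"
  proof unfold_locales
    fix p assume "p \<in> (@) w ` S"
    then obtain q where "q \<in> S" "p = w @ q" by blast
    then show "p \<noteq> [] \<and> set p \<subseteq> V" using S.SV[of q] w by simp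
  qed (rule S.finV)
  define u where "u = S.res z (l2_delta y)"
  define h where "h = shift_op ((@) w ` S) (drop (length w)) u"
  have inj: "inj_on (drop (length w)) ((@) w ` S)" by (auto simp: inj_on_def)
  have hf: "l2_fun h q = (if q \<in> (@) w ` S then l2_fun u (drop (length w) q) else 0)" for q
    unfolding h_def by (rule l2_fun_shift_op[OF inj])
  have hw: "l2_fun h (w @ p) = l2_fun u p" if "p \<in> S" for p using that by (simp add: hf)
  have "S'.Hop h - cscale z h = l2_delta (w @ y)"
  proof (rule l2_eqI)
    fix q
    show "l2_fun (S'.Hop h - cscale z h) q = l2_fun (l2_delta (w @ y)) q"
    proof (cases "q \<in> (@) w ` S")
      case True
      then obtain p where p: "p \<in> S" "q = w @ p" by blast
      have "{q' \<in> (@) w ` S. tadj q q'} = (@) w ` {p' \<in> S. tadj p p'}" unfolding p by (auto simp: tadj_append)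
      then have "(\<Sum>q'\<in>{q' \<in> (@) w ` S. tadj q q'}. l2_fun h q') = (\<Sum>p'\<in>{p' \<in> S. tadj p p'}. l2_fun h (w @ p'))"
        by (simp add: sum.reindex inj_on_def)
      also have "\<dots> = (\<Sum>p'\<in>{p' \<in> S. tadj p p'}. l2_fun u p')" by (rule sum.cong) (auto simp: hw)
      finally have "l2_fun (S'.Hop h - cscale z h) q = l2_fun (S.Hop u - cscale z u) p"
        using True p S.SV[OF p(1)] by (simp add: S'.l2_fun_Hop S.l2_fun_Hop Hsub_def hw)
      also have "\<dots> = l2_fun (l2_delta y) p" unfolding u_def S.res_eq(1)[OF z] ..
      finally show ?thesis by (simp add: p)
    next
      case False
      then show ?thesis using y by (auto simp: S'.l2_fun_Hop Hsub_def hf)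
    qed
  qed
  then have "h = S'.res z (l2_delta (w @ y))" by (rule S'.res_unique[OF z])
  then show ?thesis
    using hw[OF x] y by (simp add: S.green_eq[OF z y] S'.green_eq[OF z imageI[OF y]] u_def)
qed

text \<open>Non-backtracking words in recursive form. The optional vertex is the one visited just
  before the word; it is forbidden as second letter, so that words can be cut and continued
  anywhere.\<close>

fun nbt :: "'a set \<Rightarrow> ('a \<Rightarrow> 'a \<Rightarrow> bool) \<Rightarrow> 'a option \<Rightarrow> 'a list \<Rightarrow> bool" where
  "nbt V E ao [] = False"
| "nbt V E ao [b] = (b \<in> V)"
| "nbt V E ao (b # c # p) = (b \<in> V \<and> E b c \<and> ao \<noteq> Some c \<and> nbt V E (Some b) (c # p))"

text \<open>For \<open>j = (Some a, b)\<close> this is the part of the tree beyond the directed edge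
  from a to b, with its root moved to \<open>[b]\<close>; for \<open>j = (None, b)\<close> it is the
  whole tree rooted at b.\<close>

definition nb_cone :: "'a set \<Rightarrow> ('a \<Rightarrow> 'a \<Rightarrow> bool) \<Rightarrow> 'a option \<times> 'a \<Rightarrow> 'a list set" where
  "nb_cone V E j = {p. nbt V E (fst j) p \<and> hd p = snd j}"

definition prev :: "'a option \<Rightarrow> 'a list \<Rightarrow> 'a option" where
  "prev ao p = (if length p \<ge> 2 then Some (last (butlast p)) else ao)"

lemma nbt_iff:
  "nbt V E ao p \<longleftrightarrow> p \<noteq> [] \<and> set p \<subseteq> V \<and> (\<forall>i. Suc i < length p \<longrightarrow> E (p ! i) (p ! Suc i))
     \<and> (\<forall>i. i + 2 < length p \<longrightarrow> p ! i \<noteq> p ! (i + 2)) \<and> (length p \<ge> 2 \<longrightarrow> ao \<noteq> Some (p ! 1))"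
proof (induction V E ao p rule: nbt.induct)
  case (3 V E ao b c p)
  have split: "(\<forall>i. Suc i < length (b # c # p) \<longrightarrow> Q i) \<longleftrightarrow> Q 0 \<and> (\<forall>i. Suc i < length (c # p) \<longrightarrow> Q (Suc i))" for Q
    by (auto simp: less_Suc_eq_0_disj)
  have split2: "(\<forall>i. i + 2 < length (b # c # p) \<longrightarrow> Q i) \<longleftrightarrow> (p \<noteq> [] \<longrightarrow> Q 0) \<and> (\<forall>i. i + 2 < length (c # p) \<longrightarrow> Q (Suc i))" for Q
    by (cases p) (auto simp: less_Suc_eq_0_disj)
  show ?case unfolding split split2 nbt.simps 3 by (cases p) auto
qed auto

lemma nbt_append:
  "p \<noteq> [] \<Longrightarrow> q \<noteq> [] \<Longrightarrow>
    nbt V E ao (p @ q) \<longleftrightarrow> nbt V E ao p \<and> E (last p) (hd q) \<and> prev ao p \<noteq> Some (hd q) \<and> nbt V E (Some (last p)) q"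
proof (induction V E ao p rule: nbt.induct)
  case (2 V E ao b)
  then show ?case by (cases q) (auto simp: prev_def)
next
  case (3 V E ao b c p)
  have "prev ao (b # c # p) = prev (Some b) (c # p)" by (cases p) (auto simp: prev_def)
  then show ?case using 3 by simp
qed simp

lemma nbw_eq_cone: "nbw V E r = nb_cone V E (None, r)"
  unfolding nbw_def nb_cone_def nbt_iff by auto

section \<open>The finite system for the Green functions of the cones\<close>

locale ugraph =
  fixes V :: "'a set" and E :: "'a \<Rightarrow> 'a \<Rightarrow> bool" and W :: "'a \<Rightarrow> real"
  assumes sg: "simple_graph V E"
begin

abbreviation "Wl \<equiv> W \<circ> last"

lemma finV: "finite V" and EV: "E x y \<Longrightarrow> x \<in> V \<and> y \<in> V" and Esym: "E x y \<Longrightarrow> E y x" and Eirr: "\<not> E x x"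
  using sg unfolding simple_graph_def by blast+

lemma cone_list_graph: "S \<subseteq> {p. nbt V E ao p} \<Longrightarrow> list_graph V S"
  using finV by unfold_locales (auto simp: nbt_iff)

lemma cone_list_graph': "list_graph V (nb_cone V E j)"
  by (rule cone_list_graph[of _ "fst j"]) (auto simp: nb_cone_def)

definition succ :: "'a option \<times> 'a \<Rightarrow> ('a option \<times> 'a) set" where
  "succ j = {(Some (snd j), c) | c. E (snd j) c \<and> fst j \<noteq> Some c}"

text \<open>To the directed edges are added the vertices without incoming edge, whose functions are
  the diagonal Green functions of the whole tree. No \<open>succ\<close> leads back to them.\<close>

definition idx :: "('a option \<times> 'a) set" where
  "idx = {(None, b) | b. b \<in> V} \<union> {(Some a, b) | a b. E a b}"

lemma finite_idx: "finite idx"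
proof (rule finite_subset)
  show "idx \<subseteq> (insert None (Some ` V)) \<times> V" unfolding idx_def using EV by auto
qed (use finV in auto)

lemma succ_idx: "succ j \<subseteq> idx"
  unfolding succ_def idx_def by auto

lemma finite_succ: "finite (succ j)"
  using finite_subset[OF succ_idx finite_idx] .

lemma idx_snd: "j \<in> idx \<Longrightarrow> snd j \<in> V"
  unfolding idx_def using EV by auto

text \<open>The sign follows \<open>zeta\<close>, so these functions have negative imaginary part in
  the upper half plane.\<close>

definition y :: "'a option \<times> 'a \<Rightarrow> complex \<Rightarrow> complex" where
  "y j z = - green Wl (nb_cone V E j) z [snd j] [snd j]"

lemma cone_single: "snd j \<in> V \<Longrightarrow> [snd j] \<in> nb_cone V E j"
  by (simp add: nb_cone_def)

text \<open>This is \<open>green_root\<close> at \<open>[b]\<close>. The branch at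
  \<open>[b, c]\<close> is the translate by b of the cone of \<open>(Some b, c)\<close> and thus has
  the same Green function.\<close>

lemma y_eq:
  assumes j: "j \<in> idx" and z: "Im z \<noteq> 0"
  shows "y j z * (z - complex_of_real (W (snd j)) - (\<Sum>k\<in>succ j. y k z)) = 1"
proof -
  obtain ao b where jj: "j = (ao, b)" by (cases j)
  have bV: "b \<in> V" using idx_snd[OF j] jj by simp
  let ?S = "nb_cone V E j"
  define B where "B u = (@) [b] ` nb_cone V E (Some b, last u)" for u :: "'a list"
  have nb: "{u \<in> ?S. tadj [b] u} = (\<lambda>k. [b, snd k]) ` succ j"
  proof (intro set_eqI iffI)
    fix u assume "u \<in> {u \<in> ?S. tadj [b] u}"
    then have a: "tadj [b] u" and n: "nbt V E ao u" by (auto simp: nb_cone_def jj)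
    have "u \<noteq> []" using n by auto
    then obtain c where "u = [b, c]" using a by (auto simp: tadj_def)
    moreover have "nbt V E ao [b, c]" using n calculation by simp
    ultimately show "u \<in> (\<lambda>k. [b, snd k]) ` succ j" by (auto simp: succ_def jj image_iff)
  next
    fix u assume "u \<in> (\<lambda>k. [b, snd k]) ` succ j"
    then obtain c where "u = [b, c]" "E b c" "ao \<noteq> Some c" by (auto simp: succ_def jj)
    then show "u \<in> {u \<in> ?S. tadj [b] u}" using EV[of b c] by (auto simp: tadj_def nb_cone_def jj)
  qed
  have cs: "b # q \<in> ?S \<longleftrightarrow> q = [] \<or> (E b (hd q) \<and> ao \<noteq> Some (hd q) \<and> nbt V E (Some b) q)" for q
    using bV by (cases q) (auto simp: nb_cone_def jj)
  have Bu: "B u \<subseteq> ?S \<and> u \<in> B u \<and> [b] \<notin> B u \<and> (\<forall>x\<in>B u. \<forall>q\<in>?S - B u. tadj x q \<longrightarrow> x = u \<and> q = [b])"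
    if u: "u \<in> ?S" "tadj [b] u" for u
  proof -
    have "u \<in> (\<lambda>k. [b, snd k]) ` succ j" using u nb by blast
    then obtain c where c: "u = [b, c]" "E b c" "ao \<noteq> Some c" by (auto simp: succ_def jj)
    have "c \<in> V" using EV c by blast
    have mem: "b # q \<in> B u \<longleftrightarrow> nbt V E (Some b) q \<and> hd q = c" for q unfolding B_def c by (auto simp: nb_cone_def)
    have "B u \<subseteq> ?S" unfolding B_def c using cs c by (auto simp: nb_cone_def jj)
    moreover have "u \<in> B u" using mem[of "[c]"] c \<open>c \<in> V\<close> by simp
    moreover have "[b] \<notin> B u" using mem[of "[]"] by simp
    moreover have "x = u \<and> q = [b]" if x: "x \<in> B u" and q: "q \<in> ?S" "q \<notin> B u" and a: "tadj x q" for x q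
    proof -
      obtain x' where x': "x = b # x'" "nbt V E (Some b) x'" "hd x' = c" using x mem unfolding B_def c by (auto simp: nb_cone_def)
      have "x' \<noteq> []" using x'(2) by auto
      from a show ?thesis unfolding tadj_def
      proof
        assume "\<exists>e. q = x @ [e]"
        then obtain e where e: "q = b # (x' @ [e])" using x' by auto
        then have "nbt V E (Some b) (x' @ [e])" using q(1) cs[of "x' @ [e]"] by simp
        then have "q \<in> B u" unfolding e mem using x' \<open>x' \<noteq> []\<close> by simp
        then show ?thesis using q by blast
      next
        assume "\<exists>e. x = q @ [e]"
        then obtain e where e: "x = q @ [e]" by blast
        then have q1: "q = b # butlast x'" using x' \<open>x' \<noteq> []\<close> q(1) by (cases q) (auto simp: nb_cone_def)
        show ?thesis
        proof (cases "butlast x' = []")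
          case True
          then have "x' = [c]" using x' \<open>x' \<noteq> []\<close> by (metis append_butlast_last_id append_Nil list.sel(1))
          then show ?thesis using True q1 x' c by simp
        next
          case False
          then have "hd (butlast x') = c" using x' \<open>x' \<noteq> []\<close> by (metis append_butlast_last_id hd_append2)
          moreover have "nbt V E (Some b) (butlast x')" using q(1) cs[of "butlast x'"] q1 False by simp
          ultimately have "q \<in> B u" unfolding q1 mem by simp
          then show ?thesis using q by blast
        qed
      qed
    qed
    ultimately show ?thesis by blast
  qed
  have "(- green Wl ?S z [b] [b]) *
     (z - complex_of_real (W (last [b])) - (\<Sum>u\<in>{u \<in> ?S. tadj [b] u}. - green Wl (B u) z u u)) = 1"
    by (rule green_root[OF cone_list_graph' z]) (use bV Bu in \<open>auto simp: nb_cone_def jj\<close>)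
  moreover have "(\<Sum>u\<in>{u \<in> ?S. tadj [b] u}. - green Wl (B u) z u u) = (\<Sum>k\<in>succ j. y k z)"
  proof -
    have "inj_on (\<lambda>k. [b, snd k]) (succ j)" by (auto simp: inj_on_def succ_def)
    then have "(\<Sum>u\<in>{u \<in> ?S. tadj [b] u}. - green Wl (B u) z u u) = (\<Sum>k\<in>succ j. - green Wl (B [b, snd k]) z [b, snd k] [b, snd k])"
      unfolding nb by (simp add: sum.reindex)
    also have "\<dots> = (\<Sum>k\<in>succ j. y k z)"
    proof (rule sum.cong[OF refl])
      fix k assume "k \<in> succ j"
      then obtain c where k: "k = (Some b, c)" "E b c" by (auto simp: succ_def jj)
      have "[c] \<in> nb_cone V E k" using EV[OF k(2)] by (simp add: nb_cone_def k)
      then have "green Wl ((@) [b] ` nb_cone V E k) z ([b] @ [c]) ([b] @ [c]) = green Wl (nb_cone V E k) z [c] [c]"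
        using bV by (intro green_translate[OF cone_list_graph' z]) auto
      then show "- green Wl (B [b, snd k]) z [b, snd k] [b, snd k] = y k z" by (simp add: y_def B_def k)
    qed
    finally show ?thesis .
  qed
  ultimately show ?thesis by (simp add: y_def jj)
qed

lemma Im_y_neg:
  assumes j: "j \<in> idx" and z: "Im z > 0"
  shows "Im (y j z) < 0"
proof -
  interpret list_graph V W "nb_cone V E j" by (rule cone_list_graph')
  have z': "Im z \<noteq> 0" using z by simp
  have v: "[snd j] \<in> nb_cone V E j" using cone_single idx_snd[OF j] by blast
  let ?R = "res z (l2_delta [snd j])"
  have "?R \<noteq> 0" using res_eq(1)[OF z', of "l2_delta [snd j]"]
  proof (rule contrapos_pn)
    assume R: "?R = 0"
    have "cscale z 0 = (0 :: 'a list l2)" by (rule l2_eqI) simp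
    then show "Hop ?R - cscale z ?R \<noteq> l2_delta [snd j]" unfolding R using norm_l2_delta[of "[snd j]"] by (metis A_0 diff_zero norm_zero zero_neq_one)
  qed
  moreover have "Im (y j z) = - (Im z * (norm ?R)\<^sup>2)"
    using Im_cinner_res[OF z', of "l2_delta [snd j]"] by (simp add: y_def green_eq[OF z' v] cinner_delta)
  ultimately show ?thesis using z by simp
qed

end

section \<open>Components of the tree with one edge removed\<close>

definition strict_step :: "'a list set \<Rightarrow> 'a list \<Rightarrow> 'a list \<Rightarrow> 'a list \<Rightarrow> 'a list \<Rightarrow> bool" where
  "strict_step T v w a b \<longleftrightarrow> a \<in> T \<and> b \<in> T \<and> tadj a b \<and> {a, b} \<noteq> {v, w}"

lemma cut_component_eq: "cut_component T v w = {u. (strict_step T v w)\<^sup>*\<^sup>* v u}"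
  unfolding cut_component_def strict_step_def by simp

lemma cut_self: "v \<in> cut_component T v w"
  by (simp add: cut_component_eq)

lemma cut_subset: "v \<in> T \<Longrightarrow> cut_component T v w \<subseteq> T"
proof
  fix u assume v: "v \<in> T" and "u \<in> cut_component T v w"
  then have "(strict_step T v w)\<^sup>*\<^sup>* v u" by (simp add: cut_component_eq)
  then show "u \<in> T" by (induction rule: rtranclp_induct) (auto simp: v strict_step_def)
qed

lemma cut_closed:
  "v \<in> T \<Longrightarrow> a \<in> cut_component T v w \<Longrightarrow> b \<in> T \<Longrightarrow> tadj a b \<Longrightarrow> {a, b} \<noteq> {v, w} \<Longrightarrow> b \<in> cut_component T v w"
proof -
  assume v: "v \<in> T" and a: "a \<in> cut_component T v w" and b: "b \<in> T" "tadj a b" "{a, b} \<noteq> {v, w}"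
  have "strict_step T v w a b" using cut_subset[OF v] a b unfolding strict_step_def by blast
  moreover have "(strict_step T v w)\<^sup>*\<^sup>* v a" using a by (simp add: cut_component_eq)
  ultimately have "(strict_step T v w)\<^sup>*\<^sup>* v b" by (rule rtranclp.rtrancl_into_rtrancl[rotated])
  then show ?thesis by (simp add: cut_component_eq)
qed

text \<open>The only edge leaving the set of words that extend \<open>w @ [x]\<close> is the removed
  one.\<close>

lemma cut_down_prefix:
  assumes "u \<in> cut_component T (w @ [x]) w"
  shows "\<exists>q. u = (w @ [x]) @ q"
proof -
  have "(strict_step T (w @ [x]) w)\<^sup>*\<^sup>* (w @ [x]) u" using assms by (simp add: cut_component_eq)
  then show ?thesis
  proof (induction rule: rtranclp_induct)
    case (step a b)
    then obtain q where q: "a = (w @ [x]) @ q" by blast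
    have s: "tadj a b" "{a, b} \<noteq> {w @ [x], w}" using step by (auto simp: strict_step_def)
    from s(1) show ?case unfolding tadj_def
    proof
      assume "\<exists>e. b = a @ [e]"
      then show ?thesis using q by auto
    next
      assume "\<exists>e. a = b @ [e]"
      then have b: "b = butlast a" by auto
      show ?thesis
      proof (cases "q = []")
        case True
        then have "a = w @ [x]" "b = w" using q b by auto
        then show ?thesis using s(2) by simp
      next
        case False
        then have "b = (w @ [x]) @ butlast q" unfolding b q by (simp only: butlast_append if_False)
        then show ?thesis by blast
      qed
    qed
  qed simp
qed

lemma cut_up_prefix:
  assumes "u \<in> cut_component T v (v @ [x])"
  shows "\<not> (\<exists>q. u = (v @ [x]) @ q)"
proof -
  have "(strict_step T v (v @ [x]))\<^sup>*\<^sup>* v u" using assms by (simp add: cut_component_eq)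
  then show ?thesis
  proof (induction rule: rtranclp_induct)
    case (step a b)
    have s: "tadj a b" "{a, b} \<noteq> {v, v @ [x]}" using step by (auto simp: strict_step_def)
    show ?case
    proof
      assume "\<exists>q. b = (v @ [x]) @ q"
      then obtain q where q: "b = (v @ [x]) @ q" by blast
      from s(1) show False unfolding tadj_def
      proof
        assume "\<exists>e. b = a @ [e]"
        then have a: "a = butlast b" by auto
        show False
        proof (cases "q = []")
          case True
          then have "b = v @ [x]" "a = v" using q a by auto
          then show False using s(2) by auto
        next
          case False
          then have "a = (v @ [x]) @ butlast q" unfolding a q by (simp only: butlast_append if_False)
          then show False using step.IH by blast
        qed
      next
        assume "\<exists>e. a = b @ [e]"
        then show False using step.IH q by auto
      qed
    qed
  qed simp
qed

lemma cut_other: "tadj v w \<Longrightarrow> w \<notin> cut_component T v w"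
  unfolding tadj_def
proof (elim disjE exE)
  fix x assume "w = v @ [x]"
  then show ?thesis using cut_up_prefix[of w T v x] by auto
next
  fix x assume "v = w @ [x]"
  then show ?thesis using cut_down_prefix[of w T w x] by auto
qed

text \<open>A path in the branch of u away from v avoids v, hence never uses the edge between v and
  w. The induction carries membership in both components to have this avoidance at hand.\<close>

lemma cut_nested:
  assumes "v \<in> T" "u \<in> T" "tadj v u" "u \<noteq> w"
  shows "cut_component T u v \<subseteq> cut_component T v w"
proof
  fix p assume p: "p \<in> cut_component T u v"
  have vn: "v \<notin> cut_component T u v" using cut_other tadj_sym assms(3) by blast
  have "(strict_step T u v)\<^sup>*\<^sup>* u p" using p by (simp add: cut_component_eq)
  then have "p \<in> cut_component T v w \<and> p \<in> cut_component T u v"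
  proof (induction rule: rtranclp_induct)
    case base
    have "u \<in> cut_component T v w"
      by (rule cut_closed[OF assms(1) cut_self assms(2,3)]) (use assms(4) in \<open>auto simp: doubleton_eq_iff\<close>)
    then show ?case using cut_self by blast
  next
    case (step a b)
    have ab: "a \<in> T" "b \<in> T" "tadj a b" "{a, b} \<noteq> {u, v}" using step.hyps by (auto simp: strict_step_def)
    have bu: "b \<in> cut_component T u v" using cut_closed[OF assms(2) conjunct2[OF step.IH] ab(2-4)] .
    have "a \<noteq> v" "b \<noteq> v" using vn bu step.IH by auto
    then have "{a, b} \<noteq> {v, w}" by (auto simp: doubleton_eq_iff)
    then show ?case using cut_closed[OF assms(1) conjunct1[OF step.IH] ab(2,3)] bu by blast
  qed
  then show "p \<in> cut_component T v w" by blast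
qed

lemma cut_edge:
  assumes "v \<in> T" "tadj v w" "a \<in> cut_component T v w" "b \<in> T" "b \<notin> cut_component T v w" "tadj a b"
  shows "a = v \<and> b = w"
proof -
  have "{a, b} = {v, w}" using cut_closed[OF assms(1,3,4,6)] assms(5) by blast
  moreover have "a \<noteq> w" using cut_other[OF assms(2)] assms(3) by blast
  ultimately show ?thesis by (auto simp: doubleton_eq_iff)
qed

section \<open>Green functions of the tree and of its cut components\<close>

locale rooted_ugraph = ugraph +
  fixes r :: 'a
  assumes rV: "r \<in> V"
begin

definition T :: "'a list set" where "T = nbw V E r"

lemma T_iff: "p \<in> T \<longleftrightarrow> nbt V E None p \<and> hd p = r"
  unfolding T_def nbw_eq_cone nb_cone_def by simp

lemma T_list_graph: "S \<subseteq> T \<Longrightarrow> list_graph V S"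
  by (rule cone_list_graph[of _ None]) (auto simp: T_iff)

lemma T_nonempty: "p \<in> T \<Longrightarrow> p \<noteq> []"
  by (auto simp: T_iff)

lemma T_last: "p \<in> T \<Longrightarrow> last p \<in> V"
  using list_graph.last_in_V[OF T_list_graph[OF subset_refl]] .

lemma T_append_iff:
  assumes "p \<noteq> []" "q \<noteq> []"
  shows "p @ q \<in> T \<longleftrightarrow> p \<in> T \<and> E (last p) (hd q) \<and> prev None p \<noteq> Some (hd q) \<and> nbt V E (Some (last p)) q"
  unfolding T_iff nbt_append[OF assms] using assms by auto

lemma T_child_iff: "p \<in> T \<Longrightarrow> p @ [c] \<in> T \<longleftrightarrow> E (last p) c \<and> prev None p \<noteq> Some c"
  using T_append_iff[of p "[c]"] T_nonempty[of p] EV by auto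

lemma T_prefix: "p @ q \<in> T \<Longrightarrow> p \<noteq> [] \<Longrightarrow> p \<in> T"
  using T_append_iff[of p q] by (cases "q = []") auto

lemma T_parent: "p \<in> T \<Longrightarrow> length p \<ge> 2 \<Longrightarrow> butlast p \<in> T \<and> E (last (butlast p)) (last p)"
proof -
  assume p: "p \<in> T" "length p \<ge> 2"
  then have ne: "butlast p \<noteq> []" "butlast p @ [last p] = p" by (cases p; auto)+
  then show ?thesis using T_append_iff[OF ne(1), of "[last p]"] p by simp
qed

lemma T_single: "p \<in> T \<Longrightarrow> length p = 1 \<Longrightarrow> p = [r]"
  by (cases p) (auto simp: T_iff)

lemma root_T: "[r] \<in> T"
  using rV by (simp add: T_iff)

text \<open>The local covering property of \<open>last\<close>: the children miss exactly the
  neighbour excluded by non-backtracking, and the parent supplies it.\<close>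

lemma nbrs_last: "v \<in> T \<Longrightarrow> bij_betw last {u \<in> T. tadj v u} {c. E (last v) c}"
proof -
  assume v: "v \<in> T"
  have parent: "tadj v u \<and> u \<in> T \<longleftrightarrow> (\<exists>c. u = v @ [c] \<and> E (last v) c \<and> prev None v \<noteq> Some c) \<or> (length v \<ge> 2 \<and> u = butlast v)" for u
  proof
    assume a: "tadj v u \<and> u \<in> T"
    then show "(\<exists>c. u = v @ [c] \<and> E (last v) c \<and> prev None v \<noteq> Some c) \<or> (length v \<ge> 2 \<and> u = butlast v)"
      using T_child_iff[OF v] T_nonempty[of u] unfolding tadj_def by (auto simp: Suc_le_eq)
  next
    assume "(\<exists>c. u = v @ [c] \<and> E (last v) c \<and> prev None v \<noteq> Some c) \<or> (length v \<ge> 2 \<and> u = butlast v)"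
    then show "tadj v u \<and> u \<in> T"
    proof
      assume "length v \<ge> 2 \<and> u = butlast v"
      then show ?thesis using T_parent[OF v] T_nonempty[OF v] unfolding tadj_def by (metis append_butlast_last_id)
    qed (use T_child_iff[OF v] in \<open>auto simp: tadj_def\<close>)
  qed
  show ?thesis
    unfolding bij_betw_def
  proof
    show "inj_on last {u \<in> T. tadj v u}"
    proof (rule inj_onI)
      fix a b assume "a \<in> {u \<in> T. tadj v u}" "b \<in> {u \<in> T. tadj v u}" "last a = last b"
      then show "a = b" using parent[of a] parent[of b] by (auto simp: prev_def)
    qed
    show "last ` {u \<in> T. tadj v u} = {c. E (last v) c}"
    proof (intro set_eqI iffI)
      fix c assume "c \<in> last ` {u \<in> T. tadj v u}"
      then obtain u where u: "u \<in> T" "tadj v u" "c = last u" by blast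
      then have "(\<exists>c. u = v @ [c] \<and> E (last v) c \<and> prev None v \<noteq> Some c) \<or> (length v \<ge> 2 \<and> u = butlast v)"
        using parent[of u] by blast
      then show "c \<in> {c. E (last v) c}" using T_parent[OF v] Esym u(3) by auto
    next
      fix c assume c: "c \<in> {c. E (last v) c}"
      show "c \<in> last ` {u \<in> T. tadj v u}"
      proof (cases "prev None v = Some c")
        case True
        then have "length v \<ge> 2" "c = last (butlast v)" by (auto simp: prev_def split: if_splits)
        then show ?thesis using parent[of "butlast v"] by blast
      next
        case False
        then show ?thesis using parent[of "v @ [c]"] c by (intro image_eqI[of _ _ "v @ [c]"]) auto
      qed
    qed
  qed
qed

text \<open>One statement for the full tree, where \<open>ao = None\<close>, and for a cut
  component, where \<open>ao\<close> records the neighbour cut off. Both sides are inverse to the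
  same factor: by \<open>green_root\<close> and the hypothesis on the branches on one side, by
  \<open>y_eq\<close> on the other.\<close>

lemma green_branching:
  assumes v: "v \<in> T" and z: "Im z \<noteq> 0" and S: "S = T \<and> ao = None \<or> (\<exists>w\<in>T. tadj v w \<and> S = cut_component T v w \<and> ao = Some (last w))"
    and IH: "\<And>u. u \<in> S \<Longrightarrow> tadj v u \<Longrightarrow> zeta Wl T z v u = y (Some (last v), last u) z"
  shows "- green Wl S z v v = y (ao, last v) z"
proof -
  have ST: "S \<subseteq> T" and vS: "v \<in> S" using S cut_subset[OF v] cut_self v by auto
  have nbS: "{u \<in> S. tadj v u} = {u \<in> T. tadj v u \<and> ao \<noteq> Some (last u)}"
    using S
  proof
    assume S: "\<exists>w\<in>T. tadj v w \<and> S = cut_component T v w \<and> ao = Some (last w)"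
    then obtain w where w: "w \<in> T" "tadj v w" "S = cut_component T v w" "ao = Some (last w)" by blast
    have lw: "last u = last w \<longleftrightarrow> u = w" if "u \<in> T" "tadj v u" for u
      using nbrs_last[OF v] that w by (auto simp: bij_betw_def inj_on_def)
    have mem: "u \<in> S \<longleftrightarrow> u \<noteq> w" if "u \<in> T" "tadj v u" for u
      unfolding w(3) using cut_other[OF w(2)] cut_closed[OF v cut_self that] by (auto simp: doubleton_eq_iff)
    show ?thesis
    proof (rule set_eqI)
      fix u show "u \<in> {u \<in> S. tadj v u} \<longleftrightarrow> u \<in> {u \<in> T. tadj v u \<and> ao \<noteq> Some (last u)}"
      proof (cases "u \<in> T \<and> tadj v u")
        case True
        then show ?thesis using lw[of u] mem[of u] w(4) by auto
      next
        case False
        then show ?thesis using ST by auto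
      qed
    qed
  qed auto
  have B: "cut_component T u v \<subseteq> S \<and> u \<in> cut_component T u v \<and> v \<notin> cut_component T u v \<and>
        (\<forall>x\<in>cut_component T u v. \<forall>q\<in>S - cut_component T u v. tadj x q \<longrightarrow> x = u \<and> q = v)"
    if u: "u \<in> S" "tadj v u" for u
  proof -
    have uT: "u \<in> T" using u ST by blast
    have uv: "tadj u v" using u tadj_sym by blast
    have "cut_component T u v \<subseteq> S"
      using S
    proof
      assume "\<exists>w\<in>T. tadj v w \<and> S = cut_component T v w \<and> ao = Some (last w)"
      then obtain w where w: "w \<in> T" "tadj v w" "S = cut_component T v w" by blast
      have "u \<noteq> w" using u(1) cut_other[OF w(2)] w(3) by blast
      then show ?thesis using cut_nested[OF v uT u(2)] w(3) by simp
    qed (use cut_subset[OF uT] in auto)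
    then show ?thesis
      using cut_self cut_other[OF uv] cut_edge[OF uT uv] ST by blast
  qed
  have "(- green Wl S z v v) * (z - complex_of_real (W (last v)) -
      (\<Sum>u\<in>{u \<in> S. tadj v u}. - green Wl (cut_component T u v) z u u)) = 1"
    by (rule green_root[OF T_list_graph[OF ST] z vS B])
  also have "(\<Sum>u\<in>{u \<in> S. tadj v u}. - green Wl (cut_component T u v) z u u) = (\<Sum>u\<in>{u \<in> S. tadj v u}. y (Some (last v), last u) z)"
    by (rule sum.cong[OF refl]) (use IH in \<open>auto simp: zeta_def\<close>)
  also have "\<dots> = (\<Sum>k\<in>succ (ao, last v). y k z)"
  proof (rule sum.reindex_bij_betw[of "\<lambda>u. (Some (last v), last u)" _ _ "\<lambda>k. y k z"])
    have "inj_on (\<lambda>u. (Some (last v), last u)) {u \<in> S. tadj v u}"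
      using nbrs_last[OF v] ST by (auto simp: bij_betw_def inj_on_def)
    moreover have "(\<lambda>u. (Some (last v), last u)) ` {u \<in> S. tadj v u} = succ (ao, last v)"
    proof -
      have im: "last ` {u \<in> T. tadj v u} = {c. E (last v) c}" using nbrs_last[OF v] by (simp add: bij_betw_def)
      have "(\<lambda>u. (Some (last v), last u)) ` {u \<in> S. tadj v u} = (\<lambda>c. (Some (last v), c)) ` {c \<in> last ` {u \<in> T. tadj v u}. ao \<noteq> Some c}"
        unfolding nbS by auto
      then show ?thesis unfolding im succ_def by auto
    qed
    ultimately show "bij_betw (\<lambda>u. (Some (last v), last u)) {u \<in> S. tadj v u} (succ (ao, last v))"
      by (simp add: bij_betw_def)
  qed
  finally have eq1: "(- green Wl S z v v) * (z - complex_of_real (W (last v)) - (\<Sum>k\<in>succ (ao, last v). y k z)) = 1" .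
  have "(ao, last v) \<in> idx"
  proof -
    have "last v \<in> V" by (rule T_last[OF v])
    moreover have "E a (last v)" if ao: "ao = Some a" for a
    proof -
      obtain w where w: "w \<in> T" "tadj v w" "a = last w" using S ao by auto
      then have "E (last v) a" using nbrs_last[OF v] unfolding bij_betw_def by blast
      then show ?thesis by (rule Esym)
    qed
    ultimately show ?thesis unfolding idx_def by (cases ao) auto
  qed
  from y_eq[OF this z] have "y (ao, last v) z * (z - complex_of_real (W (last v)) - (\<Sum>k\<in>succ (ao, last v). y k z)) = 1" by simp
  with eq1 have "- green Wl S z v v * (z - complex_of_real (W (last v)) - (\<Sum>k\<in>succ (ao, last v). y k z))
      = y (ao, last v) z * (z - complex_of_real (W (last v)) - (\<Sum>k\<in>succ (ao, last v). y k z))" by (simp only:)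
  moreover have "z - complex_of_real (W (last v)) - (\<Sum>k\<in>succ (ao, last v). y k z) \<noteq> 0" using eq1 by auto
  ultimately show ?thesis using mult_right_cancel by blast
qed

lemma zeta_down:
  assumes w: "w \<in> T" and v: "w @ [x] \<in> T" and z: "Im z \<noteq> 0"
  shows "zeta Wl T z w (w @ [x]) = y (Some (last w), x) z"
proof -
  have ne: "w \<noteq> []" by (rule T_nonempty[OF w])
  have c: "E (last w) x" "prev None w \<noteq> Some x" using v T_child_iff[OF w] by auto
  have "cut_component T (w @ [x]) w = (@) w ` nb_cone V E (Some (last w), x)"
  proof (intro set_eqI iffI)
    fix p assume p: "p \<in> cut_component T (w @ [x]) w"
    obtain q where q: "p = (w @ [x]) @ q" using cut_down_prefix[OF p] by blast
    then have "w @ ([x] @ q) \<in> T" using subsetD[OF cut_subset[OF v] p] by simp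
    then have "nbt V E (Some (last w)) ([x] @ q)" using T_append_iff[OF ne, of "[x] @ q"] by simp
    then show "p \<in> (@) w ` nb_cone V E (Some (last w), x)" using q by (auto simp: nb_cone_def)
  next
    fix p assume "p \<in> (@) w ` nb_cone V E (Some (last w), x)"
    then obtain q0 where q0: "p = w @ q0" "nbt V E (Some (last w)) q0" "hd q0 = x" by (auto simp: nb_cone_def)
    have "q0 \<noteq> []" using q0(2) by auto
    then obtain q where q: "q0 = x # q" using q0(3) by (cases q0) auto
    have pT: "w @ (x # q) \<in> T" using T_append_iff[OF ne, of "x # q"] w c q0 q by simp
    have "w @ (x # q) \<in> T \<Longrightarrow> w @ (x # q) \<in> cut_component T (w @ [x]) w"
    proof (induction q rule: rev_induct)
      case Nil
      show ?case by (rule cut_self)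
    next
      case (snoc e q)
      have qT: "w @ (x # q) \<in> T" using T_prefix[of "w @ (x # q)" "[e]"] snoc.prems by simp
      have "tadj (w @ (x # q)) (w @ (x # q @ [e]))" unfolding tadj_def by simp
      moreover have "{w @ (x # q), w @ (x # q @ [e])} \<noteq> {w @ [x], w}" by (auto simp: doubleton_eq_iff)
      ultimately show ?case using cut_closed[OF v snoc.IH[OF qT] snoc.prems] by simp
    qed
    then show "p \<in> cut_component T (w @ [x]) w" using pT q0 q by simp
  qed
  moreover have "[x] \<in> nb_cone V E (Some (last w), x)" using EV[OF c(1)] by (simp add: nb_cone_def)
  moreover have "set w \<subseteq> V" using w by (auto simp: T_iff nbt_iff)
  ultimately show ?thesis
    unfolding zeta_def y_def using green_translate[OF cone_list_graph' z, of w "[x]" "(Some (last w), x)" "[x]"] by simp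
qed

text \<open>If v lies below w, the cut component is a translated cone. If v lies above w, the
  component contains the root; its branches at v are the other children, already treated, and the
  parent of v, which is shorter. Hence the induction on the length of v.\<close>

lemma zeta_eq_y:
  assumes z: "Im z \<noteq> 0" and v: "v \<in> T" and w: "w \<in> T" and a: "tadj v w"
  shows "zeta Wl T z w v = y (Some (last w), last v) z"
  using v w a
proof (induction "length v" arbitrary: v w rule: less_induct)
  case less
  from less.prems(3) show ?case unfolding tadj_def
  proof
    assume "\<exists>x. v = w @ [x]"
    then show ?thesis using zeta_down[OF less.prems(2) _ z] less.prems(1) by auto
  next
    assume "\<exists>x. w = v @ [x]"
    then obtain x where x: "w = v @ [x]" by blast
    have "zeta Wl T z v u = y (Some (last v), last u) z" if u: "u \<in> cut_component T v w" "tadj v u" for u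
    proof -
      have uT: "u \<in> T" using cut_subset[OF less.prems(1)] u(1) by blast
      from u(2) show ?thesis unfolding tadj_def
      proof
        assume "\<exists>e. u = v @ [e]"
        then show ?thesis using zeta_down[OF less.prems(1) _ z] uT by auto
      next
        assume e: "\<exists>e. v = u @ [e]"
        then have "length u < length v" by auto
        then show ?thesis using less.hyps[of u v] uT less.prems(1) tadj_sym[of u v] u(2) by blast
      qed
    qed
    then show ?thesis
      unfolding zeta_def using less.prems by (intro green_branching[OF less.prems(1) z]) (auto simp: zeta_def)
  qed
qed

lemma green_T_diag:
  assumes "Im z \<noteq> 0" "v \<in> T"
  shows "green Wl T z v v = - y (None, last v) z"
proof -
  have "- green Wl T z v v = y (None, last v) z"
    by (rule green_branching[OF assms(2,1)]) (use zeta_eq_y[OF assms(1)] assms(2) tadj_sym in blast)+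
  then show ?thesis by (simp add: minus_equation_iff)
qed

text \<open>Here p is the next vertex on the path from x to v, so off-diagonal values factor along
  that path.\<close>

lemma green_T_step:
  assumes z: "Im z \<noteq> 0" and x: "x \<in> T" "p \<in> T" "tadj x p" and v: "v \<in> T" "v \<notin> cut_component T x p"
  shows "green Wl T z x v = green Wl T z p v * y (Some (last p), last x) z"
proof -
  have "green Wl T z x v = - green Wl T z p v * green Wl (cut_component T x p) z x x"
  proof (rule green_restrict[OF T_list_graph[OF subset_refl] z cut_subset[OF x(1)] cut_self x(2) _ x(3) v])
    show "p \<notin> cut_component T x p" by (rule cut_other[OF x(3)])
  qed (rule cut_edge[OF x(1) x(3)])
  then show ?thesis using zeta_eq_y[OF z x] by (simp add: zeta_def) (metis mult_minus_right)
qed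

text \<open>Starting from the diagonal value, each step away from v multiplies by one of finitely
  many functions with a limit. Towards v one moves to a child when x is a proper prefix of v, and to
  the parent when x is not a prefix; this explains the two inductions.\<close>

lemma green_T_limit:
  assumes v: "v \<in> T" and x: "x \<in> T"
    and F: "\<forall>\<^sub>F \<eta> in F. Im (f \<eta>) \<noteq> 0"
    and lim: "\<And>j. j \<in> idx \<Longrightarrow> \<exists>L. ((\<lambda>\<eta>. y j (f \<eta>)) \<longlongrightarrow> L) F"
  shows "\<exists>L. ((\<lambda>\<eta>. green Wl T (f \<eta>) x v) \<longlongrightarrow> L) F"
proof -
  have step: "\<exists>L. ((\<lambda>\<eta>. green Wl T (f \<eta>) x v) \<longlongrightarrow> L) F"
    if x: "x \<in> T" "p \<in> T" "tadj x p" "v \<notin> cut_component T x p" and p: "\<exists>L. ((\<lambda>\<eta>. green Wl T (f \<eta>) p v) \<longlongrightarrow> L) F" for x p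
  proof -
    have "E (last x) (last p)" using nbrs_last[OF x(1)] x(2,3) unfolding bij_betw_def by blast
    then have "(Some (last p), last x) \<in> idx" unfolding idx_def using Esym by auto
    then obtain L1 where L1: "((\<lambda>\<eta>. y (Some (last p), last x) (f \<eta>)) \<longlongrightarrow> L1) F" using lim by blast
    obtain L2 where L2: "((\<lambda>\<eta>. green Wl T (f \<eta>) p v) \<longlongrightarrow> L2) F" using p by blast
    have l: "((\<lambda>\<eta>. green Wl T (f \<eta>) p v * y (Some (last p), last x) (f \<eta>)) \<longlongrightarrow> L2 * L1) F"
      by (intro tendsto_mult L1 L2)
    have e: "\<forall>\<^sub>F \<eta> in F. green Wl T (f \<eta>) p v * y (Some (last p), last x) (f \<eta>) = green Wl T (f \<eta>) x v"
      using F by eventually_elim (simp add: green_T_step[OF _ x(1-3) v x(4)])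
    from Lim_transform_eventually[OF l e] show ?thesis by blast
  qed
  have diag: "\<exists>L. ((\<lambda>\<eta>. green Wl T (f \<eta>) v v) \<longlongrightarrow> L) F"
  proof -
    have "(None, last v) \<in> idx" unfolding idx_def using T_last[OF v] by simp
    then obtain L1 where L1: "((\<lambda>\<eta>. y (None, last v) (f \<eta>)) \<longlongrightarrow> L1) F" using lim by blast
    then have l: "((\<lambda>\<eta>. - y (None, last v) (f \<eta>)) \<longlongrightarrow> - L1) F" by (rule tendsto_minus)
    have e: "\<forall>\<^sub>F \<eta> in F. - y (None, last v) (f \<eta>) = green Wl T (f \<eta>) v v"
      using F by eventually_elim (simp add: green_T_diag[OF _ v])
    from Lim_transform_eventually[OF l e] show ?thesis by blast
  qed
  have pre: "\<exists>L. ((\<lambda>\<eta>. green Wl T (f \<eta>) x v) \<longlongrightarrow> L) F" if "x \<in> T" "\<exists>q. v = x @ q" for x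
    using that
  proof (induction "length v - length x" arbitrary: x rule: less_induct)
    case less
    then obtain q where q: "v = x @ q" by blast
    show ?case
    proof (cases q)
      case Nil
      then show ?thesis using diag q by simp
    next
      case (Cons e q')
      have pT: "x @ [e] \<in> T" using T_prefix[of "x @ [e]" q'] v q Cons by simp
      have "v \<notin> cut_component T x (x @ [e])" using cut_up_prefix[of v T x e] q Cons by auto
      moreover have "\<exists>L. ((\<lambda>\<eta>. green Wl T (f \<eta>) (x @ [e]) v) \<longlongrightarrow> L) F"
        using less.hyps[of "x @ [e]"] pT q Cons by auto
      ultimately show ?thesis using step[OF less.prems(1) pT] by (auto simp: tadj_def)
    qed
  qed
  show ?thesis
    using x
  proof (induction "length x" arbitrary: x rule: less_induct)
    case less
    show ?case
    proof (cases "\<exists>q. v = x @ q")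
      case True
      then show ?thesis using pre less.prems by blast
    next
      case False
      have "length x \<ge> 2"
      proof (rule ccontr)
        assume "\<not> length x \<ge> 2"
        then have "length x = 1" using T_nonempty[OF less.prems] by (cases x; cases "tl x") auto
        then have "x = [r]" using T_single less.prems by blast
        moreover have "v = r # tl v" using v T_nonempty[OF v] by (cases v) (auto simp: T_iff)
        ultimately show False using False by (metis append_Cons append_Nil)
      qed
      then have pT: "butlast x \<in> T" using T_parent[OF less.prems] by blast
      have xx: "x = butlast x @ [last x]" using T_nonempty[OF less.prems] by simp
      have "v \<notin> cut_component T x (butlast x)"
        using cut_down_prefix[of v T "butlast x" "last x"] False xx by metis
      moreover have "tadj x (butlast x)" unfolding tadj_def using xx by blast
      moreover have "length (butlast x) < length x" using \<open>length x \<ge> 2\<close> by simp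
      ultimately show ?thesis using step[OF less.prems pT] less.hyps[OF _ pT] by blast
    qed
  qed
qed

end

section \<open>Derivations and algebraicity\<close>

text \<open>Subfields are sets inside one ambient field: the field grows by adjunction while all
  elements remain Laurent series.\<close>

definition subfld :: "'m::field set \<Rightarrow> bool" where
  "subfld L \<longleftrightarrow> 0 \<in> L \<and> 1 \<in> L \<and> (\<forall>a\<in>L. \<forall>b\<in>L. a + b \<in> L \<and> a * b \<in> L) \<and> (\<forall>a\<in>L. - a \<in> L \<and> inverse a \<in> L)"

definition coeffs_in :: "'m::field set \<Rightarrow> 'm poly \<Rightarrow> bool" where
  "coeffs_in L p \<longleftrightarrow> (\<forall>i. Polynomial.coeff p i \<in> L)"

definition deriv_on :: "'m::field set \<Rightarrow> ('m \<Rightarrow> 'm) \<Rightarrow> bool" where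
  "deriv_on L D \<longleftrightarrow> (\<forall>a\<in>L. \<forall>b\<in>L. D (a + b) = D a + D b \<and> D (a * b) = a * D b + b * D a)"

definition adjoin :: "'m::field set \<Rightarrow> 'm \<Rightarrow> 'm set" where
  "adjoin L a = {poly p a / poly q a | p q. coeffs_in L p \<and> coeffs_in L q \<and> poly q a \<noteq> 0}"

lemma subfldD:
  assumes "subfld L"
  shows "0 \<in> L" "1 \<in> L" "a \<in> L \<Longrightarrow> b \<in> L \<Longrightarrow> a + b \<in> L" "a \<in> L \<Longrightarrow> b \<in> L \<Longrightarrow> a * b \<in> L"
    "a \<in> L \<Longrightarrow> - a \<in> L" "a \<in> L \<Longrightarrow> inverse a \<in> L" "a \<in> L \<Longrightarrow> b \<in> L \<Longrightarrow> a - b \<in> L" "a \<in> L \<Longrightarrow> b \<in> L \<Longrightarrow> a / b \<in> L"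
  using assms unfolding subfld_def by (simp_all add: divide_inverse) (metis add_uminus_conv_diff)

lemma subfld_sum: "subfld L \<Longrightarrow> (\<And>i. i \<in> A \<Longrightarrow> f i \<in> L) \<Longrightarrow> (\<Sum>i\<in>A. f i) \<in> L"
  by (induction A rule: infinite_finite_induct) (auto simp: subfldD)

lemma subfld_of_nat: "subfld L \<Longrightarrow> of_nat n \<in> L"
  by (induction n) (auto simp: subfldD)

context
  fixes L :: "'m::field_char_0 set"
  assumes L: "subfld L"
begin

lemma coeffs_in_const: "x \<in> L \<Longrightarrow> coeffs_in L [:x:]"
  by (auto simp: coeffs_in_def coeff_pCons subfldD[OF L] split: nat.split)

lemma coeffs_in_0: "coeffs_in L 0"
  by (simp add: coeffs_in_def subfldD[OF L])

lemma coeffs_in_X: "coeffs_in L [:0, 1:]"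
  by (auto simp: coeffs_in_def coeff_pCons subfldD[OF L] split: nat.split)

lemma coeffs_in_add: "coeffs_in L p \<Longrightarrow> coeffs_in L q \<Longrightarrow> coeffs_in L (p + q)"
  by (auto simp: coeffs_in_def subfldD[OF L])

lemma coeffs_in_diff: "coeffs_in L p \<Longrightarrow> coeffs_in L q \<Longrightarrow> coeffs_in L (p - q)"
  by (auto simp: coeffs_in_def subfldD[OF L])

lemma coeffs_in_uminus: "coeffs_in L p \<Longrightarrow> coeffs_in L (- p)"
  by (auto simp: coeffs_in_def subfldD[OF L])

lemma coeffs_in_mult: "coeffs_in L p \<Longrightarrow> coeffs_in L q \<Longrightarrow> coeffs_in L (p * q)"
  unfolding coeffs_in_def coeff_mult by (intro allI subfld_sum[OF L] subfldD[OF L]) auto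

lemma coeffs_in_monom: "x \<in> L \<Longrightarrow> coeffs_in L (monom x n)"
  by (auto simp: coeffs_in_def subfldD[OF L])

lemma coeffs_in_pCons: "coeffs_in L (pCons x p) \<longleftrightarrow> x \<in> L \<and> coeffs_in L p"
  unfolding coeffs_in_def by (metis coeff_pCons_0 coeff_pCons_Suc not0_implies_Suc)

lemma coeffs_in_pderiv: "coeffs_in L p \<Longrightarrow> coeffs_in L (pderiv p)"
  unfolding coeffs_in_def coeff_pderiv by (intro allI subfldD[OF L] subfld_of_nat[OF L]) auto

lemma subfld_adjoin: "subfld (adjoin L a)"
proof -
  have mem: "poly p a / poly q a \<in> adjoin L a" if "coeffs_in L p" "coeffs_in L q" "poly q a \<noteq> 0" for p q
    unfolding adjoin_def using that by blast
  have c1: "coeffs_in L 1" using coeffs_in_const[of 1] subfldD[OF L] by (simp add: one_pCons)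
  show ?thesis
    unfolding subfld_def
  proof (intro conjI ballI)
    show "0 \<in> adjoin L a" using mem[OF coeffs_in_0 c1] by simp
    show "1 \<in> adjoin L a" using mem[OF c1 c1] by simp
    fix x assume "x \<in> adjoin L a"
    then obtain p q where x: "x = poly p a / poly q a" "coeffs_in L p" "coeffs_in L q" "poly q a \<noteq> 0" unfolding adjoin_def by blast
    show "- x \<in> adjoin L a" using mem[OF coeffs_in_uminus[OF x(2)] x(3,4)] x(1) by simp
    show "inverse x \<in> adjoin L a"
    proof (cases "poly p a = 0")
      case True
      then show ?thesis using \<open>0 \<in> adjoin L a\<close> x by simp
    next
      case False
      then show ?thesis using mem[OF x(3,2)] x(1) by simp
    qed
    fix y assume "y \<in> adjoin L a"
    then obtain p' q' where y: "y = poly p' a / poly q' a" "coeffs_in L p'" "coeffs_in L q'" "poly q' a \<noteq> 0" unfolding adjoin_def by blast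
    show "x + y \<in> adjoin L a"
      using mem[of "p * q' + p' * q" "q * q'"] x y by (simp add: coeffs_in_add coeffs_in_mult add_frac_eq)
    show "x * y \<in> adjoin L a"
      using mem[of "p * p'" "q * q'"] x y by (simp add: coeffs_in_mult)
  qed
qed

lemma subset_adjoin: "L \<subseteq> adjoin L a" and elem_adjoin: "a \<in> adjoin L a"
proof -
  have c1: "coeffs_in L 1" using coeffs_in_const[of 1] subfldD[OF L] by (simp add: one_pCons)
  show "L \<subseteq> adjoin L a"
  proof
    fix x assume "x \<in> L"
    then show "x \<in> adjoin L a" unfolding adjoin_def
      using coeffs_in_const c1 by (intro CollectI exI[of _ "[:x:]"] exI[of _ 1]) auto
  qed
  show "a \<in> adjoin L a" unfolding adjoin_def
    using coeffs_in_X c1 by (intro CollectI exI[of _ "[:0, 1:]"] exI[of _ 1]) auto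
qed

lemma deriv_0: "deriv_on L D \<Longrightarrow> D 0 = 0"
  using subfldD(1)[OF L] unfolding deriv_on_def by (metis add_cancel_right_right add_0)

lemma deriv_1: "deriv_on L D \<Longrightarrow> D 1 = 0"
  using subfldD(2)[OF L] unfolding deriv_on_def by (metis add_cancel_right_right mult_1)

lemma deriv_uminus: "deriv_on L D \<Longrightarrow> a \<in> L \<Longrightarrow> D (- a) = - D a"
  using subfldD(5)[OF L] deriv_0 unfolding deriv_on_def by (metis add.right_inverse add_eq_0_iff)

lemma deriv_kernel_subfld: "deriv_on L D \<Longrightarrow> subfld {a \<in> L. D a = 0}"
proof -
  assume D: "deriv_on L D"
  have "D (inverse a) = 0" if a: "a \<in> L" "D a = 0" for a
  proof (cases "a = 0")
    case False
    have "D (a * inverse a) = a * D (inverse a) + inverse a * D a" using D a subfldD(6)[OF L] unfolding deriv_on_def by blast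
    then show ?thesis using False deriv_1[OF D] a by simp
  qed (use deriv_0[OF D] in simp)
  then show ?thesis
    using D deriv_0[OF D] deriv_1[OF D] deriv_uminus[OF D] subfldD[OF L] unfolding subfld_def deriv_on_def by auto
qed

context
  fixes D :: "'m \<Rightarrow> 'm"
  assumes D: "deriv_on L D"
begin

lemma coeff_map_deriv: "Polynomial.coeff (map_poly D p) i = D (Polynomial.coeff p i)"
  by (simp add: coeff_map_poly deriv_0[OF D])

lemma map_deriv_add: "coeffs_in L p \<Longrightarrow> coeffs_in L q \<Longrightarrow> map_poly D (p + q) = map_poly D p + map_poly D q"
  using D unfolding deriv_on_def coeffs_in_def by (intro poly_eqI) (simp add: coeff_map_deriv)

lemma map_deriv_smult: "c \<in> L \<Longrightarrow> coeffs_in L p \<Longrightarrow> map_poly D (smult c p) = smult c (map_poly D p) + smult (D c) p"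
  using D unfolding deriv_on_def coeffs_in_def by (intro poly_eqI) (simp add: coeff_map_deriv mult.commute)

lemma map_deriv_pCons: "map_poly D (pCons a p) = pCons (D a) (map_poly D p)"
  by (rule map_poly_pCons) (use deriv_0[OF D] in simp)

lemma map_deriv_mult: "coeffs_in L p \<Longrightarrow> coeffs_in L q \<Longrightarrow> map_poly D (p * q) = map_poly D p * q + p * map_poly D q"
proof (induction p)
  case (pCons a p)
  have ap: "a \<in> L" "coeffs_in L p" using pCons.prems coeffs_in_pCons by auto
  have c: "coeffs_in L (smult a q)" "coeffs_in L (pCons 0 (p * q))"
    using coeffs_in_mult[OF coeffs_in_const[OF ap(1)] pCons.prems(2)] coeffs_in_pCons coeffs_in_mult[OF ap(2) pCons.prems(2)] subfldD(1)[OF L]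
    by simp_all
  have "map_poly D (pCons a p * q) = map_poly D (smult a q + pCons 0 (p * q))" by simp
  also have "\<dots> = smult a (map_poly D q) + smult (D a) q + pCons 0 (map_poly D p * q + p * map_poly D q)"
    unfolding map_deriv_add[OF c] map_deriv_smult[OF ap(1) pCons.prems(2)] map_deriv_pCons pCons.IH[OF ap(2) pCons.prems(2)]
    by (simp add: deriv_0[OF D])
  also have "\<dots> = map_poly D (pCons a p) * q + pCons a p * map_poly D q"
    by (simp add: map_deriv_pCons algebra_simps)
  finally show ?case .
qed simp

text \<open>The value at p(a) forced on any extension of D that sends a to c: D acts on the
  coefficients, plus c times the formal derivative at a.\<close>

definition ext_val :: "'m \<Rightarrow> 'm \<Rightarrow> 'm poly \<Rightarrow> 'm" where
  "ext_val a c p = poly (map_poly D p) a + c * poly (pderiv p) a"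

lemma ext_val_add: "coeffs_in L p \<Longrightarrow> coeffs_in L q \<Longrightarrow> ext_val a c (p + q) = ext_val a c p + ext_val a c q"
  by (simp add: ext_val_def map_deriv_add pderiv_add algebra_simps)

lemma ext_val_mult: "coeffs_in L p \<Longrightarrow> coeffs_in L q \<Longrightarrow> ext_val a c (p * q) = ext_val a c p * poly q a + poly p a * ext_val a c q"
  by (simp add: ext_val_def map_deriv_mult pderiv_mult algebra_simps)

lemma ext_val_diff: "coeffs_in L p \<Longrightarrow> coeffs_in L q \<Longrightarrow> ext_val a c (p - q) = ext_val a c p - ext_val a c q"
  using ext_val_add[OF coeffs_in_diff, of p q q a c] by (simp add: eq_diff_eq)

text \<open>The extension is defined by the quotient rule from the forced values. The hypothesis
  says that they respect the polynomial relations of a, which is what makes the definition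
  independent of the chosen fraction.\<close>

lemma deriv_extend:
  assumes c: "\<And>p. coeffs_in L p \<Longrightarrow> poly p a = 0 \<Longrightarrow> ext_val a c p = 0"
  shows "\<exists>D'. deriv_on (adjoin L a) D' \<and> (\<forall>x\<in>L. D' x = D x) \<and> D' a = c"
proof -
  define val where "val p q = (ext_val a c p * poly q a - poly p a * ext_val a c q) / (poly q a)\<^sup>2" for p q
  have wd: "val p q = val p' q'"
    if h: "coeffs_in L p" "coeffs_in L q" "poly q a \<noteq> 0" "coeffs_in L p'" "coeffs_in L q'" "poly q' a \<noteq> 0"
      "poly p a / poly q a = poly p' a / poly q' a" for p q p' q'
  proof -
    have e: "poly p a * poly q' a = poly p' a * poly q a" using h by (simp add: frac_eq_eq)
    \<comment> \<open>Two fractions for the same element make p q' - p' q a relation of a. Applying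
      the hypothesis to it gives the equality of the two quotient-rule values.\<close>
    have "ext_val a c (p * q' - p' * q) = 0"
      by (rule c) (use h e in \<open>auto intro!: coeffs_in_diff coeffs_in_mult\<close>)
    then have x: "ext_val a c p * poly q' a + poly p a * ext_val a c q' = ext_val a c p' * poly q a + poly p' a * ext_val a c q"
      using h by (simp add: ext_val_diff ext_val_mult coeffs_in_mult)
    define P Q P' Q' p0 q0 p1 q1 where "P = ext_val a c p" "Q = ext_val a c q" "P' = ext_val a c p'" "Q' = ext_val a c q'"
      "p0 = poly p a" "q0 = poly q a" "p1 = poly p' a" "q1 = poly q' a"
    note defs = this
    have x': "P * q1 + p0 * Q' = P' * q0 + p1 * Q" and e': "p0 * q1 = p1 * q0" using x e by (simp_all add: defs)
    have nz: "q0 \<noteq> 0" "q1 \<noteq> 0" using h by (simp_all add: defs)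
    have "(P * q0 - p0 * Q) * q1\<^sup>2 = (P' * q1 - p1 * Q') * q0\<^sup>2"
    proof -
      have "(P * q0 - p0 * Q) * q1\<^sup>2 = q0 * q1 * (P * q1) - (p0 * q1) * Q * q1" by (simp add: power2_eq_square algebra_simps)
      also have "P * q1 = P' * q0 + p1 * Q - p0 * Q'" using x' by (simp add: eq_diff_eq)
      also have "q0 * q1 * (P' * q0 + p1 * Q - p0 * Q') - (p0 * q1) * Q * q1
          = q0 * q1 * (P' * q0 + p1 * Q - p0 * Q') - (p1 * q0) * Q * q1" by (simp only: e')
      also have "\<dots> = q0 * q1 * P' * q0 - (p0 * q1) * q0 * Q'" by (simp add: algebra_simps)
      also have "\<dots> = (P' * q1 - p1 * Q') * q0\<^sup>2" unfolding e' by (simp add: power2_eq_square algebra_simps)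
      finally show ?thesis .
    qed
    then have "(P * q0 - p0 * Q) / q0\<^sup>2 = (P' * q1 - p1 * Q') / q1\<^sup>2" using nz by (simp add: frac_eq_eq)
    then show ?thesis unfolding val_def defs .
  qed
  define D' where "D' x = (SOME d. \<exists>p q. coeffs_in L p \<and> coeffs_in L q \<and> poly q a \<noteq> 0 \<and> x = poly p a / poly q a \<and> d = val p q)" for x
  have D': "D' (poly p a / poly q a) = val p q" if h: "coeffs_in L p" "coeffs_in L q" "poly q a \<noteq> 0" for p q
  proof -
    have "\<exists>d p' q'. coeffs_in L p' \<and> coeffs_in L q' \<and> poly q' a \<noteq> 0 \<and> poly p a / poly q a = poly p' a / poly q' a \<and> d = val p' q'"
      using h by blast
    from someI_ex[OF this] obtain p' q' where "coeffs_in L p'" "coeffs_in L q'" "poly q' a \<noteq> 0"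
      "poly p a / poly q a = poly p' a / poly q' a" "D' (poly p a / poly q a) = val p' q'" unfolding D'_def by blast
    then show ?thesis using wd[OF h, of p' q'] by simp
  qed
  have c1: "coeffs_in L 1" using coeffs_in_const[of 1] subfldD[OF L] by (simp add: one_pCons)
  have e1: "ext_val a c 1 = 0" by (simp add: ext_val_def deriv_1[OF D] one_pCons map_deriv_pCons pderiv_pCons)
  have "deriv_on (adjoin L a) D'"
    unfolding deriv_on_def
  proof (intro ballI)
    fix x y assume "x \<in> adjoin L a" "y \<in> adjoin L a"
    then obtain p q p' q' where x: "x = poly p a / poly q a" "coeffs_in L p" "coeffs_in L q" "poly q a \<noteq> 0"
      and y: "y = poly p' a / poly q' a" "coeffs_in L p'" "coeffs_in L q'" "poly q' a \<noteq> 0" unfolding adjoin_def by blast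
    have xy: "x + y = poly (p * q' + p' * q) a / poly (q * q') a" "x * y = poly (p * p') a / poly (q * q') a"
      using x y by (simp_all add: add_frac_eq)
    have co: "coeffs_in L (p * q' + p' * q)" "coeffs_in L (p * p')" "coeffs_in L (q * q')" "poly (q * q') a \<noteq> 0"
      using x y by (auto intro!: coeffs_in_add coeffs_in_mult)
    have dx: "D' x = val p q" "D' y = val p' q'" using D'[OF x(2-4)] D'[OF y(2-4)] x(1) y(1) by simp_all
    have "D' (x + y) = val (p * q' + p' * q) (q * q')" unfolding xy by (rule D'[OF co(1,3,4)])
    also have "\<dots> = D' x + D' y"
      unfolding dx val_def using x y
      by (simp add: ext_val_add ext_val_mult coeffs_in_mult field_simps power2_eq_square)
    finally have 1: "D' (x + y) = D' x + D' y" .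
    have "D' (x * y) = val (p * p') (q * q')" unfolding xy by (rule D'[OF co(2,3,4)])
    also have "\<dots> = x * D' y + y * D' x"
      unfolding dx val_def unfolding x(1) y(1) using x y
      by (simp add: ext_val_mult field_simps power2_eq_square)
    finally show "D' (x + y) = D' x + D' y \<and> D' (x * y) = x * D' y + y * D' x" using 1 by blast
  qed
  moreover have "D' x = D x" if "x \<in> L" for x
    using D'[OF coeffs_in_const[OF that] c1] e1 by (simp add: val_def ext_val_def map_deriv_pCons pderiv_pCons)
  moreover have "D' a = c"
    using D'[OF coeffs_in_X c1] e1 by (simp add: val_def ext_val_def map_deriv_pCons pderiv_pCons deriv_0[OF D] deriv_1[OF D])
  ultimately show ?thesis by blast
qed

text \<open>If a has no relation over L, any image will do and 0 is taken. Otherwise let m be a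
  relation of least degree: its derivative does not vanish at a in characteristic 0, so the
  condition for m determines c, and division by m with coefficients kept in L shows that every
  relation is a multiple of m.\<close>

lemma deriv_extend_exists: "\<exists>D'. deriv_on (adjoin L a) D' \<and> (\<forall>x\<in>L. D' x = D x)"
proof (cases "\<exists>p. coeffs_in L p \<and> p \<noteq> 0 \<and> poly p a = 0")
  case False
  then show ?thesis using deriv_extend[of a 0] by (metis (mono_tags, lifting) ext_val_def map_poly_0 mult_zero_left add_0 poly_0)
next
  case True
  define P where "P p \<longleftrightarrow> coeffs_in L p \<and> p \<noteq> 0 \<and> poly p a = 0" for p
  obtain m where m: "P m" "\<And>p. P p \<Longrightarrow> Polynomial.degree m \<le> Polynomial.degree p"
    using ex_has_least_nat[of P _ Polynomial.degree] True unfolding P_def by blast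
  have mL: "coeffs_in L m" "m \<noteq> 0" "poly m a = 0" using m(1) by (auto simp: P_def)
  have deg: "Polynomial.degree m > 0"
  proof (rule ccontr)
    assume "\<not> Polynomial.degree m > 0"
    then obtain k where "m = [:k:]" by (metis degree_eq_zeroE gr0I)
    then show False using mL by auto
  qed
  have pd: "poly (pderiv m) a \<noteq> 0"
  proof
    assume "poly (pderiv m) a = 0"
    moreover have "pderiv m \<noteq> 0" using deg by (simp add: pderiv_eq_0_iff)
    ultimately have "P (pderiv m)" using coeffs_in_pderiv[OF mL(1)] by (simp add: P_def)
    then have "Polynomial.degree m \<le> Polynomial.degree (pderiv m)" by (rule m(2))
    then show False using deg by (simp add: degree_pderiv)
  qed
  define c where "c = - poly (map_poly D m) a / poly (pderiv m) a"
  have ev0: "ext_val a c m = 0" using pd by (simp add: ext_val_def c_def)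
  have div: "\<exists>s. coeffs_in L s \<and> p = m * s" if "coeffs_in L p" "poly p a = 0" for p
    using that
  proof (induction "Polynomial.degree p" arbitrary: p rule: less_induct)
    case less
    show ?case
    proof (cases "p = 0")
      case True
      then show ?thesis using coeffs_in_0 by (intro exI[of _ 0]) simp
    next
      case False
      then have dle: "Polynomial.degree m \<le> Polynomial.degree p" using m(2)[of p] less.prems by (simp add: P_def)
      define k where "k = lead_coeff p / lead_coeff m"
      have kL: "k \<in> L" unfolding k_def using less.prems(1) mL(1) by (intro subfldD(8)[OF L]) (auto simp: coeffs_in_def)
      define t where "t = monom k (Polynomial.degree p - Polynomial.degree m)"
      have tL: "coeffs_in L t" unfolding t_def by (rule coeffs_in_monom[OF kL])
      have k0: "k \<noteq> 0" using False mL by (simp add: k_def)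
      have dt: "Polynomial.degree (m * t) = Polynomial.degree p"
        using k0 mL(2) dle by (subst degree_mult_eq) (auto simp: t_def monom_eq_0_iff degree_monom_eq)
      have lt: "lead_coeff (m * t) = lead_coeff p"
      proof -
        have "lead_coeff t = k" unfolding t_def degree_monom_eq[OF k0] by simp
        then show ?thesis using mL(2) by (simp add: lead_coeff_mult k_def)
      qed
      define p' where "p' = p - m * t"
      have p'L: "coeffs_in L p'" unfolding p'_def by (intro coeffs_in_diff coeffs_in_mult less.prems(1) mL(1) tL)
      have p'0: "poly p' a = 0" using less.prems(2) mL(3) by (simp add: p'_def)
      have "\<exists>s. coeffs_in L s \<and> p' = m * s"
      proof (cases "p' = 0")
        case True
        then show ?thesis using coeffs_in_0 by (intro exI[of _ 0]) simp
      next
        case p'nz: False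
        have "Polynomial.degree p' < Polynomial.degree p"
        proof -
          have "Polynomial.degree p' \<le> Polynomial.degree p" unfolding p'_def using dt degree_diff_le[of p "Polynomial.degree p" "m * t"] by simp
          moreover have "Polynomial.coeff p' (Polynomial.degree p) = 0" using lt dt by (simp add: p'_def)
          ultimately show ?thesis using p'nz by (metis le_neq_implies_less leading_coeff_0_iff)
        qed
        then show ?thesis using less.hyps p'L p'0 by blast
      qed
      then obtain s where s: "coeffs_in L s" "p' = m * s" by blast
      have "p = m * (s + t)" using s(2) by (simp add: p'_def algebra_simps)
      then show ?thesis using coeffs_in_add[OF s(1) tL] by blast
    qed
  qed
  have "ext_val a c p = 0" if p: "coeffs_in L p" "poly p a = 0" for p
  proof -
    obtain s where s: "coeffs_in L s" "p = m * s" using div[OF p] by blast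
    then show ?thesis using ext_val_mult[OF mL(1) s(1)] ev0 mL(3) by simp
  qed
  then show ?thesis using deriv_extend[of a c] by blast
qed

end

end

lemma deriv_extend_finite:
  assumes "finite A" "subfld (L :: 'm::field_char_0 set)" "deriv_on L D"
  shows "\<exists>L' D'. subfld L' \<and> L \<subseteq> L' \<and> A \<subseteq> L' \<and> deriv_on L' D' \<and> (\<forall>a\<in>L. D' a = D a)"
  using assms(1)
proof (induction A)
  case empty
  show ?case using assms(2,3) by (intro exI[of _ L] exI[of _ D]) auto
next
  case (insert x A)
  then obtain L' D' where L': "subfld L'" "L \<subseteq> L'" "A \<subseteq> L'" "deriv_on L' D'" "\<forall>a\<in>L. D' a = D a" by blast
  obtain D'' where D'': "deriv_on (adjoin L' x) D''" "\<forall>a\<in>L'. D'' a = D' a"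
    using deriv_extend_exists[OF L'(1) L'(4), of x] by blast
  have "subfld (adjoin L' x)" "L \<subseteq> adjoin L' x" "insert x A \<subseteq> adjoin L' x" "\<forall>a\<in>L. D'' a = D a"
    using subfld_adjoin[OF L'(1)] subset_adjoin[OF L'(1), of x] elem_adjoin[OF L'(1), of x] L' D''(2) by auto
  then show ?case using D''(1) by blast
qed

text \<open>An element of a finitely generated extension on which every derivation vanishes is algebraic:
  otherwise some derivation would map it to \<open>1\<close>.\<close>

lemma algebraic_if_no_derivation:
  fixes K :: "'m::field_char_0 set" and A :: "'m set"
  assumes K: "subfld K" and A: "finite A"
    and H: "\<And>L D. subfld L \<Longrightarrow> K \<subseteq> L \<Longrightarrow> A \<subseteq> L \<Longrightarrow> deriv_on L D \<Longrightarrow> (\<forall>k\<in>K. D k = 0) \<Longrightarrow> \<forall>a\<in>A. D a = 0"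
    and u: "\<And>L. subfld L \<Longrightarrow> K \<subseteq> L \<Longrightarrow> A \<subseteq> L \<Longrightarrow> u \<in> L"
  shows "\<exists>p. p \<noteq> 0 \<and> coeffs_in K p \<and> poly p u = 0"
proof (rule ccontr)
  assume neg: "\<not> ?thesis"
  have D0: "deriv_on K (\<lambda>_. 0)" by (simp add: deriv_on_def)
  have "ext_val (\<lambda>_. 0) u 1 p = 0" if "coeffs_in K p" "poly p u = 0" for p
  proof -
    have "p = 0" using neg that by blast
    then show ?thesis by (simp add: ext_val_def[OF K D0])
  qed
  from deriv_extend[OF K D0 this] obtain D1 where D1: "deriv_on (adjoin K u) D1" "\<forall>x\<in>K. D1 x = 0" "D1 u = 1" by blast
  obtain L D where L: "subfld L" "adjoin K u \<subseteq> L" "A \<subseteq> L" "deriv_on L D" "\<forall>a\<in>adjoin K u. D a = D1 a"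
    using deriv_extend_finite[OF A subfld_adjoin[OF K] D1(1)] by blast
  have KL: "K \<subseteq> L" using subset_adjoin[OF K] L(2) by blast
  have DK: "\<forall>k\<in>K. D k = 0" using L(5) D1(2) subset_adjoin[OF K, of u] by auto
  have "\<forall>a\<in>A. D a = 0" by (rule H[OF L(1) KL L(3,4) DK])
  then have "u \<in> {a \<in> L. D a = 0}"
    using u[OF deriv_kernel_subfld[OF L(1,4)]] KL L(3) DK by blast
  moreover have "D u = 1" using L(5) elem_adjoin[OF K, of u] D1(3) by simp
  ultimately show False by simp
qed

section \<open>Algebraic systems of power series\<close>

definition emb :: "real poly \<Rightarrow> real fls" where "emb p = fps_to_fls (fps_of_poly p)"

lemma emb_simps [simp]:
  "emb 0 = 0" "emb 1 = 1" "emb (p + q) = emb p + emb q" "emb (p * q) = emb p * emb q" "emb (- p) = - emb p"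
  "emb [:0, 1:] = fls_X" "emb p = 0 \<longleftrightarrow> p = 0"
  using fps_of_poly_eq_iff[of p 0]
  by (simp_all add: emb_def fps_of_poly_add fps_of_poly_mult fps_of_poly_uminus fls_times_fps_to_fls)

lemma emb_const: "emb [:c:] = fls_const c"
  by (simp add: emb_def fps_of_poly_const)

text \<open>The series variable stands for s = 1 / z, so these are the expansions at infinity of
  rational functions.\<close>

definition ratfun :: "real fls set" where "ratfun = {emb p / emb q | p q. q \<noteq> 0}"

lemma subfld_ratfun: "subfld ratfun"
proof -
  have mem: "emb p / emb q \<in> ratfun" if "q \<noteq> 0" for p q unfolding ratfun_def using that by blast
  show ?thesis
    unfolding subfld_def
  proof (intro conjI ballI)
    show "0 \<in> ratfun" using mem[of 1 0] by simp
    show "1 \<in> ratfun" using mem[of 1 1] by simp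
    fix a assume "a \<in> ratfun"
    then obtain p q where a: "a = emb p / emb q" "q \<noteq> 0" unfolding ratfun_def by blast
    show "- a \<in> ratfun" using mem[of q "- p"] a by simp
    show "inverse a \<in> ratfun"
      using mem[of p q] a \<open>0 \<in> ratfun\<close> by (cases "p = 0") simp_all
    fix b assume "b \<in> ratfun"
    then obtain p' q' where b: "b = emb p' / emb q'" "q' \<noteq> 0" unfolding ratfun_def by blast
    show "a + b \<in> ratfun" using mem[of "q * q'" "p * q' + p' * q"] a b by (simp add: add_frac_eq)
    show "a * b \<in> ratfun" using mem[of "q * q'" "p * p'"] a b by simp
  qed
qed

lemma emb_ratfun: "emb p \<in> ratfun"
  unfolding ratfun_def by (intro CollectI exI[of _ p] exI[of _ 1]) simp

definition emb_eval :: "real poly poly \<Rightarrow> real fls \<Rightarrow> real fls" where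
  "emb_eval P x = poly (map_poly emb P) x"

lemma clear_denominators:
  assumes "p \<noteq> 0" "coeffs_in ratfun p" "poly p u = 0"
  shows "\<exists>P. P \<noteq> 0 \<and> emb_eval P u = 0"
proof -
  let ?n = "Polynomial.degree p"
  have "\<forall>i. \<exists>a b. Polynomial.coeff p i = emb a / emb b \<and> b \<noteq> 0"
    using assms(2) unfolding coeffs_in_def ratfun_def by blast
  then obtain a b where ab: "\<And>i. Polynomial.coeff p i = emb (a i) / emb (b i)" "\<And>i. b i \<noteq> 0" by metis
  define d where "d = (\<Prod>i\<le>?n. b i)"
  have d0: "d \<noteq> 0" using ab(2) by (simp add: d_def)
  define c where "c i = a i * (\<Prod>k\<in>{..?n} - {i}. b k)" for i
  have c: "emb (c i) = emb d * Polynomial.coeff p i" if "i \<le> ?n" for i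
  proof -
    have "emb d = emb (b i) * emb (\<Prod>k\<in>{..?n} - {i}. b k)"
      unfolding d_def emb_simps(4)[symmetric] using that by (subst prod.remove[of "{..?n}" i]) auto
    then show ?thesis using ab by (simp add: c_def)
  qed
  define P where "P = (\<Sum>i\<le>?n. monom (c i) i)"
  have coP: "Polynomial.coeff P i = (if i \<le> ?n then c i else 0)" for i
    unfolding P_def by (simp add: coeff_sum if_distrib cong: if_cong)
  have mP: "map_poly emb P = smult (emb d) p"
  proof (rule poly_eqI)
    fix i
    show "Polynomial.coeff (map_poly emb P) i = Polynomial.coeff (smult (emb d) p) i"
      using c by (cases "i \<le> ?n") (auto simp: coeff_map_poly coP coeff_eq_0)
  qed
  have "P \<noteq> 0"
  proof
    assume "P = 0"
    then have "smult (emb d) p = 0" using mP by simp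
    then show False using assms(1) d0 by simp
  qed
  moreover have "emb_eval P u = 0" unfolding emb_eval_def mP using assms(3) by simp
  ultimately show ?thesis by blast
qed

text \<open>The equations are those of the Green functions multiplied by s = 1 / z. The element u
  may be anything in the field generated by the solution, so that the result also applies to the
  derivative of a minimal polynomial along it.\<close>

lemma fls_system_algebraic:
  fixes x :: "'i \<Rightarrow> real fls"
  assumes I: "finite I" and N: "\<And>j. j \<in> I \<Longrightarrow> N j \<subseteq> I"
    and eq: "\<And>j. j \<in> I \<Longrightarrow> x j * (1 - fls_const (w j) * fls_X - fls_X * (\<Sum>k\<in>N j. x k)) = fls_X"
    and sd: "\<And>j. j \<in> I \<Longrightarrow> fls_subdegree (x j) \<ge> 1"
    and u: "\<And>L. subfld L \<Longrightarrow> ratfun \<subseteq> L \<Longrightarrow> x ` I \<subseteq> L \<Longrightarrow> u \<in> L"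
  shows "\<exists>P. P \<noteq> 0 \<and> emb_eval P u = 0"
proof -
  have "\<exists>p. p \<noteq> 0 \<and> coeffs_in ratfun p \<and> poly p u = 0"
  proof (rule algebraic_if_no_derivation[OF subfld_ratfun, of "x ` I"])
    fix L D assume L: "subfld L" "ratfun \<subseteq> L" "x ` I \<subseteq> L" and D: "deriv_on L D" and DK: "\<forall>k\<in>ratfun. D k = 0"
    have Dadd: "D (a + b) = D a + D b" and Dmult: "D (a * b) = a * D b + b * D a" if "a \<in> L" "b \<in> L" for a b
      using D that unfolding deriv_on_def by blast+
    have Ddiff: "D (a - b) = D a - D b" if "a \<in> L" "b \<in> L" for a b
      using Dadd[OF that(1) subfldD(5)[OF L(1) that(2)]] deriv_uminus[OF L(1) D that(2)] by simp
    have Dsum: "D (\<Sum>k\<in>A. f k) = (\<Sum>k\<in>A. D (f k))" if "\<And>k. k \<in> A \<Longrightarrow> f k \<in> L" for A and f :: "'i \<Rightarrow> real fls"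
      using that
    proof (induction A rule: infinite_finite_induct)
      case (insert k A)
      then show ?case by (simp add: Dadd subfld_sum[OF L(1)])
    qed (auto simp: deriv_0[OF L(1) D])
    have XK: "fls_X \<in> ratfun" using emb_ratfun[of "[:0, 1:]"] by simp
    have cK: "fls_const c \<in> ratfun" for c using emb_ratfun[of "[:c:]"] by (simp add: emb_const)
    have XL: "fls_X \<in> L" "D fls_X = 0" using XK L(2) DK by auto
    have cL: "fls_const c \<in> L" "D (fls_const c) = 0" for c using cK L(2) DK by auto
    have xL: "x j \<in> L" if "j \<in> I" for j using that L(3) by blast
    \<comment> \<open>Differentiate x_j b = s, where b is the second factor and D s = 0, and
      multiply by x_j to replace x_j b by s, which cancels.\<close>
    have Deq: "D (x j) = (x j)\<^sup>2 * (\<Sum>k\<in>N j. D (x k))" if j: "j \<in> I" for j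
    proof -
      have kL: "x k \<in> L" if "k \<in> N j" for k using xL N[OF j] that by blast
      let ?S = "\<Sum>k\<in>N j. x k"
      have SL: "?S \<in> L" by (rule subfld_sum[OF L(1)]) (rule kL)
      have DS: "D ?S = (\<Sum>k\<in>N j. D (x k))" by (rule Dsum) (rule kL)
      define b where "b = 1 - fls_const (w j) * fls_X - fls_X * ?S"
      have m: "fls_const (w j) * fls_X \<in> L" "fls_X * ?S \<in> L" "1 - fls_const (w j) * fls_X \<in> L" "b \<in> L"
        unfolding b_def by (intro subfldD[OF L(1)] cL XL SL)+
      have "D b = D (1 - fls_const (w j) * fls_X) - D (fls_X * ?S)" unfolding b_def by (rule Ddiff[OF m(3,2)])
      also have "D (1 - fls_const (w j) * fls_X) = 0"
        using Ddiff[OF subfldD(2)[OF L(1)] m(1)] Dmult[OF cL(1) XL(1)] XL(2) cL(2) deriv_1[OF L(1) D] by simp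
      also have "D (fls_X * ?S) = fls_X * (\<Sum>k\<in>N j. D (x k))" using Dmult[OF XL(1) SL] XL(2) DS by simp
      finally have Db: "D b = - fls_X * (\<Sum>k\<in>N j. D (x k))" by simp
      have e: "x j * b = fls_X" unfolding b_def by (rule eq[OF j])
      have "x j * D b + b * D (x j) = 0" using Dmult[OF xL[OF j] m(4)] XL(2) e by simp
      then have bD: "b * D (x j) = - (x j * D b)" by (rule add_eq_0_iff[THEN iffD1])
      have "fls_X * D (x j) = x j * (b * D (x j))" unfolding e[symmetric] by (simp only: mult.assoc)
      also have "\<dots> = fls_X * ((x j)\<^sup>2 * (\<Sum>k\<in>N j. D (x k)))"
        unfolding bD Db by (simp add: power2_eq_square mult_ac)
      finally have "fls_X * D (x j) = fls_X * ((x j)\<^sup>2 * (\<Sum>k\<in>N j. D (x k)))" .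
      then show ?thesis by simp
    qed
    show "\<forall>a\<in>x ` I. D a = 0"
    proof (rule ccontr)
      assume "\<not> (\<forall>a\<in>x ` I. D a = 0)"
      then have ne: "{j \<in> I. D (x j) \<noteq> 0} \<noteq> {}" by blast
      have fin: "finite {j \<in> I. D (x j) \<noteq> 0}" using I by simp
      \<comment> \<open>Every x_j has order at least 1, so \<open>Deq\<close> would make this least
        order exceed itself by at least 2.\<close>
      obtain j where j: "j \<in> I" "D (x j) \<noteq> 0" and min: "\<And>k. k \<in> I \<Longrightarrow> D (x k) \<noteq> 0 \<Longrightarrow> fls_subdegree (D (x j)) \<le> fls_subdegree (D (x k))"
        using arg_min_if_finite[OF fin ne, of "\<lambda>j. fls_subdegree (D (x j))"] by (smt (verit) mem_Collect_eq)
      let ?S = "\<Sum>k\<in>N j. D (x k)"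
      have S0: "?S \<noteq> 0" "x j \<noteq> 0" using Deq[OF j(1)] j(2) by auto
      have "fls_subdegree (D (x j)) \<le> fls_subdegree ?S"
      proof (rule fls_subdegree_geI[OF S0(1)])
        fix n assume n: "n < fls_subdegree (D (x j))"
        have "fls_nth (D (x k)) n = 0" if "k \<in> N j" for k
        proof (cases "D (x k) = 0")
          case False
          then have "n < fls_subdegree (D (x k))" using min[of k] N[OF j(1)] that n by force
          then show ?thesis by (rule fls_eq0_below_subdegree)
        qed simp
        then show "fls_nth ?S n = 0" by (simp add: fls_nth_sum)
      qed
      moreover have "fls_subdegree (D (x j)) = 2 * fls_subdegree (x j) + fls_subdegree ?S"
        unfolding Deq[OF j(1)] using S0 by (subst fls_subdegree_mult) (auto simp: power2_eq_square)
      ultimately show False using sd[OF j(1)] by simp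
    qed
  qed (use I u in auto)
  then show ?thesis using clear_denominators by blast
qed

section \<open>Bivariate polynomials on power series and on functions\<close>

definition fps_eval :: "real poly poly \<Rightarrow> real fps \<Rightarrow> real fps" where
  "fps_eval P F = poly (map_poly fps_of_poly P) F"

lemma fps_to_fls_sum: "fps_to_fls (\<Sum>i\<in>A. f i) = (\<Sum>i\<in>A. fps_to_fls (f i))"
  by (induction A rule: infinite_finite_induct) auto

lemma fps_eval_pCons: "fps_eval (pCons c P) F = fps_of_poly c + F * fps_eval P F"
  unfolding fps_eval_def by (subst map_poly_pCons) auto

lemma fps_eval_0 [simp]: "fps_eval 0 F = 0"
  by (simp add: fps_eval_def)

lemma emb_eval_pCons: "emb_eval (pCons c P) x = emb c + x * emb_eval P x"
  unfolding emb_eval_def by (subst map_poly_pCons) auto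

lemma emb_eval_fps: "emb_eval P (fps_to_fls F) = fps_to_fls (fps_eval P F)"
proof (induction P)
  case 0 then show ?case by (simp add: emb_eval_def)
next
  case (pCons c P)
  then show ?case by (simp add: emb_eval_pCons fps_eval_pCons emb_def fls_times_fps_to_fls)
qed

text \<open>The value P(s, x) of a polynomial in x whose coefficients are polynomials in s. It is
  generic in the field because relations are found on the real axis near s = 0 and used at complex
  points.\<close>

definition peval :: "real poly poly \<Rightarrow> 'f::real_field \<Rightarrow> 'f \<Rightarrow> 'f" where
  "peval P s x = poly (map_poly (\<lambda>c. poly (map_poly of_real c) s) P) x"

lemma peval_0 [simp]: "peval 0 s x = 0"
  by (simp add: peval_def)

lemma peval_pCons: "peval (pCons c P) s x = poly (map_poly of_real c) s + x * peval P s x"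
  unfolding peval_def by (subst map_poly_pCons) auto

lemma poly_of_real_poly: "poly (map_poly of_real c) (of_real s :: 'f::real_field) = of_real (poly c s)"
  by (induction c) (auto simp: map_poly_pCons)

lemma peval_of_real: "peval P (of_real s) (of_real x :: 'f::real_field) = of_real (peval P s x)"
  by (induction P) (auto simp: peval_pCons poly_of_real_poly)

lemma poly_cnj_real: "poly (map_poly complex_of_real c) (cnj s) = cnj (poly (map_poly complex_of_real c) s)"
  by (induction c) (auto simp: map_poly_pCons)

lemma peval_cnj: "peval P (cnj s) (cnj x) = cnj (peval P s x)"
  by (induction P) (auto simp: peval_pCons poly_cnj_real)

lemma peval_at_0: "peval P s 0 = poly (map_poly of_real (Polynomial.coeff P 0)) s"
  by (cases P) (simp add: peval_pCons)

lemma has_fps_expansion_poly: "(\<lambda>s::real. poly c s) has_fps_expansion fps_of_poly c"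
proof (induction c)
  case (pCons a c)
  have "(\<lambda>s. a + poly c s * s) has_fps_expansion (fps_const a + fps_of_poly c * fps_X)"
    by (intro fps_expansion_intros pCons)
  then show ?case by (simp add: fps_of_poly_pCons mult.commute)
qed simp

lemma has_fps_expansion_peval:
  assumes "(f :: real \<Rightarrow> real) has_fps_expansion F"
  shows "(\<lambda>s. peval P s (f s)) has_fps_expansion fps_eval P F"
proof (induction P)
  case (pCons c P)
  have "(\<lambda>s. poly c s + f s * peval P s (f s)) has_fps_expansion (fps_of_poly c + F * fps_eval P F)"
    by (intro has_fps_expansion_add has_fps_expansion_mult has_fps_expansion_poly assms pCons.IH)
  then show ?case by (simp add: peval_pCons fps_eval_pCons)
qed simp

text \<open>P has least degree for \<open>F i\<close>, so its derivative does not vanish along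
  \<open>F i\<close>. That derivative is itself algebraic, and a relation Q of least degree for it
  has nonzero constant term, since otherwise it could be divided by its unknown. This constant term
  does the work of a discriminant: the derivative can vanish only where it does.\<close>

lemma separable_relation:
  fixes F :: "'i \<Rightarrow> real fps"
  assumes I: "finite I" and N: "\<And>j. j \<in> I \<Longrightarrow> N j \<subseteq> I"
    and eq: "\<And>j. j \<in> I \<Longrightarrow> F j * (1 - fps_const (w j) * fps_X - fps_X * (\<Sum>k\<in>N j. F k)) = fps_X"
    and F0: "\<And>j. j \<in> I \<Longrightarrow> fps_nth (F j) 0 = 0" and i: "i \<in> I"
  obtains P Q where "P \<noteq> 0" "Polynomial.coeff Q 0 \<noteq> 0" "fps_eval P (F i) = 0" "fps_eval Q (fps_eval (pderiv P) (F i)) = 0"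
proof -
  have alg: "\<exists>P. P \<noteq> 0 \<and> fps_eval P (fps_eval R (F i)) = 0" for R
  proof -
    have "\<exists>P. P \<noteq> 0 \<and> emb_eval P (emb_eval R (fps_to_fls (F i))) = 0"
    proof (rule fls_system_algebraic[where I = I and N = N and x = "\<lambda>j. fps_to_fls (F j)" and w = w, OF I N])
      fix j assume j: "j \<in> I"
      have "fps_to_fls (F j * (1 - fps_const (w j) * fps_X - fps_X * (\<Sum>k\<in>N j. F k))) = fls_X"
        unfolding eq[OF j] by simp
      then show "fps_to_fls (F j) * (1 - fls_const (w j) * fls_X - fls_X * (\<Sum>k\<in>N j. fps_to_fls (F k))) = fls_X"
        by (simp add: fls_times_fps_to_fls fps_to_fls_sum)
      have "F j \<noteq> 0" using eq[OF j] by auto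
      then have "subdegree (F j) \<noteq> 0" using F0[OF j] by (simp add: subdegree_eq_0_iff)
      then show "1 \<le> fls_subdegree (fps_to_fls (F j))" by (simp add: fls_subdegree_fls_to_fps)
    next
      fix L assume L: "subfld L" "ratfun \<subseteq> L" "(\<lambda>j. fps_to_fls (F j)) ` I \<subseteq> L"
      show "emb_eval R (fps_to_fls (F i)) \<in> L"
      proof (induction R)
        case 0 then show ?case using subfldD(1)[OF L(1)] by (simp add: emb_eval_def)
      next
        case (pCons c R)
        have "emb c \<in> L" using emb_ratfun L(2) by blast
        moreover have "fps_to_fls (F i) \<in> L" using L(3) i by blast
        ultimately show ?case unfolding emb_eval_pCons using pCons.IH by (intro subfldD[OF L(1)])
      qed
    qed
    then show ?thesis by (simp add: emb_eval_fps)
  qed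
  have X1: "fps_eval [:0, 1:] (F i) = F i" by (simp add: fps_eval_pCons)
  obtain P0 where "P0 \<noteq> 0 \<and> fps_eval P0 (F i) = 0" using alg[of "[:0, 1:]"] unfolding X1 by blast
  then obtain P where P: "P \<noteq> 0 \<and> fps_eval P (F i) = 0"
    and Pmin: "\<And>R. R \<noteq> 0 \<and> fps_eval R (F i) = 0 \<Longrightarrow> Polynomial.degree P \<le> Polynomial.degree R"
    using ex_has_least_nat[of "\<lambda>P. P \<noteq> 0 \<and> fps_eval P (F i) = 0" P0 Polynomial.degree] by blast
  have degP: "Polynomial.degree P > 0"
  proof (rule ccontr)
    assume "\<not> Polynomial.degree P > 0"
    then obtain c where c: "P = [:c:]" by (metis degree_eq_zeroE gr0I)
    then have "fps_of_poly c = 0" using P by (simp add: fps_eval_pCons)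
    then have "c = 0" using fps_of_poly_eq_iff[of c 0] by simp
    then show False using P c by simp
  qed
  define u where "u = fps_eval (pderiv P) (F i)"
  have u0: "u \<noteq> 0"
  proof
    assume "u = 0"
    moreover have "pderiv P \<noteq> 0" using degP by (simp add: pderiv_eq_0_iff)
    ultimately have "Polynomial.degree P \<le> Polynomial.degree (pderiv P)" using Pmin unfolding u_def by blast
    then show False using degP by (simp add: degree_pderiv)
  qed
  obtain Q0 where "Q0 \<noteq> 0 \<and> fps_eval Q0 u = 0" using alg unfolding u_def by blast
  then obtain Q where Q: "Q \<noteq> 0 \<and> fps_eval Q u = 0"
    and Qmin: "\<And>R. R \<noteq> 0 \<and> fps_eval R u = 0 \<Longrightarrow> Polynomial.degree Q \<le> Polynomial.degree R"
    using ex_has_least_nat[of "\<lambda>P. P \<noteq> 0 \<and> fps_eval P u = 0" Q0 Polynomial.degree] by blast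
  have "Polynomial.coeff Q 0 \<noteq> 0"
  proof
    assume 0: "Polynomial.coeff Q 0 = 0"
    obtain c R where QR: "Q = pCons c R" by (cases Q)
    then have c0: "c = 0" using 0 by simp
    then have R0: "R \<noteq> 0" using Q QR by auto
    have "u * fps_eval R u = 0" using Q QR c0 by (simp add: fps_eval_pCons)
    then have "fps_eval R u = 0" using u0 by simp
    then have "Polynomial.degree Q \<le> Polynomial.degree R" using Qmin R0 by blast
    then show False using QR c0 R0 by simp
  qed
  then show ?thesis using that P Q unfolding u_def by blast
qed

section \<open>Boundary values of algebraic functions\<close>

abbreviation "upper \<equiv> {z::complex. Im z > 0}"

lemma tendsto_peval:
  assumes "(s \<longlongrightarrow> s0) F" "(x \<longlongrightarrow> x0) F"
  shows "((\<lambda>z. peval P (s z) (x z) :: complex) \<longlongrightarrow> peval P s0 x0) F"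
proof (induction P)
  case (pCons c P)
  have "((\<lambda>z. poly (map_poly of_real c) (s z)) \<longlongrightarrow> poly (map_poly of_real c) s0) F"
    by (intro tendsto_intros assms)
  then show ?case unfolding peval_pCons by (intro tendsto_intros assms pCons.IH)
qed simp

lemma peval_altdef:
  "peval P s x = (\<Sum>i\<le>Polynomial.degree P. poly (map_poly of_real (Polynomial.coeff P i)) s * x ^ i)"
proof -
  have "peval P s x = (\<Sum>i\<le>Polynomial.degree P. Polynomial.coeff (map_poly (\<lambda>c. poly (map_poly of_real c) s) P) i * x ^ i)"
  proof -
    have "Polynomial.degree (map_poly (\<lambda>c. poly (map_poly of_real c) s) P) \<le> Polynomial.degree P"
      by (rule degree_le) (auto simp: coeff_map_poly coeff_eq_0)
    then show ?thesis
      unfolding peval_def poly_altdef by (intro sum.mono_neutral_left) (auto simp: coeff_eq_0)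
  qed
  then show ?thesis by (simp add: coeff_map_poly)
qed

text \<open>Cauchy's bound for roots, in terms of bounds on the coefficients only, so that it holds
  uniformly as the coefficients vary.\<close>

lemma root_bound:
  fixes x :: complex
  assumes eq: "(\<Sum>i\<le>n. c i * x ^ i) = 0" and m: "cmod (c n) \<ge> m" "m > 0" and M: "\<And>i. i < n \<Longrightarrow> cmod (c i) \<le> M" "M \<ge> 0"
  shows "cmod x \<le> max 1 (real n * M / m)"
proof (rule ccontr)
  assume "\<not> ?thesis"
  then have x1: "cmod x > 1" and xM: "cmod x > real n * M / m" by auto
  show False
  proof (cases n)
    case 0
    then show False using eq m by simp
  next
    case (Suc k)
    have "c n * x ^ n = - (\<Sum>i<n. c i * x ^ i)"
      using eq by (simp add: lessThan_Suc_atMost[symmetric] add_eq_0_iff)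
    then have "cmod (c n) * cmod x ^ n = cmod (\<Sum>i<n. c i * x ^ i)" by (metis norm_minus_cancel norm_mult norm_power)
    also have "\<dots> \<le> (\<Sum>i<n. M * cmod x ^ k)"
    proof (rule sum_norm_le)
      fix i assume "i \<in> {..<n}"
      then show "cmod (c i * x ^ i) \<le> M * cmod x ^ k"
        unfolding norm_mult norm_power using M x1 Suc by (intro mult_mono power_increasing) auto
    qed
    also have "\<dots> = real n * M * cmod x ^ k" by simp
    finally have "m * cmod x * cmod x ^ k \<le> real n * M * cmod x ^ k"
      using mult_right_mono[OF m(1), of "cmod x ^ n"] by (simp add: Suc mult_ac)
    moreover have "cmod x ^ k > 0" using x1 by (intro zero_less_power) linarith
    ultimately have "m * cmod x \<le> real n * M" by (simp only: mult_le_cancel_right_pos)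
    then show False using xM m(2) by (simp add: field_simps)
  qed
qed

lemma dist_Complex_real: "dist (Complex l t) (complex_of_real l) = \<bar>t\<bar>"
proof -
  have "Complex l t - complex_of_real l = Complex 0 t" by (simp add: complex_eq_iff)
  then show ?thesis by (simp add: dist_norm complex_norm)
qed

lemma upper_frontier_nontrivial: "at (complex_of_real l) within upper \<noteq> bot"
proof -
  have "complex_of_real l islimpt upper"
    unfolding islimpt_approachable
  proof (intro allI impI)
    fix e :: real assume "e > 0"
    then show "\<exists>x'\<in>upper. x' \<noteq> complex_of_real l \<and> dist x' (complex_of_real l) < e"
      by (intro bexI[of _ "Complex l (e / 2)"]) (auto simp: dist_Complex_real complex_eq_iff)
  qed
  then show ?thesis by (simp add: trivial_limit_within)
qed

text \<open>Near l the value h(z) is bounded and nearly a zero of the limit polynomial, so it is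
  close to the finite set Z of its zeros. A small half disc at l is connected and is mapped into
  disjoint balls around the points of Z, so h stays near a single one.\<close>

lemma continuous_root_limit:
  fixes h :: "complex \<Rightarrow> complex"
  assumes cont: "continuous_on upper h" and P: "P \<noteq> 0"
    and rel: "\<And>z. Im z > 0 \<Longrightarrow> peval P (1 / z) (h z) = 0"
    and l: "l \<noteq> 0" "poly (lead_coeff P) (1 / l) \<noteq> 0"
  shows "\<exists>L. (h \<longlongrightarrow> L) (at (complex_of_real l) within upper)"
proof -
  define F where "F = at (complex_of_real l) within upper"
  define n where "n = Polynomial.degree P"
  define s0 where "s0 = complex_of_real (1 / l)"
  define c where "c i s = poly (map_poly complex_of_real (Polynomial.coeff P i)) s" for i s
  have s: "((\<lambda>z. 1 / z) \<longlongrightarrow> s0) F"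
    unfolding F_def s0_def using l(1) by (auto intro!: tendsto_eq_intros)
  have c: "((\<lambda>z. c i (1 / z)) \<longlongrightarrow> c i s0) F" for i unfolding c_def by (intro tendsto_intros s)
  have cn: "c n s0 \<noteq> 0" using l(2) unfolding c_def n_def s0_def poly_of_real_poly by simp
  define p0 where "p0 x = (\<Sum>i\<le>n. c i s0 * x ^ i)" for x
  have upF: "\<forall>\<^sub>F z in F. Im z > 0" unfolding F_def by (auto simp: eventually_at_filter)
  have relF: "\<forall>\<^sub>F z in F. (\<Sum>i\<le>n. c i (1 / z) * h z ^ i) = 0"
    using upF by eventually_elim (use rel in \<open>simp add: peval_altdef n_def c_def\<close>)
  define m where "m = cmod (c n s0) / 2"
  define M where "M = (\<Sum>i\<le>n. cmod (c i s0)) + 1"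
  have m0: "m > 0" using cn by (simp add: m_def)
  have ev1: "\<forall>\<^sub>F z in F. cmod (c n (1 / z)) > m"
    using order_tendstoD(1)[OF tendsto_norm[OF c[of n]], of m] cn by (simp add: m_def)
  have ev2: "\<forall>\<^sub>F z in F. \<forall>i\<in>{..n}. cmod (c i (1 / z)) < M"
  proof (rule eventually_ball_finite[OF finite_atMost], rule ballI)
    fix i assume i: "i \<in> {..n}"
    have "cmod (c i s0) \<le> (\<Sum>i\<le>n. cmod (c i s0))" using i by (intro member_le_sum) auto
    then show "\<forall>\<^sub>F z in F. cmod (c i (1 / z)) < M"
      by (intro order_tendstoD(2)[OF tendsto_norm[OF c[of i]]]) (simp add: M_def)
  qed
  have M0: "M \<ge> 0" unfolding M_def by (intro add_nonneg_nonneg sum_nonneg) auto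
  define B where "B = max 1 (real n * M / m)"
  have bd: "\<forall>\<^sub>F z in F. cmod (h z) \<le> B"
    using relF ev1 ev2
  proof eventually_elim
    case (elim z)
    show ?case unfolding B_def by (rule root_bound[OF elim(1)]) (use elim m0 M0 in \<open>auto intro: less_imp_le\<close>)
  qed
  have p0lim: "((\<lambda>z. p0 (h z)) \<longlongrightarrow> 0) F"
  proof -
    have t: "((\<lambda>z. (c i s0 - c i (1 / z)) * h z ^ i) \<longlongrightarrow> 0) F" for i
    proof (rule Lim_null_comparison)
      show "\<forall>\<^sub>F z in F. norm ((c i s0 - c i (1 / z)) * h z ^ i) \<le> cmod (c i s0 - c i (1 / z)) * B ^ i"
        using bd by eventually_elim (auto simp: norm_mult norm_power intro!: mult_left_mono power_mono)
      have "((\<lambda>z. cmod (c i s0 - c i (1 / z)) * B ^ i) \<longlongrightarrow> cmod (c i s0 - c i s0) * B ^ i) F"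
        by (intro tendsto_intros c)
      then show "((\<lambda>z. cmod (c i s0 - c i (1 / z)) * B ^ i) \<longlongrightarrow> 0) F" by simp
    qed
    have "((\<lambda>z. \<Sum>i\<le>n. (c i s0 - c i (1 / z)) * h z ^ i) \<longlongrightarrow> (\<Sum>i\<le>n. 0)) F" by (intro tendsto_sum t)
    moreover have "\<forall>\<^sub>F z in F. (\<Sum>i\<le>n. (c i s0 - c i (1 / z)) * h z ^ i) = p0 (h z)"
      using relF by eventually_elim (simp add: p0_def left_diff_distrib sum_subtractf)
    ultimately show ?thesis using Lim_transform_eventually by force
  qed
  define Z where "Z = {x. p0 x = 0}"
  have finZ: "finite Z"
    unfolding Z_def p0_def using cn by (auto simp: polyfun_finite_roots)
  have contp: "continuous_on A p0" for A unfolding p0_def by (intro continuous_intros)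
  have near: "\<forall>\<^sub>F z in F. \<exists>\<xi>\<in>Z. dist (h z) \<xi> < e" if e: "e > 0" for e
  proof -
    define K where "K = cball 0 B - (\<Union>\<xi>\<in>Z. ball \<xi> e)"
    have "compact K" unfolding K_def by (intro compact_diff open_UN) auto
    have "\<exists>\<mu>>0. \<forall>x\<in>K. \<mu> \<le> cmod (p0 x)"
    proof (cases "K = {}")
      case True
      then show ?thesis by (intro exI[of _ 1]) simp
    next
      case False
      obtain x0 where x0: "x0 \<in> K" "\<And>x. x \<in> K \<Longrightarrow> cmod (p0 x0) \<le> cmod (p0 x)"
        using continuous_attains_inf[OF \<open>compact K\<close> False continuous_on_norm[OF contp]] by blast
      have "p0 x0 \<noteq> 0" using x0(1) e by (auto simp: K_def Z_def)
      then show ?thesis using x0 by (intro exI[of _ "cmod (p0 x0)"]) auto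
    qed
    then obtain \<mu> where \<mu>: "\<mu> > 0" "\<And>x. x \<in> K \<Longrightarrow> \<mu> \<le> cmod (p0 x)" by blast
    have "\<forall>\<^sub>F z in F. cmod (p0 (h z)) < \<mu>"
      using order_tendstoD(2)[OF tendsto_norm[OF p0lim], of \<mu>] \<mu>(1) by simp
    then show ?thesis using bd
    proof eventually_elim
      case (elim z)
      have "h z \<notin> K" using \<mu>(2)[of "h z"] elim(1) by auto
      then show ?case using elim(2) by (auto simp: K_def dist_commute)
    qed
  qed
  obtain e0 where e0: "e0 > 0" "\<And>\<xi> \<xi>'. \<xi> \<in> Z \<Longrightarrow> \<xi>' \<in> Z \<Longrightarrow> \<xi> \<noteq> \<xi>' \<Longrightarrow> 2 * e0 \<le> dist \<xi> \<xi>'"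
  proof -
    \<comment> \<open>The radius will be half the least distance between two zeros; the element 1
      keeps the minimum meaningful when there are fewer than two.\<close>
    define D where "D = insert 1 ((\<lambda>p. dist (fst p) (snd p) / 2) ` {p \<in> Z \<times> Z. fst p \<noteq> snd p})"
    have finD: "finite D" unfolding D_def using finZ by auto
    have "Min D > 0" using finD by (subst Min_gr_iff) (auto simp: D_def)
    moreover have "2 * Min D \<le> dist \<xi> \<xi>'" if "\<xi> \<in> Z" "\<xi>' \<in> Z" "\<xi> \<noteq> \<xi>'" for \<xi> \<xi>'
    proof -
      have "dist \<xi> \<xi>' / 2 \<in> D" unfolding D_def using that by (auto intro!: image_eqI[of _ _ "(\<xi>, \<xi>')"])
      then have "Min D \<le> dist \<xi> \<xi>' / 2" by (intro Min_le finD)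
      then show ?thesis by simp
    qed
    ultimately show ?thesis using that by blast
  qed
  have Fne: "F \<noteq> bot" unfolding F_def by (rule upper_frontier_nontrivial)
  from near[OF e0(1)] obtain d where d: "d > 0"
    "\<And>z. z \<in> upper \<Longrightarrow> z \<noteq> complex_of_real l \<Longrightarrow> dist z (complex_of_real l) < d \<Longrightarrow> \<exists>\<xi>\<in>Z. dist (h z) \<xi> < e0"
    unfolding F_def eventually_at by blast
  define U where "U = upper \<inter> ball (complex_of_real l) d"
  have conU: "connected U"
    unfolding U_def by (intro convex_connected convex_Int convex_halfspace_Im_gt convex_ball)
  have nearU: "\<exists>\<xi>\<in>Z. dist (h z) \<xi> < e0" if "z \<in> U" for z
  proof -
    have "z \<noteq> complex_of_real l" using that by (auto simp: U_def)
    then show ?thesis using d(2)[of z] that by (simp add: U_def dist_commute)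
  qed
  have z1: "Complex l (d / 2) \<in> U"
    unfolding U_def using d(1) dist_Complex_real[of l "d / 2"] by (simp add: dist_commute)
  then obtain \<xi> where \<xi>: "\<xi> \<in> Z" "dist (h (Complex l (d / 2))) \<xi> < e0" using nearU by blast
  have sep: "\<xi>' = \<xi>''" if "\<xi>' \<in> Z" "\<xi>'' \<in> Z" "dist x \<xi>' < e0" "dist x \<xi>'' < e0" for x \<xi>' \<xi>''
  proof (rule ccontr)
    assume "\<xi>' \<noteq> \<xi>''"
    then have "2 * e0 \<le> dist \<xi>' \<xi>''" using e0(2) that by blast
    also have "\<dots> \<le> dist x \<xi>' + dist x \<xi>''" by (rule dist_triangle3)
    finally show False using that by simp
  qed
  have conh: "connected (h ` U)"
    by (rule connected_continuous_image[OF continuous_on_subset[OF cont] conU]) (auto simp: U_def)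
  have one: "dist (h z) \<xi> < e0" if z: "z \<in> U" for z
  proof -
    let ?A = "ball \<xi> e0" and ?B = "\<Union>\<xi>'\<in>Z - {\<xi>}. ball \<xi>' e0"
    have "?A \<inter> ?B \<inter> h ` U = {}" using sep \<xi>(1) by (auto simp: dist_commute)
    moreover have "h ` U \<subseteq> ?A \<union> ?B" using nearU by (fastforce simp: dist_commute)
    ultimately have "?A \<inter> h ` U = {} \<or> ?B \<inter> h ` U = {}"
      using connectedD[OF conh, of ?A ?B] by auto
    moreover have "?A \<inter> h ` U \<noteq> {}" using z1 \<xi>(2) by (auto simp: dist_commute)
    ultimately have "h z \<in> ?A" using z \<open>h ` U \<subseteq> ?A \<union> ?B\<close> by blast
    then show ?thesis by (simp add: dist_commute)
  qed
  have oneF: "\<forall>\<^sub>F z in F. dist (h z) \<xi> < e0"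
    unfolding F_def eventually_at using d(1) one by (intro exI[of _ d]) (auto simp: U_def dist_commute)
  have "(h \<longlongrightarrow> \<xi>) F"
  proof (rule tendstoI)
    fix e :: real assume "e > 0"
    then have "\<forall>\<^sub>F z in F. \<exists>\<xi>'\<in>Z. dist (h z) \<xi>' < min e e0" using near[of "min e e0"] e0(1) by simp
    then show "\<forall>\<^sub>F z in F. dist (h z) \<xi> < e"
      using oneF
    proof eventually_elim
      case (elim z)
      then obtain \<xi>' where "\<xi>' \<in> Z" "dist (h z) \<xi>' < min e e0" by blast
      then show ?case using sep[of \<xi>' \<xi> "h z"] \<xi>(1) elim(2) by auto
    qed
  qed
  then show ?thesis unfolding F_def by blast
qed

text \<open>The divided difference of P in its second argument. It is continuous also on the
  diagonal, where it is the derivative; where it does not vanish, two roots with the same s must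
  coincide.\<close>

definition divdiff :: "real poly poly \<Rightarrow> complex \<Rightarrow> complex \<Rightarrow> complex \<Rightarrow> complex" where
  "divdiff P s x x' = (\<Sum>i\<le>Polynomial.degree P. poly (map_poly of_real (Polynomial.coeff P i)) s * (\<Sum>k<i. x ^ k * x' ^ (i - Suc k)))"

lemma divdiff_eq: "peval P s x - peval P s x' = (x - x') * divdiff P s x x'"
proof -
  have pw: "x ^ i - x' ^ i = (x - x') * (\<Sum>k<i. x ^ k * x' ^ (i - Suc k))" for i
    by (rule power_diff_sumr2[THEN trans]) (simp add: mult.commute)
  let ?c = "\<lambda>i. poly (map_poly complex_of_real (Polynomial.coeff P i)) s"
  have "peval P s x - peval P s x' = (\<Sum>i\<le>Polynomial.degree P. ?c i * x ^ i - ?c i * x' ^ i)"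
    by (simp only: peval_altdef sum_subtractf)
  also have "\<dots> = (\<Sum>i\<le>Polynomial.degree P. (x - x') * (?c i * (\<Sum>k<i. x ^ k * x' ^ (i - Suc k))))"
    by (intro sum.cong refl) (simp only: right_diff_distrib[symmetric] pw mult.left_commute)
  also have "\<dots> = (x - x') * divdiff P s x x'" unfolding divdiff_def by (rule sum_distrib_left[symmetric])
  finally show ?thesis .
qed

lemma divdiff_diag: "divdiff P s x x = peval (pderiv P) s x"
proof -
  let ?c = "\<lambda>i. poly (map_poly complex_of_real (Polynomial.coeff P i)) s"
  have inner: "(\<Sum>k<i. x ^ k * x ^ (i - Suc k)) = of_nat i * x ^ (i - 1)" for i
  proof -
    have "(\<Sum>k<i. x ^ k * x ^ (i - Suc k)) = (\<Sum>k<i. x ^ (i - 1))"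
      by (intro sum.cong refl) (auto simp flip: power_add)
    then show ?thesis by simp
  qed
  have lhs: "divdiff P s x x = (\<Sum>i\<le>Polynomial.degree P. ?c i * (of_nat i * x ^ (i - 1)))"
    unfolding divdiff_def inner ..
  have co: "poly (map_poly complex_of_real (Polynomial.coeff (pderiv P) i)) s = of_nat (Suc i) * ?c (Suc i)" for i
  proof -
    have "map_poly complex_of_real (of_nat (Suc i) * Polynomial.coeff P (Suc i)) = smult (of_nat (Suc i)) (map_poly complex_of_real (Polynomial.coeff P (Suc i)))"
      by (rule poly_eqI) (simp add: coeff_map_poly of_nat_poly)
    then show ?thesis by (simp add: coeff_pderiv del: of_nat_Suc)
  qed
  show ?thesis
  proof (cases "Polynomial.degree P")
    case 0
    then have "pderiv P = 0" by (simp add: pderiv_eq_0_iff)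
    then show ?thesis using 0 by (simp add: lhs)
  next
    case (Suc n)
    have "peval (pderiv P) s x = (\<Sum>i\<le>n. of_nat (Suc i) * ?c (Suc i) * x ^ i)"
      unfolding peval_altdef co by (simp add: degree_pderiv Suc del: of_nat_Suc)
    also have "\<dots> = (\<Sum>i\<le>Suc n. ?c i * (of_nat i * x ^ (i - 1)))"
      unfolding sum.atMost_Suc_shift by (simp add: mult_ac)
    finally show ?thesis by (simp add: lhs Suc)
  qed
qed

lemma tendsto_divdiff:
  assumes "(s \<longlongrightarrow> s0) F" "(x \<longlongrightarrow> x0) F" "(x' \<longlongrightarrow> x0') F"
  shows "((\<lambda>z. divdiff P (s z) (x z) (x' z)) \<longlongrightarrow> divdiff P s0 x0 x0') F"
  unfolding divdiff_def by (intro tendsto_intros assms)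

text \<open>Off X the boundary values are simple roots and depend continuously on l. Then both the
  set of real values and the set of nonreal values are open in an interval without points of X, and
  connectedness leaves one of them.\<close>

lemma algebraic_boundary:
  fixes h :: "complex \<Rightarrow> complex"
  assumes cont: "continuous_on upper h" and P: "P \<noteq> 0" and Q: "Polynomial.coeff Q 0 \<noteq> 0"
    and rel: "\<And>z. Im z > 0 \<Longrightarrow> peval P (1 / z) (h z) = 0"
    and relQ: "\<And>z. Im z > 0 \<Longrightarrow> peval Q (1 / z) (peval (pderiv P) (1 / z) (h z)) = 0"
  shows "\<exists>X L. finite X \<and> (\<forall>l. l \<notin> X \<longrightarrow> (h \<longlongrightarrow> L l) (at (complex_of_real l) within upper)) \<and>
     (\<forall>a b. {a<..<b} \<inter> X = {} \<longrightarrow> (\<forall>l\<in>{a<..<b}. Im (L l) = 0) \<or> (\<forall>l\<in>{a<..<b}. Im (L l) \<noteq> 0))"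
proof -
  \<comment> \<open>The point 0 is excluded because of s = 1 / l. Zeros of the leading coefficient
    of P may destroy the limit, and zeros of the constant term of Q may produce a multiple
    root.\<close>
  define X where "X = {0} \<union> {l. poly (lead_coeff P) (1 / l) = 0} \<union> {l. poly (Polynomial.coeff Q 0) (1 / l) = 0}"
  have fin: "finite {l::real. poly c (1 / l) = 0}" if "c \<noteq> 0" for c
  proof -
    have "{l::real. poly c (1 / l) = 0} \<subseteq> (\<lambda>s. 1 / s) ` {s. poly c s = 0}"
      by (auto intro!: image_eqI[of _ _ "1 / _"])
    then show ?thesis using poly_roots_finite[OF that] finite_surj by blast
  qed
  have finX: "finite X" unfolding X_def using fin[of "lead_coeff P"] fin[OF Q] P by simp
  have "\<exists>L. (h \<longlongrightarrow> L) (at (complex_of_real l) within upper)" if "l \<notin> X" for l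
    by (rule continuous_root_limit[OF cont P rel]) (use that in \<open>auto simp: X_def\<close>)
  then obtain L where L: "\<And>l. l \<notin> X \<Longrightarrow> (h \<longlongrightarrow> L l) (at (complex_of_real l) within upper)" by metis
  have s: "((\<lambda>z. 1 / z) \<longlongrightarrow> complex_of_real (1 / l)) (at (complex_of_real l) within upper)" if "l \<noteq> 0" for l
    using that by (auto intro!: tendsto_eq_intros)
  have up: "\<forall>\<^sub>F z in at (complex_of_real l) within upper. Im z > 0" for l by (auto simp: eventually_at_filter)
  have root: "peval P (complex_of_real (1 / l)) (L l) = 0" if l: "l \<notin> X" for l
  proof -
    have "((\<lambda>z. peval P (1 / z) (h z)) \<longlongrightarrow> peval P (complex_of_real (1 / l)) (L l)) (at (complex_of_real l) within upper)"
      by (rule tendsto_peval[OF s L[OF l]]) (use l in \<open>simp add: X_def\<close>)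
    moreover have "((\<lambda>z. peval P (1 / z) (h z)) \<longlongrightarrow> 0) (at (complex_of_real l) within upper)"
      by (rule tendsto_eventually) (use up in \<open>eventually_elim, use rel in auto\<close>)
    ultimately show ?thesis using tendsto_unique[OF upper_frontier_nontrivial] by blast
  qed
  have simple: "peval (pderiv P) (complex_of_real (1 / l)) (L l) \<noteq> 0" if l: "l \<notin> X" for l
  proof
    assume 0: "peval (pderiv P) (complex_of_real (1 / l)) (L l) = 0"
    have l0: "l \<noteq> 0" using l by (simp add: X_def)
    have "((\<lambda>z. peval Q (1 / z) (peval (pderiv P) (1 / z) (h z))) \<longlongrightarrow>
        peval Q (complex_of_real (1 / l)) (peval (pderiv P) (complex_of_real (1 / l)) (L l))) (at (complex_of_real l) within upper)"
      by (intro tendsto_peval s[OF l0] L[OF l])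
    moreover have "((\<lambda>z. peval Q (1 / z) (peval (pderiv P) (1 / z) (h z))) \<longlongrightarrow> 0) (at (complex_of_real l) within upper)"
      by (rule tendsto_eventually) (use up in \<open>eventually_elim, use relQ in auto\<close>)
    ultimately have "peval Q (complex_of_real (1 / l)) 0 = 0"
      using tendsto_unique[OF upper_frontier_nontrivial] unfolding 0 by blast
    then show False using l by (simp only: peval_at_0 poly_of_real_poly of_real_eq_0_iff) (simp add: X_def)
  qed
  have contL: "isCont L l" if "l \<notin> X" for l
  proof -
    have "\<forall>\<^sub>F l' in nhds l. dist (L l') (L l) \<le> e" if e: "e > 0" for e
    proof -
      obtain d where d: "d > 0" "\<And>z. z \<in> upper \<Longrightarrow> z \<noteq> complex_of_real l \<Longrightarrow> dist z (complex_of_real l) < d \<Longrightarrow> dist (h z) (L l) < e"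
        using tendstoD[OF L[OF \<open>l \<notin> X\<close>] e] unfolding eventually_at by blast
      have "\<forall>\<^sub>F l' in nhds l. l' \<in> - (X - {l})"
        using finX by (intro eventually_nhds_in_open open_Compl finite_imp_closed) auto
      moreover have "\<forall>\<^sub>F l' in nhds l. dist l' l < d" using d(1) by (simp add: eventually_nhds_metric) blast
      ultimately show ?thesis
      proof eventually_elim
        case (elim l')
        show ?case
        proof (cases "l' = l")
          case False
          then have l'X: "l' \<notin> X" using elim(1) by blast
          have "\<forall>\<^sub>F z in at (complex_of_real l') within upper. dist (h z) (L l) \<le> e"
          proof -
            have "\<forall>\<^sub>F z in at (complex_of_real l') within upper. dist z (complex_of_real l') < d - dist l' l"
              unfolding eventually_at using elim(2) by (intro exI[of _ "d - dist l' l"]) auto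
            then show ?thesis
              using up[of l']
            proof eventually_elim
              case (elim z)
              have "dist z (complex_of_real l) \<le> dist z (complex_of_real l') + dist (complex_of_real l') (complex_of_real l)" by (rule dist_triangle)
              then have "dist z (complex_of_real l) < d" using elim(1) by (simp add: dist_of_real)
              moreover have "z \<noteq> complex_of_real l" using elim(2) by auto
              ultimately show ?case using d(2)[of z] elim(2) by (simp add: less_imp_le)
            qed
          qed
          then show ?thesis
            by (rule tendsto_upperbound[OF tendsto_dist[OF L[OF l'X] tendsto_const] _ upper_frontier_nontrivial])
        qed (use e in simp)
      qed
    qed
    note ev = this
    show ?thesis
      unfolding continuous_at_eps_delta
    proof (intro allI impI)
      fix e :: real assume e: "e > 0"
      then obtain d where "d > 0" "\<And>l'. dist l' l < d \<Longrightarrow> dist (L l') (L l) \<le> e / 2"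
        using ev[of "e / 2"] unfolding eventually_nhds_metric by auto
      then show "\<exists>d>0. \<forall>x'. dist x' l < d \<longrightarrow> dist (L x') (L l) < e"
        using e by (intro exI[of _ d]) force
    qed
  qed
  \<comment> \<open>P has real coefficients, so \<open>cnj (L l')\<close> is a root as well. Both it
    and \<open>L l'\<close> are close to the simple real root \<open>L l\<close>, where the divided
    difference is nonzero; hence they coincide.\<close>
  have real_open: "\<forall>\<^sub>F l' in at l. l' \<notin> X \<longrightarrow> Im (L l') = 0" if l: "l \<notin> X" "Im (L l) = 0" for l
  proof -
    have l0: "l \<noteq> 0" using l by (simp add: X_def)
    have Lt: "(L \<longlongrightarrow> L l) (at l)" using contL[OF l(1)] by (simp add: isCont_def)
    have "((\<lambda>l'. divdiff P (complex_of_real (1 / l')) (L l') (cnj (L l'))) \<longlongrightarrow> divdiff P (complex_of_real (1 / l)) (L l) (cnj (L l))) (at l)"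
      by (intro tendsto_divdiff tendsto_intros Lt l0)
    moreover have "cnj (L l) = L l" using l(2) by (simp add: complex_eq_iff)
    ultimately have "\<forall>\<^sub>F l' in at l. divdiff P (complex_of_real (1 / l')) (L l') (cnj (L l')) \<noteq> 0"
      using tendsto_imp_eventually_ne[of _ "divdiff P (complex_of_real (1 / l)) (L l) (L l)"] simple[OF l(1)] by (simp add: divdiff_diag)
    then show ?thesis
    proof eventually_elim
      case (elim l')
      show ?case
      proof
        assume l': "l' \<notin> X"
        have r1: "peval P (complex_of_real (1 / l')) (L l') = 0" by (rule root[OF l'])
        have "peval P (complex_of_real (1 / l')) (cnj (L l')) = 0"
          using peval_cnj[of P "complex_of_real (1 / l')" "L l'"] r1 by simp
        then have "(L l' - cnj (L l')) * divdiff P (complex_of_real (1 / l')) (L l') (cnj (L l')) = 0"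
          using divdiff_eq[of P "complex_of_real (1 / l')" "L l'" "cnj (L l')"] r1 by simp
        then have "L l' = cnj (L l')" using elim by simp
        then show "Im (L l') = 0" by (simp add: complex_eq_iff)
      qed
    qed
  qed
  have "(\<forall>l\<in>{a<..<b}. Im (L l) = 0) \<or> (\<forall>l\<in>{a<..<b}. Im (L l) \<noteq> 0)" if ab: "{a<..<b} \<inter> X = {}" for a b
  proof -
    let ?A = "{l \<in> {a<..<b}. Im (L l) = 0}" and ?B = "{l \<in> {a<..<b}. Im (L l) \<noteq> 0}"
    have inX: "l \<notin> X" if "l \<in> {a<..<b}" for l using ab that by blast
    have "open ?A"
    proof (subst open_subopen, intro ballI)
      fix l assume "l \<in> ?A"
      then have l: "l \<in> {a<..<b}" "Im (L l) = 0" by auto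
      have "\<forall>\<^sub>F l' in nhds l. l' \<in> {a<..<b}" using l(1) by (intro eventually_nhds_in_open) auto
      moreover have "\<forall>\<^sub>F l' in nhds l. l' \<notin> X \<longrightarrow> Im (L l') = 0"
        using real_open[OF inX[OF l(1)] l(2)] unfolding eventually_at_filter by eventually_elim (use l(2) in auto)
      ultimately have "\<forall>\<^sub>F l' in nhds l. l' \<in> ?A" by eventually_elim (use inX in auto)
      then show "\<exists>T. open T \<and> l \<in> T \<and> T \<subseteq> ?A" unfolding eventually_nhds by blast
    qed
    moreover have "open ?B"
    proof (subst open_subopen, intro ballI)
      fix l assume "l \<in> ?B"
      then have l: "l \<in> {a<..<b}" "Im (L l) \<noteq> 0" by auto
      have "((\<lambda>l'. Im (L l')) \<longlongrightarrow> Im (L l)) (at l)" using contL[OF inX[OF l(1)]] by (intro tendsto_intros) (simp add: isCont_def)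
      then have "\<forall>\<^sub>F l' in at l. Im (L l') \<noteq> 0" using l(2) by (rule tendsto_imp_eventually_ne)
      then have "\<forall>\<^sub>F l' in nhds l. Im (L l') \<noteq> 0" unfolding eventually_at_filter by eventually_elim (use l(2) in auto)
      moreover have "\<forall>\<^sub>F l' in nhds l. l' \<in> {a<..<b}" using l(1) by (intro eventually_nhds_in_open) auto
      ultimately have "\<forall>\<^sub>F l' in nhds l. l' \<in> ?B" by eventually_elim auto
      then show "\<exists>T. open T \<and> l \<in> T \<and> T \<subseteq> ?B" unfolding eventually_nhds by blast
    qed
    moreover have "?A \<inter> ?B \<inter> {a<..<b} = {}" "{a<..<b} \<subseteq> ?A \<union> ?B" by auto
    ultimately have "?A \<inter> {a<..<b} = {} \<or> ?B \<inter> {a<..<b} = {}"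
      using connectedD[of "{a<..<b}" ?A ?B] by simp
    then show ?thesis by blast
  qed
  then show ?thesis using finX L by blast
qed

section \<open>Algebraic systems of Stieltjes transforms\<close>

lemma has_fps_expansion_0_unique:
  fixes F :: "real fps"
  assumes "f has_fps_expansion F" "\<forall>\<^sub>F s in nhds 0. f s = 0"
  shows "F = 0"
proof (rule ccontr)
  assume F: "F \<noteq> 0"
  have rad: "fps_conv_radius F > 0" and ev: "\<forall>\<^sub>F s in nhds 0. eval_fps F s = 0"
    using assms(1) eventually_elim2[OF conjunct2[OF assms(1)[unfolded has_fps_expansion_def]] assms(2), of "\<lambda>s. eval_fps F s = 0"]
    by (auto simp: has_fps_expansion_def)
  have F0: "fps_nth F 0 = 0" using eventually_nhds_x_imp_x[OF ev] by (simp add: eval_fps_at_0)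
  define m where "m = subdegree F"
  have m: "fps_nth F m \<noteq> 0" "m > 0" using F F0 by (auto simp: m_def subdegree_eq_0_iff intro!: Nat.gr0I)
  obtain r where r: "r > 0" "ereal r < fps_conv_radius F" using ereal_dense2[OF rad] by (auto simp: ereal_less(2) zero_ereal_def)
  have "(\<lambda>n. fps_nth F n * x ^ n) sums eval_fps F x" if "norm x < r" for x
  proof -
    have "ereal (norm x) < fps_conv_radius F" using that r(2) by (meson ereal_less_le less_ereal.simps(1) less_trans)
    then show ?thesis by (rule sums_eval_fps)
  qed
  then have sm: "\<And>x. norm (x - 0) < r \<Longrightarrow> (\<lambda>n. fps_nth F n * (x - 0) ^ n) sums eval_fps F x" by simp
  have z0: "eval_fps F 0 = 0" using F0 by (simp add: eval_fps_at_0)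
  obtain s where s: "s > 0" "\<And>z. z \<in> cball 0 s - {0} \<Longrightarrow> eval_fps F z \<noteq> 0"
    by (rule powser_0_nonzero[where a="fps_nth F" and \<xi>=0 and f="eval_fps F" and m=m and r=r, OF r(1) sm z0 m]) blast+
  obtain d where d: "d > 0" "\<And>z. dist z 0 < d \<Longrightarrow> eval_fps F z = 0" using ev unfolding eventually_nhds_metric by blast
  define z where "z = min s (d / 2)"
  have "z \<in> cball 0 s - {0}" "dist z 0 < d" using s(1) d(1) by (auto simp: z_def min_def)
  then show False using s(2) d(2) by blast
qed

section \<open>Stieltjes transforms of compactly supported measures\<close>

definition stj :: "real measure \<Rightarrow> complex \<Rightarrow> complex" where
  "stj \<mu> z = (\<integral>t. 1 / (z - complex_of_real t) \<partial>\<mu>)"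

text \<open>A connected domain that contains the half plane where the system is given and also the
  large real points, where expansions in 1 / z converge. It avoids the support [-C, C].\<close>

definition resolv_dom :: "real \<Rightarrow> complex set" where
  "resolv_dom C = {z. Im z > 0 \<or> cmod z > C}"

lemma open_resolv_dom: "open (resolv_dom C)"
proof -
  have "resolv_dom C = {z. Im z > 0} \<union> {z. cmod z > C}" by (auto simp: resolv_dom_def)
  then show ?thesis by (simp only:) (intro open_Un open_halfspace_Im_gt open_Collect_less continuous_intros)
qed

lemma connected_resolv_dom:
  assumes "C > 0" shows "connected (resolv_dom C)"
proof -
  have "resolv_dom C = {z. Im z > 0} \<union> - cball 0 C" by (auto simp: resolv_dom_def)
  moreover have "connected ({z. Im z > 0} \<union> - cball (0::complex) C)"
  proof (rule connected_Un)
    show "connected {z. Im z > 0}" by (intro convex_connected convex_halfspace_Im_gt)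
    show "connected (- cball (0::complex) C)" by (rule connected_complement_bounded_convex) auto
    have "Complex 0 (C + 1) \<in> {z. Im z > 0} \<inter> - cball 0 C" using assms by (simp add: complex_norm)
    then show "{z. Im z > 0} \<inter> - cball (0::complex) C \<noteq> {}" by blast
  qed
  ultimately show ?thesis by simp
qed

lemma resolv_dom_sep:
  assumes "z \<in> resolv_dom C"
  obtains \<rho> where "\<rho> > 0" "\<And>t. \<bar>t\<bar> \<le> C \<Longrightarrow> \<rho> \<le> cmod (z - complex_of_real t)"
proof (cases "Im z > 0")
  case True
  show ?thesis
  proof (rule that[OF True])
    fix t show "Im z \<le> cmod (z - complex_of_real t)" using abs_Im_le_cmod[of "z - complex_of_real t"] by simp
  qed
next
  case False
  then have z: "cmod z - C > 0" using assms by (simp add: resolv_dom_def)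
  show ?thesis
  proof (rule that[OF z])
    fix t :: real assume "\<bar>t\<bar> \<le> C"
    then show "cmod z - C \<le> cmod (z - complex_of_real t)" using norm_triangle_ineq2[of z "complex_of_real t"] by simp
  qed
qed

locale compact_measure =
  fixes \<mu> :: "real measure" and C :: real
  assumes fin: "finite_measure \<mu>" and sets_mu [simp, measurable_cong]: "sets \<mu> = sets borel"
    and AE_C: "AE t in \<mu>. \<bar>t\<bar> \<le> C" and C: "C > 0"
begin

sublocale finite_measure \<mu> by (rule fin)

lemma integrable_bounded_AE:
  fixes f :: "real \<Rightarrow> 'b::{banach,second_countable_topology}"
  assumes "f \<in> borel_measurable borel" "\<And>t. \<bar>t\<bar> \<le> C \<Longrightarrow> norm (f t) \<le> B"
  shows "integrable \<mu> f"
proof (rule integrable_const_bound[where B = B])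
  show "AE t in \<mu>. norm (f t) \<le> B" using AE_C by eventually_elim (rule assms(2))
  show "f \<in> borel_measurable \<mu>" using assms(1) by (simp cong: measurable_cong_sets)
qed

lemma stj_integrable:
  assumes "z \<in> resolv_dom C"
  shows "integrable \<mu> (\<lambda>t. 1 / (z - complex_of_real t))"
proof -
  obtain \<rho> where \<rho>: "\<rho> > 0" "\<And>t. \<bar>t\<bar> \<le> C \<Longrightarrow> \<rho> \<le> cmod (z - complex_of_real t)" using resolv_dom_sep[OF assms] by blast
  show ?thesis
  proof (rule integrable_bounded_AE[where B = "1 / \<rho>"])
    show "(\<lambda>t. 1 / (z - complex_of_real t)) \<in> borel_measurable borel" by measurable
    fix t :: real assume "\<bar>t\<bar> \<le> C"
    then show "norm (1 / (z - complex_of_real t)) \<le> 1 / \<rho>" using \<rho> by (simp add: norm_divide frac_le)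
  qed
qed

text \<open>With \<rho> a lower bound for the distance from z to the points of [-C, C], the
  difference quotient of the kernel is within 2 |w - z| / \<rho>^3 of its derivative for |w - z| <
  \<rho> / 2, uniformly over the support.\<close>

lemma stj_holomorphic: "stj \<mu> holomorphic_on resolv_dom C"
proof (subst holomorphic_on_open[OF open_resolv_dom], intro ballI)
  fix z assume z: "z \<in> resolv_dom C"
  obtain \<rho> where \<rho>: "\<rho> > 0" "\<And>t. \<bar>t\<bar> \<le> C \<Longrightarrow> \<rho> \<le> cmod (z - complex_of_real t)" using resolv_dom_sep[OF z] by blast
  define D where "D = (\<integral>t. - 1 / (z - complex_of_real t)\<^sup>2 \<partial>\<mu>)"
  have iD: "integrable \<mu> (\<lambda>t. - 1 / (z - complex_of_real t)\<^sup>2)"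
  proof (rule integrable_bounded_AE[where B = "1 / \<rho>\<^sup>2"])
    show "(\<lambda>t. - 1 / (z - complex_of_real t)\<^sup>2) \<in> borel_measurable borel" by measurable
    fix t :: real assume "\<bar>t\<bar> \<le> C"
    then have "\<rho>\<^sup>2 \<le> (cmod (z - complex_of_real t))\<^sup>2" using \<rho> by (intro power_mono) auto
    then show "norm (- 1 / (z - complex_of_real t)\<^sup>2) \<le> 1 / \<rho>\<^sup>2" using \<rho>(1) by (simp add: norm_divide norm_power frac_le)
  qed
  obtain e where e: "e > 0" "ball z e \<subseteq> resolv_dom C" using open_resolv_dom z open_contains_ball by blast
  define B where "B = (2 / \<rho>) * (1 / \<rho>\<^sup>2) * measure \<mu> UNIV"
  have est: "norm ((stj \<mu> w - stj \<mu> z) / (w - z) - D) \<le> norm (w - z) * B"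
    if w: "w \<noteq> z" "norm (w - z) < min e (\<rho> / 2)" for w
  proof -
    have wd: "w \<in> resolv_dom C" using e(2) w(2) by (auto simp: dist_norm norm_minus_commute)
    have wt: "\<rho> / 2 \<le> cmod (w - complex_of_real t)" if t: "\<bar>t\<bar> \<le> C" for t
    proof -
      have "cmod (z - complex_of_real t) \<le> cmod (w - complex_of_real t) + cmod (w - z)"
        using norm_triangle_ineq4[of "w - complex_of_real t" "w - z"] by simp
      then show ?thesis using \<rho>(2)[OF t] w(2) by simp
    qed
    have "(stj \<mu> w - stj \<mu> z) / (w - z) - D
        = (\<integral>t. (1 / (w - complex_of_real t) - 1 / (z - complex_of_real t)) / (w - z) - (- 1 / (z - complex_of_real t)\<^sup>2) \<partial>\<mu>)"
      unfolding stj_def D_def using stj_integrable[OF wd] stj_integrable[OF z] iD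
      by (subst Bochner_Integration.integral_diff) (auto simp: Bochner_Integration.integral_diff)
    also have "norm \<dots> \<le> (\<integral>t. norm (w - z) * ((2 / \<rho>) * (1 / \<rho>\<^sup>2)) \<partial>\<mu>)"
    proof (rule order_trans[OF integral_norm_bound integral_mono_AE])
      show "integrable \<mu> (\<lambda>t. norm ((1 / (w - complex_of_real t) - 1 / (z - complex_of_real t)) / (w - z) - (- 1 / (z - complex_of_real t)\<^sup>2)))"
        using stj_integrable[OF wd] stj_integrable[OF z] iD by (intro integrable_norm Bochner_Integration.integrable_diff integrable_divide_zero) auto
      show "AE t in \<mu>. norm ((1 / (w - complex_of_real t) - 1 / (z - complex_of_real t)) / (w - z) - (- 1 / (z - complex_of_real t)\<^sup>2)) \<le> norm (w - z) * ((2 / \<rho>) * (1 / \<rho>\<^sup>2))"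
        using AE_C
      proof eventually_elim
        case (elim t)
        define a b where "a = w - complex_of_real t" and "b = z - complex_of_real t"
        have ab: "cmod a \<ge> \<rho> / 2" "cmod b \<ge> \<rho>" using wt[OF elim] \<rho>(2)[OF elim] by (auto simp: a_def b_def)
        have nz: "a \<noteq> 0" "b \<noteq> 0" "a - b \<noteq> 0" using ab \<rho>(1) w(1) by (auto simp: a_def b_def)
        have "(1 / a - 1 / b) / (a - b) - (- 1 / b\<^sup>2) = (a - b) * (1 / a) * (1 / b\<^sup>2)"
          using nz by (simp add: field_simps power2_eq_square)
        then have "norm ((1 / a - 1 / b) / (a - b) - (- 1 / b\<^sup>2)) = cmod (a - b) * ((1 / cmod a) * (1 / (cmod b)\<^sup>2))"
          by (simp add: norm_mult norm_divide norm_power)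
        also have "\<dots> \<le> cmod (a - b) * ((2 / \<rho>) * (1 / \<rho>\<^sup>2))"
        proof (intro mult_left_mono mult_mono)
          show "1 / cmod a \<le> 2 / \<rho>" using ab \<rho>(1) frac_le[of 1 1 "\<rho> / 2" "cmod a"] by simp
          show "1 / (cmod b)\<^sup>2 \<le> 1 / \<rho>\<^sup>2" using ab \<rho>(1) by (intro frac_le power_mono) auto
        qed (use \<rho>(1) in auto)
        finally show ?case by (simp add: a_def b_def)
      qed
    qed simp
    also have "\<dots> = norm (w - z) * B" using sets_eq_imp_space_eq[OF sets_mu] by (simp add: B_def mult_ac)
    finally show ?thesis .
  qed
  have "((\<lambda>w. (stj \<mu> w - stj \<mu> z) / (w - z) - D) \<longlongrightarrow> 0) (at z)"
  proof (rule Lim_null_comparison)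
    show "\<forall>\<^sub>F w in at z. norm ((stj \<mu> w - stj \<mu> z) / (w - z) - D) \<le> norm (w - z) * B"
      unfolding eventually_at using e(1) \<rho>(1) est by (intro exI[of _ "min e (\<rho> / 2)"]) (auto simp: dist_norm)
    have "((\<lambda>w. norm (w - z) * B) \<longlongrightarrow> norm (z - z) * B) (at z)" by (intro tendsto_intros)
    then show "((\<lambda>w. norm (w - z) * B) \<longlongrightarrow> 0) (at z)" by simp
  qed
  then have "((\<lambda>w. (stj \<mu> w - stj \<mu> z) / (w - z)) \<longlongrightarrow> D) (at z)" by (simp add: LIM_zero_iff)
  then show "\<exists>f'. (stj \<mu> has_field_derivative f') (at z)" by (auto simp: has_field_derivative_iff)
qed

definition mom :: "nat \<Rightarrow> real" where "mom k = (\<integral>t. t ^ k \<partial>\<mu>)"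

text \<open>The transform at z = 1 / s for small real s, in a form that is also defined at s = 0,
  the point at infinity, where it is 0.\<close>

definition real_stj :: "real \<Rightarrow> real" where "real_stj s = (\<integral>t. s / (1 - s * t) \<partial>\<mu>)"

lemma real_stj_sums:
  assumes "\<bar>s\<bar> < 1 / C"
  shows "(\<lambda>k. mom k * s ^ Suc k) sums real_stj s"
proof -
  define q where "q = \<bar>s\<bar> * C"
  have q: "0 \<le> q" "q < 1" using assms C by (auto simp: q_def field_simps)
  have ts: "\<bar>s * t\<bar> \<le> q" if "\<bar>t\<bar> \<le> C" for t unfolding q_def abs_mult using that by (intro mult_left_mono) auto
  have int: "integrable \<mu> (\<lambda>t. s * (s * t) ^ k)" for k
  proof (rule integrable_bounded_AE[where B = "\<bar>s\<bar>"])
    show "(\<lambda>t. s * (s * t) ^ k) \<in> borel_measurable borel" by measurable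
    fix t :: real assume "\<bar>t\<bar> \<le> C"
    then have "\<bar>s * t\<bar> ^ k \<le> 1" using ts[of t] q by (intro power_le_one) auto
    then show "norm (s * (s * t) ^ k) \<le> \<bar>s\<bar>" using mult_left_mono[of "\<bar>s * t\<bar> ^ k" 1 "\<bar>s\<bar>"] by (simp add: abs_mult power_abs)
  qed
  have nb: "norm (s * (s * t) ^ k) \<le> \<bar>s\<bar> * q ^ k" if "\<bar>t\<bar> \<le> C" for t k
    using power_mono[OF ts[OF that], of k] by (simp add: abs_mult power_abs mult_left_mono)
  have "(\<lambda>k. \<integral>t. s * (s * t) ^ k \<partial>\<mu>) sums (\<integral>t. (\<Sum>k. s * (s * t) ^ k) \<partial>\<mu>)"
  proof (rule sums_integral[OF int])
    show "AE t in \<mu>. summable (\<lambda>k. norm (s * (s * t) ^ k))"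
      using AE_C
    proof eventually_elim
      case (elim t)
      show ?case
        by (rule summable_comparison_test'[where N = 0, OF summable_mult[OF summable_geometric, of q "\<bar>s\<bar>"]])
           (use q nb[OF elim] in auto)
    qed
    show "summable (\<lambda>k. \<integral>t. norm (s * (s * t) ^ k) \<partial>\<mu>)"
    proof (rule summable_comparison_test'[where N = 0, OF summable_mult[OF summable_geometric, of q "\<bar>s\<bar> * measure \<mu> UNIV"]])
      show "norm q < 1" using q by simp
      fix k
      have "(\<integral>t. norm (s * (s * t) ^ k) \<partial>\<mu>) \<le> (\<integral>t. \<bar>s\<bar> * q ^ k \<partial>\<mu>)"
      proof (rule integral_mono_AE)
        show "AE t in \<mu>. norm (s * (s * t) ^ k) \<le> \<bar>s\<bar> * q ^ k" using AE_C by eventually_elim (rule nb)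
      qed (use int[of k] in auto)
      then show "norm (\<integral>t. norm (s * (s * t) ^ k) \<partial>\<mu>) \<le> \<bar>s\<bar> * measure \<mu> UNIV * q ^ k"
        using sets_eq_imp_space_eq[OF sets_mu] by (simp add: mult_ac)
    qed
  qed
  moreover have "(\<integral>t. s * (s * t) ^ k \<partial>\<mu>) = mom k * s ^ Suc k" for k
    by (simp add: mom_def power_mult_distrib mult_ac)
  moreover have "(\<integral>t. (\<Sum>k. s * (s * t) ^ k) \<partial>\<mu>) = real_stj s"
    unfolding real_stj_def
  proof (rule integral_cong_AE)
    show "(\<lambda>t. \<Sum>k. s * (s * t) ^ k) \<in> borel_measurable \<mu>" by measurable
    show "(\<lambda>t. s / (1 - s * t)) \<in> borel_measurable \<mu>" by measurable
    show "AE t in \<mu>. (\<Sum>k. s * (s * t) ^ k) = s / (1 - s * t)"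
      using AE_C
    proof eventually_elim
      case (elim t)
      then have "norm (s * t) < 1" using ts[OF elim] q by simp
      from sums_mult[OF geometric_sums[OF this], of s] show ?case by (simp add: sums_iff)
    qed
  qed
  ultimately show ?thesis by (simp only:)
qed

definition mom_fps :: "real fps" where "mom_fps = Abs_fps (\<lambda>n. case n of 0 \<Rightarrow> 0 | Suc k \<Rightarrow> mom k)"

lemma mom_fps_sums: "\<bar>s\<bar> < 1 / C \<Longrightarrow> (\<lambda>n. fps_nth mom_fps n * s ^ n) sums real_stj s"
  using sums_Suc[of "\<lambda>n. fps_nth mom_fps n * s ^ n" "real_stj s"] real_stj_sums[of s] by (simp add: mom_fps_def)

lemma real_stj_expansion: "real_stj has_fps_expansion mom_fps"
  unfolding has_fps_expansion_def
proof
  define s0 where "s0 = 1 / (2 * C)"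
  have s0: "s0 > 0" "\<bar>s0\<bar> < 1 / C" using C by (auto simp: s0_def field_simps)
  have "fps_conv_radius mom_fps \<ge> ereal (norm s0)"
    unfolding fps_conv_radius_def using mom_fps_sums[OF s0(2)] by (intro conv_radius_geI) (auto simp: sums_iff)
  moreover have "ereal (norm s0) > 0" using s0(1) by simp
  ultimately show "fps_conv_radius mom_fps > 0" by (rule less_le_trans[rotated])
  have "\<forall>\<^sub>F s in nhds (0::real). \<bar>s\<bar> < 1 / C"
    unfolding eventually_nhds_metric using C by (intro exI[of _ "1 / C"]) auto
  then show "\<forall>\<^sub>F s in nhds 0. eval_fps mom_fps s = real_stj s"
    by eventually_elim (use mom_fps_sums in \<open>auto simp: eval_fps_def sums_iff\<close>)
qed

lemma stj_real:
  assumes "s \<noteq> 0" "\<bar>s\<bar> < 1 / C"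
  shows "stj \<mu> (complex_of_real (1 / s)) = complex_of_real (real_stj s)"
proof -
  have "stj \<mu> (complex_of_real (1 / s)) = (\<integral>t. complex_of_real (s / (1 - s * t)) \<partial>\<mu>)"
    unfolding stj_def
  proof (rule integral_cong_AE)
    show "(\<lambda>t. 1 / (complex_of_real (1 / s) - complex_of_real t)) \<in> borel_measurable \<mu>" by measurable
    show "(\<lambda>t. complex_of_real (s / (1 - s * t))) \<in> borel_measurable \<mu>" by measurable
    show "AE t in \<mu>. 1 / (complex_of_real (1 / s) - complex_of_real t) = complex_of_real (s / (1 - s * t))"
      using AE_C
    proof eventually_elim
      case (elim t)
      have "\<bar>s * t\<bar> \<le> \<bar>s\<bar> * C" unfolding abs_mult using elim by (intro mult_left_mono) auto
      also have "\<dots> < 1" using assms(2) C by (simp add: field_simps)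
      finally have "1 - s * t \<noteq> 0" by auto
      then have "1 / (1 / s - t) = s / (1 - s * t)" using assms(1) by (simp add: field_simps)
      then show ?case by (metis of_real_1 of_real_diff of_real_divide)
    qed
  qed
  also have "\<dots> = complex_of_real (real_stj s)" unfolding real_stj_def by (rule integral_complex_of_real)
  finally show ?thesis .
qed

end

lemma holomorphic_poly_inverse:
  assumes "0 \<notin> A"
  shows "(\<lambda>z. poly (map_poly complex_of_real c) (1 / z)) holomorphic_on A"
proof (induction c)
  case (pCons a c)
  have "(\<lambda>z. complex_of_real a + 1 / z * poly (map_poly complex_of_real c) (1 / z)) holomorphic_on A"
    by (intro holomorphic_intros pCons.IH) (use assms in auto)
  then show ?case by (simp add: map_poly_pCons)
qed simp

lemma holomorphic_peval:
  assumes "0 \<notin> A" "g holomorphic_on A"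
  shows "(\<lambda>z. peval P (1 / z) (g z)) holomorphic_on A"
proof (induction P)
  case (pCons c P)
  show ?case unfolding peval_pCons by (intro holomorphic_intros holomorphic_poly_inverse assms pCons.IH)
qed simp

text \<open>The half plane does not contain the neighbourhood of infinity where power series are
  available. The identity theorem on \<open>resolv_dom\<close> carries the system there, and carries
  the algebraic relations found for the series back to the half plane.\<close>

theorem stieltjes_system_boundary:
  fixes \<mu> :: "'i \<Rightarrow> real measure"
  assumes I: "finite I" and N: "\<And>j. j \<in> I \<Longrightarrow> N j \<subseteq> I" and C: "C > 0"
    and cm: "\<And>j. j \<in> I \<Longrightarrow> compact_measure (\<mu> j) C"
    and eq: "\<And>j z. j \<in> I \<Longrightarrow> Im z > 0 \<Longrightarrow> stj (\<mu> j) z * (z - complex_of_real (w j) - (\<Sum>k\<in>N j. stj (\<mu> k) z)) = 1"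
    and i: "i \<in> I"
  shows "\<exists>X L. finite X \<and> (\<forall>l. l \<notin> X \<longrightarrow> (stj (\<mu> i) \<longlongrightarrow> L l) (at (complex_of_real l) within upper)) \<and>
     (\<forall>a b. {a<..<b} \<inter> X = {} \<longrightarrow> (\<forall>l\<in>{a<..<b}. Im (L l) = 0) \<or> (\<forall>l\<in>{a<..<b}. Im (L l) \<noteq> 0))"
proof -
  let ?\<Omega> = "resolv_dom C"
  define f where "f j = compact_measure.real_stj (\<mu> j)" for j
  define F where "F j = compact_measure.mom_fps (\<mu> j)" for j
  have hol: "stj (\<mu> j) holomorphic_on ?\<Omega>" if "j \<in> I" for j
    by (rule compact_measure.stj_holomorphic[OF cm[OF that]])
  have expn: "f j has_fps_expansion F j" if "j \<in> I" for j
    unfolding f_def F_def by (rule compact_measure.real_stj_expansion[OF cm[OF that]])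
  have real: "stj (\<mu> j) (complex_of_real (1 / s)) = complex_of_real (f j s)" if "j \<in> I" "s \<noteq> 0" "\<bar>s\<bar> < 1 / C" for j s
    unfolding f_def by (rule compact_measure.stj_real[OF cm[OF that(1)] that(2,3)])
  have f0: "f j 0 = 0" if "j \<in> I" for j
    unfolding f_def by (simp add: compact_measure.real_stj_def[OF cm[OF that]])
  have zero: "0 \<notin> ?\<Omega>" using C by (simp add: resolv_dom_def)
  have up: "upper \<subseteq> ?\<Omega>" by (auto simp: resolv_dom_def)
  have eq\<Omega>: "stj (\<mu> j) z * (z - complex_of_real (w j) - (\<Sum>k\<in>N j. stj (\<mu> k) z)) - 1 = 0" if j: "j \<in> I" and z: "z \<in> ?\<Omega>" for j z
  proof (rule analytic_continuation[where f = "\<lambda>z. stj (\<mu> j) z * (z - complex_of_real (w j) - (\<Sum>k\<in>N j. stj (\<mu> k) z)) - 1" and S = ?\<Omega> and U = upper and \<xi> = \<i>])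
    show "(\<lambda>z. stj (\<mu> j) z * (z - complex_of_real (w j) - (\<Sum>k\<in>N j. stj (\<mu> k) z)) - 1) holomorphic_on ?\<Omega>"
      using N[OF j] by (intro holomorphic_intros hol j) auto
    show "\<i> islimpt upper" by (intro interior_limit_point) (simp add: interior_open open_halfspace_Im_gt)
    show "stj (\<mu> j) z * (z - complex_of_real (w j) - (\<Sum>k\<in>N j. stj (\<mu> k) z)) - 1 = 0" if "z \<in> upper" for z
      using eq[OF j, of z] that by simp
  qed (use up z C open_resolv_dom connected_resolv_dom in auto)
  have feq: "f j s * (1 - w j * s - s * (\<Sum>k\<in>N j. f k s)) = s" if j: "j \<in> I" and s: "\<bar>s\<bar> < 1 / C" for j s
  proof (cases "s = 0")
    case True
    then show ?thesis using f0[OF j] by simp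
  next
    case False
    have "complex_of_real (1 / s) \<in> ?\<Omega>" using False s C by (simp add: resolv_dom_def norm_divide field_simps)
    from eq\<Omega>[OF j this] have "complex_of_real (f j s * (1 / s - w j - (\<Sum>k\<in>N j. f k s)) - 1) = 0"
      using real[OF _ False s] j N[OF j] by (simp add: subset_iff)
    then have "f j s * (1 / s - w j - (\<Sum>k\<in>N j. f k s)) = 1" by (simp only: of_real_eq_0_iff)
    then have "s * (f j s * (1 / s - w j - (\<Sum>k\<in>N j. f k s))) = s" by simp
    then show ?thesis using False by (simp add: algebra_simps)
  qed
  have near: "\<forall>\<^sub>F s in nhds (0::real). \<bar>s\<bar> < 1 / C"
    unfolding eventually_nhds_metric using C by (intro exI[of _ "1 / C"]) auto
  have Feq: "F j * (1 - fps_const (w j) * fps_X - fps_X * (\<Sum>k\<in>N j. F k)) = fps_X" if j: "j \<in> I" for j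
  proof -
    have "(\<lambda>s. f j s * (1 - w j * s - s * (\<Sum>k\<in>N j. f k s)) - s) has_fps_expansion
        F j * (1 - fps_const (w j) * fps_X - fps_X * (\<Sum>k\<in>N j. F k)) - fps_X"
      using N[OF j] by (intro fps_expansion_intros expn j) auto
    moreover have "\<forall>\<^sub>F s in nhds 0. f j s * (1 - w j * s - s * (\<Sum>k\<in>N j. f k s)) - s = 0"
      using near by eventually_elim (simp add: feq[OF j])
    ultimately show ?thesis using has_fps_expansion_0_unique by fastforce
  qed
  have F0: "fps_nth (F j) 0 = 0" if "j \<in> I" for j
    unfolding F_def by (simp add: compact_measure.mom_fps_def[OF cm[OF that]])
  obtain P Q where P: "P \<noteq> 0" and Q: "Polynomial.coeff Q 0 \<noteq> 0"
    and PF: "fps_eval P (F i) = 0" and QF: "fps_eval Q (fps_eval (pderiv P) (F i)) = 0"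
    by (rule separable_relation[OF I N Feq F0 i])
  \<comment> \<open>Vanishing for small real s means vanishing at all large real z. Such points
    accumulate, for instance at R + 1, inside the connected domain.\<close>
  have transfer: "g z = 0"
    if g: "g holomorphic_on ?\<Omega>" and gr: "\<forall>\<^sub>F s in nhds 0. s \<noteq> 0 \<longrightarrow> g (complex_of_real (1 / s)) = 0" and z: "z \<in> ?\<Omega>" for g z
  proof -
    obtain d where d: "d > 0" "\<And>s. \<bar>s\<bar> < d \<Longrightarrow> s \<noteq> 0 \<Longrightarrow> g (complex_of_real (1 / s)) = 0"
      using gr unfolding eventually_nhds_metric by (auto simp: dist_real_def)
    define R where "R = max C (1 / d)"
    have R: "R > 0" using C by (simp add: R_def less_max_iff_disj)
    have "g (complex_of_real x) = 0" if "x > R" for x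
    proof -
      have x: "x > 0" "x > 1 / d" using that R by (auto simp: R_def)
      have "1 / x < d" using x d(1) by (simp add: field_simps)
      then show ?thesis using d(2)[of "1 / x"] x(1) by simp
    qed
    note zeroR = this
    show ?thesis
    proof (rule analytic_continuation[OF g open_resolv_dom connected_resolv_dom[OF C], of "complex_of_real ` {R<..}" "complex_of_real (R + 1)"])
      show "complex_of_real ` {R<..} \<subseteq> ?\<Omega>" using R by (auto simp: resolv_dom_def R_def)
      have "cmod (complex_of_real (R + 1)) > C" unfolding norm_of_real using R by (simp add: R_def)
      then show "complex_of_real (R + 1) \<in> ?\<Omega>" unfolding resolv_dom_def by blast
      show "complex_of_real (R + 1) islimpt complex_of_real ` {R<..}"
        unfolding islimpt_approachable
      proof (intro allI impI)
        fix e :: real assume "e > 0"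
        show "\<exists>x'\<in>complex_of_real ` {R<..}. x' \<noteq> complex_of_real (R + 1) \<and> dist x' (complex_of_real (R + 1)) < e"
        proof (intro bexI conjI)
          show "complex_of_real (R + 1 + e / 2) \<noteq> complex_of_real (R + 1)" unfolding of_real_eq_iff using \<open>e > 0\<close> by simp
          show "dist (complex_of_real (R + 1 + e / 2)) (complex_of_real (R + 1)) < e" unfolding dist_of_real dist_real_def using \<open>e > 0\<close> by simp
          show "complex_of_real (R + 1 + e / 2) \<in> complex_of_real ` {R<..}" using \<open>e > 0\<close> by (intro imageI) simp
        qed
      qed
    qed (use zeroR z in auto)
  qed
  have exP: "(\<lambda>s. peval P s (f i s)) has_fps_expansion 0"
    using has_fps_expansion_peval[OF expn[OF i], of P] unfolding PF .
  have exQ: "(\<lambda>s. peval Q s (peval (pderiv P) s (f i s))) has_fps_expansion 0"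
    using has_fps_expansion_peval[OF has_fps_expansion_peval[OF expn[OF i], of "pderiv P"], of Q] unfolding QF .
  have small: "\<forall>\<^sub>F s in nhds 0. peval P s (f i s) = 0" "\<forall>\<^sub>F s in nhds 0. peval Q s (peval (pderiv P) s (f i s)) = 0"
    using conjunct2[OF exP[unfolded has_fps_expansion_def]] conjunct2[OF exQ[unfolded has_fps_expansion_def]]
    by (auto elim!: eventually_mono)
  have relP: "peval P (1 / z) (stj (\<mu> i) z) = 0" if "z \<in> ?\<Omega>" for z
  proof (rule transfer[OF holomorphic_peval[OF zero hol[OF i]] _ that])
    show "\<forall>\<^sub>F s in nhds 0. s \<noteq> 0 \<longrightarrow> peval P (1 / complex_of_real (1 / s)) (stj (\<mu> i) (complex_of_real (1 / s))) = 0"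
      using small(1) near
    proof eventually_elim
      case (elim s)
      show ?case
      proof
        assume s: "s \<noteq> 0"
        have "peval P (1 / complex_of_real (1 / s)) (stj (\<mu> i) (complex_of_real (1 / s))) = peval P (complex_of_real s) (complex_of_real (f i s))"
          using real[OF i s elim(2)] by simp
        also have "\<dots> = 0" unfolding peval_of_real elim(1) by simp
        finally show "peval P (1 / complex_of_real (1 / s)) (stj (\<mu> i) (complex_of_real (1 / s))) = 0" .
      qed
    qed
  qed
  have relQ: "peval Q (1 / z) (peval (pderiv P) (1 / z) (stj (\<mu> i) z)) = 0" if "z \<in> ?\<Omega>" for z
  proof (rule transfer[OF holomorphic_peval[OF zero holomorphic_peval[OF zero hol[OF i]]] _ that])
    show "\<forall>\<^sub>F s in nhds 0. s \<noteq> 0 \<longrightarrow> peval Q (1 / complex_of_real (1 / s)) (peval (pderiv P) (1 / complex_of_real (1 / s)) (stj (\<mu> i) (complex_of_real (1 / s)))) = 0"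
      using small(2) near
    proof eventually_elim
      case (elim s)
      show ?case
      proof
        assume s: "s \<noteq> 0"
        have "peval Q (1 / complex_of_real (1 / s)) (peval (pderiv P) (1 / complex_of_real (1 / s)) (stj (\<mu> i) (complex_of_real (1 / s))))
           = peval Q (complex_of_real s) (peval (pderiv P) (complex_of_real s) (complex_of_real (f i s)))"
          using real[OF i s elim(2)] by simp
        also have "\<dots> = 0" unfolding peval_of_real elim(1) by simp
        finally show "peval Q (1 / complex_of_real (1 / s)) (peval (pderiv P) (1 / complex_of_real (1 / s)) (stj (\<mu> i) (complex_of_real (1 / s)))) = 0" .
      qed
    qed
  qed
  show ?thesis
  proof (rule algebraic_boundary[OF _ P Q])
    show "continuous_on upper (stj (\<mu> i))"
      using holomorphic_on_imp_continuous_on[OF hol[OF i]] up continuous_on_subset by blast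
  qed (use relP relQ up in auto)
qed

section \<open>Sets of directed edges closed under continuation\<close>

locale core_graph = rooted_ugraph +
  assumes conn: "graph_connected V E" and deg2: "\<forall>v\<in>V. Defs.degree V E v \<ge> 2"
    and ncyc: "\<not> is_cycle_graph V E"
begin

abbreviation nb :: "'a \<Rightarrow> 'a set" where "nb b \<equiv> {c. E b c}"

lemma finite_nb: "finite (nb b)"
  by (rule finite_subset[OF _ finV]) (use EV in auto)

lemma card_nb: "b \<in> V \<Longrightarrow> card (nb b) \<ge> 2"
proof -
  assume "b \<in> V"
  moreover have "{u \<in> V. E b u} = nb b" using EV by auto
  ultimately show ?thesis using deg2 unfolding Defs.degree_def by auto
qed

lemma connected_induct:
  assumes "a \<in> V" "P a" "\<And>b c. P b \<Longrightarrow> E b c \<Longrightarrow> P c" "b \<in> V"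
  shows "P b"
proof -
  have "E\<^sup>*\<^sup>* a b" using conn assms(1,4) unfolding graph_connected_def by blast
  then show ?thesis using assms(2) by (induction rule: rtranclp_induct) (use assms(3) in blast)+
qed

text \<open>Iterating s from r must repeat in the finite set V, and since p undoes s the first
  repetition is r itself, after n steps. Connectedness makes the orbit exhaust V, and the distinct
  vertices r, \<open>p r\<close>, \<open>s r\<close> give n at least 3.\<close>

lemma cyclic_permutation_is_cycle:
  assumes ps: "\<And>b. b \<in> V \<Longrightarrow> nb b = {p b, s b} \<and> p b \<noteq> s b \<and> p (s b) = b \<and> s (p b) = b"
  shows "is_cycle_graph V E"
proof -
  have sV: "s b \<in> V" "p b \<in> V" if "b \<in> V" for b using ps[OF that] EV[of b "s b"] EV[of b "p b"] by auto
  define g where "g i = (s ^^ i) r" for i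
  have gV: "g i \<in> V" for i unfolding g_def by (induction i) (use rV sV in auto)
  have pg: "p (g (Suc i)) = g i" for i using ps[OF gV[of i]] by (simp add: g_def)
  have unwind: "g i = g j \<Longrightarrow> i \<le> j \<Longrightarrow> g (j - i) = g 0" for i j
  proof (induction i arbitrary: j)
    case (Suc i)
    then obtain j' where j': "j = Suc j'" by (cases j) auto
    have "g i = g j'" using Suc.prems(1) pg[of i] pg[of j'] by (simp add: j')
    then show ?case using Suc.IH[of j'] Suc.prems(2) by (simp add: j')
  qed simp
  have "\<not> inj g"
  proof
    assume "inj g"
    then have "infinite (range g)" by (simp add: finite_image_iff)
    moreover have "finite (range g)" by (rule finite_subset[OF _ finV]) (use gV in auto)
    ultimately show False by simp
  qed
  then obtain i j where "g i = g j" "i \<noteq> j" unfolding inj_def by blast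
  then obtain i j where ij: "g i = g j" "i < j" by (metis linorder_neqE_nat)
  have "j - i > 0 \<and> g (j - i) = g 0" using unwind[OF ij(1)] ij(2) by simp
  then have ex: "\<exists>n. n > 0 \<and> g n = g 0" by blast
  define n where "n = (LEAST n. n > 0 \<and> g n = g 0)"
  have n: "n > 0" "g n = g 0" using LeastI_ex[OF ex] by (auto simp: n_def)
  have nmin: "m \<ge> n" if "m > 0" "g m = g 0" for m unfolding n_def by (rule Least_le) (use that in simp)
  have inj: "inj_on g {..<n}"
  proof (rule linorder_inj_onI')
    fix i j assume "i \<in> {..<n}" "j \<in> {..<n}" "i < j"
    then show "g i \<noteq> g j" using unwind[of i j] nmin[of "j - i"] by auto
  qed
  have sg': "s (g i) = g (Suc i mod n)" if "i < n" for i
  proof (cases "Suc i = n")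
    case True
    then show ?thesis using n(2) by (simp add: g_def flip: True)
  next
    case False
    then show ?thesis using that by (simp add: g_def)
  qed
  have orb: "b \<in> g ` {..<n}" if b: "b \<in> V" for b
  proof (rule connected_induct[OF rV, of "\<lambda>b. b \<in> g ` {..<n}", OF _ _ b])
    show "r \<in> g ` {..<n}" using n(1) by (auto simp: g_def intro!: image_eqI[of _ _ 0])
    fix b c assume "b \<in> g ` {..<n}" and E: "E b c"
    then obtain i where i: "b = g i" "i < n" by auto
    have "c = p b \<or> c = s b" using ps[OF gV[of i]] E i by blast
    then show "c \<in> g ` {..<n}"
    proof
      assume c: "c = s b"
      show ?thesis unfolding c i(1) sg'[OF i(2)] using n(1) by (intro imageI) auto
    next
      assume c: "c = p b"
      show ?thesis
      proof (cases i)
        case 0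
        have "c = g (n - 1)" using pg[of "n - 1"] n by (simp add: c i(1) 0)
        then show ?thesis using n(1) by auto
      next
        case (Suc k)
        then show ?thesis using pg[of k] i(2) by (auto simp: c i(1))
      qed
    qed
  qed
  have bij: "bij_betw g {..<n} V" unfolding bij_betw_def using inj orb gV by auto
  have "card {r, p r, s r} \<le> card V" by (rule card_mono[OF finV]) (use rV sV in auto)
  moreover have "r \<noteq> p r" "r \<noteq> s r" using ps[OF rV] Eirr by auto
  ultimately have "n \<ge> 3" using bij_betw_same_card[OF bij] ps[OF rV] by simp
  moreover have "E (g i) (g j) \<longleftrightarrow> (j = (i + 1) mod n \<or> i = (j + 1) mod n)" if "i < n" "j < n" for i j
  proof -
    have "E (g i) (g j) \<longleftrightarrow> g j = p (g i) \<or> g j = s (g i)" using ps[OF gV[of i]] by blast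
    moreover have "g j = p (g i) \<longleftrightarrow> g i = s (g j)" using ps[OF gV[of i]] ps[OF gV[of j]] by metis
    moreover have "g j = s (g i) \<longleftrightarrow> j = (i + 1) mod n" unfolding sg'[OF that(1)]
      using inj_on_eq_iff[OF inj, of j "Suc i mod n"] that n(1) by auto
    moreover have "g i = s (g j) \<longleftrightarrow> i = (j + 1) mod n" unfolding sg'[OF that(2)]
      using inj_on_eq_iff[OF inj, of i "Suc j mod n"] that n(1) by auto
    ultimately show ?thesis by blast
  qed
  ultimately show ?thesis unfolding is_cycle_graph_def using bij by blast
qed

text \<open>Counting incoming against outgoing edges at each vertex shows that a nonempty set of directed edges
  closed under non-backtracking continuation is either everything or an orientation of a cycle.\<close>

theorem succ_closed_all_edges:
  assumes Z: "Z \<subseteq> {(a, b). E a b}" "Z \<noteq> {}"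
    and cl: "\<And>a b c. (a, b) \<in> Z \<Longrightarrow> E b c \<Longrightarrow> c \<noteq> a \<Longrightarrow> (b, c) \<in> Z"
  shows "Z = {(a, b). E a b}"
proof -
  define In where "In b = {a. (a, b) \<in> Z}" for b
  define Out where "Out b = {c. (b, c) \<in> Z}" for b
  have Insub: "In b \<subseteq> nb b" for b using Z(1) Esym by (auto simp: In_def)
  have Outsub: "Out b \<subseteq> nb b" for b using Z(1) by (auto simp: Out_def)
  have fin: "finite (In b)" "finite (Out b)" for b
    using finite_subset[OF Insub finite_nb] finite_subset[OF Outsub finite_nb] by auto
  have InOut: "nb b - {a} \<subseteq> Out b" if "a \<in> In b" for a b using that cl by (auto simp: In_def Out_def)
  have full2: "Out b = nb b" if "a \<in> In b" "a' \<in> In b" "a \<noteq> a'" for a a' b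
    using InOut[OF that(1)] InOut[OF that(2)] that(3) Outsub[of b] by blast
  \<comment> \<open>One incoming edge continues to all neighbours but one, and there is at least one
    of these as degrees are at least 2. Two incoming edges continue to all neighbours. Since both
    cardinalities sum to that of Z, equality holds at every vertex.\<close>
  have le: "card (In b) \<le> card (Out b)" if b: "b \<in> V" for b
  proof (cases "\<exists>a a'. a \<in> In b \<and> a' \<in> In b \<and> a \<noteq> a'")
    case True
    then have "Out b = nb b" using full2 by blast
    then show ?thesis using card_mono[OF finite_nb Insub] by simp
  next
    case False
    show ?thesis
    proof (cases "In b = {}")
      case False
      then obtain a where a: "a \<in> In b" by blast
      then have "In b = {a}" using \<open>\<not> (\<exists>a a'. a \<in> In b \<and> a' \<in> In b \<and> a \<noteq> a')\<close> by blast
      moreover have "a \<in> nb b" using a Insub by blast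
      then have "card (nb b - {a}) = card (nb b) - 1" using finite_nb by simp
      then have "card (Out b) \<ge> 1" using card_mono[OF fin(2) InOut[OF a]] card_nb[OF b] by simp
      ultimately show ?thesis by simp
    qed simp
  qed
  have "Z = (SIGMA b:V. Out b)" using Z(1) EV by (auto simp: Out_def)
  then have 1: "card Z = (\<Sum>b\<in>V. card (Out b))" using finV fin by (simp add: card_SigmaI)
  have "Z\<inverse> = (SIGMA b:V. In b)" using Z(1) EV by (auto simp: In_def)
  then have "card (Z\<inverse>) = (\<Sum>b\<in>V. card (In b))" using finV fin by (simp add: card_SigmaI)
  then have sums: "(\<Sum>b\<in>V. card (In b)) = (\<Sum>b\<in>V. card (Out b))" using 1 by (simp add: card_inverse)
  have eq: "card (In b) = card (Out b)" if "b \<in> V" for b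
    by (rule sum_mono_inv[OF sums le that finV])
  obtain a0 b0 where ab0: "(a0, b0) \<in> Z" using Z(2) by auto
  then have b0: "b0 \<in> V" "a0 \<in> In b0" using Z(1) EV by (auto simp: In_def)
  show ?thesis
  proof (cases "\<exists>b a a'. a \<in> In b \<and> a' \<in> In b \<and> a \<noteq> a'")
    case True
    then obtain b a a' where b: "a \<in> In b" "a' \<in> In b" "a \<noteq> a'" by blast
    have bV: "b \<in> V" using b(1) Insub EV by blast
    have mk: "In c = nb c" if "c \<in> V" "Out c = nb c" for c
      using card_subset_eq[OF finite_nb Insub] eq[OF that(1)] that(2) by metis
    have "In c = nb c \<and> Out c = nb c" if c: "c \<in> V" for c
    proof (rule connected_induct[OF bV, of "\<lambda>c. In c = nb c \<and> Out c = nb c", OF _ _ c])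
      show "In b = nb b \<and> Out b = nb b" using mk[OF bV] full2[OF b] by simp
      fix b c assume h: "In b = nb b \<and> Out b = nb b" and E: "E b c"
      have "b \<in> In c" "b \<in> Out c" using h E by (auto simp: In_def Out_def)
      then have "Out c = nb c" using InOut[of b c] Outsub[of c] by blast
      then show "In c = nb c \<and> Out c = nb c" using mk[of c] E EV by blast
    qed
    then have "(a, b) \<in> Z" if "E a b" for a b using that EV[OF that] by (auto simp: Out_def)
    then show ?thesis using Z(1) by auto
  next
    case False
    have "\<exists>a s. nb b = {a, s} \<and> a \<noteq> s \<and> In b = {a} \<and> Out b = {s}" if b: "b \<in> V" for b
    proof -
      have "In b \<noteq> {}"
      proof (rule connected_induct[OF b0(1), of "\<lambda>b. In b \<noteq> {}", OF _ _ b])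
        show "In b0 \<noteq> {}" using b0(2) by blast
        fix b c assume h: "In b \<noteq> {}" and E: "E b c"
        then obtain a where a: "a \<in> In b" by blast
        show "In c \<noteq> {}"
        proof (cases "c = a")
          case True
          \<comment> \<open>Here c is the vertex from which b is entered, and closure says nothing
            about going back to it. The equality of incoming and outgoing numbers at c supplies an
            incoming edge.\<close>
          then have "b \<in> Out c" using a by (auto simp: In_def Out_def)
          then have "card (Out c) \<noteq> 0" using fin by auto
          then have "card (In c) \<noteq> 0" using eq[of c] E EV by simp
          then show ?thesis by auto
        next
          case False
          then show ?thesis using InOut[OF a] E by (auto simp: In_def Out_def)
        qed
      qed
      then obtain a where a: "a \<in> In b" by blast
      then have Ia: "In b = {a}" using False by blast
      then have "card (Out b) = 1" using eq[OF b] by simp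
      then obtain s where s: "Out b = {s}" by (auto simp: card_1_singleton_iff)
      have anb: "a \<in> nb b" using a Insub by blast
      have sub: "nb b - {a} \<subseteq> {s}" using InOut[OF a] s by simp
      have "nb b - {a} \<noteq> {}"
      proof
        assume "nb b - {a} = {}"
        then have "nb b = {a}" using anb by blast
        then show False using card_nb[OF b] by simp
      qed
      then have "nb b - {a} = {s}" using sub by blast
      then have "nb b = {a, s}" "a \<noteq> s" using anb by blast+
      then show ?thesis using Ia s by blast
    qed
    then obtain p s where ps: "\<And>b. b \<in> V \<Longrightarrow> nb b = {p b, s b} \<and> p b \<noteq> s b \<and> In b = {p b} \<and> Out b = {s b}"
      by metis
    have "nb b = {p b, s b} \<and> p b \<noteq> s b \<and> p (s b) = b \<and> s (p b) = b" if b: "b \<in> V" for b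
    proof (intro conjI)
      have V: "s b \<in> V" "p b \<in> V" using ps[OF b] EV[of b "s b"] EV[of b "p b"] by auto
      have "b \<in> In (s b)" "b \<in> Out (p b)" using ps[OF b] by (auto simp: In_def Out_def)
      then show "p (s b) = b" "s (p b) = b" using ps[OF V(1)] ps[OF V(2)] by simp_all
    qed (use ps[OF b] in auto)
    from cyclic_permutation_is_cycle[OF this] ncyc show ?thesis by blast
  qed
qed

section \<open>Long words and infinite fibres of the covering\<close>

lemma T_extend: assumes "p \<in> T" shows "\<exists>c. p @ [c] \<in> T"
proof (rule ccontr)
  assume "\<nexists>c. p @ [c] \<in> T"
  then have "nb (last p) \<subseteq> {c. prev None p = Some c}" using T_child_iff[OF assms] by blast
  also have "\<dots> \<subseteq> {the (prev None p)}" by auto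
  finally have "card (nb (last p)) \<le> 1" using card_mono[of "{the (prev None p)}"] by simp
  then show False using card_nb[OF T_last[OF assms]] by simp
qed

lemma T_length: "\<exists>q\<in>T. length q = Suc n"
proof (induction n)
  case 0
  then show ?case using root_T by (intro bexI[of _ "[r]"]) auto
next
  case (Suc n)
  then obtain q where "q \<in> T" "length q = Suc n" by blast
  then show ?case using T_extend[of q] by (metis length_append_singleton)
qed

text \<open>The directed edges at the ends of words of length at least n + 2 form a nonempty set
  closed under continuation, hence all edges. So every vertex is the end of words longer than any
  bound n.\<close>

lemma infinite_fibre:
  assumes "b \<in> V" shows "infinite {q \<in> T. last q = b}"
proof
  assume "finite {q \<in> T. last q = b}"
  then have "finite (length ` {q \<in> T. last q = b})" by simp
  then obtain n where n: "\<And>q. q \<in> T \<Longrightarrow> last q = b \<Longrightarrow> length q \<le> n" unfolding finite_nat_set_iff_bounded_le by blast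
  define Z where "Z = {(a, b). \<exists>q\<in>T. length q \<ge> n + 2 \<and> last (butlast q) = a \<and> last q = b}"
  have "Z = {(a, b). E a b}"
  proof (rule succ_closed_all_edges)
    show "Z \<subseteq> {(a, b). E a b}" using T_parent by (auto simp: Z_def)
    obtain q where "q \<in> T" "length q = Suc (Suc n)" using T_length[of "Suc n"] by auto
    then have "(last (butlast q), last q) \<in> Z" unfolding Z_def by (auto intro!: bexI[of _ q])
    then show "Z \<noteq> {}" by blast
    fix a b c assume "(a, b) \<in> Z" and E: "E b c" "c \<noteq> a"
    then obtain q where q: "q \<in> T" "length q \<ge> n + 2" "last (butlast q) = a" "last q = b" by (auto simp: Z_def)
    have "q @ [c] \<in> T" using T_child_iff[OF q(1)] E q by (simp add: prev_def)
    then show "(b, c) \<in> Z" unfolding Z_def using q by (auto intro!: bexI[of _ "q @ [c]"])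
  qed
  moreover have "nb b \<noteq> {}" using card_nb[OF assms] by (metis card.empty not_numeral_le_zero)
  then obtain a where "E a b" using Esym by blast
  ultimately obtain q where "q \<in> T" "length q \<ge> n + 2" "last q = b" unfolding Z_def by blast
  then show False using n[of q] by simp
qed

end

section \<open>Spectrum of the universal cover\<close>

context core_graph
begin

abbreviation "C0 \<equiv> list_graph.Cbound V W"

lemma y_stieltjes:
  assumes "j \<in> idx"
  shows "\<exists>\<mu>. compact_measure \<mu> C0 \<and> (\<forall>z. Im z \<noteq> 0 \<longrightarrow> y j z = stj \<mu> z)"
proof -
  interpret N: list_graph V W "nb_cone V E j" by (rule cone_list_graph')
  let ?\<mu> = "N.spec (l2_delta [snd j])"
  have "compact_measure ?\<mu> C0"
    by (intro compact_measure.intro N.finite_measure_spec N.sets_spec N.AE_spec N.Cbound_pos)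
  moreover have "y j z = stj ?\<mu> z" if z: "Im z \<noteq> 0" for z
  proof -
    have "1 / (z - complex_of_real t) = - (1 / (complex_of_real t - z))" for t
      by (metis minus_diff_eq minus_divide_right)
    then have "stj ?\<mu> z = - (\<integral>t. 1 / (complex_of_real t - z) \<partial>?\<mu>)"
      unfolding stj_def by (simp only: Bochner_Integration.integral_minus)
    then show ?thesis
      unfolding y_def N.green_diag[OF z cone_single[OF idx_snd[OF assms]]] by simp
  qed
  ultimately show ?thesis by blast
qed

lemma y_boundary:
  "\<exists>X L. finite X \<and> (\<forall>j\<in>idx. \<forall>l. l \<notin> X \<longrightarrow> (y j \<longlongrightarrow> L j l) (at (complex_of_real l) within upper)) \<and>
     (\<forall>j\<in>idx. \<forall>a b. {a<..<b} \<inter> X = {} \<longrightarrow> (\<forall>l\<in>{a<..<b}. Im (L j l) = 0) \<or> (\<forall>l\<in>{a<..<b}. Im (L j l) \<noteq> 0))"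
proof -
  have "\<forall>j\<in>idx. \<exists>\<mu>. compact_measure \<mu> C0 \<and> (\<forall>z. Im z \<noteq> 0 \<longrightarrow> y j z = stj \<mu> z)" using y_stieltjes by blast
  from bchoice[OF this] obtain \<mu> where \<mu>: "\<And>j. j \<in> idx \<Longrightarrow> compact_measure (\<mu> j) C0"
    and y\<mu>: "\<And>j z. j \<in> idx \<Longrightarrow> Im z \<noteq> 0 \<Longrightarrow> y j z = stj (\<mu> j) z" by blast
  interpret TG: list_graph V W T by (rule T_list_graph) simp
  define P where "P j X L \<longleftrightarrow> finite X \<and> (\<forall>l. l \<notin> X \<longrightarrow> (y j \<longlongrightarrow> L l) (at (complex_of_real l) within upper)) \<and>
     (\<forall>a b. {a<..<b} \<inter> X = {} \<longrightarrow> (\<forall>l\<in>{a<..<b}. Im (L l) = 0) \<or> (\<forall>l\<in>{a<..<b}. Im (L l) \<noteq> 0))" for j X L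
  have "\<exists>X L. P j X L" if j: "j \<in> idx" for j
  proof -
    have "\<exists>X L. finite X \<and> (\<forall>l. l \<notin> X \<longrightarrow> (stj (\<mu> j) \<longlongrightarrow> L l) (at (complex_of_real l) within upper)) \<and>
     (\<forall>a b. {a<..<b} \<inter> X = {} \<longrightarrow> (\<forall>l\<in>{a<..<b}. Im (L l) = 0) \<or> (\<forall>l\<in>{a<..<b}. Im (L l) \<noteq> 0))"
    proof (rule stieltjes_system_boundary[where I = idx and N = succ and w = "W \<circ> snd" and C = C0, OF finite_idx succ_idx TG.Cbound_pos \<mu> _ j])
      fix k z assume k: "k \<in> idx" and z: "Im z > 0"
      have s: "(\<Sum>i\<in>succ k. y i z) = (\<Sum>i\<in>succ k. stj (\<mu> i) z)"
        by (rule sum.cong[OF refl y\<mu>[OF subsetD[OF succ_idx]]]) (use z in auto)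
      show "stj (\<mu> k) z * (z - complex_of_real ((W \<circ> snd) k) - (\<Sum>i\<in>succ k. stj (\<mu> i) z)) = 1"
        using y_eq[OF k, of z] z y\<mu>[OF k, of z] unfolding s by simp
    qed
    then obtain X L where X: "finite X" and lim: "\<And>l. l \<notin> X \<Longrightarrow> (stj (\<mu> j) \<longlongrightarrow> L l) (at (complex_of_real l) within upper)"
      and d: "\<forall>a b. {a<..<b} \<inter> X = {} \<longrightarrow> (\<forall>l\<in>{a<..<b}. Im (L l) = 0) \<or> (\<forall>l\<in>{a<..<b}. Im (L l) \<noteq> 0)" by blast
    have "(y j \<longlongrightarrow> L l) (at (complex_of_real l) within upper)" if "l \<notin> X" for l
    proof (rule Lim_transform_eventually[OF lim[OF that]])
      show "\<forall>\<^sub>F z in at (complex_of_real l) within upper. stj (\<mu> j) z = y j z"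
        unfolding eventually_at_filter by (intro always_eventually) (use y\<mu>[OF j] in auto)
    qed
    then have "P j X L" unfolding P_def using X d by blast
    then show ?thesis by blast
  qed
  then have "\<forall>j\<in>idx. \<exists>XL. P j (fst XL) (snd XL)" by auto
  from bchoice[OF this] obtain XL where XL: "\<forall>j\<in>idx. P j (fst (XL j)) (snd (XL j))" by (elim exE)
  define Xs where "Xs j = fst (XL j)" for j
  define Ls where "Ls j = snd (XL j)" for j
  have PL: "P j (Xs j) (Ls j)" if "j \<in> idx" for j unfolding Xs_def Ls_def by (rule bspec[OF XL that])
  define X where "X = (\<Union>j\<in>idx. Xs j)"
  have sub: "Xs j \<subseteq> X" if "j \<in> idx" for j using that by (auto simp: X_def)
  have "finite X" unfolding X_def using PL finite_idx by (auto simp: P_def)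
  moreover have "(y j \<longlongrightarrow> Ls j l) (at (complex_of_real l) within upper)" if "j \<in> idx" "l \<notin> X" for j l
    using PL[OF that(1)] sub[OF that(1)] that(2) unfolding P_def by blast
  moreover have "(\<forall>l\<in>{a<..<b}. Im (Ls j l) = 0) \<or> (\<forall>l\<in>{a<..<b}. Im (Ls j l) \<noteq> 0)" if "j \<in> idx" "{a<..<b} \<inter> X = {}" for j a b
  proof -
    have "{a<..<b} \<inter> Xs j = {}" using sub[OF that(1)] that(2) by blast
    then show ?thesis using PL[OF that(1)] unfolding P_def by blast
  qed
  ultimately show ?thesis by (intro exI[of _ X] exI[of _ Ls] conjI ballI allI impI)
qed

end

lemma filterlim_vertical: "filterlim (\<lambda>\<eta>. Complex l \<eta>) (at (complex_of_real l) within upper) (at_right 0)"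
  unfolding filterlim_at
proof
  show "\<forall>\<^sub>F \<eta> in at_right 0. Complex l \<eta> \<in> upper \<and> Complex l \<eta> \<noteq> complex_of_real l"
    using eventually_at_right_less by eventually_elim (auto simp: complex_eq_iff)
  have "((\<lambda>\<eta>. Complex l \<eta>) \<longlongrightarrow> Complex l 0) (at_right 0)" by (intro tendsto_Complex tendsto_intros)
  then show "((\<lambda>\<eta>. Complex l \<eta>) \<longlongrightarrow> complex_of_real l) (at_right 0)" by (simp add: complex_of_real_def)
qed

text \<open>The two points beyond the spectral bound are put into X so that every point of [-C0, C0]
  has neighbours in X on both sides and, if not in X, lies in a bounded cell.\<close>

locale core_boundary = core_graph +
  fixes X :: "real set" and L :: "'a option \<times> 'a \<Rightarrow> real \<Rightarrow> complex"
  assumes finX: "finite X"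
    and lim: "j \<in> idx \<Longrightarrow> l \<notin> X \<Longrightarrow> (y j \<longlongrightarrow> L j l) (at (complex_of_real l) within upper)"
    and dich: "j \<in> idx \<Longrightarrow> {a<..<b} \<inter> X = {} \<Longrightarrow> (\<forall>l\<in>{a<..<b}. Im (L j l) = 0) \<or> (\<forall>l\<in>{a<..<b}. Im (L j l) \<noteq> 0)"
    and CX: "C0 + 1 \<in> X" "- (C0 + 1) \<in> X"
begin

interpretation TG: list_graph V W T by (rule T_list_graph) simp

lemma lim_ray: "j \<in> idx \<Longrightarrow> l \<notin> X \<Longrightarrow> ((\<lambda>\<eta>. y j (Complex l \<eta>)) \<longlongrightarrow> L j l) (at_right 0)"
  by (rule filterlim_compose[OF lim filterlim_vertical])

lemma L_eq:
  assumes j: "j \<in> idx" and l: "l \<notin> X"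
  shows "L j l * (complex_of_real l - complex_of_real (W (snd j)) - (\<Sum>k\<in>succ j. L k l)) = 1"
proof (rule tendsto_unique)
  have "((\<lambda>\<eta>. Complex l \<eta>) \<longlongrightarrow> complex_of_real l) (at_right 0)"
    using filterlim_vertical unfolding filterlim_at by blast
  moreover have "((\<lambda>\<eta>. \<Sum>k\<in>succ j. y k (Complex l \<eta>)) \<longlongrightarrow> (\<Sum>k\<in>succ j. L k l)) (at_right 0)"
    by (rule tendsto_sum) (rule lim_ray[OF subsetD[OF succ_idx] l])
  ultimately show "((\<lambda>\<eta>. y j (Complex l \<eta>) * (Complex l \<eta> - complex_of_real (W (snd j)) - (\<Sum>k\<in>succ j. y k (Complex l \<eta>)))) \<longlongrightarrow>
      L j l * (complex_of_real l - complex_of_real (W (snd j)) - (\<Sum>k\<in>succ j. L k l))) (at_right 0)"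
    by (intro tendsto_mult tendsto_diff tendsto_const lim_ray[OF j l])
  show "((\<lambda>\<eta>. y j (Complex l \<eta>) * (Complex l \<eta> - complex_of_real (W (snd j)) - (\<Sum>k\<in>succ j. y k (Complex l \<eta>)))) \<longlongrightarrow> 1) (at_right 0)"
  proof (rule Lim_transform_eventually[OF tendsto_const])
    show "\<forall>\<^sub>F \<eta> in at_right 0. 1 = y j (Complex l \<eta>) * (Complex l \<eta> - complex_of_real (W (snd j)) - (\<Sum>k\<in>succ j. y k (Complex l \<eta>)))"
      using eventually_at_right_less by eventually_elim (use y_eq[OF j] in simp)
  qed
qed simp

lemma Im_L: "j \<in> idx \<Longrightarrow> l \<notin> X \<Longrightarrow> Im (L j l) \<le> 0"
proof -
  assume j: "j \<in> idx" and l: "l \<notin> X"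
  show ?thesis
  proof (rule tendsto_upperbound[OF tendsto_Im[OF lim_ray[OF j l]]])
    show "\<forall>\<^sub>F \<eta> in at_right 0. Im (y j (Complex l \<eta>)) \<le> 0"
      using eventually_at_right_less by eventually_elim (use Im_y_neg[OF j] in \<open>simp add: less_imp_le\<close>)
  qed simp
qed

text \<open>Taking imaginary parts in L_j s = 1 gives Im L_j = |L_j|^2 times the sum of the Im L_k.
  All these terms are \<le> 0, so the sum vanishes only termwise.\<close>

lemma Im_L_succ:
  assumes j: "j \<in> idx" and l: "l \<notin> X"
  shows "Im (L j l) = 0 \<longleftrightarrow> (\<forall>k\<in>succ j. Im (L k l) = 0)"
proof -
  define s where "s = complex_of_real l - complex_of_real (W (snd j)) - (\<Sum>k\<in>succ j. L k l)"
  have Ls: "L j l * s = 1" using L_eq[OF j l] by (simp add: s_def)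
  have "cnj (L j l) * cnj s = 1" using arg_cong[OF Ls, of cnj] by simp
  then have "L j l = (L j l * cnj (L j l)) * cnj s" by (simp add: mult.assoc)
  then have "L j l = complex_of_real ((cmod (L j l))\<^sup>2) * cnj s" by (simp add: complex_norm_square[symmetric])
  then have "Im (L j l) = (cmod (L j l))\<^sup>2 * Im (cnj s)" by (metis Im_complex_of_real mult_zero_left add_0_right times_complex.sel(2) Re_complex_of_real)
  also have "Im (cnj s) = (\<Sum>k\<in>succ j. Im (L k l))" by (simp add: s_def sum_negf)
  finally have eq: "Im (L j l) = (cmod (L j l))\<^sup>2 * (\<Sum>k\<in>succ j. Im (L k l))" .
  have "L j l \<noteq> 0" using Ls by auto
  then have "Im (L j l) = 0 \<longleftrightarrow> (\<Sum>k\<in>succ j. - Im (L k l)) = 0" by (subst eq) (simp add: sum_negf)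
  also have "\<dots> \<longleftrightarrow> (\<forall>k\<in>succ j. - Im (L k l) = 0)"
    by (rule sum_nonneg_eq_0_iff[OF finite_succ]) (use Im_L[OF subsetD[OF succ_idx] l] in simp)
  finally show ?thesis by simp
qed

text \<open>The root is only a convenient representative: by \<open>Im_L_iff_on\<close> all indices
  give the same answer.\<close>

definition on :: "real \<Rightarrow> bool" where "on l \<longleftrightarrow> Im (L (None, r) l) \<noteq> 0"

lemma root_idx: "(None, r) \<in> idx" using rV by (simp add: idx_def)

lemma edge_idx: "E a b \<Longrightarrow> (Some a, b) \<in> idx" by (simp add: idx_def)

text \<open>A real value at any index passes to one of its continuations, of which there is at least
  one, so the set Z of real directed edges is then nonempty and thus complete. Conversely, if Z is
  complete, all continuations of an index are real, and so is the index.\<close>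

lemma Im_L_iff_on:
  assumes j: "j \<in> idx" and l: "l \<notin> X"
  shows "Im (L j l) \<noteq> 0 \<longleftrightarrow> on l"
proof -
  define Z where "Z = {(a, b). E a b \<and> Im (L (Some a, b) l) = 0}"
  have all: "Z = {(a, b). E a b}" if "Z \<noteq> {}"
  proof (rule succ_closed_all_edges[OF _ that])
    show "Z \<subseteq> {(a, b). E a b}" by (auto simp: Z_def)
    fix a b c assume ab: "(a, b) \<in> Z" and E: "E b c" "c \<noteq> a"
    have "(Some b, c) \<in> succ (Some a, b)" using E by (auto simp: succ_def)
    then show "(b, c) \<in> Z" using Im_L_succ[OF edge_idx l, of a b] ab E by (auto simp: Z_def)
  qed
  have edge: "Im (L j l) = 0 \<longleftrightarrow> Z \<noteq> {}" if j: "j \<in> idx" for j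
  proof
    assume Lj: "Im (L j l) = 0"
    have "\<exists>c. E (snd j) c \<and> fst j \<noteq> Some c"
    proof (rule ccontr)
      assume "\<not> ?thesis"
      then have "nb (snd j) \<subseteq> {the (fst j)}" by auto
      then have "card (nb (snd j)) \<le> 1" using card_mono[of "{the (fst j)}"] by simp
      then show False using card_nb[OF idx_snd[OF j]] by simp
    qed
    then obtain c where c: "E (snd j) c" "fst j \<noteq> Some c" by blast
    then have "(Some (snd j), c) \<in> succ j" by (auto simp: succ_def)
    then have "(snd j, c) \<in> Z" using Im_L_succ[OF j l] Lj c by (auto simp: Z_def)
    then show "Z \<noteq> {}" by blast
  next
    assume "Z \<noteq> {}"
    then have "(a, b) \<in> Z" if "E a b" for a b using all that by blast
    then have "Im (L (Some a, b) l) = 0" if "E a b" for a b using that by (auto simp: Z_def)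
    then show "Im (L j l) = 0" unfolding Im_L_succ[OF j l] by (auto simp: succ_def)
  qed
  show ?thesis unfolding on_def using edge[OF j] edge[OF root_idx] by blast
qed

lemma on_dich: "{a<..<b} \<inter> X = {} \<Longrightarrow> l \<in> {a<..<b} \<Longrightarrow> l' \<in> {a<..<b} \<Longrightarrow> on l \<longleftrightarrow> on l'"
  using dich[OF root_idx, of a b] unfolding on_def by blast

text \<open>Cells between consecutive points of X, tested at the midpoint; by \<open>on_dich\<close>
  one point decides for the whole cell.\<close>

definition J :: "(real \<times> real) set" where
  "J = {(a, b). a \<in> X \<and> b \<in> X \<and> a < b \<and> {a<..<b} \<inter> X = {} \<and> on ((a + b) / 2)}"

lemma finite_J: "finite J"
  by (rule finite_subset[of _ "X \<times> X"]) (use finX in \<open>auto simp: J_def\<close>)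

lemma JD: "(a, b) \<in> J \<Longrightarrow> a \<in> X \<and> b \<in> X \<and> a < b \<and> {a<..<b} \<inter> X = {}"
  by (simp add: J_def)

lemma J_on: "(a, b) \<in> J \<Longrightarrow> l \<in> {a<..<b} \<Longrightarrow> l \<notin> X \<and> on l"
  using on_dich[of a b "(a + b) / 2" l] by (auto simp: J_def)

lemma cell_J: "a \<in> X \<Longrightarrow> b \<in> X \<Longrightarrow> {a<..<b} \<inter> X = {} \<Longrightarrow> l \<in> {a<..<b} \<Longrightarrow> on l \<Longrightarrow> (a, b) \<in> J"
  using on_dich[of a b "(a + b) / 2" l] by (auto simp: J_def)

lemma left_end:
  assumes "\<bar>l\<bar> \<le> C0"
  obtains a where "a \<in> X" "a < l" "{a<..<l} \<inter> X = {}"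
proof -
  let ?A = "{x \<in> X. x < l}"
  have f: "finite ?A" "?A \<noteq> {}" using finX CX assms by auto
  show thesis
  proof (rule that[of "Max ?A"])
    show "Max ?A \<in> X" "Max ?A < l" using Max_in[OF f] by auto
    show "{Max ?A<..<l} \<inter> X = {}" using Max_ge[OF f(1)] by fastforce
  qed
qed

lemma right_end:
  assumes "\<bar>l\<bar> \<le> C0"
  obtains b where "b \<in> X" "l < b" "{l<..<b} \<inter> X = {}"
proof -
  let ?A = "{x \<in> X. l < x}"
  have f: "finite ?A" "?A \<noteq> {}" using finX CX assms by auto
  show thesis
  proof (rule that[of "Min ?A"])
    show "Min ?A \<in> X" "l < Min ?A" using Min_in[OF f] by auto
    show "{l<..<Min ?A} \<inter> X = {}" using Min_le[OF f(1)] by fastforce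
  qed
qed

lemma cell:
  assumes "\<bar>l\<bar> \<le> C0" "l \<notin> X"
  obtains a b where "a \<in> X" "b \<in> X" "{a<..<b} \<inter> X = {}" "l \<in> {a<..<b}"
proof -
  obtain a where a: "a \<in> X" "a < l" "{a<..<l} \<inter> X = {}" by (rule left_end[OF assms(1)])
  obtain b where b: "b \<in> X" "l < b" "{l<..<b} \<inter> X = {}" by (rule right_end[OF assms(1)])
  have "{a<..<b} = {a<..<l} \<union> {l} \<union> {l<..<b}" using a(2) b(2) by auto
  then have "{a<..<b} \<inter> X = {}" using a(3) b(3) assms(2) by auto
  then show thesis using that a b by auto
qed

lemma idx_last: "v \<in> T \<Longrightarrow> (None, last v) \<in> idx"
  using T_last by (simp add: idx_def)

lemma Im_green_lim:
  assumes "v \<in> T" "l \<notin> X"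
  shows "((\<lambda>\<eta>. Im (green Wl T (Complex l \<eta>) v v)) \<longlongrightarrow> - Im (L (None, last v) l)) (at_right 0)"
proof (rule Lim_transform_eventually)
  show "((\<lambda>\<eta>. - Im (y (None, last v) (Complex l \<eta>))) \<longlongrightarrow> - Im (L (None, last v) l)) (at_right 0)"
    by (intro tendsto_minus tendsto_Im lim_ray idx_last assms)
  show "\<forall>\<^sub>F \<eta> in at_right 0. - Im (y (None, last v) (Complex l \<eta>)) = Im (green Wl T (Complex l \<eta>) v v)"
    using eventually_at_right_less by eventually_elim (simp add: green_T_diag assms(1))
qed

lemma off_cell_null:
  assumes "{a<..<b} \<inter> X = {}" "\<And>l. l \<in> {a<..<b} \<Longrightarrow> \<not> on l" "v \<in> T"
  shows "measure (TG.spec (l2_delta v)) {a<..<b} = 0"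
proof (rule TG.gap_no_mass[OF assms(3)])
  fix l assume "a < l" "l < b"
  then have l: "l \<notin> X" "\<not> on l" using assms(1,2) by auto
  then have "Im (L (None, last v) l) = 0" using Im_L_iff_on[OF idx_last[OF assms(3)] l(1)] by blast
  then show "((\<lambda>\<eta>. Im (green Wl T (Complex l \<eta>) v v)) \<longlongrightarrow> 0) (at_right 0)"
    using Im_green_lim[OF assms(3) l(1)] by simp
qed

lemma measure_spec_mono:
  assumes "measure (TG.spec u) B = 0" "A \<subseteq> B" "A \<in> sets borel" "B \<in> sets borel"
  shows "measure (TG.spec u) A = 0"
proof -
  interpret finite_measure "TG.spec u" by (rule TG.finite_measure_spec)
  have "measure (TG.spec u) A \<le> measure (TG.spec u) B" by (rule finite_measure_mono) (use assms in auto)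
  then show ?thesis using assms(1) measure_nonneg[of "TG.spec u" A] by simp
qed

lemma outside_not_spectrum:
  assumes "\<bar>l\<bar> > C0" shows "complex_of_real l \<notin> spectrum_op Wl T"
proof (rule TG.gap_not_spectrum)
  show "(\<bar>l\<bar> - C0) / 2 > 0" using assms by simp
  fix v
  interpret finite_measure "TG.spec (l2_delta v)" by (rule TG.finite_measure_spec)
  have "AE t in TG.spec (l2_delta v). t \<in> {l - (\<bar>l\<bar> - C0) / 2..l + (\<bar>l\<bar> - C0) / 2} \<longleftrightarrow> t \<in> {}"
    using TG.AE_spec
  proof eventually_elim
    case (elim t)
    then show ?case using assms by (auto simp: abs_le_iff field_simps abs_real_def split: if_splits)
  qed
  then have "measure (TG.spec (l2_delta v)) {l - (\<bar>l\<bar> - C0) / 2..l + (\<bar>l\<bar> - C0) / 2} = measure (TG.spec (l2_delta v)) {}"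
    by (rule measure_eq_AE) auto
  then show "measure (TG.spec (l2_delta v)) {l - (\<bar>l\<bar> - C0) / 2..l + (\<bar>l\<bar> - C0) / 2} = 0" by simp
qed

lemma off_not_spectrum:
  assumes l: "l \<notin> X" "\<not> on l" shows "complex_of_real l \<notin> spectrum_op Wl T"
proof (cases "\<bar>l\<bar> \<le> C0")
  case True
  obtain a b where ab: "a \<in> X" "b \<in> X" "{a<..<b} \<inter> X = {}" "l \<in> {a<..<b}" by (rule cell[OF True l(1)])
  define e where "e = min (l - a) (b - l) / 2"
  show ?thesis
  proof (rule TG.gap_not_spectrum)
    show "e > 0" using ab(4) by (simp add: e_def)
    fix v assume v: "v \<in> T"
    show "measure (TG.spec (l2_delta v)) {l - e..l + e} = 0"
    proof (rule measure_spec_mono[OF off_cell_null[OF ab(3) _ v]])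
      show "\<not> on l'" if "l' \<in> {a<..<b}" for l' using on_dich[OF ab(3) ab(4) that] l(2) by simp
      show "{l - e..l + e} \<subseteq> {a<..<b}" using ab(4) by (auto simp: e_def min_def field_simps split: if_splits)
    qed auto
  qed
next
  case False
  then show ?thesis using outside_not_spectrum by simp
qed

lemma near_on_in_spectrum:
  assumes "\<And>e. e > 0 \<Longrightarrow> \<exists>l'. \<bar>l' - l\<bar> < e \<and> l' \<notin> X \<and> on l'"
  shows "complex_of_real l \<in> spectrum_op Wl T"
proof (rule TG.in_spectrum[OF root_T])
  fix e :: real assume "e > 0"
  then obtain l' where l': "\<bar>l' - l\<bar> < e" "l' \<notin> X" "on l'" using assms by blast
  have "((\<lambda>\<eta>. Im (green Wl T (Complex l' \<eta>) [r] [r])) \<longlongrightarrow> - Im (L (None, r) l')) (at_right 0)"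
    using Im_green_lim[OF root_T l'(2)] by simp
  moreover have "- Im (L (None, r) l') \<noteq> 0" using l'(3) by (simp add: on_def)
  ultimately show "\<exists>l' L. \<bar>l' - l\<bar> < e \<and> ((\<lambda>\<eta>. Im (green Wl T (Complex l' \<eta>) [r] [r])) \<longlongrightarrow> L) (at_right 0) \<and> L \<noteq> 0"
    using l'(1) by blast
qed

text \<open>Endpoints are included: moving a point of the closed interval towards the centre by a
  small fraction t of the way reaches an interior point within distance e.\<close>

lemma band_in_spectrum:
  assumes ab: "(a, b) \<in> J" and l: "a \<le> l" "l \<le> b"
  shows "complex_of_real l \<in> spectrum_op Wl T"
proof (rule near_on_in_spectrum)
  fix e :: real assume e: "e > 0"
  define c where "c = (a + b) / 2"
  define t where "t = min (1 / 2) (e / (2 * (b - a)))"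
  have "a < b" using JD[OF ab] by blast
  then have t: "t > 0" "t < 1" using e by (auto simp: t_def min_def)
  have "t * (b - a) \<le> e / (2 * (b - a)) * (b - a)" using \<open>a < b\<close> by (intro mult_right_mono) (auto simp: t_def)
  also have "\<dots> = e / 2" using \<open>a < b\<close> by (simp add: field_simps)
  finally have t3: "t * (b - a) < e" using e by simp
  define l' where "l' = l + t * (c - l)"
  have d: "\<bar>c - l\<bar> \<le> b - a" using l \<open>a < b\<close> by (auto simp: c_def abs_le_iff field_simps)
  have "\<bar>l' - l\<bar> = t * \<bar>c - l\<bar>" using t(1) by (simp add: l'_def abs_mult)
  also have "\<dots> \<le> t * (b - a)" using d t(1) by (intro mult_left_mono) auto
  finally have "\<bar>l' - l\<bar> < e" using t3 by simp
  moreover have "l' \<in> {a<..<b}"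
  proof -
    have "l' = (1 - t) * l + t * c" by (simp add: l'_def algebra_simps)
    moreover have "(1 - t) * a \<le> (1 - t) * l" "(1 - t) * l \<le> (1 - t) * b" using t(2) l by (auto intro!: mult_left_mono)
    moreover have "t * a < t * c" "t * c < t * b" using t(1) \<open>a < b\<close> by (auto simp: c_def)
    ultimately show ?thesis by (auto simp: algebra_simps)
  qed
  ultimately show "\<exists>l'. \<bar>l' - l\<bar> < e \<and> l' \<notin> X \<and> on l'" using J_on[OF ab] by blast
qed

lemma J_nonempty: "J \<noteq> {}"
proof
  assume J: "J = {}"
  let ?\<mu> = "TG.spec (l2_delta [r])"
  interpret finite_measure ?\<mu> by (rule TG.finite_measure_spec)
  define K where "K = {(a, b) \<in> X \<times> X. {a<..<b} \<inter> X = {}}"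
  have K: "finite K" unfolding K_def by (rule finite_subset[of _ "X \<times> X"]) (use finX in auto)
  have "AE t in ?\<mu>. \<forall>k\<in>K. t \<notin> {fst k<..<snd k}"
  proof (rule AE_finite_allI[OF K])
    fix k assume k: "k \<in> K"
    have "measure ?\<mu> {fst k<..<snd k} = 0"
    proof (rule off_cell_null[OF _ _ root_T])
      have k': "fst k \<in> X" "snd k \<in> X" "{fst k<..<snd k} \<inter> X = {}" using k by (auto simp: K_def)
      then show "{fst k<..<snd k} \<inter> X = {}" by blast
      show "\<not> on l" if "l \<in> {fst k<..<snd k}" for l using cell_J[OF k' that] J by blast
    qed
    then have "{fst k<..<snd k} \<in> null_sets ?\<mu>" by (auto simp: null_sets_def emeasure_eq_measure)
    then show "AE t in ?\<mu>. t \<notin> {fst k<..<snd k}" by (rule AE_not_in)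
  qed
  moreover have "AE t in ?\<mu>. \<bar>t\<bar> \<le> C0" by (rule TG.AE_spec)
  ultimately have "AE t in ?\<mu>. t \<in> X"
  proof eventually_elim
    case (elim t)
    show ?case
    proof (rule ccontr)
      assume "t \<notin> X"
      then obtain a b where "a \<in> X" "b \<in> X" "{a<..<b} \<inter> X = {}" "t \<in> {a<..<b}" using cell[OF elim(2)] by blast
      then show False using elim(1) by (auto simp: K_def)
    qed
  qed
  moreover have "\<not> (AE t in ?\<mu>. t \<in> X)"
    by (rule TG.spectral_measure_not_finite_support[OF root_T T_single _ T_length finX]) (use T_parent in auto)
  ultimately show False by contradiction
qed

text \<open>The diagonal Green function depends on the vertex only through its image in the graph,
  and \<open>poisson_atom\<close> recovers the atom from it.\<close>

lemma atom_fibre: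
  assumes "v \<in> T" "q \<in> T" "last q = last v"
  shows "measure (TG.spec (l2_delta q)) {l} = measure (TG.spec (l2_delta v)) {l}"
proof (rule LIMSEQ_unique)
  show "(\<lambda>n. inverse (real (Suc n)) * poisson (TG.spec (l2_delta q)) l (inverse (real (Suc n)))) \<longlonglongrightarrow> measure (TG.spec (l2_delta q)) {l}"
    by (rule poisson_atom[OF TG.finite_measure_spec TG.sets_spec])
  have "poisson (TG.spec (l2_delta q)) l b = poisson (TG.spec (l2_delta v)) l b" if "b > 0" for b
    using that by (simp add: TG.poisson_delta green_T_diag assms)
  then have eq: "poisson (TG.spec (l2_delta q)) l (inverse (real (Suc n))) = poisson (TG.spec (l2_delta v)) l (inverse (real (Suc n)))" for n by simp
  show "(\<lambda>n. inverse (real (Suc n)) * poisson (TG.spec (l2_delta q)) l (inverse (real (Suc n)))) \<longlonglongrightarrow> measure (TG.spec (l2_delta v)) {l}"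
    unfolding eq by (rule poisson_atom[OF TG.finite_measure_spec TG.sets_spec])
qed

text \<open>As l is no endpoint of an interval in J, the cells on both sides carry no mass. Some
  vertex must have an atom at l, as otherwise l would lie in a gap; \<open>atom_fibre\<close>
  spreads this atom over the infinite fibre.\<close>

lemma isolated_point_eigenvalue:
  assumes l: "l \<in> X" "complex_of_real l \<in> spectrum_op Wl T" "l \<notin> fst ` J \<union> snd ` J"
  shows "eigenvalue_inf_mult Wl T l"
proof -
  have C: "\<bar>l\<bar> \<le> C0" using outside_not_spectrum[of l] l(2) by force
  obtain a where a: "a \<in> X" "a < l" "{a<..<l} \<inter> X = {}" by (rule left_end[OF C])
  obtain b where b: "b \<in> X" "l < b" "{l<..<b} \<inter> X = {}" by (rule right_end[OF C])
  define e where "e = min (l - a) (b - l)"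
  have e: "e > 0" using a(2) b(2) by (simp add: e_def)
  have g1: "measure (TG.spec (l2_delta v)) {l - e<..<l} = 0" if v: "v \<in> T" for v
  proof (rule measure_spec_mono[OF off_cell_null[OF a(3) _ v]])
    show "\<not> on l'" if "l' \<in> {a<..<l}" for l' using cell_J[OF a(1) l(1) a(3) that] l(3) by force
  qed (auto simp: e_def)
  have g2: "measure (TG.spec (l2_delta v)) {l<..<l + e} = 0" if v: "v \<in> T" for v
  proof (rule measure_spec_mono[OF off_cell_null[OF b(3) _ v]])
    show "\<not> on l'" if "l' \<in> {l<..<b}" for l' using cell_J[OF l(1) b(1) b(3) that] l(3) by force
  qed (auto simp: e_def)
  have "\<exists>v\<in>T. measure (TG.spec (l2_delta v)) {l} \<noteq> 0"
  proof (rule ccontr)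
    assume none: "\<not> ?thesis"
    have "complex_of_real l \<notin> spectrum_op Wl T"
    proof (rule TG.gap_not_spectrum)
      show "e / 2 > 0" using e by simp
      fix v assume v: "v \<in> T"
      interpret finite_measure "TG.spec (l2_delta v)" by (rule TG.finite_measure_spec)
      let ?\<mu> = "TG.spec (l2_delta v)"
      have "measure ?\<mu> {l} = 0" using none v by blast
      moreover have "measure ?\<mu> ({l - e<..<l} \<union> {l}) \<le> measure ?\<mu> {l - e<..<l} + measure ?\<mu> {l}"
        by (rule measure_Un_le) auto
      moreover have "measure ?\<mu> (({l - e<..<l} \<union> {l}) \<union> {l<..<l + e}) \<le> measure ?\<mu> ({l - e<..<l} \<union> {l}) + measure ?\<mu> {l<..<l + e}"
        by (rule measure_Un_le) auto
      ultimately have "measure ?\<mu> (({l - e<..<l} \<union> {l}) \<union> {l<..<l + e}) = 0"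
        using g1[OF v] g2[OF v] measure_nonneg[of ?\<mu> "({l - e<..<l} \<union> {l}) \<union> {l<..<l + e}"] by linarith
      then show "measure (TG.spec (l2_delta v)) {l - e / 2..l + e / 2} = 0"
        by (rule measure_spec_mono) (use e in auto)
    qed
    then show False using l(2) by contradiction
  qed
  then obtain v where v: "v \<in> T" "measure (TG.spec (l2_delta v)) {l} \<noteq> 0" by blast
  show ?thesis
  proof (rule TG.isolated_eigenvalue[OF e g1 g2])
    show "infinite {q \<in> T. last q = last v}" by (rule infinite_fibre[OF T_last[OF v(1)]])
    show "measure (TG.spec (l2_delta q)) {l} = measure (TG.spec (l2_delta v)) {l}" if "q \<in> {q \<in> T. last q = last v}" for q
      using atom_fibre[OF v(1)] that by blast
    show "measure (TG.spec (l2_delta v)) {l} > 0" using v(2) measure_nonneg[of "TG.spec (l2_delta v)" "{l}"] by linarith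
  qed auto
qed

lemma zeta_limit:
  assumes l: "l \<notin> X" "on l" and v: "v \<in> T" and w: "w \<in> T" and vw: "tadj v w"
  shows "\<exists>M. ((\<lambda>\<eta>. zeta Wl T (Complex l \<eta>) w v) \<longlongrightarrow> M) (at_right 0) \<and> Im M \<noteq> 0"
proof (intro exI conjI)
  have "last w \<in> last ` {u \<in> T. tadj v u}" using w vw by blast
  then have "E (last v) (last w)" using nbrs_last[OF v] unfolding bij_betw_def by blast
  then have j: "(Some (last w), last v) \<in> idx" using Esym edge_idx by blast
  show "((\<lambda>\<eta>. zeta Wl T (Complex l \<eta>) w v) \<longlongrightarrow> L (Some (last w), last v) l) (at_right 0)"
  proof (rule Lim_transform_eventually[OF lim_ray[OF j l(1)]])
    show "\<forall>\<^sub>F \<eta> in at_right 0. y (Some (last w), last v) (Complex l \<eta>) = zeta Wl T (Complex l \<eta>) w v"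
      using eventually_at_right_less by eventually_elim (use zeta_eq_y[OF _ v w vw] in auto)
  qed
  show "Im (L (Some (last w), last v) l) \<noteq> 0" using Im_L_iff_on[OF j l(1)] l(2) by blast
qed

lemma green_limit:
  assumes l: "l \<notin> X" and v: "v \<in> T" and w: "w \<in> T"
  shows "\<exists>M. ((\<lambda>\<eta>. green Wl T (Complex l \<eta>) v w) \<longlongrightarrow> M) (at_right 0)"
proof (rule green_T_limit[OF w v])
  show "\<forall>\<^sub>F \<eta> in at_right 0. Im (Complex l \<eta>) \<noteq> 0" using eventually_at_right_less by eventually_elim simp
qed (use lim_ray[OF _ l] in blast)

text \<open>The limit at l is taken within the whole half plane, not only along the vertical ray, so
  it bounds the Green function on a neighbourhood of l as \<open>purely_ac_onI\<close>
  demands.\<close>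

lemma ac_on_band:
  assumes "{c..d} \<inter> X = {}"
  shows "purely_ac_on Wl T {c..d}"
proof (rule TG.purely_ac_onI)
  fix v l assume v: "v \<in> T" and "c \<le> l" "l \<le> d"
  then have l: "l \<notin> X" using assms by auto
  let ?j = "(None, last v)"
  have "\<forall>\<^sub>F z in at (complex_of_real l) within upper. dist (y ?j z) (L ?j l) < 1"
    by (rule tendstoD[OF lim[OF idx_last[OF v] l]]) simp
  then obtain \<delta> where \<delta>: "\<delta> > 0" "\<And>z. z \<in> upper \<Longrightarrow> z \<noteq> complex_of_real l \<Longrightarrow> dist z (complex_of_real l) < \<delta> \<Longrightarrow> dist (y ?j z) (L ?j l) < 1"
    unfolding eventually_at by blast
  have "Im (green Wl T (Complex a b) v v) \<le> 1 + cmod (L ?j l)" if ab: "\<bar>a - l\<bar> < \<delta> / 2" "0 < b" "b < \<delta> / 2" for a b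
  proof -
    have "dist (Complex a b) (complex_of_real l) \<le> \<bar>a - l\<bar> + \<bar>b\<bar>"
      using cmod_le[of "Complex a b - complex_of_real l"] by (simp add: dist_norm)
    then have "dist (y ?j (Complex a b)) (L ?j l) < 1" using ab by (intro \<delta>(2)) (auto simp: complex_eq_iff)
    then have "cmod (y ?j (Complex a b)) \<le> 1 + cmod (L ?j l)"
      using norm_triangle_ineq2[of "y ?j (Complex a b)" "L ?j l"] by (simp add: dist_norm)
    moreover have "- Im (y ?j (Complex a b)) \<le> cmod (y ?j (Complex a b))" using abs_Im_le_cmod[of "y ?j (Complex a b)"] by linarith
    ultimately show ?thesis using ab(2) by (simp add: green_T_diag v)
  qed
  then show "\<exists>\<delta>>0. \<exists>B. \<forall>a b. \<bar>a - l\<bar> < \<delta> \<longrightarrow> 0 < b \<longrightarrow> b < \<delta> \<longrightarrow> Im (green Wl T (Complex a b) v v) \<le> B"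
    using \<delta>(1) by (intro exI[of _ "\<delta> / 2"] conjI exI[of _ "1 + cmod (L ?j l)"]) auto
qed

definition F :: "real set" where
  "F = {l \<in> X. complex_of_real l \<in> spectrum_op Wl T} - (fst ` J \<union> snd ` J)"

lemma spectrum_eq: "spectrum_op Wl T = complex_of_real ` ((\<Union>(a, b)\<in>J. {a<..<b}) \<union> F \<union> (fst ` J \<union> snd ` J))"
proof (intro equalityI subsetI)
  fix z assume z: "z \<in> spectrum_op Wl T"
  then have "Im z = 0" using TG.nonreal_not_spectrum by blast
  then obtain l where l: "z = complex_of_real l" by (metis complex_is_Real_iff Reals_cases)
  have C: "\<bar>l\<bar> \<le> C0" using outside_not_spectrum[of l] z l by force
  have "l \<in> (\<Union>(a, b)\<in>J. {a<..<b}) \<union> F \<union> (fst ` J \<union> snd ` J)"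
  proof (cases "l \<in> X")
    case True
    then show ?thesis using z unfolding l F_def by blast
  next
    case False
    then have "on l" using off_not_spectrum z l by blast
    moreover obtain a b where ab: "a \<in> X" "b \<in> X" "{a<..<b} \<inter> X = {}" "l \<in> {a<..<b}" by (rule cell[OF C False])
    ultimately have "(a, b) \<in> J" using cell_J by blast
    then show ?thesis using ab(4) by blast
  qed
  then show "z \<in> complex_of_real ` ((\<Union>(a, b)\<in>J. {a<..<b}) \<union> F \<union> (fst ` J \<union> snd ` J))" using l by blast
next
  fix z assume "z \<in> complex_of_real ` ((\<Union>(a, b)\<in>J. {a<..<b}) \<union> F \<union> (fst ` J \<union> snd ` J))"
  then obtain l where l: "z = complex_of_real l" "l \<in> (\<Union>(a, b)\<in>J. {a<..<b}) \<union> F \<union> (fst ` J \<union> snd ` J)" by blast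
  show "z \<in> spectrum_op Wl T"
  proof (cases "l \<in> F")
    case True
    then show ?thesis using l by (simp add: F_def)
  next
    case False
    then obtain a b where ab: "(a, b) \<in> J" "l \<in> {a<..<b} \<or> l = a \<or> l = b" using l(2) by auto
    then have "a \<le> l" "l \<le> b" using JD[OF ab(1)] by auto
    then show ?thesis using band_in_spectrum[OF ab(1)] l(1) by blast
  qed
qed

lemma spectral_decomposition:
  "\<exists>J F. finite J \<and> J \<noteq> {} \<and> (\<forall>(a, b)\<in>J. a < b) \<and> finite (F :: real set) \<and>
    (let T = nbw V E r; Wt = W \<circ> last;
         U = (\<Union>(a, b)\<in>J. {a<..<b}); F' = fst ` J \<union> snd ` J in
      spectrum_op Wt T = complex_of_real ` (U \<union> F \<union> F')
      \<and> U \<inter> F = {} \<and> U \<inter> F' = {} \<and> F \<inter> F' = {}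
      \<and> (\<forall>(a, b)\<in>J. \<forall>lam\<in>{a<..<b}. \<forall>v\<in>T. \<forall>w\<in>T. tadj v w \<longrightarrow>
            (\<exists>L. ((\<lambda>\<eta>. zeta Wt T (complex_of_real lam + \<i> * complex_of_real \<eta>) w v) \<longlongrightarrow> L) (at_right 0)
                 \<and> Im L \<noteq> 0))
      \<and> (\<forall>(a, b)\<in>J. \<forall>lam\<in>{a<..<b}. \<forall>v\<in>T. \<forall>w\<in>T.
            (\<exists>L. ((\<lambda>\<eta>. green Wt T (complex_of_real lam + \<i> * complex_of_real \<eta>) v w) \<longlongrightarrow> L) (at_right 0)))
      \<and> (\<forall>(a, b)\<in>J. \<forall>c d. a < c \<longrightarrow> c \<le> d \<longrightarrow> d < b \<longrightarrow> purely_ac_on Wt T {c..d})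
      \<and> (\<forall>lam\<in>F. eigenvalue_inf_mult Wt T lam))"
  unfolding Let_def T_def[symmetric] complex_eq[of "Complex _ _", simplified complex.sel, symmetric]
proof (intro exI conjI)
  show "finite J" "J \<noteq> {}" by (rule finite_J, rule J_nonempty)
  show "\<forall>(a, b)\<in>J. a < b" using JD by blast
  show "finite F" unfolding F_def using finX by simp
  show "spectrum_op Wl T = complex_of_real ` ((\<Union>(a, b)\<in>J. {a<..<b}) \<union> F \<union> (fst ` J \<union> snd ` J))" by (rule spectrum_eq)
  have UX: "(\<Union>(a, b)\<in>J. {a<..<b}) \<inter> X = {}" using JD by blast
  show "(\<Union>(a, b)\<in>J. {a<..<b}) \<inter> F = {}" using UX by (auto simp: F_def)
  have "fst ` J \<union> snd ` J \<subseteq> X" using JD by auto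
  then show "(\<Union>(a, b)\<in>J. {a<..<b}) \<inter> (fst ` J \<union> snd ` J) = {}" using UX by blast
  show "F \<inter> (fst ` J \<union> snd ` J) = {}" by (auto simp: F_def)
  show "\<forall>(a, b)\<in>J. \<forall>lam\<in>{a<..<b}. \<forall>v\<in>T. \<forall>w\<in>T. tadj v w \<longrightarrow>
      (\<exists>L. ((\<lambda>\<eta>. zeta Wl T (Complex lam \<eta>) w v) \<longlongrightarrow> L) (at_right 0) \<and> Im L \<noteq> 0)"
    using J_on zeta_limit by blast
  show "\<forall>(a, b)\<in>J. \<forall>lam\<in>{a<..<b}. \<forall>v\<in>T. \<forall>w\<in>T.
      (\<exists>L. ((\<lambda>\<eta>. green Wl T (Complex lam \<eta>) v w) \<longlongrightarrow> L) (at_right 0))"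
    using J_on green_limit by blast
  show "\<forall>(a, b)\<in>J. \<forall>c d. a < c \<longrightarrow> c \<le> d \<longrightarrow> d < b \<longrightarrow> purely_ac_on Wl T {c..d}"
  proof safe
    fix a b c d assume ab: "(a, b) \<in> J" and "a < c" "d < b"
    then have "{c..d} \<subseteq> {a<..<b}" by auto
    then show "purely_ac_on Wl T {c..d}" using JD[OF ab] by (intro ac_on_band) blast
  qed
  show "\<forall>lam\<in>F. eigenvalue_inf_mult Wl T lam"
    using isolated_point_eigenvalue by (auto simp: F_def)
qed

end

theorem theorem2p2:
  fixes V :: "'a set" and E :: "'a \<Rightarrow> 'a \<Rightarrow> bool" and W :: "'a \<Rightarrow> real" and r :: 'a
  assumes "simple_graph V E" and "graph_connected V E"
    and "\<forall>v\<in>V. degree V E v \<ge> 2" and "\<not> is_cycle_graph V E" and "r \<in> V"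
  shows "\<exists>J F. finite J \<and> J \<noteq> {} \<and> (\<forall>(a, b)\<in>J. a < b) \<and> finite (F :: real set) \<and>
    (let T = nbw V E r; Wt = W \<circ> last;
         U = (\<Union>(a, b)\<in>J. {a<..<b}); F' = fst ` J \<union> snd ` J in
      spectrum_op Wt T = complex_of_real ` (U \<union> F \<union> F')
      \<and> U \<inter> F = {} \<and> U \<inter> F' = {} \<and> F \<inter> F' = {}
      \<and> (\<forall>(a, b)\<in>J. \<forall>lam\<in>{a<..<b}. \<forall>v\<in>T. \<forall>w\<in>T. tadj v w \<longrightarrow>
            (\<exists>L. ((\<lambda>\<eta>. zeta Wt T (complex_of_real lam + \<i> * complex_of_real \<eta>) w v) \<longlongrightarrow> L) (at_right 0)
                 \<and> Im L \<noteq> 0))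
      \<and> (\<forall>(a, b)\<in>J. \<forall>lam\<in>{a<..<b}. \<forall>v\<in>T. \<forall>w\<in>T.
            (\<exists>L. ((\<lambda>\<eta>. green Wt T (complex_of_real lam + \<i> * complex_of_real \<eta>) v w) \<longlongrightarrow> L) (at_right 0)))
      \<and> (\<forall>(a, b)\<in>J. \<forall>c d. a < c \<longrightarrow> c \<le> d \<longrightarrow> d < b \<longrightarrow> purely_ac_on Wt T {c..d})
      \<and> (\<forall>lam\<in>F. eigenvalue_inf_mult Wt T lam))"
proof -
  interpret core_graph V E W r
    using assms by unfold_locales
  obtain X L where X: "finite X"
    and lim: "\<And>j l. j \<in> idx \<Longrightarrow> l \<notin> X \<Longrightarrow> (y j \<longlongrightarrow> L j l) (at (complex_of_real l) within upper)"
    and d: "\<And>j a b. j \<in> idx \<Longrightarrow> {a<..<b} \<inter> X = {} \<Longrightarrow> (\<forall>l\<in>{a<..<b}. Im (L j l) = 0) \<or> (\<forall>l\<in>{a<..<b}. Im (L j l) \<noteq> 0)"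
  proof -
    obtain X L where XL: "finite X \<and> (\<forall>j\<in>idx. \<forall>l. l \<notin> X \<longrightarrow> (y j \<longlongrightarrow> L j l) (at (complex_of_real l) within upper)) \<and>
     (\<forall>j\<in>idx. \<forall>a b. {a<..<b} \<inter> X = {} \<longrightarrow> (\<forall>l\<in>{a<..<b}. Im (L j l) = 0) \<or> (\<forall>l\<in>{a<..<b}. Im (L j l) \<noteq> 0))"
      using y_boundary by (elim exE)
    show thesis
      by (rule that[OF conjunct1[OF XL] bspec[OF conjunct1[OF conjunct2[OF XL]], rule_format]
          bspec[OF conjunct2[OF conjunct2[OF XL]], rule_format]])
  qed
  \<comment> \<open>Enlarging the exceptional set by two points preserves both the limits and the
    dichotomy.\<close>
  have "core_boundary V E W r (X \<union> {C0 + 1, - (C0 + 1)}) L"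
  proof unfold_locales
    fix j a b assume "j \<in> idx" "{a<..<b} \<inter> (X \<union> {C0 + 1, - (C0 + 1)}) = {}"
    then show "(\<forall>l\<in>{a<..<b}. Im (L j l) = 0) \<or> (\<forall>l\<in>{a<..<b}. Im (L j l) \<noteq> 0)"
      using d[of j a b] by blast
  qed (use X lim in auto)
  then show ?thesis by (rule core_boundary.spectral_decomposition)
qed

end
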